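(* Let $T>0$, $s>0$, $d\ge1$, $p\ge 0$ and $u_0\in H^s(\mathbb{R}^d)$, and consider the Cauchy problem $$i u_t(t,x)+(-\Delta)^s u(t,x)+p(x)u(t,x)=0,\quad (t,x)\in(0,T)\times\mathbb{R}^d,\qquad u(0,x)=u_0(x).\qquad ( * )$$ Assume that $p$ and $u_0$ satisfy the moderateness assumptions: their regularisations $(p_\varepsilon)_{\varepsilon\in(0,1]}$, $(u_{0,\varepsilon})_{\varepsilon\in(0,1]}$ satisfy $p_\varepsilon\ge0$, $\|p_\varepsilon\|_{L^\infty}\le C\varepsilon^{-N}$ and $\|u_{0,\varepsilon}\|_{H^s}\le C_0\varepsilon^{-N_0}$ for all $\varepsilon\in(0,1]$, for some $N,N_0\in\mathbb{N}_0$ and $C,C_0>0$ (depending on the regularisation). Then $( * )$ has a unique very weak solution, in the following sense: for all families of such regularisations $(p_\varepsilon)_\varepsilon$, $(\tilde p_\varepsilon)_\varepsilon$ of $p$ and $(u_{0,\varepsilon})_\varepsilon$, $(\tilde u_{0,\varepsilon})_\varepsilon$ of $u_0$ such that $$\|p_\varepsilon-\tilde p_\varepsilon\|_{L^\infty}\le C_k\varepsilon^k\ \text{ for all } k>0\qquad\text{and}\qquad \|u_{0,\varepsilon}-\tilde u_{0,\varepsilon}\|_{L^2}\le C_l\varepsilon^l\ \text{ for all } l>0$$ (for all $\varepsilon\in(0,1]$, with constants $C_k$, $C_l$ independent of $\varepsilon$), the corresponding families $(u_\varepsilon)_\varepsilon$, $(\tilde u_\varepsilon)_\varepsilon$ of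 solutions in $C([0,T];H^s)$ of the regularised Cauchy problems $$i\partial_t u_\varepsilon+(-\Delta)^s u_\varepsilon+p_\varepsilon u_\varepsilon=0,\quad u_\varepsilon(0,\cdot)=u_{0,\varepsilon};\qquad i\partial_t \tilde u_\varepsilon+(-\Delta)^s \tilde u_\varepsilon+\tilde p_\varepsilon \tilde u_\varepsilon=0,\quad \tilde u_\varepsilon(0,\cdot)=\tilde u_{0,\varepsilon},$$ satisfy: for every $N>0$ there is a constant $C_N>0$ such that $$\|u_\varepsilon(t,\cdot)-\tilde u_\varepsilon(t,\cdot)\|_{L^2}\le C_N\varepsilon^N\quad\text{for all } t\in[0,T],\ \varepsilon\in(0,1].$$
   Context: $(-\Delta)^s$ is the fractional Laplacian on $\mathbb{R}^d$, i.e. the Fourier multiplier with symbol $|\xi|^{2s}$; $H^s(\mathbb{R}^d)=\{u\in L^2(\mathbb{R}^d):\|u\|_{H^s}:=\|u\|_{L^2}+\|(-\Delta)^{s/2}u\|_{L^2}<\infty\}$. Functions $u$ are complex-valued. Equations are understood in the sense of distributions on $(0,T)\times\mathbb{R}^d$. Regularisations. The possibly singular coefficient $p$ and the data $u_0$ enter only through nets $(p_\varepsilon)_{\varepsilon\in(0,1]}$ and $(u_{0,\varepsilon})_{\varepsilon\in(0,1]}$ of functions on $\mathbb{R}^d$ regularising them. When they are distributions, one takes $p_\varepsilon=p*\psi_\varepsilon$, $u_{0,\varepsilon}=u_0*\psi_\varepsilon$, with $\psi_\varepsilon(x)=\varepsilon^{-d}\psi(x/\varepsilon)$, $\psi\in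 C_0^\infty(\mathbb{R}^d)$, $\psi\ge0$, $\int\psi=1$. For more generality the assumptions are placed on the nets: any nets satisfying the moderateness bounds in the claim are allowed. The condition $p\ge 0$ is understood as: the regularisations satisfy $p_\varepsilon\ge 0$ for all $\varepsilon\in(0,1]$. A very weak solution of order $s$ is a net $(u_\varepsilon)_\varepsilon$ in $C([0,T];H^s)$ solving, for each $\varepsilon\in(0,1]$, the Cauchy problem with $p,u_0$ replaced by such regularisations $p_\varepsilon,u_{0,\varepsilon}$, and such that $\|u_\varepsilon(t,\cdot)\|_{H^s}\le c\varepsilon^{-M}$ for all $t\in[0,T]$, $\varepsilon\in(0,1]$, for some $M\in\mathbb{N}_0$, $c>0$. *)

theory Defs
  imports "HOL-Analysis.Analysis" "HOL-Probability.Essential_Supremum"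
begin

subsection \<open>Lebesgue spaces\<close>

text \<open>Elements of Lebesgue and Sobolev spaces are represented by Borel functions on the Euclidean
  space; every class modulo null sets contains one.\<close>

definition L2 :: "('a::euclidean_space \<Rightarrow> complex) set" where
  "L2 = {f \<in> borel_measurable lborel. integrable lborel (\<lambda>x. (cmod (f x))\<^sup>2)}"

definition L2_norm :: "('a::euclidean_space \<Rightarrow> complex) \<Rightarrow> real" where
  "L2_norm f = sqrt (\<integral>x. (cmod (f x))\<^sup>2 \<partial>lborel)"

definition Linf_norm :: "('a::euclidean_space \<Rightarrow> real) \<Rightarrow> ereal" where
  "Linf_norm f = esssup lborel (\<lambda>x. ereal \<bar>f x\<bar>)"

subsection \<open>Fourier transform and fractional Laplacian\<close>

definition fourier_L1 :: "('a::euclidean_space \<Rightarrow> complex) \<Rightarrow> 'a \<Rightarrow> complex" where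
  "fourier_L1 f \<xi> =
     of_real ((2 * pi) powr (- (real DIM('a) / 2))) * (\<integral>x. cis (- (x \<bullet> \<xi>)) * f x \<partial>lborel)"

text \<open>The Fourier transform on \<open>L2\<close> is the limit in mean square of the transforms of the
  truncations of \<open>f\<close> to balls (which are in \<open>L1\<close>). By Plancherel's theorem the limit exists; it is
  determined up to a null set, and \<open>SOME\<close> merely picks a representative. The distance is
  measured by the nonnegative integral, so that convergence cannot hold through a default
  value of the Bochner integral.\<close>

definition is_fourier :: "('a::euclidean_space \<Rightarrow> complex) \<Rightarrow> ('a \<Rightarrow> complex) \<Rightarrow> bool" where
  "is_fourier f g \<longleftrightarrow> f \<in> L2 \<and> g \<in> L2 \<and>
     (\<lambda>n::nat. \<integral>\<^sup>+\<xi>. ennreal ((cmod (fourier_L1 (\<lambda>x. indicator (cball 0 (real n)) x * f x) \<xi> - g \<xi>))\<^sup>2)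
        \<partial>lborel) \<longlonglongrightarrow> 0"

definition fourier :: "('a::euclidean_space \<Rightarrow> complex) \<Rightarrow> 'a \<Rightarrow> complex" where
  "fourier f = (SOME g. is_fourier f g)"

text \<open>\<open>is_frac_laplacian \<sigma> u v\<close>: the distribution with Fourier transform
  \<open>norm \<xi> powr (2 * \<sigma>) * fourier u \<xi>\<close> is (represented by) the \<open>L2\<close> function \<open>v\<close>.\<close>

definition is_frac_laplacian ::
    "real \<Rightarrow> ('a::euclidean_space \<Rightarrow> complex) \<Rightarrow> ('a \<Rightarrow> complex) \<Rightarrow> bool" where
  "is_frac_laplacian \<sigma> u v \<longleftrightarrow> u \<in> L2 \<and> v \<in> L2 \<and>
     (AE \<xi> in lborel. fourier v \<xi> = of_real (norm \<xi> powr (2 * \<sigma>)) * fourier u \<xi>)"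

definition frac_laplacian :: "real \<Rightarrow> ('a::euclidean_space \<Rightarrow> complex) \<Rightarrow> 'a \<Rightarrow> complex" where
  "frac_laplacian \<sigma> u = (SOME v. is_frac_laplacian \<sigma> u v)"

definition Hs :: "real \<Rightarrow> ('a::euclidean_space \<Rightarrow> complex) set" where
  "Hs s = {u \<in> L2. \<exists>v. is_frac_laplacian (s / 2) u v}"

definition Hs_norm :: "real \<Rightarrow> ('a::euclidean_space \<Rightarrow> complex) \<Rightarrow> real" where
  "Hs_norm s u = L2_norm u + L2_norm (frac_laplacian (s / 2) u)"

definition C_Hs :: "real \<Rightarrow> real \<Rightarrow> (real \<Rightarrow> 'a::euclidean_space \<Rightarrow> complex) set" where
  "C_Hs T s = {u. (\<forall>t\<in>{0..T}. u t \<in> Hs s) \<and>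
     (\<forall>t\<in>{0..T}. ((\<lambda>\<tau>. Hs_norm s (\<lambda>x. u \<tau> x - u t x)) \<longlongrightarrow> 0) (at t within {0..T}))}"

subsection \<open>Distributional solutions\<close>

primrec Ck :: "nat \<Rightarrow> ('b::real_normed_vector \<Rightarrow> complex) \<Rightarrow> bool" where
  "Ck 0 f \<longleftrightarrow> continuous_on UNIV f"
| "Ck (Suc k) f \<longleftrightarrow> (\<forall>z. f differentiable (at z)) \<and>
     (\<forall>v. Ck k (\<lambda>z. frechet_derivative f (at z) v))"

definition test_functions :: "real \<Rightarrow> (real \<times> 'a::euclidean_space \<Rightarrow> complex) set" where
  "test_functions T = {\<phi>. (\<forall>k. Ck k \<phi>) \<and>
     (\<exists>K. compact K \<and> K \<subseteq> {0<..<T} \<times> UNIV \<and> (\<forall>z. z \<notin> K \<longrightarrow> \<phi> z = 0))}"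

text \<open>The equation \<open>i u_t + (-\<Delta>)^s u + p u = 0\<close> as a distribution on \<open>(0,T) \<times> R^d\<close>, tested by the
  bilinear pairing: the transpose of \<open>i \<partial>_t\<close> is \<open>- i \<partial>_t\<close>, and \<open>(-\<Delta>)^s\<close> is its own transpose because
  its symbol is even. The integral is iterated, since a curve in \<open>C([0,T]; H^s)\<close> determines each
  \<open>u t\<close> only up to a null set and so need not be jointly measurable as a function of \<open>(t, x)\<close>.\<close>

definition schroedinger_eq ::
    "real \<Rightarrow> real \<Rightarrow> ('a::euclidean_space \<Rightarrow> real) \<Rightarrow> (real \<Rightarrow> 'a \<Rightarrow> complex) \<Rightarrow> bool" where
  "schroedinger_eq T s p u \<longleftrightarrow> (\<forall>\<phi>\<in>test_functions T.
     (LINT t:{0..T}|lborel. (\<integral>x. u t x *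
        (- \<i> * vector_derivative (\<lambda>\<tau>. \<phi> (\<tau>, x)) (at t)
         + frac_laplacian s (\<lambda>y. \<phi> (t, y)) x
         + of_real (p x) * \<phi> (t, x)) \<partial>lborel)) = 0)"

definition cauchy_solution ::
    "real \<Rightarrow> real \<Rightarrow> ('a::euclidean_space \<Rightarrow> real) \<Rightarrow> ('a \<Rightarrow> complex) \<Rightarrow> (real \<Rightarrow> 'a \<Rightarrow> complex) \<Rightarrow> bool"
  where
  "cauchy_solution T s p u0 u \<longleftrightarrow>
     u \<in> C_Hs T s \<and> schroedinger_eq T s p u \<and> (AE x in lborel. u 0 x = u0 x)"

subsection \<open>Nets of regularisations and very weak solutions\<close>

text \<open>A net indexed by \<open>\<epsilon> \<in> (0,1]\<close> is a function of a real \<open>\<epsilon>\<close>, only used on \<open>{0<..1}\<close>.\<close>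

definition moderate_coefficient :: "(real \<Rightarrow> 'a::euclidean_space \<Rightarrow> real) \<Rightarrow> bool" where
  "moderate_coefficient p \<longleftrightarrow>
     (\<forall>\<epsilon>\<in>{0<..1}. p \<epsilon> \<in> borel_measurable lborel \<and> (AE x in lborel. p \<epsilon> x \<ge> 0)) \<and>
     (\<exists>(N::nat) C. C > 0 \<and> (\<forall>\<epsilon>\<in>{0<..1}. Linf_norm (p \<epsilon>) \<le> ereal (C * \<epsilon> powr (- real N))))"

definition moderate_data :: "real \<Rightarrow> (real \<Rightarrow> 'a::euclidean_space \<Rightarrow> complex) \<Rightarrow> bool" where
  "moderate_data s u0 \<longleftrightarrow>
     (\<forall>\<epsilon>\<in>{0<..1}. u0 \<epsilon> \<in> Hs s) \<and>
     (\<exists>(N::nat) C. C > 0 \<and> (\<forall>\<epsilon>\<in>{0<..1}. Hs_norm s (u0 \<epsilon>) \<le> C * \<epsilon> powr (- real N)))"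

definition very_weak_solution ::
    "real \<Rightarrow> real \<Rightarrow> (real \<Rightarrow> 'a::euclidean_space \<Rightarrow> real) \<Rightarrow> (real \<Rightarrow> 'a \<Rightarrow> complex) \<Rightarrow>
      (real \<Rightarrow> real \<Rightarrow> 'a \<Rightarrow> complex) \<Rightarrow> bool" where
  "very_weak_solution T s p u0 u \<longleftrightarrow>
     (\<forall>\<epsilon>\<in>{0<..1}. cauchy_solution T s (p \<epsilon>) (u0 \<epsilon>) (u \<epsilon>)) \<and>
     (\<exists>(M::nat) c. c > 0 \<and>
        (\<forall>t\<in>{0..T}. \<forall>\<epsilon>\<in>{0<..1}. Hs_norm s (u \<epsilon> t) \<le> c * \<epsilon> powr (- real M)))"

end

theory Submission imports Defs "HOL-Probability.Sinc_Integral"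
begin

text \<open>Write \<open>A = (-\<Delta>)^s + p\<close>. For a bounded nonnegative \<open>p\<close> the equation says \<open>u_t = i A u\<close> with \<open>A\<close>
  symmetric and nonnegative, so the flow preserves the \<open>L2\<close> norm and the energy
  \<open>\<parallel>(-\<Delta>)^(s/2) u\<parallel>^2 + \<integral> p |u|^2\<close>. Everything in the theorem follows from these two facts, once
  distributional solutions in \<open>C([0,T]; H^s)\<close> are known to be given by the flow.

  \<^bold>\<open>Existence.\<close> Conservation of mass and energy gives
  \<open>\<parallel>u t\<parallel>_(H^s) \<le> (2 + \<parallel>p\<parallel>_\<infinity>) \<parallel>u0\<parallel>_(H^s)\<close>
  (\<open>Hs_norm_bound\<close>), and products of powers of \<open>1 / \<epsilon>\<close> are powers of \<open>1 / \<epsilon>\<close>.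

  \<^bold>\<open>Uniqueness.\<close> By Duhamel's principle and the isometry of both flows,
  \<open>\<parallel>u t - u' t\<parallel> \<le> \<parallel>u0 - u0'\<parallel> + T \<parallel>p - p'\<parallel>_\<infinity> \<parallel>u0'\<parallel>\<close>
  in \<open>L2\<close> (\<open>solution_stability\<close>). If \<open>\<parallel>u0'\<parallel>\<close> grows at most like \<open>\<epsilon>^(-N0)\<close>, a coefficient error of order
  \<open>\<epsilon>^(N + N0)\<close> and a data error of order \<open>\<epsilon>^N\<close> give an error of order \<open>\<epsilon>^N\<close>.

  \<^bold>\<open>The flow.\<close> Under the Fourier transform the free flow is multiplication by \<open>exp (i t |\<xi>|^(2s))\<close>, a
  strongly continuous unitary group \<open>S\<close>, and \<open>p\<close> becomes a bounded operator that is skew after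
  multiplication by \<open>i\<close>. In the interaction picture \<open>S (-t) u(t)\<close> solves an ordinary differential
  equation with bounded skew right-hand side; its Dyson series yields the perturbed group \<open>V\<close>.
  For initial values in \<open>H^s\<close>, which is only the form domain, the energy cannot be differentiated.
  Instead, the average \<open>E h w\<close> of \<open>\<langle>V \<tau> w, i w\<rangle>\<close> over \<open>\<tau> \<in> [0,h]\<close>, divided by \<open>h\<close>, is conserved exactly,
  because \<open>V t\<close> is an isometry which commutes with \<open>V \<tau>\<close> and \<open>i\<close>. As \<open>h\<close> tends to \<open>0\<close> it tends to half
  of the energy, and for the free group it is the integral of \<open>|w(\<xi>)|^2\<close> against a nonnegative kernel that
  stays below \<open>|\<xi>|^(2s) / 2\<close> and converges to it. Fatou's lemma thus shows that \<open>V t\<close> preserves \<open>H^s\<close>, and dominated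
  convergence that it preserves the energy (\<open>energy_conservation\<close>). Weak convergence together with
  convergence of norms makes the curve continuous in \<open>H^s\<close>.

  \<^bold>\<open>Distributional solutions.\<close> Testing with products \<open>\<theta>(t) g(x)\<close> and applying the du Bois-Reymond lemma in
  \<open>t\<close>, the function \<open>W t = \<integral>_0^t u\<close> satisfies \<open>u t - u 0 = i A W t\<close> when paired with any smooth \<open>g\<close> of compact
  support. The translates of a narrow bump function serve as \<open>g\<close>; injectivity of the Fourier transform turns
  these identities into the pointwise equation on a large ball of the Fourier side, the larger the narrower the bump; in particular \<open>|\<xi>|^(2s)\<close> times the transform of
  \<open>W t\<close> is square integrable (\<open>integrated_equation\<close>). The integrated difference of two solutions with the
  same initial value is therefore a genuine solution starting from \<open>0\<close>, hence vanishes, and so does its derivative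
  (\<open>solution_unique\<close>).

  \<^bold>\<open>Plancherel's theorem.\<close> For indicators of intervals it is the integral
  \<open>\<integral> (1 - cos (a x)) / x^2 = \<pi> |a|\<close>, for boxes it follows by Fubini's theorem. The closure of the span of
  the pairs (indicator of a box, its transform) is the graph of an isometry. A Dynkin argument and
  limits of simple functions show that this isometry is the classical transform for square-integrable
  functions of bounded support, and it is the limit in mean square in general.\<close>

section \<open>Square-integrable functions modulo null sets\<close>

lemma L2_measurable: "f \<in> L2 \<Longrightarrow> f \<in> borel_measurable borel"
  by (simp add: L2_def)

lemma L2_integrable: "f \<in> L2 \<Longrightarrow> integrable lborel (\<lambda>x. (cmod (f x))\<^sup>2)"
  by (simp add: L2_def)

lemma L2_I: "f \<in> borel_measurable borel \<Longrightarrow> integrable lborel (\<lambda>x. (cmod (f x))\<^sup>2) \<Longrightarrow> f \<in> L2"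
  by (simp add: L2_def)

lemma L2_dominated:
  assumes "g \<in> L2" "f \<in> borel_measurable borel" "AE x in lborel. cmod (f x) \<le> K * cmod (g x)"
  shows "f \<in> L2"
proof (rule L2_I)
  note [measurable] = assms(2) L2_measurable[OF assms(1)]
  show "integrable lborel (\<lambda>x. (cmod (f x))\<^sup>2)"
  proof (rule Bochner_Integration.integrable_bound)
    show "integrable lborel (\<lambda>x. K\<^sup>2 * (cmod (g x))\<^sup>2)"
      using L2_integrable[OF assms(1)] by simp
    show "AE x in lborel. norm ((cmod (f x))\<^sup>2) \<le> norm (K\<^sup>2 * (cmod (g x))\<^sup>2)"
      using assms(3)
    proof eventually_elim
      case (elim x)
      then have "(cmod (f x))\<^sup>2 \<le> (K * cmod (g x))\<^sup>2" by (intro power_mono) auto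
      then show ?case by (simp add: power_mult_distrib)
    qed
  qed simp
qed fact

lemma L2_0 [simp]: "(\<lambda>x. 0) \<in> L2"
  by (intro L2_I) auto

lemma L2_add:
  assumes "f \<in> L2" "g \<in> L2" shows "(\<lambda>x. f x + g x) \<in> L2"
proof (rule L2_I)
  note [measurable] = L2_measurable[OF assms(1)] L2_measurable[OF assms(2)]
  show "(\<lambda>x. f x + g x) \<in> borel_measurable borel" by simp
  show "integrable lborel (\<lambda>x. (cmod (f x + g x))\<^sup>2)"
  proof (rule Bochner_Integration.integrable_bound)
    show "integrable lborel (\<lambda>x. 2 * (cmod (f x))\<^sup>2 + 2 * (cmod (g x))\<^sup>2)"
      using L2_integrable[OF assms(1)] L2_integrable[OF assms(2)] by simp
    have "(cmod (a + b))\<^sup>2 \<le> 2 * (cmod a)\<^sup>2 + 2 * (cmod b)\<^sup>2" for a b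
    proof -
      have "(cmod (a + b))\<^sup>2 \<le> (cmod a + cmod b)\<^sup>2"
        by (intro power_mono norm_triangle_ineq) auto
      moreover have "0 \<le> (cmod a - cmod b)\<^sup>2" by simp
      ultimately show ?thesis by (simp add: power2_sum power2_diff)
    qed
    then show "AE x in lborel. norm ((cmod (f x + g x))\<^sup>2) \<le> norm (2 * (cmod (f x))\<^sup>2 + 2 * (cmod (g x))\<^sup>2)"
      by simp
  qed simp
qed

lemma L2_mult_bounded:
  assumes "f \<in> L2" "h \<in> borel_measurable borel" "AE x in lborel. cmod (h x) \<le> K"
  shows "(\<lambda>x. h x * f x) \<in> L2"
proof (rule L2_dominated[where K=K and g = f])
  note [measurable] = assms(2) L2_measurable[OF assms(1)]
  show "(\<lambda>x. h x * f x) \<in> borel_measurable borel" by simp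
  show "AE x in lborel. cmod (h x * f x) \<le> K * cmod (f x)"
    using assms(3) by eventually_elim (simp add: norm_mult mult_right_mono)
qed fact

lemma L2_cmult: "f \<in> L2 \<Longrightarrow> (\<lambda>x. c * f x) \<in> L2"
  by (rule L2_mult_bounded[where K = "cmod c"]) auto

lemma L2_scaleR: "f \<in> L2 \<Longrightarrow> (\<lambda>x. c *\<^sub>R f x) \<in> L2"
  by (simp add: scaleR_conv_of_real L2_cmult)

lemma L2_uminus: "f \<in> L2 \<Longrightarrow> (\<lambda>x. - f x) \<in> L2"
  using L2_cmult[of f "-1"] by simp

lemma L2_diff: "f \<in> L2 \<Longrightarrow> g \<in> L2 \<Longrightarrow> (\<lambda>x. f x - g x) \<in> L2"
  using L2_add[of f "\<lambda>x. - g x"] L2_uminus[of g] by simp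

lemma L2_cnj: "f \<in> L2 \<Longrightarrow> (\<lambda>x. cnj (f x)) \<in> L2"
proof (rule L2_dominated[where K = 1])
  assume "f \<in> L2"
  then have [measurable]: "f \<in> borel_measurable borel" by (rule L2_measurable)
  show "(\<lambda>x. cnj (f x)) \<in> borel_measurable borel"
    by (rule measurable_compose[of f _ borel]) (auto intro: borel_measurable_continuous_onI continuous_intros)
qed auto

lemma lborel_distr_affine:
  fixes t :: "'a::euclidean_space"
  assumes "\<bar>c\<bar> = 1" shows "distr lborel borel (\<lambda>x. t + c *\<^sub>R x) = (lborel :: 'a measure)"
proof -
  have "c \<noteq> 0" using assms by auto
  from lborel_affine[OF this, of t] assms
  have "lborel = density (distr lborel borel (\<lambda>x. t + c *\<^sub>R x)) (\<lambda>_. 1)" by simp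
  then show ?thesis by (simp add: density_1)
qed

lemma AE_lborel_affine:
  fixes P :: "'a::euclidean_space \<Rightarrow> bool"
  assumes "AE x in lborel. P x" "\<bar>c\<bar> = 1" shows "AE x in lborel. P (t + c *\<^sub>R x)"
proof -
  from assms obtain N where N: "{x \<in> space lborel. \<not> P x} \<subseteq> N" "emeasure lborel N = 0" "N \<in> sets lborel"
    by (auto elim: AE_E)
  have "AE x in distr lborel borel (\<lambda>x. t + c *\<^sub>R x). x \<notin> N"
    unfolding lborel_distr_affine[OF assms(2)] using N by (intro AE_not_in) auto
  then have "AE x in lborel. t + c *\<^sub>R x \<notin> N"
    using N(3) by (subst (asm) AE_distr_iff) auto
  then show ?thesis by eventually_elim (use N(1) in auto)
qed

lemma integral_lborel_affine:
  fixes f :: "'a::euclidean_space \<Rightarrow> 'b::{banach,second_countable_topology}"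
  assumes [measurable]: "f \<in> borel_measurable borel" and "\<bar>c\<bar> = 1"
  shows "(\<integral>x. f (t + c *\<^sub>R x) \<partial>lborel) = (\<integral>x. f x \<partial>lborel)"
proof -
  have "(\<integral>x. f x \<partial>distr lborel borel (\<lambda>x. t + c *\<^sub>R x)) = (\<integral>x. f (t + c *\<^sub>R x) \<partial>lborel)"
    by (rule integral_distr) auto
  then show ?thesis by (simp add: lborel_distr_affine[OF assms(2)])
qed

lemma integrable_lborel_affine:
  fixes f :: "'a::euclidean_space \<Rightarrow> 'b::{banach,second_countable_topology}"
  assumes "integrable lborel f" and "\<bar>c\<bar> = 1"
  shows "integrable lborel (\<lambda>x. f (t + c *\<^sub>R x))"
proof -
  have "integrable (distr lborel borel (\<lambda>x. t + c *\<^sub>R x)) f"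
    unfolding lborel_distr_affine[OF assms(2)] by fact
  then show ?thesis
    by (subst (asm) integrable_distr_eq) (use assms(1) in auto)
qed

lemma L2_affine:
  assumes "f \<in> L2" "\<bar>c\<bar> = 1" shows "(\<lambda>x. f (t + c *\<^sub>R x)) \<in> L2"
proof (rule L2_I)
  note [measurable] = L2_measurable[OF assms(1)]
  show "(\<lambda>x. f (t + c *\<^sub>R x)) \<in> borel_measurable borel" by measurable
  show "integrable lborel (\<lambda>x. (cmod (f (t + c *\<^sub>R x)))\<^sup>2)"
    by (rule integrable_lborel_affine[OF L2_integrable[OF assms(1)] assms(2)])
qed

lemma L2_integrable_mult:
  assumes "f \<in> L2" "g \<in> L2" shows "integrable lborel (\<lambda>x. f x * g x)"
proof (rule Bochner_Integration.integrable_bound)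
  note [measurable] = L2_measurable[OF assms(1)] L2_measurable[OF assms(2)]
  show "integrable lborel (\<lambda>x. (cmod (f x))\<^sup>2 + (cmod (g x))\<^sup>2)"
    using L2_integrable[OF assms(1)] L2_integrable[OF assms(2)] by simp
  have "cmod (a * b) \<le> (cmod a)\<^sup>2 + (cmod b)\<^sup>2" for a b
  proof -
    have "0 \<le> (cmod a - cmod b)\<^sup>2" by simp
    then have "2 * (cmod a * cmod b) \<le> (cmod a)\<^sup>2 + (cmod b)\<^sup>2" by (simp add: power2_diff)
    moreover have "0 \<le> cmod a * cmod b" by simp
    ultimately show ?thesis unfolding norm_mult by linarith
  qed
  then show "AE x in lborel. cmod (f x * g x) \<le> norm ((cmod (f x))\<^sup>2 + (cmod (g x))\<^sup>2)"
    by simp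
  show "(\<lambda>x. f x * g x) \<in> borel_measurable lborel" by simp
qed

lemma inner_complex_mult_cnj: "inner a b = Re (a * cnj b)" for a b :: complex
  by (simp add: inner_complex_def)

lemma L2_integrable_inner:
  assumes "f \<in> L2" "g \<in> L2" shows "integrable lborel (\<lambda>x. inner (f x) (g x))"
  unfolding inner_complex_mult_cnj
  by (intro integrable_Re L2_integrable_mult assms L2_cnj)

text \<open>A type of equivalence classes makes \<open>L2\<close> an instance of the classes of inner product and Banach
  spaces, and so gives access to vector-valued derivatives and integrals. The inner product is the
  real one; the complex structure is the operator of multiplication by \<open>i\<close>.\<close>

typedef (overloaded) 'a lsq = "{{g \<in> L2. AE x in lborel. f x = g x} | f. f \<in> (L2 :: ('a::euclidean_space \<Rightarrow> complex) set)}"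
  by (auto intro: L2_0)

definition cls :: "('a::euclidean_space \<Rightarrow> complex) \<Rightarrow> 'a lsq" where
  "cls f = Abs_lsq {g \<in> L2. AE x in lborel. f x = g x}"

definition rep :: "'a::euclidean_space lsq \<Rightarrow> 'a \<Rightarrow> complex" where
  "rep x = (SOME g. g \<in> Rep_lsq x)"

lemma rep_in_Rep: "rep x \<in> Rep_lsq x"
proof -
  obtain f where f: "f \<in> L2" "Rep_lsq x = {g \<in> L2. AE x in lborel. f x = g x}"
    using Rep_lsq[of x] by auto
  then have "f \<in> Rep_lsq x" by auto
  then show ?thesis unfolding rep_def by (rule someI[of "\<lambda>g. g \<in> Rep_lsq x"])
qed

lemma rep_L2 [simp]: "rep x \<in> L2"
  using rep_in_Rep[of x] Rep_lsq[of x] by auto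

lemma rep_measurable [measurable]: "rep x \<in> borel_measurable borel"
  by (rule L2_measurable) simp

lemma rep_cls: "f \<in> L2 \<Longrightarrow> AE x in lborel. rep (cls f) x = f x"
proof -
  assume f: "f \<in> L2"
  then have "Rep_lsq (cls f) = {g \<in> L2. AE x in lborel. f x = g x}"
    unfolding cls_def by (intro Abs_lsq_inverse) auto
  then have "AE x in lborel. f x = rep (cls f) x"
    using rep_in_Rep[of "cls f"] by auto
  then show ?thesis by eventually_elim simp
qed

lemma lsq_eqI:
  assumes "AE t in lborel. rep x t = rep y t" shows "x = y"
proof -
  have *: "\<exists>f. f \<in> L2 \<and> Rep_lsq z = {g \<in> L2. AE x in lborel. f x = g x} \<and> (AE t in lborel. f t = rep z t)" for z :: "'a lsq"
    using Rep_lsq[of z] rep_in_Rep[of z] by auto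
  obtain f where f: "f \<in> L2" "Rep_lsq x = {g \<in> L2. AE x in lborel. f x = g x}" "AE t in lborel. f t = rep x t"
    using *[of x] by auto
  obtain g where g: "g \<in> L2" "Rep_lsq y = {h \<in> L2. AE x in lborel. g x = h x}" "AE t in lborel. g t = rep y t"
    using *[of y] by auto
  have fg: "AE t in lborel. f t = g t"
    using f(3) g(3) assms by eventually_elim simp
  have "Rep_lsq x = Rep_lsq y"
  proof (intro set_eqI iffI)
    fix h assume "h \<in> Rep_lsq x"
    then have h: "h \<in> L2" "AE x in lborel. f x = h x" using f by auto
    have "AE x in lborel. g x = h x" using fg h(2) by eventually_elim simp
    then show "h \<in> Rep_lsq y" using h g by auto
  next
    fix h assume "h \<in> Rep_lsq y"
    then have h: "h \<in> L2" "AE x in lborel. g x = h x" using g by auto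
    have "AE x in lborel. f x = h x" using fg h(2) by eventually_elim simp
    then show "h \<in> Rep_lsq x" using h f by auto
  qed
  then show ?thesis by (simp add: Rep_lsq_inject)
qed

lemma cls_rep [simp]: "cls (rep x) = x"
  by (rule lsq_eqI, rule rep_cls) simp

lemma cls_eq_iff: "f \<in> L2 \<Longrightarrow> g \<in> L2 \<Longrightarrow> cls f = cls g \<longleftrightarrow> (AE x in lborel. f x = g x)"
proof
  assume fg: "f \<in> L2" "g \<in> L2" and eq: "cls f = cls g"
  show "AE x in lborel. f x = g x"
    using rep_cls[OF fg(1)] rep_cls[OF fg(2)] by eventually_elim (simp add: eq)
next
  assume fg: "f \<in> L2" "g \<in> L2" and eq: "AE x in lborel. f x = g x"
  show "cls f = cls g"
    by (rule lsq_eqI) (use rep_cls[OF fg(1)] rep_cls[OF fg(2)] eq in eventually_elim, simp)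
qed

lemma cls_eqI: "f \<in> L2 \<Longrightarrow> g \<in> L2 \<Longrightarrow> AE x in lborel. f x = g x \<Longrightarrow> cls f = cls g"
  by (simp add: cls_eq_iff)

instantiation lsq :: (euclidean_space) real_inner
begin

definition "0 = cls (\<lambda>x. 0)"
definition "x + y = cls (\<lambda>t. rep x t + rep y t)"
definition "x - y = cls (\<lambda>t. rep x t - rep y t)"
definition "- x = cls (\<lambda>t. - rep x t)"
definition "c *\<^sub>R x = cls (\<lambda>t. c *\<^sub>R rep x t)"
definition "inner x y = (\<integral>t. inner (rep x t) (rep y t) \<partial>lborel)"
definition "norm x = sqrt (\<integral>t. inner (rep x t) (rep x t) \<partial>lborel)" for x :: "'a lsq"
definition "sgn x = inverse (norm x) *\<^sub>R x" for x :: "'a lsq"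
definition "dist x y = norm (x - y)" for x y :: "'a lsq"
definition "uniformity = (INF e\<in>{0<..}. principal {(x, y :: 'a lsq). dist x y < e})"
definition "open U = (\<forall>x\<in>U. \<forall>\<^sub>F (x', y) in uniformity. x' = x \<longrightarrow> y \<in> U)" for U :: "'a lsq set"

lemma rep_zero: "AE t in lborel. rep (0 :: 'a lsq) t = 0"
  unfolding zero_lsq_def by (rule rep_cls) simp
lemma rep_add: "AE t in lborel. rep (x + y :: 'a lsq) t = rep x t + rep y t"
  unfolding plus_lsq_def by (rule rep_cls) (simp add: L2_add)
lemma rep_diff: "AE t in lborel. rep (x - y :: 'a lsq) t = rep x t - rep y t"
  unfolding minus_lsq_def by (rule rep_cls) (simp add: L2_diff)
lemma rep_uminus: "AE t in lborel. rep (- x :: 'a lsq) t = - rep x t"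
  unfolding uminus_lsq_def by (rule rep_cls) (simp add: L2_uminus)
lemma rep_scaleR: "AE t in lborel. rep (c *\<^sub>R x :: 'a lsq) t = c *\<^sub>R rep x t"
  unfolding scaleR_lsq_def by (rule rep_cls) (simp add: L2_scaleR)

instance
proof
  fix x y z :: "'a lsq" and a b :: real
  show "x + y + z = x + (y + z)"
    by (rule lsq_eqI)
       (use rep_add[of "x+y" z] rep_add[of x y] rep_add[of x "y+z"] rep_add[of y z] in eventually_elim, simp)
  show "x + y = y + x"
    by (rule lsq_eqI) (use rep_add[of x y] rep_add[of y x] in eventually_elim, simp)
  show "0 + x = x"
    by (rule lsq_eqI) (use rep_add[of 0 x] rep_zero in eventually_elim, simp)
  show "- x + x = 0"
    by (rule lsq_eqI) (use rep_add[of "- x" x] rep_uminus[of x] rep_zero in eventually_elim, simp)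
  show "x - y = x + - y"
    by (rule lsq_eqI) (use rep_add[of x "- y"] rep_uminus[of y] rep_diff[of x y] in eventually_elim, simp)
  show "a *\<^sub>R (x + y) = a *\<^sub>R x + a *\<^sub>R y"
    by (rule lsq_eqI) (use rep_add[of x y] rep_scaleR[of a "x+y"] rep_scaleR[of a x] rep_scaleR[of a y]
      rep_add[of "a *\<^sub>R x" "a *\<^sub>R y"] in eventually_elim, simp add: scaleR_add_right)
  show "(a + b) *\<^sub>R x = a *\<^sub>R x + b *\<^sub>R x"
    by (rule lsq_eqI) (use rep_scaleR[of "a+b" x] rep_scaleR[of a x] rep_scaleR[of b x]
      rep_add[of "a *\<^sub>R x" "b *\<^sub>R x"] in eventually_elim, simp add: scaleR_add_left)
  show "a *\<^sub>R b *\<^sub>R x = (a * b) *\<^sub>R x"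
    by (rule lsq_eqI) (use rep_scaleR[of "a*b" x] rep_scaleR[of b x] rep_scaleR[of a "b *\<^sub>R x"] in eventually_elim, simp)
  show "1 *\<^sub>R x = x"
    by (rule lsq_eqI) (use rep_scaleR[of 1 x] in eventually_elim, simp)
  show "dist x y = norm (x - y)" by (rule dist_lsq_def)
  show "sgn x = inverse (norm x) *\<^sub>R x" by (rule sgn_lsq_def)
  show "uniformity = (INF e\<in>{0<..}. principal {(x, y :: 'a lsq). dist x y < e})" by (rule uniformity_lsq_def)
  show "open U = (\<forall>x\<in>U. \<forall>\<^sub>F (x', y) in uniformity. x' = x \<longrightarrow> y \<in> U)" for U :: "'a lsq set"
    by (rule open_lsq_def)
  show "inner x y = inner y x" by (simp add: inner_lsq_def inner_commute)
  show "inner (x + y) z = inner x z + inner y z"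
  proof -
    have "inner (x + y) z = (\<integral>t. inner (rep x t) (rep z t) + inner (rep y t) (rep z t) \<partial>lborel)"
      unfolding inner_lsq_def
      by (rule integral_cong_AE) (use rep_add[of x y] in \<open>auto simp: inner_add_left elim: eventually_mono\<close>)
    then show ?thesis by (simp add: inner_lsq_def L2_integrable_inner)
  qed
  show "inner (a *\<^sub>R x) y = a * inner x y"
  proof -
    have "inner (a *\<^sub>R x) y = (\<integral>t. a * inner (rep x t) (rep y t) \<partial>lborel)"
      unfolding inner_lsq_def
      by (rule integral_cong_AE) (use rep_scaleR[of a x] in \<open>auto elim: eventually_mono\<close>)
    then show ?thesis by (simp add: inner_lsq_def)
  qed
  show "0 \<le> inner x x" unfolding inner_lsq_def by (rule integral_nonneg_AE) simp
  show "inner x x = 0 \<longleftrightarrow> x = 0"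
  proof
    assume "inner x x = 0"
    then have ae: "AE t in lborel. inner (rep x t) (rep x t) = 0"
      unfolding inner_lsq_def
      by (subst (asm) integral_nonneg_eq_0_iff_AE) (auto simp: L2_integrable_inner)
    show "x = 0"
      by (rule lsq_eqI) (use rep_zero ae in eventually_elim, simp)
  next
    assume "x = 0"
    then have "inner x x = (\<integral>t. 0 \<partial>(lborel :: 'a measure))"
      unfolding inner_lsq_def by (intro integral_cong_AE) (use rep_zero in \<open>auto elim: eventually_mono\<close>)
    then show "inner x x = 0" by simp
  qed
  show "norm x = sqrt (inner x x)" by (simp add: norm_lsq_def inner_lsq_def)
qed

end

lemma L2_norm_rep: "L2_norm (rep x) = norm x"
  by (simp add: norm_lsq_def L2_norm_def dot_square_norm)

lemma L2_norm_AE_cong: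
  assumes "f \<in> L2" "g \<in> L2" "AE x in lborel. f x = g x" shows "L2_norm f = L2_norm g"
proof -
  note [measurable] = L2_measurable[OF assms(1)] L2_measurable[OF assms(2)]
  show ?thesis unfolding L2_norm_def
    by (rule arg_cong[where f = sqrt], rule integral_cong_AE) (use assms(3) in \<open>auto elim: eventually_mono\<close>)
qed

lemma norm_cls: "f \<in> L2 \<Longrightarrow> norm (cls f) = L2_norm f"
  unfolding L2_norm_rep[symmetric] by (rule L2_norm_AE_cong) (auto intro: rep_cls)

lemma cls_add: "f \<in> L2 \<Longrightarrow> g \<in> L2 \<Longrightarrow> cls (\<lambda>x. f x + g x) = cls f + cls g"
  unfolding plus_lsq_def
proof (rule cls_eqI)
  assume fg: "f \<in> L2" "g \<in> L2"
  show "AE x in lborel. f x + g x = rep (cls f) x + rep (cls g) x"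
    using rep_cls[OF fg(1)] rep_cls[OF fg(2)] by eventually_elim simp
qed (auto intro: L2_add)

lemma cls_diff: "f \<in> L2 \<Longrightarrow> g \<in> L2 \<Longrightarrow> cls (\<lambda>x. f x - g x) = cls f - cls g"
  unfolding minus_lsq_def
proof (rule cls_eqI)
  assume fg: "f \<in> L2" "g \<in> L2"
  show "AE x in lborel. f x - g x = rep (cls f) x - rep (cls g) x"
    using rep_cls[OF fg(1)] rep_cls[OF fg(2)] by eventually_elim simp
qed (auto intro: L2_diff)

lemma cls_scaleR: "f \<in> L2 \<Longrightarrow> cls (\<lambda>x. c *\<^sub>R f x) = c *\<^sub>R cls f"
  unfolding scaleR_lsq_def
proof (rule cls_eqI)
  assume f: "f \<in> L2"
  show "AE x in lborel. c *\<^sub>R f x = c *\<^sub>R rep (cls f) x"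
    using rep_cls[OF f] by eventually_elim simp
qed (auto intro: L2_scaleR)

lemma nn_integral_rep: "(\<integral>\<^sup>+t. ennreal ((cmod (rep x t))\<^sup>2) \<partial>lborel) = ennreal ((norm x)\<^sup>2)"
proof -
  have "(\<integral>\<^sup>+t. ennreal ((cmod (rep x t))\<^sup>2) \<partial>lborel) = ennreal (\<integral>t. (cmod (rep x t))\<^sup>2 \<partial>lborel)"
    by (rule nn_integral_eq_integral) (auto intro: L2_integrable)
  also have "(\<integral>t. (cmod (rep x t))\<^sup>2 \<partial>lborel) = (norm x)\<^sup>2"
    by (simp add: norm_lsq_def dot_square_norm)
  finally show ?thesis .
qed

lemma nn_integral_L2: "f \<in> L2 \<Longrightarrow> (\<integral>\<^sup>+t. ennreal ((cmod (f t))\<^sup>2) \<partial>lborel) = ennreal ((norm (cls f))\<^sup>2)"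
  unfolding nn_integral_rep[symmetric]
  by (rule nn_integral_cong_AE) (drule rep_cls, auto elim: eventually_mono)

lemma L2_of_nn_integral:
  assumes [measurable]: "f \<in> borel_measurable borel"
    and le: "(\<integral>\<^sup>+t. ennreal ((cmod (f t))\<^sup>2) \<partial>lborel) \<le> ennreal (B\<^sup>2)" and "B \<ge> 0"
  shows "f \<in> L2" "norm (cls f) \<le> B"
proof -
  show f: "f \<in> L2"
  proof (rule L2_I)
    show "integrable lborel (\<lambda>x. (cmod (f x))\<^sup>2)"
    proof (rule integrableI_bounded)
      show "(\<integral>\<^sup>+ x. ennreal (norm ((cmod (f x))\<^sup>2)) \<partial>lborel) < \<infinity>"
        using le_less_trans[OF le ennreal_less_top] by simp
    qed simp
  qed simp
  have "ennreal ((norm (cls f))\<^sup>2) \<le> ennreal (B\<^sup>2)"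
    using le nn_integral_L2[OF f] by simp
  then show "norm (cls f) \<le> B" using \<open>B \<ge> 0\<close> by (simp add: power2_le_iff_abs_le)
qed

text \<open>Fatou's lemma replaces any domination: a bound on the norms passes to almost everywhere limits.\<close>

lemma L2_Fatou:
  assumes meas: "\<And>k. f k \<in> L2" "g \<in> borel_measurable borel"
    and lim: "AE t in lborel. (\<lambda>k. f k t) \<longlonglongrightarrow> g t"
    and bd: "\<forall>\<^sub>F k in sequentially. norm (cls (f k)) \<le> B"
  shows "g \<in> L2" "norm (cls g) \<le> B"
proof -
  note [measurable] = L2_measurable[OF meas(1)] meas(2)
  have B: "B \<ge> 0"
    using eventually_happens[OF bd] norm_ge_zero by (metis order_trans trivial_limit_sequentially)
  have "(\<integral>\<^sup>+t. ennreal ((cmod (g t))\<^sup>2) \<partial>lborel) = (\<integral>\<^sup>+t. liminf (\<lambda>k. ennreal ((cmod (f k t))\<^sup>2)) \<partial>lborel)"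
  proof (rule nn_integral_cong_AE, use lim in eventually_elim)
    fix t assume "(\<lambda>k. f k t) \<longlonglongrightarrow> g t"
    then have "(\<lambda>k. ennreal ((cmod (f k t))\<^sup>2)) \<longlonglongrightarrow> ennreal ((cmod (g t))\<^sup>2)"
      by (intro tendsto_intros)
    from lim_imp_Liminf[OF _ this] show "ennreal ((cmod (g t))\<^sup>2) = liminf (\<lambda>k. ennreal ((cmod (f k t))\<^sup>2))"
      by simp
  qed
  also have "\<dots> \<le> liminf (\<lambda>k. \<integral>\<^sup>+t. ennreal ((cmod (f k t))\<^sup>2) \<partial>lborel)"
    by (rule nn_integral_liminf) simp
  also have "\<dots> \<le> ennreal (B\<^sup>2)"
  proof (rule order_trans[OF Liminf_mono Liminf_const[THEN eq_refl]])
    show "\<forall>\<^sub>F k in sequentially. (\<integral>\<^sup>+t. ennreal ((cmod (f k t))\<^sup>2) \<partial>lborel) \<le> ennreal (B\<^sup>2)"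
      using bd by eventually_elim (simp add: nn_integral_L2[OF meas(1)] power_mono)
  qed simp
  finally have le: "(\<integral>\<^sup>+t. ennreal ((cmod (g t))\<^sup>2) \<partial>lborel) \<le> ennreal (B\<^sup>2)" .
  show "g \<in> L2" "norm (cls g) \<le> B" using L2_of_nn_integral[OF _ le B] by auto
qed

text \<open>The differences to the limit are eventually smaller than any given bound, and Fatou's lemma
  transfers this bound to the almost everywhere limit of the differences.\<close>

lemma tendsto_AE_unique:
  assumes lim: "X \<longlonglongrightarrow> x" and ae: "AE t in lborel. (\<lambda>k. rep (X k) t) \<longlonglongrightarrow> g t"
    and [measurable]: "g \<in> borel_measurable borel"
  shows "AE t in lborel. rep x t = g t" "g \<in> L2"
proof -
  have bd: "\<forall>\<^sub>F k in sequentially. norm (cls (\<lambda>t. rep (X k) t - rep x t)) \<le> e" if "e > 0" for e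
    using tendstoD[OF lim that] by eventually_elim (simp add: cls_diff dist_norm)
  have "AE t in lborel. (\<lambda>k. rep (X k) t - rep x t) \<longlonglongrightarrow> g t - rep x t"
    using ae by eventually_elim (intro tendsto_intros)
  note * = L2_Fatou[OF _ _ this bd]
  have L: "(\<lambda>t. g t - rep x t) \<in> L2" by (rule *(1)[of 1]) (auto intro: L2_diff)
  have "norm (cls (\<lambda>t. g t - rep x t)) \<le> e" if "e > 0" for e
    by (rule *(2)[OF _ _ that]) (auto intro: L2_diff)
  then have "norm (cls (\<lambda>t. g t - rep x t)) \<le> 0" by (rule field_le_epsilon) simp
  then have "cls (\<lambda>t. g t - rep x t) = cls (\<lambda>t. 0)" by (simp add: zero_lsq_def[symmetric])
  then have "AE t in lborel. g t - rep x t = 0" using L by (simp add: cls_eq_iff)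
  then show "AE t in lborel. rep x t = g t" by eventually_elim simp
  show "g \<in> L2" using L2_add[OF L, of "rep x"] by simp
qed

lemma lsq_dominated_convergence:
  assumes meas: "\<And>k. f k \<in> borel_measurable borel" "g \<in> borel_measurable borel" and w: "w \<in> L2"
    and lim: "AE t in lborel. (\<lambda>k. f k t) \<longlonglongrightarrow> g t"
    and dom: "\<And>k. AE t in lborel. cmod (f k t) \<le> cmod (w t)"
  shows "(\<lambda>k. cls (f k)) \<longlonglongrightarrow> cls g" "g \<in> L2" "f k \<in> L2"
proof -
  note [measurable] = meas L2_measurable[OF w]
  show fk: "f k \<in> L2" for k by (rule L2_dominated[OF w, of _ 1]) (use dom in auto)
  have gw: "AE t in lborel. cmod (g t) \<le> cmod (w t)"
  proof -
    have "AE t in lborel. \<forall>k. cmod (f k t) \<le> cmod (w t)" using dom by (simp add: AE_all_countable)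
    with lim show ?thesis
    proof eventually_elim
      case (elim t)
      then show ?case by (intro LIMSEQ_le_const2[OF tendsto_norm[OF elim(1)]]) auto
    qed
  qed
  then show g: "g \<in> L2" by (intro L2_dominated[OF w, of _ 1]) auto
  have "(\<lambda>k. \<integral>t. (cmod (f k t - g t))\<^sup>2 \<partial>lborel) \<longlonglongrightarrow> (\<integral>t. 0 \<partial>(lborel::'a measure))"
  proof (rule integral_dominated_convergence[where w = "\<lambda>t. 4 * (cmod (w t))\<^sup>2"])
    show "integrable lborel (\<lambda>t. 4 * (cmod (w t))\<^sup>2)" using L2_integrable[OF w] by simp
    show "AE t in lborel. (\<lambda>k. (cmod (f k t - g t))\<^sup>2) \<longlonglongrightarrow> 0"
      using lim by eventually_elim (auto intro!: tendsto_eq_intros)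
    show "AE t in lborel. norm ((cmod (f k t - g t))\<^sup>2) \<le> 4 * (cmod (w t))\<^sup>2" for k
      using dom[of k] gw
    proof eventually_elim
      case (elim t)
      have "cmod (f k t - g t) \<le> 2 * cmod (w t)"
        using norm_triangle_ineq4[of "f k t" "g t"] elim by simp
      then have "(cmod (f k t - g t))\<^sup>2 \<le> (2 * cmod (w t))\<^sup>2" by (intro power_mono) auto
      then show ?case by (simp add: power_mult_distrib)
    qed
  qed auto
  then have "(\<lambda>k. sqrt (\<integral>t. (cmod (f k t - g t))\<^sup>2 \<partial>lborel)) \<longlonglongrightarrow> 0"
    using tendsto_real_sqrt[of _ 0 sequentially] by simp
  then have "(\<lambda>k. norm (cls (f k) - cls g)) \<longlonglongrightarrow> 0"
    by (simp add: cls_diff[symmetric] fk g norm_cls L2_diff L2_norm_def)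
  then show "(\<lambda>k. cls (f k)) \<longlonglongrightarrow> cls g" by (rule LIM_zero_cancel[OF tendsto_norm_zero_cancel])
qed

text \<open>Riesz-Fischer. A subsequence whose increments have norms at most \<open>2^(-k)\<close> converges almost
  everywhere, since the squared increments remain summable after multiplication by \<open>2^k\<close>; this makes
  the increments themselves geometrically small at almost every point. Fatou's lemma then bounds the
  distance of the subsequence to its pointwise limit.\<close>

instance lsq :: (euclidean_space) complete_space
proof
  fix X :: "nat \<Rightarrow> 'a lsq" assume X: "Cauchy X"
  have "\<exists>N. \<forall>m\<ge>N. \<forall>n\<ge>N. norm (X m - X n) < (1/2)^k" for k
    using X unfolding Cauchy_iff by simp
  then obtain N where N: "\<And>k m n. m \<ge> N k \<Longrightarrow> n \<ge> N k \<Longrightarrow> norm (X m - X n) < (1/2)^k" by metis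
  \<comment> \<open>The sum makes the indices increase, and the summand \<open>k\<close> makes them unbounded.\<close>
  define r where "r k = (\<Sum>j\<le>k. N j) + k" for k
  have rN: "r k \<ge> N k" for k unfolding r_def by (simp add: trans_le_add1 member_le_sum)
  have rS: "r (Suc k) \<ge> r k" for k by (simp add: r_def)
  have rk: "r k \<ge> k" for k by (simp add: r_def)
  define Y where "Y k = X (r k)" for k
  define D where "D k = Y (Suc k) - Y k" for k
  have D: "norm (D k) \<le> (1/2)^k" for k
    unfolding D_def Y_def using N[of k "r (Suc k)" "r k"] rN[of k] rS[of k] by simp
  have "(\<integral>\<^sup>+t. (\<Sum>k. ennreal (2^k * (cmod (rep (D k) t))\<^sup>2)) \<partial>lborel) = (\<Sum>k. \<integral>\<^sup>+t. ennreal (2^k * (cmod (rep (D k) t))\<^sup>2) \<partial>lborel)"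
    by (rule nn_integral_suminf) simp
  also have "\<dots> = (\<Sum>k. ennreal (2^k * (norm (D k))\<^sup>2))"
    by (simp add: ennreal_mult nn_integral_cmult nn_integral_rep)
  also have "\<dots> \<le> (\<Sum>k. ennreal ((1/2)^k))"
  proof (rule suminf_le, rule ennreal_leI)
    fix k
    have "2^k * (norm (D k))\<^sup>2 \<le> 2^k * ((1/2)^k)\<^sup>2" using D[of k] by (intro mult_left_mono power_mono) auto
    also have "\<dots> = (2 * (1/2) * (1/2::real))^k" unfolding power2_eq_square power_mult_distrib by simp
    finally show "2^k * (norm (D k))\<^sup>2 \<le> (1/2)^k" by simp
  qed auto
  also have "\<dots> = ennreal (\<Sum>k. (1/2)^k)"
    by (rule suminf_ennreal2) (auto simp: summable_geometric)
  also have "\<dots> < \<infinity>" by simp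
  finally have "(\<integral>\<^sup>+t. (\<Sum>k. ennreal (2^k * (cmod (rep (D k) t))\<^sup>2)) \<partial>lborel) \<noteq> \<infinity>" by simp
  then have "AE t in lborel. (\<Sum>k. ennreal (2^k * (cmod (rep (D k) t))\<^sup>2)) \<noteq> \<infinity>"
    by (intro nn_integral_PInf_AE) auto
  moreover have "AE t in lborel. \<forall>k. rep (D k) t = rep (Y (Suc k)) t - rep (Y k) t"
    unfolding AE_all_countable D_def by (auto intro: rep_diff)
  ultimately have conv: "AE t in lborel. convergent (\<lambda>k. rep (Y k) t)"
  proof eventually_elim
    case (elim t)
    have sm: "summable (\<lambda>k. 2^k * (cmod (rep (D k) t))\<^sup>2)"
      by (rule summable_suminf_not_top) (use elim(1) in auto)
    then have "(\<lambda>k. 2^k * (cmod (rep (D k) t))\<^sup>2) \<longlonglongrightarrow> 0" by (rule summable_LIMSEQ_zero)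
    then have "Bseq (\<lambda>k. 2^k * (cmod (rep (D k) t))\<^sup>2)" by (intro convergent_imp_Bseq convergentI)
    then obtain K where K: "K > 0" "\<And>k. norm (2^k * (cmod (rep (D k) t))\<^sup>2) \<le> K" by (auto elim: BseqE)
    have "cmod (rep (D k) t) \<le> sqrt K * (sqrt (1/2))^k" for k
    proof (rule real_le_rsqrt[THEN order_trans])
      have "(cmod (rep (D k) t))\<^sup>2 = (2^k * (cmod (rep (D k) t))\<^sup>2) * (1/2)^k"
        by (simp add: power_one_over)
      also have "\<dots> \<le> K * (1/2)^k" using K(2)[of k] by (intro mult_right_mono) auto
      finally show "(cmod (rep (D k) t))\<^sup>2 \<le> K * (1/2)^k" .
      show "sqrt (K * (1/2)^k) \<le> sqrt K * (sqrt (1/2))^k" by (simp add: real_sqrt_mult real_sqrt_power)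
    qed
    moreover have "summable (\<lambda>k. sqrt K * (sqrt (1/2))^k)"
      by (intro summable_mult summable_geometric) (simp add: real_sqrt_divide)
    ultimately have "summable (\<lambda>k. rep (D k) t)"
      by (rule summable_comparison_test'[of _ 0, rotated])
    then have "summable (\<lambda>k. rep (Y (Suc k)) t - rep (Y k) t)" using elim(2) by simp
    then have "convergent (\<lambda>n. \<Sum>k<n. rep (Y (Suc k)) t - rep (Y k) t)" by (simp add: summable_iff_convergent)
    then have "convergent (\<lambda>n. rep (Y n) t - rep (Y 0) t)" by (simp add: sum_lessThan_telescope[of "\<lambda>k. rep (Y k) t"])
    then show ?case by (simp add: convergent_diff_const_right_iff)
  qed
  define g where "g t = lim (\<lambda>k. rep (Y k) t)" for t
  have g [measurable]: "g \<in> borel_measurable borel"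
    unfolding g_def by (rule borel_measurable_lim_metric) simp
  have lim: "AE t in lborel. (\<lambda>k. rep (Y k) t) \<longlonglongrightarrow> g t"
    using conv by eventually_elim (simp add: g_def convergent_LIMSEQ_iff)
  have bd: "norm (Y j - Y n) \<le> (1/2)^n" if "j \<ge> n" for j n
  proof -
    have "r j \<ge> r n" by (rule lift_Suc_mono_le[of r, OF rS that])
    then show ?thesis unfolding Y_def using N[of n "r j" "r n"] rN[of n] by simp
  qed
  have *: "(\<lambda>t. g t - rep (Y n) t) \<in> L2" "norm (cls (\<lambda>t. g t - rep (Y n) t)) \<le> (1/2)^n" for n
  proof -
    have ae: "AE t in lborel. (\<lambda>k. rep (Y k) t - rep (Y n) t) \<longlonglongrightarrow> g t - rep (Y n) t"
      using lim by eventually_elim (intro tendsto_intros)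
    have ev: "\<forall>\<^sub>F k in sequentially. norm (cls (\<lambda>t. rep (Y k) t - rep (Y n) t)) \<le> (1/2)^n"
      using eventually_ge_at_top[of n] by eventually_elim (simp add: cls_diff bd)
    show "(\<lambda>t. g t - rep (Y n) t) \<in> L2" "norm (cls (\<lambda>t. g t - rep (Y n) t)) \<le> (1/2)^n"
      by (rule L2_Fatou[OF _ _ ae ev]; simp add: L2_diff)+
  qed
  have gL: "g \<in> L2" using L2_add[OF *(1)[of 0], of "rep (Y 0)"] by simp
  have "Y \<longlonglongrightarrow> cls g"
  proof (rule LIM_zero_cancel, rule Lim_null_comparison)
    show "\<forall>\<^sub>F n in sequentially. norm (Y n - cls g) \<le> (1/2)^n"
      using *(2) gL by (simp add: cls_diff norm_minus_commute[of _ "cls g"])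
    show "(\<lambda>n. (1/2::real)^n) \<longlonglongrightarrow> 0" by (simp add: LIMSEQ_realpow_zero)
  qed
  moreover have "(\<lambda>k. Y k - X k) \<longlonglongrightarrow> 0"
  proof (rule metric_LIMSEQ_I)
    fix e :: real assume "e > 0"
    then obtain M where "\<And>m n. m \<ge> M \<Longrightarrow> n \<ge> M \<Longrightarrow> norm (X m - X n) < e"
      using X unfolding Cauchy_iff by metis
    then show "\<exists>no. \<forall>n\<ge>no. dist (Y n - X n) 0 < e"
      unfolding Y_def using order_trans[OF _ rk] by (intro exI[of _ M]) (simp add: dist_norm)
  qed
  ultimately have "(\<lambda>k. Y k - (Y k - X k)) \<longlonglongrightarrow> cls g - 0" by (intro tendsto_diff)
  then show "convergent X" by (auto simp: convergent_def)
qed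

instance lsq :: (euclidean_space) banach ..

section \<open>Multiplication operators, reflection and the bilinear pairing\<close>

lemma borel_measurable_cis [measurable]: "cis \<in> borel_measurable borel"
  by (intro borel_measurable_continuous_onI continuous_intros)

lemma borel_measurable_cnj [measurable]: "cnj \<in> borel_measurable borel"
  by (intro borel_measurable_continuous_onI continuous_intros)

definition cj :: "'a::euclidean_space lsq \<Rightarrow> 'a lsq" where
  "cj x = cls (\<lambda>t. cnj (rep x t))"

definition rf :: "'a::euclidean_space lsq \<Rightarrow> 'a lsq" where
  "rf x = cls (\<lambda>t. rep x (- t))"

text \<open>The domain of multiplication by \<open>h\<close>; outside it, the value \<open>mul h x\<close> below is meaningless.\<close>

definition mdom :: "('a::euclidean_space \<Rightarrow> complex) \<Rightarrow> 'a lsq \<Rightarrow> bool" where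
  "mdom h x \<longleftrightarrow> (\<lambda>t. h t * rep x t) \<in> L2"

definition mul :: "('a::euclidean_space \<Rightarrow> complex) \<Rightarrow> 'a lsq \<Rightarrow> 'a lsq" where
  "mul h x = cls (\<lambda>t. h t * rep x t)"

definition bmult :: "('a::euclidean_space \<Rightarrow> complex) \<Rightarrow> bool" where
  "bmult h \<longleftrightarrow> h \<in> borel_measurable borel \<and> (\<exists>K. AE t in lborel. cmod (h t) \<le> K)"

text \<open>The bilinear pairing, without conjugation, in which the distributional equation is tested. The
  Fourier transform and all multiplication operators are their own transposes.\<close>

definition pair :: "'a::euclidean_space lsq \<Rightarrow> 'a lsq \<Rightarrow> complex" where
  "pair x y = (\<integral>t. rep x t * rep y t \<partial>lborel)"

lemma L2_reflect: "f \<in> L2 \<Longrightarrow> (\<lambda>t. f (- t)) \<in> L2"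
  using L2_affine[of f "-1" 0] by simp

lemma AE_reflect: "AE t in lborel. P t \<Longrightarrow> AE t in lborel. P (- t :: 'a::euclidean_space)"
  using AE_lborel_affine[of P "-1" 0] by simp

lemma rep_cj: "AE t in lborel. rep (cj x) t = cnj (rep x t)"
  unfolding cj_def by (rule rep_cls) (simp add: L2_cnj)

lemma rep_rf: "AE t in lborel. rep (rf x) t = rep x (- t)"
  unfolding rf_def by (rule rep_cls) (simp add: L2_reflect)

lemma rep_mul: "mdom h x \<Longrightarrow> AE t in lborel. rep (mul h x) t = h t * rep x t"
  unfolding mul_def mdom_def by (rule rep_cls)

lemma cj_cls: "f \<in> L2 \<Longrightarrow> cj (cls f) = cls (\<lambda>t. cnj (f t))"
  unfolding cj_def by (rule cls_eqI) (use rep_cls[of f] in \<open>auto intro: L2_cnj elim: eventually_mono\<close>)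

lemma rf_cls: "f \<in> L2 \<Longrightarrow> rf (cls f) = cls (\<lambda>t. f (- t))"
  unfolding rf_def by (rule cls_eqI) (use AE_reflect[OF rep_cls[of f]] in \<open>auto intro: L2_reflect\<close>)

lemma pair_cls:
  assumes "f \<in> L2" "g \<in> L2" shows "pair (cls f) (cls g) = (\<integral>t. f t * g t \<partial>lborel)"
proof -
  note [measurable] = L2_measurable[OF assms(1)] L2_measurable[OF assms(2)]
  show ?thesis unfolding pair_def
    by (rule integral_cong_AE) (use rep_cls[OF assms(1)] rep_cls[OF assms(2)] in \<open>auto elim: eventually_elim2\<close>)
qed

lemma bmult_mdom: "bmult h \<Longrightarrow> mdom h x"
  unfolding bmult_def mdom_def using L2_mult_bounded[of "rep x" h] by auto

lemma bmult_const [simp]: "bmult (\<lambda>_. c)"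
  unfolding bmult_def by auto

lemma bmult_unimodular: "h \<in> borel_measurable borel \<Longrightarrow> (\<And>t. cmod (h t) = 1) \<Longrightarrow> bmult h"
  unfolding bmult_def by (auto intro!: exI[of _ 1])

lemma mdom_cls:
  assumes "f \<in> L2" "h \<in> borel_measurable borel" "(\<lambda>t. h t * f t) \<in> L2"
  shows "mdom h (cls f)" "mul h (cls f) = cls (\<lambda>t. h t * f t)"
proof -
  note [measurable] = L2_measurable[OF assms(1)] assms(2)
  have ae: "AE t in lborel. h t * rep (cls f) t = h t * f t"
    using rep_cls[OF assms(1)] by eventually_elim simp
  show m: "mdom h (cls f)" unfolding mdom_def
    by (rule L2_dominated[OF assms(3), of _ 1]) (use ae in \<open>auto elim: eventually_mono\<close>)
  show "mul h (cls f) = cls (\<lambda>t. h t * f t)" unfolding mul_def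
    by (rule cls_eqI[OF _ assms(3) ae]) (use m in \<open>simp add: mdom_def\<close>)
qed

lemma mdom_add:
  assumes h: "h \<in> borel_measurable borel" "mdom h x" "mdom h y"
  shows "mdom h (x + y)" "mul h (x + y) = mul h x + mul h y"
proof -
  have *: "(\<lambda>t. h t * (rep x t + rep y t)) \<in> L2"
    using L2_add[OF h(2,3)[unfolded mdom_def]] by (simp add: distrib_left)
  have e: "cls (\<lambda>t. rep x t + rep y t) = x + y" by (simp add: cls_add)
  show "mdom h (x + y)" "mul h (x + y) = mul h x + mul h y"
    using mdom_cls[OF _ h(1) *] h(2,3) unfolding e
    by (auto simp: L2_add mul_def mdom_def distrib_left cls_add)
qed

lemma mdom_scaleR:
  assumes h: "h \<in> borel_measurable borel" "mdom h x"
  shows "mdom h (c *\<^sub>R x)" "mul h (c *\<^sub>R x) = c *\<^sub>R mul h x"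
proof -
  have *: "(\<lambda>t. h t * (c *\<^sub>R rep x t)) \<in> L2"
    using L2_scaleR[OF h(2)[unfolded mdom_def]] by (simp add: scaleR_conv_of_real mult_ac)
  have e: "cls (\<lambda>t. c *\<^sub>R rep x t) = c *\<^sub>R x" by (simp add: cls_scaleR)
  have **: "(\<lambda>t. h t * (c *\<^sub>R rep x t)) = (\<lambda>t. c *\<^sub>R (h t * rep x t))"
    by (auto simp: scaleR_conv_of_real mult_ac)
  show "mdom h (c *\<^sub>R x)" "mul h (c *\<^sub>R x) = c *\<^sub>R mul h x"
    using mdom_cls[OF _ h(1) *] h(2) unfolding e ** by (auto simp: L2_scaleR mul_def mdom_def cls_scaleR)
qed

lemma mdom_diff:
  assumes h: "h \<in> borel_measurable borel" "mdom h x" "mdom h y"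
  shows "mdom h (x - y)" "mul h (x - y) = mul h x - mul h y"
  using mdom_add[OF h(1,2) mdom_scaleR(1)[OF h(1,3), of "-1"]] mdom_scaleR[OF h(1,3), of "-1"] by simp_all

lemma mdom_mul:
  assumes h: "h \<in> borel_measurable borel" "k \<in> borel_measurable borel" "mdom k x" "mdom (\<lambda>t. h t * k t) x"
  shows "mdom h (mul k x)" "mul h (mul k x) = mul (\<lambda>t. h t * k t) x"
  using mdom_cls[of "\<lambda>t. k t * rep x t" h] h by (auto simp: mul_def mdom_def mult.assoc)

lemma bmult_mul:
  assumes "bmult h" "bmult k" shows "bmult (\<lambda>t. h t * k t)"
proof -
  from assms obtain A B where *: "AE t in lborel. cmod (h t) \<le> A" "AE t in lborel. cmod (k t) \<le> B"
    and [measurable]: "h \<in> borel_measurable borel" "k \<in> borel_measurable borel" unfolding bmult_def by auto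
  have "AE t in lborel. cmod (h t * k t) \<le> A * B"
    using * by eventually_elim (auto simp: norm_mult intro!: mult_mono order_trans[OF norm_ge_zero])
  then show ?thesis unfolding bmult_def by auto
qed

lemma mul_mul: "bmult h \<Longrightarrow> bmult k \<Longrightarrow> mul h (mul k x) = mul (\<lambda>t. h t * k t) x"
  using mdom_mul(2)[of h k x] bmult_mdom bmult_mul[of h k] unfolding bmult_def by blast

lemma mul_one [simp]: "mul (\<lambda>_. 1) x = x"
  by (simp add: mul_def)

lemma norm_mul_le:
  assumes "h \<in> borel_measurable borel" "AE t in lborel. cmod (h t) \<le> K"
  shows "norm (mul h x) \<le> K * norm x"
proof -
  have m: "mdom h x" using assms by (intro bmult_mdom) (auto simp: bmult_def)
  have K: "K \<ge> 0"
  proof -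
    have "\<exists>t. cmod (h t) \<le> K"
    proof (rule ccontr)
      assume "\<nexists>t. cmod (h t) \<le> K"
      then have "AE t in (lborel :: 'a measure). False" using assms(2) by simp
      then show False by (simp add: AE_iff_measurable[OF _ refl])
    qed
    then show ?thesis using norm_ge_zero order_trans by blast
  qed
  show ?thesis
  proof (rule L2_of_nn_integral(2)[of "\<lambda>t. h t * rep x t" "K * norm x", folded mul_def])
    have "(\<integral>\<^sup>+t. ennreal ((cmod (h t * rep x t))\<^sup>2) \<partial>lborel) \<le> (\<integral>\<^sup>+t. ennreal (K\<^sup>2) * ennreal ((cmod (rep x t))\<^sup>2) \<partial>lborel)"
    proof (rule nn_integral_mono_AE, use assms(2) in eventually_elim)
      fix t assume "cmod (h t) \<le> K"
      then have "(cmod (h t * rep x t))\<^sup>2 \<le> K\<^sup>2 * (cmod (rep x t))\<^sup>2"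
        by (simp add: norm_mult power_mult_distrib mult_right_mono power_mono)
      then show "ennreal ((cmod (h t * rep x t))\<^sup>2) \<le> ennreal (K\<^sup>2) * ennreal ((cmod (rep x t))\<^sup>2)"
        by (simp add: ennreal_mult[symmetric])
    qed
    also have "\<dots> = ennreal (K\<^sup>2) * ennreal ((norm x)\<^sup>2)"
      by (simp add: nn_integral_cmult nn_integral_rep)
    also have "\<dots> = ennreal ((K * norm x)\<^sup>2)" by (simp add: power_mult_distrib ennreal_mult)
    finally show "(\<integral>\<^sup>+t. ennreal ((cmod (h t * rep x t))\<^sup>2) \<partial>lborel) \<le> ennreal ((K * norm x)\<^sup>2)" .
    show "(\<lambda>t. h t * rep x t) \<in> borel_measurable borel" using assms by simp
    show "K * norm x \<ge> 0" using K by simp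
  qed
qed

lemma bounded_linear_mul: assumes "bmult h" shows "bounded_linear (mul h)"
proof -
  from assms obtain K where h: "h \<in> borel_measurable borel" "AE t in lborel. cmod (h t) \<le> K"
    by (auto simp: bmult_def)
  show ?thesis
    by (rule bounded_linear_intro[where K=K])
       (use norm_mul_le[OF h] mdom_add(2)[OF h(1) bmult_mdom bmult_mdom, OF assms assms]
         mdom_scaleR(2)[OF h(1) bmult_mdom, OF assms] in \<open>auto simp: mult.commute\<close>)
qed

lemma norm_mul_unimodular:
  assumes "h \<in> borel_measurable borel" "\<And>t. cmod (h t) = 1"
  shows "norm (mul h x) = norm x"
  unfolding mul_def
proof (subst norm_cls)
  show "(\<lambda>t. h t * rep x t) \<in> L2" using bmult_mdom[OF bmult_unimodular[OF assms]] by (simp add: mdom_def)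
  show "L2_norm (\<lambda>t. h t * rep x t) = norm x"
    unfolding L2_norm_rep[symmetric] L2_norm_def by (simp add: norm_mult assms(2))
qed

lemma pair_mul:
  assumes "mdom h x" "mdom h y" shows "pair (mul h x) y = pair x (mul h y)"
  unfolding pair_def
  by (rule integral_cong_AE) (use rep_mul[OF assms(1)] rep_mul[OF assms(2)] in \<open>auto elim: eventually_elim2\<close>)

lemma cj_cj [simp]: "cj (cj x) = x"
  unfolding cj_def[of x] by (simp add: cj_cls L2_cnj)

lemma norm_cj [simp]: "norm (cj x) = norm x"
  unfolding cj_def by (simp add: norm_cls L2_cnj) (simp add: L2_norm_rep[symmetric] L2_norm_def)

lemma norm_rf [simp]: "norm (rf x) = norm x"
proof -
  have "(\<integral>t. (cmod (rep x (- t)))\<^sup>2 \<partial>lborel) = (\<integral>t. (cmod (rep x t))\<^sup>2 \<partial>lborel)"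
    using integral_lborel_affine[of "\<lambda>t. (cmod (rep x t))\<^sup>2" "-1" 0] by simp
  then show ?thesis
    unfolding rf_def by (simp add: norm_cls L2_reflect) (simp add: L2_norm_rep[symmetric] L2_norm_def)
qed

lemma inner_pair: "inner x y = Re (pair x (cj y))"
proof -
  have "inner x y = (\<integral>t. Re (rep x t * rep (cj y) t) \<partial>lborel)"
    unfolding inner_lsq_def inner_complex_mult_cnj
    by (rule integral_cong_AE) (use rep_cj[of y] in \<open>auto elim: eventually_mono\<close>)
  then show ?thesis unfolding pair_def by (simp add: L2_integrable_mult del: times_complex.sel)
qed

lemma pair_commute: "pair x y = pair y x"
  by (simp add: pair_def mult.commute)

lemma pair_add: "pair (x + y) z = pair x z + pair y z"
proof -
  have "pair (x + y) z = (\<integral>t. rep x t * rep z t + rep y t * rep z t \<partial>lborel)"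
    unfolding pair_def
    by (rule integral_cong_AE) (use rep_add[of x y] in \<open>auto simp: distrib_right elim: eventually_mono\<close>)
  then show ?thesis by (simp add: pair_def L2_integrable_mult)
qed

lemma pair_scaleR: "pair (c *\<^sub>R x) z = c *\<^sub>R pair x z"
proof -
  have "pair (c *\<^sub>R x) z = (\<integral>t. c *\<^sub>R (rep x t * rep z t) \<partial>lborel)"
    unfolding pair_def
    by (rule integral_cong_AE) (use rep_scaleR[of c x] in \<open>auto elim: eventually_mono\<close>)
  then show ?thesis by (simp add: pair_def)
qed

lemma pair_cmult: "pair (mul (\<lambda>_. c) x) y = c * pair x y"
proof -
  have "pair (mul (\<lambda>_. c) x) y = (\<integral>t. c * (rep x t * rep y t) \<partial>lborel)"
    unfolding pair_def
    by (rule integral_cong_AE) (use rep_mul[OF bmult_mdom, of "\<lambda>_. c" x] in \<open>auto elim: eventually_mono\<close>)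
  then show ?thesis by (simp add: pair_def)
qed

lemma norm_pair_le: "cmod (pair x y) \<le> norm x * norm y"
proof (cases "pair x y = 0")
  case False
  define c where "c = cis (- Arg (pair x y))"
  have c: "cmod c = 1" by (simp add: c_def)
  have "c * (of_real (cmod (pair x y)) * cis (Arg (pair x y))) = of_real (cmod (pair x y))"
    by (simp add: c_def cis_mult mult.left_commute)
  then have "c * pair x y = of_real (cmod (pair x y))"
    by (simp only: rcis_def[symmetric] rcis_cmod_Arg)
  then have "cmod (pair x y) = Re (pair (mul (\<lambda>_. c) x) y)" by (simp add: pair_cmult)
  also have "\<dots> = inner (mul (\<lambda>_. c) x) (cj y)" by (simp add: inner_pair)
  also have "\<dots> \<le> norm (mul (\<lambda>_. c) x) * norm (cj y)" by (rule norm_cauchy_schwarz)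
  finally show ?thesis by (simp add: norm_mul_unimodular c)
qed simp

lemma bounded_bilinear_pair: "bounded_bilinear pair"
proof
  show "pair (a + a') b = pair a b + pair a' b" for a a' b :: "'a lsq" by (rule pair_add)
  show "pair a (b + b') = pair a b + pair a b'" for a b b' :: "'a lsq"
    using pair_add[of b b' a] by (simp add: pair_commute)
  show "pair (r *\<^sub>R a) b = r *\<^sub>R pair a b" for r and a b :: "'a lsq" by (rule pair_scaleR)
  show "pair a (r *\<^sub>R b) = r *\<^sub>R pair a b" for r and a b :: "'a lsq"
    using pair_scaleR[of r b a] by (simp add: pair_commute)
  show "\<exists>K. \<forall>a b :: 'a lsq. norm (pair a b) \<le> norm a * norm b * K"
    using norm_pair_le by (auto intro!: exI[of _ 1])
qed

lemma bounded_linear_cj: "bounded_linear cj"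
proof (rule bounded_linear_intro[where K=1])
  show "cj (x + y) = cj x + cj y" for x y :: "'a lsq"
    by (rule lsq_eqI) (use rep_cj[of "x+y"] rep_add[of x y] rep_cj[of x] rep_cj[of y] rep_add[of "cj x" "cj y"] in eventually_elim, simp)
  show "cj (r *\<^sub>R x) = r *\<^sub>R cj x" for x :: "'a lsq" and r
    by (rule lsq_eqI) (use rep_cj[of "r *\<^sub>R x"] rep_scaleR[of r x] rep_cj[of x] rep_scaleR[of r "cj x"] in eventually_elim, simp)
qed simp

lemma bounded_linear_rf: "bounded_linear rf"
proof (rule bounded_linear_intro[where K=1])
  show "rf (x + y) = rf x + rf y" for x y :: "'a lsq"
    by (rule lsq_eqI) (use rep_rf[of "x+y"] AE_reflect[OF rep_add[of x y]] rep_rf[of x] rep_rf[of y] rep_add[of "rf x" "rf y"] in eventually_elim, simp)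
  show "rf (r *\<^sub>R x) = r *\<^sub>R rf x" for x :: "'a lsq" and r
    by (rule lsq_eqI) (use rep_rf[of "r *\<^sub>R x"] AE_reflect[OF rep_scaleR[of r x]] rep_rf[of x] rep_scaleR[of r "rf x"] in eventually_elim, simp)
qed simp

lemma mul_rf:
  assumes h: "h \<in> borel_measurable borel" "mdom h x" "\<And>t. h (- t) = h t"
  shows "mdom h (rf x)" "mul h (rf x) = rf (mul h x)"
proof -
  have *: "(\<lambda>t. h t * rep x (- t)) \<in> L2"
    using L2_reflect[OF h(2)[unfolded mdom_def]] by (simp add: h(3))
  show "mdom h (rf x)" "mul h (rf x) = rf (mul h x)"
    unfolding mul_def[of h x] using mdom_cls[OF _ h(1) *] h(2)
    by (simp_all add: rf_def[of x] L2_reflect rf_cls mdom_def h(3))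
qed

lemma mul_cj:
  assumes h: "h \<in> borel_measurable borel" "mdom h x"
  shows "cj (mul h x) = mul (\<lambda>t. cnj (h t)) (cj x)"
proof -
  note [measurable] = h(1)
  have *: "(\<lambda>t. cnj (h t) * cnj (rep x t)) \<in> L2"
    using L2_cnj[OF h(2)[unfolded mdom_def]] by simp
  show ?thesis
    unfolding mul_def[of h x] using mdom_cls(2)[OF _ _ *] h(2)
    by (simp add: cj_def[of x] L2_cnj cj_cls mdom_def)
qed

section \<open>The Fourier transform of intervals\<close>

text \<open>The function whose integral, \<open>\<pi> |a|\<close>, produces lengths of intervals on the Fourier side.\<close>

definition fejer :: "real \<Rightarrow> real \<Rightarrow> real" where
  "fejer a x = (1 - cos (a * x)) / x\<^sup>2"

lemma fejer_measurable [measurable]: "fejer a \<in> borel_measurable borel"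
  unfolding fejer_def[abs_def] by measurable

lemma tendsto_one_minus_cos_div: "((\<lambda>x. (1 - cos x) / x) \<longlongrightarrow> 0) (at (0::real))"
proof -
  have "((\<lambda>x. (cos x - cos 0) / (x - 0)) \<longlongrightarrow> - sin 0) (at (0::real))"
    using DERIV_cos[of 0] unfolding has_field_derivative_iff by simp
  from tendsto_minus[OF this] show ?thesis by (simp add: minus_divide_left)
qed

text \<open>Integration by parts gives the antiderivative \<open>Si x - (1 - cos x) / x\<close>, and the sine integral
  tends to \<open>\<pi> / 2\<close>.\<close>

lemma has_bochner_integral_fejer_half:
  "has_bochner_integral lborel (\<lambda>x. indicator {0<..} x * fejer 1 x) (pi / 2)"
proof -
  \<comment> \<open>The antiderivative obtained from integration by parts.\<close>
  define F where "F x = Si x - (1 - cos x) / x" for x :: real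
  have d: "DERIV F x :> fejer 1 x" if "x > 0" for x
  proof -
    have "DERIV F x :> sin x / x - (sin x * x - (1 - cos x) * 1) / (x * x)"
      unfolding F_def using DERIV_Si[of x] that by (auto intro!: derivative_eq_intros)
    also have "sin x / x - (sin x * x - (1 - cos x) * 1) / (x * x) = fejer 1 x"
      using that by (simp add: fejer_def field_simps power2_eq_square)
    finally show ?thesis .
  qed
  have A: "(F \<longlongrightarrow> 0) (at_right 0)"
  proof -
    have "(Si \<longlongrightarrow> Si 0) (at_right 0)"
      by (rule tendsto_mono[OF at_le isCont_Si[of 0, unfolded isCont_def]]) auto
    moreover have "Si 0 = 0" by (simp add: Si_def zero_ereal_def[symmetric])
    moreover have "((\<lambda>x. (1 - cos x) / x) \<longlongrightarrow> 0) (at_right (0::real))"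
      by (rule tendsto_mono[OF at_le tendsto_one_minus_cos_div]) auto
    ultimately show ?thesis unfolding F_def[abs_def] using tendsto_diff by fastforce
  qed
  have B: "(F \<longlongrightarrow> pi / 2) at_top"
  proof -
    have "((\<lambda>x. (1 - cos x) / x) \<longlongrightarrow> 0) (at_top :: real filter)"
    proof (rule Lim_null_comparison)
      show "\<forall>\<^sub>F x in at_top. norm ((1 - cos x) / x) \<le> 2 / (x::real)"
        using eventually_gt_at_top[of 0]
      proof eventually_elim
        case (elim x)
        have "\<bar>1 - cos x\<bar> \<le> 2" using cos_le_one[of x] cos_ge_minus_one[of x] by (simp add: abs_le_iff)
        then show ?case using elim by (simp add: divide_right_mono)
      qed
      show "((\<lambda>x. 2 / (x::real)) \<longlongrightarrow> 0) at_top" by real_asymp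
    qed
    then show ?thesis unfolding F_def[abs_def] using tendsto_diff[OF Si_at_top] by fastforce
  qed
  have c: "isCont (fejer 1) x" if "x > 0" for x
    unfolding fejer_def[abs_def] using that by (intro continuous_intros) auto
  have "set_integrable lborel (einterval 0 \<infinity>) (fejer 1)" "(LBINT x=0..\<infinity>. fejer 1 x) = pi / 2 - 0"
    by (rule interval_integral_FTC_nonneg[where F=F];
        use A B c d in \<open>auto simp: zero_ereal_def ereal_tendsto_simps fejer_def\<close>)+
  then have "set_integrable lborel {0<..} (fejer 1)" "(LBINT x:{0<..}. fejer 1 x) = pi / 2"
    by (simp_all add: interval_integral_to_infinity_eq zero_ereal_def)
  then show ?thesis unfolding set_integrable_def set_lebesgue_integral_def
    by (simp add: has_bochner_integral_iff)
qed

lemma has_bochner_integral_fejer_1: "has_bochner_integral lborel (fejer 1) pi"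
proof -
  have 1: "has_bochner_integral lborel (\<lambda>x. indicator {0<..} (-x) * fejer 1 (-x)) (pi / 2)"
    using lborel_has_bochner_integral_real_affine_iff[of "-1" "\<lambda>x. indicator {0<..} x * fejer 1 x" "pi / 2" 0]
      has_bochner_integral_fejer_half by simp
  have "has_bochner_integral lborel
      (\<lambda>x. indicator {0<..} x * fejer 1 x + indicator {0<..} (-x) * fejer 1 (-x)) (pi / 2 + pi / 2)"
    by (rule has_bochner_integral_add[OF has_bochner_integral_fejer_half 1])
  also have "(\<lambda>x. indicator {0<..} x * fejer 1 x + indicator {0<..} (-x) * fejer 1 (-x)) = fejer 1"
    by (auto simp: fejer_def fun_eq_iff indicator_def)
  finally show ?thesis by simp
qed

lemma has_bochner_integral_fejer: "has_bochner_integral lborel (fejer a) (pi * \<bar>a\<bar>)"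
proof (cases "a = 0")
  case True
  then show ?thesis using has_bochner_integral_zero by (simp add: fejer_def[abs_def])
next
  case False
  have "has_bochner_integral lborel (\<lambda>x. fejer 1 (a * x)) (pi / \<bar>a\<bar>)"
    using lborel_has_bochner_integral_real_affine_iff[of a "fejer 1" pi 0] has_bochner_integral_fejer_1 False
    by (simp add: divide_inverse mult.commute)
  then have "has_bochner_integral lborel (\<lambda>x. a\<^sup>2 * fejer 1 (a * x)) (a\<^sup>2 * (pi / \<bar>a\<bar>))"
    by (rule has_bochner_integral_mult_right)
  moreover have "a\<^sup>2 * (pi / \<bar>a\<bar>) = pi * \<bar>a\<bar>" using False by (simp add: power2_eq_square abs_if)
  moreover have "(\<lambda>x. a\<^sup>2 * fejer 1 (a * x)) = fejer a"
    using False by (auto simp: fejer_def fun_eq_iff power_mult_distrib)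
  ultimately show ?thesis by simp
qed

lemma fourier_L1_interval:
  fixes a b \<xi> :: real
  assumes "a \<le> b" "\<xi> \<noteq> 0"
  shows "fourier_L1 (indicator {a<..<b}) \<xi> =
    (cis (- (a * \<xi>)) - cis (- (b * \<xi>))) / (of_real (sqrt (2 * pi)) * \<i> * of_real \<xi>)"
proof -
  define F where "F x = \<i> * cis (- (x * \<xi>)) / of_real \<xi>" for x
  have "(\<integral>x. cis (- (x * \<xi>)) * indicator {a<..<b} x \<partial>lborel) = (\<integral>x. indicator {a..b} x *\<^sub>R cis (- (x * \<xi>)) \<partial>lborel)"
  proof (rule integral_cong_AE)
    show "AE x in lborel. cis (- (x * \<xi>)) * indicator {a<..<b} x = indicator {a..b} x *\<^sub>R cis (- (x * \<xi>))"
      using AE_lborel_singleton[of a] AE_lborel_singleton[of b]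
      by eventually_elim (auto simp: indicator_def)
  qed measurable
  also have "\<dots> = F b - F a"
  proof (rule integral_FTC_Icc[OF assms(1)])
    fix x
    have "((\<lambda>x. cis (- (x * \<xi>))) has_derivative (\<lambda>t. (- (t * \<xi>)) *\<^sub>R (\<i> * cis (- (x * \<xi>))))) (at x within {a..b})"
      by (intro derivative_intros)
    then have *: "((\<lambda>x. cis (- (x * \<xi>))) has_vector_derivative (- \<xi>) *\<^sub>R (\<i> * cis (- (x * \<xi>)))) (at x within {a..b})"
      by (simp add: has_vector_derivative_def)
    have "(F has_vector_derivative (\<i> * ((- \<xi>) *\<^sub>R (\<i> * cis (- (x * \<xi>)))) / of_real \<xi>)) (at x within {a..b})"
      unfolding F_def divide_inverse
      by (intro has_vector_derivative_mult_left has_vector_derivative_mult_right *)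
    moreover have "\<i> * ((- \<xi>) *\<^sub>R (\<i> * cis (- (x * \<xi>)))) / of_real \<xi> = cis (- (x * \<xi>))"
      using assms(2) by (simp add: scaleR_conv_of_real)
    ultimately show "(F has_vector_derivative cis (- (x * \<xi>))) (at x within {a..b})" by simp
  qed (intro continuous_intros)
  also have "F b - F a = (cis (- (a * \<xi>)) - cis (- (b * \<xi>))) / (\<i> * of_real \<xi>)"
    unfolding divide_divide_eq_left[symmetric] divide_i F_def
    by (simp add: diff_divide_distrib ring_distribs)
  finally have "fourier_L1 (indicator {a<..<b}) \<xi> = of_real (inverse (sqrt (2 * pi))) *
    ((cis (- (a * \<xi>)) - cis (- (b * \<xi>))) / (\<i> * of_real \<xi>))"
    by (simp add: fourier_L1_def powr_minus powr_half_sqrt)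
  then show ?thesis by (simp add: divide_inverse mult_ac)
qed

lemma cnj_fourier_L1: "cnj (fourier_L1 f \<xi>) = fourier_L1 (\<lambda>x. cnj (f x)) (- \<xi>)"
  unfolding fourier_L1_def
  by (simp del: Bochner_Integration.integral_cnj add: Bochner_Integration.integral_cnj[symmetric] cis_cnj)

lemma fourier_L1_measurable [measurable]:
  assumes [measurable]: "f \<in> borel_measurable borel"
  shows "fourier_L1 f \<in> borel_measurable borel"
proof -
  have "(\<lambda>\<xi>. \<integral>x. cis (- (x \<bullet> \<xi>)) * f x \<partial>lborel) \<in> borel_measurable lborel"
    by (rule lborel.borel_measurable_lebesgue_integral) measurable
  then show ?thesis unfolding fourier_L1_def[abs_def] by simp
qed

text \<open>Multiplying out the two differences of exponentials gives four exponentials; the constants that turn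
  their real parts into Fejer functions cancel because the signs add up to \<open>0\<close>.\<close>

lemma interval_parseval_aux:
  fixes a b c d \<xi> :: real
  assumes "a \<le> b" "c \<le> d" "\<xi> \<noteq> 0"
  shows "Re (fourier_L1 (indicator {a<..<b}) \<xi> * cnj (fourier_L1 (indicator {c<..<d}) \<xi>)) =
    (fejer (d - a) \<xi> + fejer (c - b) \<xi> - fejer (c - a) \<xi> - fejer (d - b) \<xi>) / (2 * pi)"
proof -
  have s: "complex_of_real (sqrt (2 * pi)) * complex_of_real (sqrt (2 * pi)) = of_real (2 * pi)"
    unfolding of_real_mult[symmetric] by (simp del: of_real_mult)
  have "fourier_L1 (indicator {a<..<b}) \<xi> * cnj (fourier_L1 (indicator {c<..<d}) \<xi>) =
    (cis (- (a * \<xi>)) - cis (- (b * \<xi>))) * cnj (cis (- (c * \<xi>)) - cis (- (d * \<xi>))) / of_real (2 * pi * \<xi>\<^sup>2)"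
    unfolding fourier_L1_interval[OF assms(1,3)] fourier_L1_interval[OF assms(2,3)]
    using s by (simp add: power2_eq_square mult_ac)
  also have "(cis (- (a * \<xi>)) - cis (- (b * \<xi>))) * cnj (cis (- (c * \<xi>)) - cis (- (d * \<xi>))) =
     cis ((c - a) * \<xi>) - cis ((d - a) * \<xi>) - cis ((c - b) * \<xi>) + cis ((d - b) * \<xi>)"
    by (simp add: cis_cnj ring_distribs cis_mult)
  finally have "Re (fourier_L1 (indicator {a<..<b}) \<xi> * cnj (fourier_L1 (indicator {c<..<d}) \<xi>)) =
    (cos ((c - a) * \<xi>) - cos ((d - a) * \<xi>) - cos ((c - b) * \<xi>) + cos ((d - b) * \<xi>)) / (2 * pi * \<xi>\<^sup>2)"
    by (simp only: Re_divide_of_real plus_complex.sel minus_complex.sel cis.sel)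
  also have "\<dots> = (fejer (d - a) \<xi> + fejer (c - b) \<xi> - fejer (c - a) \<xi> - fejer (d - b) \<xi>) / (2 * pi)"
    unfolding fejer_def add_divide_distrib[symmetric] diff_divide_distrib[symmetric]
    by (simp add: mult.commute)
  finally show ?thesis .
qed

lemma fourier_L1_interval_L2:
  fixes a b :: real
  shows "fourier_L1 (indicator {a<..<b}) \<in> L2"
proof (cases "a \<le> b")
  case True
  show ?thesis
  proof (rule L2_I)
    show "integrable lborel (\<lambda>x. (cmod (fourier_L1 (indicator {a<..<b}) x))\<^sup>2)"
    proof (subst integrable_cong_AE)
      show "integrable lborel (\<lambda>\<xi>. (fejer (b - a) \<xi> + fejer (a - b) \<xi> - fejer (a - a) \<xi> - fejer (b - b) \<xi>) / (2 * pi))"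
        using has_bochner_integral_fejer by (auto simp: has_bochner_integral_iff)
      show "AE \<xi> in lborel. (cmod (fourier_L1 (indicator {a<..<b}) \<xi>))\<^sup>2 =
        (fejer (b - a) \<xi> + fejer (a - b) \<xi> - fejer (a - a) \<xi> - fejer (b - b) \<xi>) / (2 * pi)"
        using AE_lborel_singleton[of 0]
      proof eventually_elim
        case (elim \<xi>)
        show ?case unfolding interval_parseval_aux[OF True True elim, symmetric]
          by (simp only: complex_norm_square[symmetric] Re_complex_of_real)
      qed
    qed measurable
  qed measurable
next
  case False
  then show ?thesis by (simp add: fourier_L1_def[abs_def])
qed

text \<open>The real part is an alternating sum of \<open>|d - a|\<close>, \<open>|c - b|\<close>, \<open>|c - a|\<close>, \<open>|d - b|\<close>, which is twice the length
  of the overlap. The imaginary part vanishes because reflection conjugates the integrand.\<close>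

lemma interval_parseval:
  fixes a b c d :: real
  shows "(\<integral>\<xi>. fourier_L1 (indicator {a<..<b}) \<xi> * cnj (fourier_L1 (indicator {c<..<d}) \<xi>) \<partial>lborel) =
    (\<integral>x. indicator {a<..<b} x * indicator {c<..<d} x \<partial>lborel)" (is "?L = ?R")
proof (cases "a \<le> b \<and> c \<le> d")
  case True
  define J where "J \<xi> = fourier_L1 (indicator {a<..<b}) \<xi> * cnj (fourier_L1 (indicator {c<..<d}) \<xi>)" for \<xi>
  have J: "integrable lborel J"
    unfolding J_def by (intro L2_integrable_mult L2_cnj fourier_L1_interval_L2)
  have [measurable]: "J \<in> borel_measurable borel" unfolding J_def by measurable
  have "Re ?L = (\<integral>\<xi>. Re (J \<xi>) \<partial>lborel)" using J by (simp add: J_def[symmetric])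
  also have "\<dots> = (\<integral>\<xi>. (fejer (d - a) \<xi> + fejer (c - b) \<xi> - fejer (c - a) \<xi> - fejer (d - b) \<xi>) / (2 * pi) \<partial>lborel)"
    by (rule integral_cong_AE)
       (use AE_lborel_singleton[of 0] interval_parseval_aux[of a b c d] True in \<open>auto simp: J_def elim: eventually_mono\<close>)
  also have "\<dots> = (pi * \<bar>d - a\<bar> + pi * \<bar>c - b\<bar> - pi * \<bar>c - a\<bar> - pi * \<bar>d - b\<bar>) / (2 * pi)"
    using has_bochner_integral_fejer by (simp add: has_bochner_integral_iff)
  also have "\<dots> = (\<bar>d - a\<bar> + \<bar>c - b\<bar> - \<bar>c - a\<bar> - \<bar>d - b\<bar>) / 2"
    by (simp add: field_simps)
  also have "\<dots> = max 0 (min b d - max a c)" using True by (simp add: abs_if max_def min_def)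
  finally have re: "Re ?L = max 0 (min b d - max a c)" .
  have "(\<integral>\<xi>. J (0 + (-1) *\<^sub>R \<xi>) \<partial>lborel) = (\<integral>\<xi>. J \<xi> \<partial>lborel)" by (rule integral_lborel_affine) auto
  moreover have "J (0 + (-1) *\<^sub>R \<xi>) = cnj (J \<xi>)" for \<xi>
  proof -
    have "cnj (indicator A x) = (indicator A x :: complex)" for A and x :: real
      by (simp add: indicator_def)
    then show ?thesis by (simp add: J_def cnj_fourier_L1)
  qed
  ultimately have "cnj ?L = ?L" by (simp add: J_def[symmetric])
  then have im: "Im ?L = 0" by (simp add: complex_eq_iff)
  have "?R = (\<integral>x. of_real (indicator {max a c<..<min b d} x) \<partial>lborel)"
    by (intro Bochner_Integration.integral_cong) (auto simp: indicator_def)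
  also have "\<dots> = of_real (max 0 (min b d - max a c))"
    by (subst integral_complex_of_real) (auto simp: max_def measure_def)
  finally show ?thesis using re im by (simp add: complex_eq_iff)
qed (auto simp: fourier_L1_def[abs_def])

section \<open>The Fourier transform of functions with bounded support\<close>

text \<open>Lebesgue measure on a Euclidean space is the image of the product measure indexed by the basis.\<close>

lemma lborel_integral_prod_Basis:
  fixes f :: "'a::euclidean_space \<Rightarrow> real \<Rightarrow> complex"
  assumes f: "\<And>b. b \<in> Basis \<Longrightarrow> integrable lborel (f b)"
  shows "integrable lborel (\<lambda>x. \<Prod>b\<in>Basis. f b (x \<bullet> b))"
    "(\<integral>x. (\<Prod>b\<in>Basis. f b (x \<bullet> b)) \<partial>lborel) = (\<Prod>b\<in>Basis. \<integral>x. f b x \<partial>lborel)"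
proof -
  interpret product_sigma_finite "\<lambda>_::'a. lborel :: real measure" ..
  let ?T = "\<lambda>f. \<Sum>b\<in>Basis. f b *\<^sub>R (b::'a)"
  have [measurable]: "\<And>b. b \<in> Basis \<Longrightarrow> f b \<in> borel_measurable borel" using f by auto
  have eq: "(lborel :: 'a measure) = distr (\<Pi>\<^sub>M b\<in>(Basis::'a set). (lborel :: real measure)) borel ?T"
    by (rule lborel_eq)
  have p: "(\<Prod>b\<in>Basis. f b (?T g \<bullet> b)) = (\<Prod>b\<in>Basis. f b (g b))" for g
    by (intro prod.cong) auto
  have T [measurable]: "?T \<in> measurable (\<Pi>\<^sub>M b\<in>Basis. lborel) borel" by measurable
  have meas: "(\<lambda>x::'a. \<Prod>b\<in>Basis. f b (x \<bullet> b)) \<in> borel_measurable borel" by measurable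
  have "integrable (\<Pi>\<^sub>M b\<in>Basis. lborel) (\<lambda>g. \<Prod>b\<in>Basis. f b (g b))"
    by (rule product_integrable_prod) (use f in auto)
  then show "integrable lborel (\<lambda>x. \<Prod>b\<in>Basis. f b (x \<bullet> b))"
    unfolding eq by (subst integrable_distr_eq[OF T meas]) (simp only: p)
  show "(\<integral>x. (\<Prod>b\<in>Basis. f b (x \<bullet> b)) \<partial>lborel) = (\<Prod>b\<in>Basis. \<integral>x. f b x \<partial>lborel)"
    unfolding eq
    by (subst integral_distr[OF T meas], simp only: p, rule product_integral_prod) (use f in auto)
qed

lemma cis_sum: "cis (\<Sum>i\<in>A. g i) = (\<Prod>i\<in>A. cis (g i))"
  by (induct A rule: infinite_finite_induct) (auto simp: cis_mult[symmetric])

lemma indicator_box: "indicator (box a b) x = (\<Prod>i\<in>Basis. indicator {a \<bullet> i<..<b \<bullet> i} (x \<bullet> i) :: 'b::{comm_semiring_1,semidom})"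
proof (cases "x \<in> box a b")
  case True then show ?thesis by (auto simp: box_def intro!: prod.neutral[symmetric])
next
  case False
  then obtain i where "i \<in> Basis" "x \<bullet> i \<notin> {a \<bullet> i<..<b \<bullet> i}" by (auto simp: box_def)
  then show ?thesis using False by (auto intro!: prod_zero[symmetric] bexI[of _ i])
qed

lemma fourier_L1_box:
  fixes a b \<xi> :: "'a::euclidean_space"
  shows "fourier_L1 (indicator (box a b)) \<xi> = (\<Prod>i\<in>Basis. fourier_L1 (indicator {a \<bullet> i<..<b \<bullet> i}) (\<xi> \<bullet> i))"
proof -
  have k: "cis (- (x \<bullet> \<xi>)) * indicator (box a b) x =
    (\<Prod>i\<in>Basis. cis (- ((x \<bullet> i) \<bullet> (\<xi> \<bullet> i))) * indicator {a \<bullet> i<..<b \<bullet> i} (x \<bullet> i))" for x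
    unfolding prod.distrib indicator_box cis_sum[symmetric]
    by (subst euclidean_inner) (simp add: sum_negf)
  have int: "integrable lborel (\<lambda>t. cis (- (t \<bullet> (\<xi> \<bullet> i))) * indicator {a \<bullet> i<..<b \<bullet> i} t)" for i
  proof (rule Bochner_Integration.integrable_bound)
    show "integrable lborel (indicat_real {a \<bullet> i<..<b \<bullet> i})"
      by (cases "a \<bullet> i \<le> b \<bullet> i") (auto intro!: integrable_real_indicator)
  qed (auto simp: norm_mult indicator_def)
  have "(\<integral>x. cis (- (x \<bullet> \<xi>)) * indicator (box a b) x \<partial>lborel) =
    (\<Prod>i\<in>Basis. \<integral>t. cis (- (t \<bullet> (\<xi> \<bullet> i))) * indicator {a \<bullet> i<..<b \<bullet> i} t \<partial>lborel)"
    unfolding k by (rule lborel_integral_prod_Basis(2)) (rule int)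
  moreover have "(2 * pi) powr (- (real DIM('a) / 2)) = (\<Prod>i\<in>(Basis::'a set). (2 * pi) powr (- (real DIM(real) / 2)))"
    by (simp add: powr_power)
  ultimately show ?thesis unfolding fourier_L1_def prod.distrib of_real_prod[symmetric] by simp
qed

lemma L2_indicator:
  assumes "A \<in> sets borel" "bounded A" shows "indicator A \<in> L2"
proof (rule L2_I)
  have "emeasure lborel A < \<infinity>" using emeasure_bounded_finite[OF assms(2)] .
  then have "integrable lborel (indicat_real A)" using assms(1) by (intro integrable_real_indicator) auto
  moreover have "(\<lambda>x. (cmod (indicator A x))\<^sup>2) = indicat_real A" by (auto simp: indicator_def fun_eq_iff)
  ultimately show "integrable lborel (\<lambda>x. (cmod (indicator A x))\<^sup>2)" by simp
qed (use assms in simp)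

lemma fourier_L1_box_L2: "fourier_L1 (indicator (box a b)) \<in> L2"
proof (rule L2_I)
  have "integrable lborel (\<lambda>\<xi>. \<Prod>i\<in>Basis. complex_of_real ((cmod (fourier_L1 (indicator {a \<bullet> i<..<b \<bullet> i}) (\<xi> \<bullet> i)))\<^sup>2))"
    by (rule lborel_integral_prod_Basis(1)) (intro integrable_of_real L2_integrable fourier_L1_interval_L2)
  from integrable_Re[OF this]
  show "integrable lborel (\<lambda>x. (cmod (fourier_L1 (indicator (box a b)) x))\<^sup>2)"
    unfolding fourier_L1_box of_real_prod[symmetric] Re_complex_of_real
    by (simp add: prod_norm[symmetric] prod_power_distrib)
qed measurable

text \<open>Both integrands are products over the coordinates, so that the claim reduces to intervals.\<close>

lemma box_parseval:
  "(\<integral>\<xi>. fourier_L1 (indicator (box a b)) \<xi> * cnj (fourier_L1 (indicator (box c d)) \<xi>) \<partial>lborel) =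
    (\<integral>x. indicator (box a b) x * indicator (box c d) (x::'a::euclidean_space) \<partial>lborel)"
proof -
  have int: "integrable lborel (\<lambda>t. indicator {a \<bullet> i<..<b \<bullet> i} t * indicator {c \<bullet> i<..<d \<bullet> i} t :: complex)" for i
    by (intro L2_integrable_mult L2_indicator) (auto simp: bounded_box)
  have "(\<integral>\<xi>. fourier_L1 (indicator (box a b)) \<xi> * cnj (fourier_L1 (indicator (box c d)) \<xi>) \<partial>lborel) =
    (\<Prod>i\<in>Basis. \<integral>t. fourier_L1 (indicator {a \<bullet> i<..<b \<bullet> i}) t * cnj (fourier_L1 (indicator {c \<bullet> i<..<d \<bullet> i}) t) \<partial>lborel)"
    unfolding fourier_L1_box cnj_prod prod.distrib[symmetric]
    by (rule lborel_integral_prod_Basis(2)) (intro L2_integrable_mult L2_cnj fourier_L1_interval_L2)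
  also have "\<dots> = (\<Prod>i\<in>Basis. \<integral>t. indicator {a \<bullet> i<..<b \<bullet> i} t * indicator {c \<bullet> i<..<d \<bullet> i} t \<partial>lborel)"
    by (simp add: interval_parseval)
  also have "\<dots> = (\<integral>x. indicator (box a b) x * indicator (box c d) x \<partial>lborel)"
    unfolding indicator_box[where 'b = complex] prod.distrib[symmetric]
    by (rule lborel_integral_prod_Basis(2)[symmetric]) (rule int)
  finally show ?thesis .
qed

text \<open>Complex multiples are included since the span below is taken over the reals.\<close>

definition box_graph :: "('a::euclidean_space lsq \<times> 'a lsq) set" where
  "box_graph = (\<Union>a b c. {(mul (\<lambda>_. c) (cls (indicator (box a b))), mul (\<lambda>_. c) (cls (fourier_L1 (indicator (box a b)))))})"

text \<open>The graph of the Fourier transform. Boxes are linearly dependent, so a function given on them need not extend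
  linearly; for a relation there is no such question. Isometry and linearity pass from the generators to the
  closure of the span, and isometry makes the relation single-valued.\<close>

definition FG :: "('a::euclidean_space lsq \<times> 'a lsq) set" where
  "FG = closure (span box_graph)"

lemma mul_const_cls: "f \<in> L2 \<Longrightarrow> mul (\<lambda>_. c) (cls f) = cls (\<lambda>t. c * f t)"
  by (rule mdom_cls(2)) (auto intro: L2_cmult)

lemma box_graph_inner:
  assumes "p \<in> box_graph" "q \<in> box_graph" shows "inner (snd p) (snd q) = inner (fst p) (fst q)"
proof -
  obtain a b c a' b' c' where p: "p = (mul (\<lambda>_. c) (cls (indicator (box a b))), mul (\<lambda>_. c) (cls (fourier_L1 (indicator (box a b)))))"
    and q: "q = (mul (\<lambda>_. c') (cls (indicator (box a' b'))), mul (\<lambda>_. c') (cls (fourier_L1 (indicator (box a' b')))))"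
    using assms unfolding box_graph_def by auto
  have *: "inner (mul (\<lambda>_. c) (cls f)) (mul (\<lambda>_. c') (cls g)) = Re (c * cnj c' * (\<integral>t. f t * cnj (g t) \<partial>lborel))"
    if "f \<in> L2" "g \<in> L2" for f g :: "'a \<Rightarrow> complex"
    using that by (simp add: inner_pair mul_const_cls cj_cls L2_cmult pair_cmult pair_cls L2_cnj mult.left_commute[of _ "cnj c'"]
       mult.assoc del: times_complex.sel)
  have cnji: "cnj (indicator A x) = (indicator A x :: complex)" for A and x :: 'a by (simp add: indicator_def)
  have L: "indicator (box a b) \<in> L2" "indicator (box a' b') \<in> L2" by (auto intro!: L2_indicator)
  show ?thesis unfolding p q fst_conv snd_conv *[OF L] *[OF fourier_L1_box_L2 fourier_L1_box_L2] box_parseval cnji ..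
qed

lemma span_box_graph_inner:
  assumes "p \<in> span box_graph" "q \<in> span box_graph" shows "inner (snd p) (snd q) = inner (fst p) (fst q)"
proof -
  have 1: "inner (snd p) (snd q) = inner (fst p) (fst q)" if q: "q \<in> box_graph" for q
    using assms(1)
    by (induct rule: span_induct_alt) (auto simp: inner_add_left box_graph_inner[OF _ q])
  show ?thesis using assms(2)
    by (induct rule: span_induct_alt) (auto simp: inner_add_right 1)
qed

lemma FG_D: "p \<in> FG \<Longrightarrow> norm (snd p) = norm (fst p)"
proof -
  assume "p \<in> FG"
  then obtain X where X: "\<And>n. X n \<in> span box_graph" "X \<longlonglongrightarrow> p" unfolding FG_def closure_sequential by auto
  have "norm (snd (X n)) = norm (fst (X n))" for n
    using span_box_graph_inner[OF X(1) X(1)] by (simp add: norm_eq_sqrt_inner)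
  then have "(\<lambda>n. norm (fst (X n))) \<longlonglongrightarrow> norm (snd p)" using tendsto_norm[OF tendsto_snd[OF X(2)]] by simp
  with tendsto_norm[OF tendsto_fst[OF X(2)]] show ?thesis by (rule LIMSEQ_unique[rotated])
qed

lemma FG_add:
  assumes "p \<in> FG" "q \<in> FG" shows "p + q \<in> FG"
proof -
  from assms obtain X Y where X: "\<And>n. X n \<in> span box_graph" "X \<longlonglongrightarrow> p"
    and Y: "\<And>n. Y n \<in> span box_graph" "Y \<longlonglongrightarrow> q" unfolding FG_def closure_sequential by auto
  show ?thesis unfolding FG_def closure_sequential
    using tendsto_add[OF X(2) Y(2)] span_add[OF X(1) Y(1)] by (intro exI[of _ "\<lambda>n. X n + Y n"]) auto
qed

lemma span_box_graph_cmult: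
  assumes "p \<in> span box_graph" shows "(mul (\<lambda>_. c) (fst p), mul (\<lambda>_. c) (snd p)) \<in> span box_graph"
  using assms
proof (induct rule: span_induct_alt)
  case base
  have "mul (\<lambda>_. c) (0::'a lsq) = 0" by (rule linear_0[OF bounded_linear.linear[OF bounded_linear_mul]]) simp
  then show ?case using span_0[of box_graph] by (simp add: zero_prod_def)
next
  case (step r x y)
  note L = linear_add[OF bounded_linear.linear[OF bounded_linear_mul]] linear_scale[OF bounded_linear.linear[OF bounded_linear_mul]]
  have "(mul (\<lambda>_. c) (fst x), mul (\<lambda>_. c) (snd x)) \<in> box_graph"
    using step(1) unfolding box_graph_def by (force simp: mul_mul)
  from span_add[OF span_scale[OF span_base[OF this], of r] step(2)] show ?case
    by (simp add: L)
qed

lemma FG_cmult: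
  assumes "p \<in> FG" shows "(mul (\<lambda>_. c) (fst p), mul (\<lambda>_. c) (snd p)) \<in> FG"
proof -
  from assms obtain X where X: "\<And>n. X n \<in> span box_graph" "X \<longlonglongrightarrow> p" unfolding FG_def closure_sequential by auto
  have B: "bounded_linear (mul (\<lambda>_::'a. c))" by (rule bounded_linear_mul) simp
  have "(\<lambda>n. (mul (\<lambda>_. c) (fst (X n)), mul (\<lambda>_. c) (snd (X n)))) \<longlonglongrightarrow> (mul (\<lambda>_. c) (fst p), mul (\<lambda>_. c) (snd p))"
    by (intro tendsto_Pair bounded_linear.tendsto[OF B] tendsto_fst tendsto_snd X(2))
  then show ?thesis unfolding FG_def closure_sequential
    using span_box_graph_cmult[OF X(1)] by (intro exI[of _ "\<lambda>n. (mul (\<lambda>_. c) (fst (X n)), mul (\<lambda>_. c) (snd (X n)))"]) auto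
qed

lemma FG_minus: "p \<in> FG \<Longrightarrow> q \<in> FG \<Longrightarrow> p - q \<in> FG"
proof -
  assume p: "p \<in> FG" and q: "q \<in> FG"
  have "mul (\<lambda>_. - 1) x = - x" for x :: "'a lsq"
    unfolding mul_def uminus_lsq_def by simp
  then show ?thesis using FG_add[OF p FG_cmult[OF q, of "-1"]] by (simp add: minus_prod_def plus_prod_def)
qed

lemma FG_0: "0 \<in> FG"
  unfolding FG_def using span_0 closure_subset by blast

text \<open>Cubes rather than balls exhaust the space here, since they are boxes.\<close>

definition Qb :: "real \<Rightarrow> 'a::euclidean_space set" where
  "Qb k = box (- k *\<^sub>R One) (k *\<^sub>R One)"

lemma Qb [simp]: "bounded (Qb k)" "Qb k \<in> sets borel"
  by (auto simp: Qb_def)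

lemma cball_subset_Qb: "cball 0 r \<subseteq> Qb (r + 1)"
proof
  fix x :: 'a assume "x \<in> cball 0 r"
  then have "norm x \<le> r" by simp
  then have "\<bar>x \<bullet> i\<bar> < r + 1" if "i \<in> Basis" for i using Basis_le_norm[OF that, of x] by simp
  then show "x \<in> Qb (r + 1)" unfolding Qb_def mem_box by (auto simp: abs_less_iff minus_less_iff)
qed

text \<open>The functions on which the classical transform agrees with the relation \<open>FG\<close>. The class turns out
  to contain all of \<open>L2\<close> with bounded support.\<close>

definition goodF :: "('a::euclidean_space \<Rightarrow> complex) \<Rightarrow> bool" where
  "goodF f \<longleftrightarrow> f \<in> L2 \<and> fourier_L1 f \<in> L2 \<and> (cls f, cls (fourier_L1 f)) \<in> FG"

lemma bounded_support_integrable: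
  assumes "f \<in> L2" "bounded A" "\<And>x. x \<notin> A \<Longrightarrow> f x = 0" shows "integrable lborel f"
proof -
  obtain r where r: "A \<subseteq> cball 0 r" using assms(2) by (auto simp: bounded_iff subset_iff)
  have "integrable lborel (\<lambda>x. indicator (cball 0 r) x * f x)"
    by (intro L2_integrable_mult L2_indicator assms) auto
  moreover have "(\<lambda>x. indicator (cball 0 r) x * f x) = f"
  proof
    fix x show "indicator (cball 0 r) x * f x = f x"
      using assms(3)[of x] r by (cases "x \<in> A") (auto simp: indicator_def)
  qed
  ultimately show ?thesis by simp
qed

lemma integrable_cis_mult:
  assumes "integrable lborel f" shows "integrable lborel (\<lambda>x. cis (- (x \<bullet> \<xi>)) * f x)"
  by (rule Bochner_Integration.integrable_bound[OF assms]) (use assms in \<open>auto simp: norm_mult\<close>)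

lemma fourier_L1_add: "integrable lborel f \<Longrightarrow> integrable lborel g \<Longrightarrow>
   fourier_L1 (\<lambda>x. f x + g x) = (\<lambda>\<xi>. fourier_L1 f \<xi> + fourier_L1 g \<xi>)"
  unfolding fourier_L1_def by (simp add: distrib_left integrable_cis_mult)

lemma fourier_L1_diff: "integrable lborel f \<Longrightarrow> integrable lborel g \<Longrightarrow>
   fourier_L1 (\<lambda>x. f x - g x) = (\<lambda>\<xi>. fourier_L1 f \<xi> - fourier_L1 g \<xi>)"
  unfolding fourier_L1_def by (simp add: right_diff_distrib integrable_cis_mult)

lemma fourier_L1_cmult: "fourier_L1 (\<lambda>x. c * f x) = (\<lambda>\<xi>. c * fourier_L1 f \<xi>)"
  unfolding fourier_L1_def by (simp add: mult.left_commute[of _ c])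

lemma goodF_add:
  assumes "goodF f" "goodF g" "integrable lborel f" "integrable lborel g" shows "goodF (\<lambda>x. f x + g x)"
  using assms FG_add[of "(cls f, cls (fourier_L1 f))" "(cls g, cls (fourier_L1 g))"]
  by (simp add: goodF_def L2_add fourier_L1_add cls_add)

lemma goodF_diff:
  assumes "goodF f" "goodF g" "integrable lborel f" "integrable lborel g" shows "goodF (\<lambda>x. f x - g x)"
  using assms FG_minus[of "(cls f, cls (fourier_L1 f))" "(cls g, cls (fourier_L1 g))"]
  by (simp add: goodF_def L2_diff fourier_L1_diff cls_diff)

lemma goodF_cmult: "goodF f \<Longrightarrow> goodF (\<lambda>x. c * f x)"
  using FG_cmult[of "(cls f, cls (fourier_L1 f))" c]
  by (simp add: goodF_def L2_cmult fourier_L1_cmult mul_const_cls)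

text \<open>On a bounded set \<open>L2\<close> convergence implies \<open>L1\<close> convergence, so the classical transforms converge
  pointwise; they also converge in \<open>L2\<close> since \<open>FG\<close> is isometric. The two limits agree.\<close>

lemma goodF_limit:
  assumes good: "\<And>n. goodF (f n)" and g: "g \<in> L2" and lim: "(\<lambda>n. cls (f n)) \<longlonglongrightarrow> cls g"
    and A: "bounded A" "\<And>n x. x \<notin> A \<Longrightarrow> f n x = 0" "\<And>x. x \<notin> A \<Longrightarrow> g x = 0"
  shows "goodF g"
proof -
  note [measurable] = L2_measurable[OF g]
  obtain r where r: "A \<subseteq> cball 0 r" using A(1) by (auto simp: bounded_iff subset_iff)
  have fL: "f n \<in> L2" "fourier_L1 (f n) \<in> L2" "(cls (f n), cls (fourier_L1 (f n))) \<in> FG" for n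
    using good[of n] by (auto simp: goodF_def)
  \<comment> \<open>The exponential cut off to the support is square integrable, so the classical transform is a continuous functional on \<open>L2\<close>.\<close>
  define E where "E \<xi> = (\<lambda>x. indicator (cball 0 r) x * cis (- (x \<bullet> \<xi>)))" for \<xi> :: 'a
  have E: "E \<xi> \<in> L2" for \<xi>
    unfolding E_def by (rule L2_dominated[OF L2_indicator[of "cball 0 r"], where K=1]) (auto simp: norm_mult intro!: borel_measurable_times borel_measurable_indicator)
  have F: "fourier_L1 h \<xi> = of_real ((2 * pi) powr (- (real DIM('a) / 2))) * pair (cls (E \<xi>)) (cls h)"
    if "h \<in> L2" "\<And>x. x \<notin> A \<Longrightarrow> h x = 0" for h \<xi>
  proof -
    have "(\<integral>x. cis (- (x \<bullet> \<xi>)) * h x \<partial>lborel) = (\<integral>x. E \<xi> x * h x \<partial>lborel)"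
    proof (rule Bochner_Integration.integral_cong)
      fix x show "cis (- (x \<bullet> \<xi>)) * h x = E \<xi> x * h x"
        using that(2)[of x] r by (cases "x \<in> A") (auto simp: E_def indicator_def)
    qed simp
    then show ?thesis unfolding fourier_L1_def pair_cls[OF E that(1)] by simp
  qed
  have Fg: "fourier_L1 g \<xi> = of_real ((2 * pi) powr (- (real DIM('a) / 2))) * pair (cls (E \<xi>)) (cls g)" for \<xi>
    by (rule F[OF g]) (rule A(3))
  have Ff: "fourier_L1 (f n) \<xi> = of_real ((2 * pi) powr (- (real DIM('a) / 2))) * pair (cls (E \<xi>)) (cls (f n))" for n \<xi>
    by (rule F[OF fL(1)]) (rule A(2))
  have pt: "(\<lambda>n. fourier_L1 (f n) \<xi>) \<longlonglongrightarrow> fourier_L1 g \<xi>" for \<xi>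
    unfolding Fg Ff
    by (intro tendsto_mult tendsto_const bounded_bilinear.tendsto[OF bounded_bilinear_pair] lim)
  have d: "norm (cls (fourier_L1 (f n)) - cls (fourier_L1 (f m))) = norm (cls (f n) - cls (f m))" for m n
    using FG_D[OF FG_minus[OF fL(3)[of n] fL(3)[of m]]] by simp
  have "Cauchy (\<lambda>n. cls (f n))" using lim by (rule LIMSEQ_imp_Cauchy)
  then have "Cauchy (\<lambda>n. cls (fourier_L1 (f n)))"
    unfolding Cauchy_def dist_norm d .
  then obtain y where y: "(\<lambda>n. cls (fourier_L1 (f n))) \<longlonglongrightarrow> y" using Cauchy_convergent unfolding convergent_def by blast
  have "AE \<xi> in lborel. \<forall>n. rep (cls (fourier_L1 (f n))) \<xi> = fourier_L1 (f n) \<xi>"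
    unfolding AE_all_countable by (intro allI rep_cls fL)
  then have ae: "AE \<xi> in lborel. (\<lambda>n. rep (cls (fourier_L1 (f n))) \<xi>) \<longlonglongrightarrow> fourier_L1 g \<xi>"
    by eventually_elim (simp add: pt)
  from tendsto_AE_unique[OF y ae]
  have ae2: "AE \<xi> in lborel. rep y \<xi> = fourier_L1 g \<xi>" and gL: "fourier_L1 g \<in> L2" by auto
  have y2: "y = cls (fourier_L1 g)"
    using cls_eqI[OF _ gL ae2] by simp
  have "(cls g, y) \<in> FG"
    unfolding FG_def
    by (rule closed_sequentially[OF closed_closure, folded FG_def, of "\<lambda>n. (cls (f n), cls (fourier_L1 (f n)))"])
       (use fL(3) y lim in \<open>auto simp: FG_def intro!: tendsto_Pair\<close>)
  then show ?thesis by (simp add: goodF_def g gL y2)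
qed

lemma goodF_box: "goodF (indicator (box a b))"
proof -
  have "(mul (\<lambda>_. 1) (cls (indicator (box a b))), mul (\<lambda>_. 1) (cls (fourier_L1 (indicator (box a b))))) \<in> box_graph"
    unfolding box_graph_def by blast
  then have "(cls (indicator (box a b)), cls (fourier_L1 (indicator (box a b)))) \<in> FG"
    unfolding FG_def using closure_subset span_base by (simp) blast
  then show ?thesis by (auto simp: goodF_def fourier_L1_box_L2 L2_indicator)
qed

lemma integrable_indicator_bounded: "A \<in> sets borel \<Longrightarrow> bounded A \<Longrightarrow> integrable lborel (indicator A :: 'a::euclidean_space \<Rightarrow> complex)"
  by (rule bounded_support_integrable[OF L2_indicator]) (auto simp: indicator_def)

lemma goodF_sum:
  fixes f :: "'i \<Rightarrow> 'c::euclidean_space \<Rightarrow> complex"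
  assumes "finite I" "\<And>i. i \<in> I \<Longrightarrow> goodF (f i)" "\<And>i. i \<in> I \<Longrightarrow> integrable lborel (f i)"
  shows "goodF (\<lambda>x. \<Sum>i\<in>I. f i x)"
  using assms
proof (induct I)
  case empty
  have F0: "fourier_L1 (\<lambda>x::'c. 0) = (\<lambda>x. 0)" by (simp add: fourier_L1_def fun_eq_iff)
  show ?case using FG_0 by (simp add: goodF_def zero_prod_def F0 zero_lsq_def[symmetric])
next
  case (insert i I)
  then show ?case by (simp add: goodF_add)
qed

text \<open>Boxes are stable under intersection and generate the Borel sets, and \<open>goodF\<close> respects
  complements and countable disjoint unions inside the cube, so a Dynkin argument applies.\<close>

lemma goodF_indicator:
  fixes A :: "'a::euclidean_space set"
  assumes "A \<in> sets borel" shows "goodF (indicator (A \<inter> Qb k))"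
proof -
  let ?G = "range (\<lambda>(a, b). box a b :: 'a set)"
  have st: "Int_stable ?G"
    unfolding Int_stable_def by (auto simp: box_Int_box)
  have A: "A \<in> sigma_sets UNIV ?G" using assms by (subst (asm) borel_eq_box) (simp)
  have S: "B \<in> sets borel" if "B \<in> sigma_sets UNIV ?G" for B using that by (subst borel_eq_box) simp
  show ?thesis
  proof (rule sigma_sets_induct_disjoint[OF st _ A])
    show "?G \<subseteq> Pow UNIV" by simp
    show "goodF (indicator (B \<inter> Qb k))" if "B \<in> ?G" for B
      using that by (auto simp: Qb_def box_Int_box goodF_box)
    show "goodF (indicator ({} \<inter> Qb k) :: 'a \<Rightarrow> complex)"
      using goodF_sum[of "{}"] by (simp add: indicator_def[abs_def])
    show "goodF (indicator ((UNIV - B) \<inter> Qb k) :: 'a \<Rightarrow> complex)"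
      if "B \<in> sigma_sets UNIV ?G" "goodF (indicator (B \<inter> Qb k))" for B
    proof -
      have "goodF (\<lambda>x. indicator (Qb k) x - indicator (B \<inter> Qb k) x)"
        by (rule goodF_diff[OF _ that(2)])
           (use S[OF that(1)] in \<open>auto simp: Qb_def goodF_box intro!: integrable_indicator_bounded bounded_subset[OF bounded_box]\<close>)
      moreover have "(\<lambda>x. indicator (Qb k) x - indicator (B \<inter> Qb k) x) = (indicator ((UNIV - B) \<inter> Qb k) :: 'a \<Rightarrow> complex)"
        by (auto simp: indicator_def fun_eq_iff)
      ultimately show ?thesis by simp
    qed
    show "goodF (indicator ((\<Union>i. B i) \<inter> Qb k) :: 'a \<Rightarrow> complex)"
      if B: "disjoint_family B" "range B \<subseteq> sigma_sets UNIV ?G" "\<And>i. goodF (indicator (B i \<inter> Qb k))" for B :: "nat \<Rightarrow> 'a set"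
    proof -
      have Bs: "B i \<in> sets borel" for i using B(2) S by auto
      define f where "f n = (\<lambda>x. \<Sum>i<n. indicator (B i \<inter> Qb k) x :: complex)" for n
      have f: "f n = indicator ((\<Union>i<n. B i) \<inter> Qb k)" for n
      proof
        fix x
        have "disjoint_family_on (\<lambda>i. B i \<inter> Qb k) {..<n}"
          using B(1) by (auto simp: disjoint_family_on_def)
        then have "indicator (\<Union>i<n. B i \<inter> Qb k) x = (\<Sum>i<n. indicator (B i \<inter> Qb k) x :: complex)"
          by (intro indicator_UN_disjoint) auto
        then show "f n x = indicator ((\<Union>i<n. B i) \<inter> Qb k) x" unfolding f_def by simp
      qed
      have gf: "goodF (f n)" for n unfolding f_def
        by (rule goodF_sum) (auto intro!: B(3) integrable_indicator_bounded Bs bounded_subset[OF Qb(1)])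
      have lim: "(\<lambda>n. f n x) \<longlonglongrightarrow> indicator ((\<Union>i. B i) \<inter> Qb k) x" for x
      proof (cases "x \<in> (\<Union>i. B i) \<inter> Qb k")
        case True
        then obtain i where i: "x \<in> B i" "x \<in> Qb k" by auto
        have "\<forall>\<^sub>F n in sequentially. f n x = 1"
          using eventually_gt_at_top[of i] by eventually_elim (use i in \<open>auto simp: f indicator_def\<close>)
        then show ?thesis using True by (simp add: tendsto_eventually)
      qed (auto simp: f indicator_def)
      show ?thesis
      proof (rule goodF_limit[of f, OF gf _ _ Qb(1)[of k]])
        show "indicator ((\<Union>i. B i) \<inter> Qb k) \<in> L2" using Bs by (intro L2_indicator) (auto intro: bounded_subset[OF Qb(1)])
        show "(\<lambda>n. cls (f n)) \<longlonglongrightarrow> cls (indicator ((\<Union>i. B i) \<inter> Qb k))"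
        proof (rule lsq_dominated_convergence(1)[OF _ _ L2_indicator[OF Qb(2) Qb(1)]])
          show "AE x in lborel. cmod (f n x) \<le> cmod (indicator (Qb k) x)" for n
            by (auto simp: f indicator_def)
        qed (use Bs lim in \<open>auto simp: f intro!: borel_measurable_indicator\<close>)
      qed (auto simp: f indicator_def)
    qed
  qed
qed

text \<open>Dominated approximation by simple functions.\<close>

lemma goodF_bounded_support:
  fixes f :: "'a::euclidean_space \<Rightarrow> complex"
  assumes f: "f \<in> L2" "\<And>x. x \<notin> Qb k \<Longrightarrow> f x = 0" shows "goodF f"
proof -
  note [measurable] = L2_measurable[OF f(1)]
  obtain s where s: "\<And>i. simple_function borel (s i)" "\<And>x. (\<lambda>i. s i x) \<longlonglongrightarrow> f x" "\<And>i x. norm (s i x) \<le> 2 * norm (f x)"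
    using borel_measurable_implies_sequence_metric[of f borel 0] by auto
  have sm [measurable]: "s i \<in> borel_measurable borel" for i
    by (rule borel_measurable_simple_function[OF s(1)])
  have s0: "s i x = 0" if "x \<notin> Qb k" for i x
  proof -
    have "norm (s i x) \<le> 2 * norm (f x)" by (rule s(3))
    also have "f x = 0" by (rule f(2)[OF that])
    finally show ?thesis by simp
  qed
  have gs: "goodF (s i)" for i
  proof -
    have "s i x = (\<Sum>y\<in>range (s i). y * indicator (s i -` {y} \<inter> Qb k) x)" for x
    proof (cases "x \<in> Qb k")
      case True
      then have "s i x = (\<Sum>y\<in>range (s i). indicator (s i -` {y}) x *\<^sub>R y)"
        using simple_function_indicator_representation_banach[OF s(1)[of i], of x]
        by (simp only: space_borel Int_UNIV_right UNIV_I)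
      also have "\<dots> = (\<Sum>y\<in>range (s i). y * indicator (s i -` {y} \<inter> Qb k) x)"
        using True by (intro sum.cong) (auto simp: indicator_def)
      finally show ?thesis .
    qed (simp add: s0 indicator_def)
    then have e: "s i = (\<lambda>x. \<Sum>y\<in>range (s i). y * indicator (s i -` {y} \<inter> Qb k) x)" by (rule ext)
    have fin: "finite (range (s i))" using simple_functionD(1)[OF s(1)[of i]] by simp
    have ms: "s i -` {y} \<in> sets borel" for y using measurable_sets[OF sm[of i], of "{y}"] by simp
    have Bd: "bounded (s i -` {y} \<inter> Qb k)" for y
      by (rule bounded_subset[OF Qb(1)]) auto
    have "goodF (\<lambda>x. \<Sum>y\<in>range (s i). y * indicator (s i -` {y} \<inter> Qb k) x)"
    proof (rule goodF_sum[OF fin])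
      fix y
      show "goodF (\<lambda>x. y * indicator (s i -` {y} \<inter> Qb k) x)"
        by (rule goodF_cmult, rule goodF_indicator, rule ms)
      show "integrable lborel (\<lambda>x. y * indicator (s i -` {y} \<inter> Qb k) x)"
        by (rule integrable_mult_right, rule integrable_indicator_bounded, rule sets.Int[OF ms Qb(2)], rule Bd)
    qed
    then show ?thesis by (simp only: e[symmetric])
  qed
  show ?thesis
  proof (rule goodF_limit[of s, OF gs f(1) _ Qb(1)[of k] s0 f(2)])
    show "(\<lambda>n. cls (s n)) \<longlonglongrightarrow> cls f"
      by (rule lsq_dominated_convergence(1)[of _ _ "\<lambda>x. 2 * f x"]) (auto simp: s norm_mult L2_cmult f)
  qed auto
qed

section \<open>The Fourier transform as a unitary operator\<close>

definition trunc :: "nat \<Rightarrow> 'a::euclidean_space lsq \<Rightarrow> 'a lsq" where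
  "trunc n x = cls (\<lambda>t. indicator (cball 0 (real n)) t * rep x t)"

lemma trunc_L2: "f \<in> L2 \<Longrightarrow> (\<lambda>t. indicator (cball 0 r) t * f t) \<in> L2"
  by (rule L2_mult_bounded[where K = 1]) (auto intro!: borel_measurable_indicator simp: indicator_def)

lemma trunc_cls: "f \<in> L2 \<Longrightarrow> trunc n (cls f) = cls (\<lambda>t. indicator (cball 0 (real n)) t * f t)"
  unfolding trunc_def by (rule cls_eqI[OF trunc_L2 trunc_L2]) (use rep_cls[of f] in \<open>auto elim: eventually_mono\<close>)

lemma indicator_cball_tendsto:
  fixes t :: "'a::euclidean_space"
  shows "(\<lambda>n. indicator (cball 0 (real n)) t * z :: complex) \<longlonglongrightarrow> z"
proof (rule tendsto_eventually)
  obtain N where "norm t \<le> real N" using real_arch_simple by blast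
  then show "\<forall>\<^sub>F n in sequentially. indicator (cball 0 (real n)) t * z = z"
    by (intro eventually_sequentiallyI[of N]) (auto simp: indicator_def intro: order_trans)
qed

lemma tendsto_trunc: "(\<lambda>n. trunc n x) \<longlonglongrightarrow> x"
proof -
  have "(\<lambda>n. cls (\<lambda>t. indicator (cball 0 (real n)) t * rep x t)) \<longlonglongrightarrow> cls (rep x)"
  proof (rule lsq_dominated_convergence(1)[of _ _ "rep x"])
    show "AE t in lborel. cmod (indicator (cball 0 (real n)) t * rep x t) \<le> cmod (rep x t)" for n
      by (auto simp: norm_mult indicator_def)
  qed (auto intro!: borel_measurable_times borel_measurable_indicator AE_I2[OF indicator_cball_tendsto])
  then show ?thesis by (simp add: trunc_def)
qed

lemma goodF_ball:
  assumes "f \<in> L2" "\<And>x. x \<notin> cball 0 r \<Longrightarrow> f x = 0" shows "goodF f"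
proof (rule goodF_bounded_support[OF assms(1)])
  fix x :: 'a assume "x \<notin> Qb (r + 1)"
  then show "f x = 0" using cball_subset_Qb[of r] assms(2)[of x] by blast
qed

lemma goodF_trunc: "f \<in> L2 \<Longrightarrow> goodF (\<lambda>t. indicator (cball 0 r) t * f t)"
  by (rule goodF_ball[where r = r]) (auto intro: trunc_L2)

lemma FG_unique: "(x, y) \<in> FG \<Longrightarrow> (x, z) \<in> FG \<Longrightarrow> y = z"
  using FG_D[OF FG_minus[of "(x, y)" "(x, z)"]] by simp

lemma FG_closed: "closed FG" by (simp add: FG_def)

text \<open>The transforms of the truncations form a Cauchy sequence because \<open>FG\<close> is isometric.\<close>

lemma FG_total: "\<exists>y. (x, y) \<in> FG"
proof -
  define f where "f n = (\<lambda>t. indicator (cball 0 (real n)) t * rep x t)" for n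
  have g: "(trunc n x, cls (fourier_L1 (f n))) \<in> FG" for n
    using goodF_trunc[OF rep_L2, of "real n" x] by (simp add: goodF_def f_def trunc_def)
  have d: "norm (cls (fourier_L1 (f n)) - cls (fourier_L1 (f m))) = norm (trunc n x - trunc m x)" for m n
    using FG_D[OF FG_minus[OF g[of n] g[of m]]] by simp
  have "Cauchy (\<lambda>n. trunc n x)" using tendsto_trunc by (rule LIMSEQ_imp_Cauchy)
  then have "Cauchy (\<lambda>n. cls (fourier_L1 (f n)))" unfolding Cauchy_def dist_norm d .
  then obtain y where y: "(\<lambda>n. cls (fourier_L1 (f n))) \<longlonglongrightarrow> y" using Cauchy_convergent unfolding convergent_def by blast
  have "(x, y) \<in> FG"
    by (rule closed_sequentially[OF FG_closed g tendsto_Pair[OF tendsto_trunc y]])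
  then show ?thesis ..
qed

definition FT :: "'a::euclidean_space lsq \<Rightarrow> 'a lsq" where
  "FT x = (THE y. (x, y) \<in> FG)"

lemma FT_graph: "(x, FT x) \<in> FG"
  unfolding FT_def by (rule theI') (use FG_total FG_unique in blast)

lemma FT_eqI: "(x, y) \<in> FG \<Longrightarrow> FT x = y"
  using FG_unique[OF FT_graph] .

lemma norm_FT [simp]: "norm (FT x) = norm x"
  using FG_D[OF FT_graph[of x]] by simp

lemma FT_add: "FT (x + y) = FT x + FT y"
  using FG_add[OF FT_graph[of x] FT_graph[of y]] by (intro FT_eqI) simp

lemma FT_mul_const: "FT (mul (\<lambda>_. c) x) = mul (\<lambda>_. c) (FT x)"
  using FG_cmult[OF FT_graph[of x], of c] by (intro FT_eqI) simp

lemma mul_const_of_real: "mul (\<lambda>_. of_real r) x = r *\<^sub>R x"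
  by (simp add: mul_def scaleR_lsq_def scaleR_conv_of_real)

lemma bounded_linear_FT: "bounded_linear FT"
proof (rule bounded_linear_intro[where K = 1])
  show "FT (r *\<^sub>R x) = r *\<^sub>R FT x" for r and x :: "'a lsq"
    using FT_mul_const[of "of_real r" x] by (simp add: mul_const_of_real)
qed (auto simp: FT_add)

lemma FT_diff: "FT (x - y) = FT x - FT y"
  by (rule linear_diff[OF bounded_linear.linear[OF bounded_linear_FT]])

lemma tendsto_FT: "(f \<longlongrightarrow> x) F \<Longrightarrow> ((\<lambda>t. FT (f t)) \<longlongrightarrow> FT x) F"
  by (rule bounded_linear.tendsto[OF bounded_linear_FT])

lemma FT_goodF: "goodF f \<Longrightarrow> FT (cls f) = cls (fourier_L1 f)"
  by (intro FT_eqI) (simp add: goodF_def)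

lemma FT_trunc:
  assumes "f \<in> L2"
  shows "FT (trunc n (cls f)) = cls (fourier_L1 (\<lambda>x. indicator (cball 0 (real n)) x * f x))"
    "fourier_L1 (\<lambda>x. indicator (cball 0 (real n)) x * f x) \<in> L2"
  using goodF_trunc[OF assms, of "real n"] by (auto simp: trunc_cls[OF assms] FT_goodF goodF_def)

text \<open>By definition \<open>g\<close> is the mean-square limit of the transforms of the truncations, and these converge to
  \<open>FT (cls f)\<close> by continuity.\<close>

lemma is_fourier_iff: "is_fourier f g \<longleftrightarrow> f \<in> L2 \<and> g \<in> L2 \<and> FT (cls f) = cls g"
proof (cases "f \<in> L2 \<and> g \<in> L2")
  case True
  then have f: "f \<in> L2" and g: "g \<in> L2" by auto
  have *: "(\<integral>\<^sup>+\<xi>. ennreal ((cmod (fourier_L1 (\<lambda>x. indicator (cball 0 (real n)) x * f x) \<xi> - g \<xi>))\<^sup>2) \<partial>lborel) =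
     ennreal ((norm (FT (trunc n (cls f)) - cls g))\<^sup>2)" for n
    by (subst nn_integral_L2) (auto simp: FT_trunc[OF f] L2_diff g cls_diff)
  have lim: "(\<lambda>n. FT (trunc n (cls f))) \<longlonglongrightarrow> FT (cls f)" by (intro tendsto_FT tendsto_trunc)
  have "is_fourier f g \<longleftrightarrow> (\<lambda>n. ennreal ((norm (FT (trunc n (cls f)) - cls g))\<^sup>2)) \<longlonglongrightarrow> ennreal 0"
    unfolding is_fourier_def * using f g by simp
  also have "\<dots> \<longleftrightarrow> (\<lambda>n. (norm (FT (trunc n (cls f)) - cls g))\<^sup>2) \<longlonglongrightarrow> 0"
    by (subst tendsto_ennreal_iff) auto
  also have "\<dots> \<longleftrightarrow> FT (cls f) = cls g"
  proof
    assume "(\<lambda>n. (norm (FT (trunc n (cls f)) - cls g))\<^sup>2) \<longlonglongrightarrow> 0"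
    moreover have "(\<lambda>n. (norm (FT (trunc n (cls f)) - cls g))\<^sup>2) \<longlonglongrightarrow> (norm (FT (cls f) - cls g))\<^sup>2"
      by (intro tendsto_intros lim)
    ultimately have "(norm (FT (cls f) - cls g))\<^sup>2 = 0" by (rule LIMSEQ_unique[rotated])
    then show "FT (cls f) = cls g" by simp
  next
    assume "FT (cls f) = cls g"
    then have "(\<lambda>n. (norm (FT (trunc n (cls f)) - cls g))\<^sup>2) \<longlonglongrightarrow> (norm (cls g - cls g))\<^sup>2"
      using lim by (intro tendsto_intros) auto
    then show "(\<lambda>n. (norm (FT (trunc n (cls f)) - cls g))\<^sup>2) \<longlonglongrightarrow> 0" by simp
  qed
  finally show ?thesis using f g by simp
qed (auto simp: is_fourier_def)

lemma fourier_spec: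
  assumes "f \<in> L2" shows "fourier f \<in> L2" "cls (fourier f) = FT (cls f)"
proof -
  have "is_fourier f (rep (FT (cls f)))" using assms by (simp add: is_fourier_iff)
  then have "is_fourier f (fourier f)" unfolding fourier_def by (rule someI[of "is_fourier f"])
  then show "fourier f \<in> L2" "cls (fourier f) = FT (cls f)" by (auto simp: is_fourier_iff)
qed

text \<open>The transforms of the truncations converge in \<open>L2\<close> to one function and, for integrable \<open>f\<close>, pointwise
  to the other.\<close>

lemma FT_integrable:
  assumes f: "f \<in> L2" "integrable lborel f"
  shows "fourier_L1 f \<in> L2" "FT (cls f) = cls (fourier_L1 f)"
proof -
  note [measurable] = L2_measurable[OF f(1)]
  define g where "g n = (\<lambda>x. indicator (cball 0 (real n)) x * f x)" for n
  have gm [measurable]: "g n \<in> borel_measurable borel" for n unfolding g_def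
    by (auto intro!: borel_measurable_times borel_measurable_indicator)
  have pt: "(\<lambda>n. fourier_L1 (g n) \<xi>) \<longlonglongrightarrow> fourier_L1 f \<xi>" for \<xi>
    unfolding fourier_L1_def
  proof (intro tendsto_mult tendsto_const integral_dominated_convergence[where w = "\<lambda>x. cmod (f x)"])
    show "AE x in lborel. (\<lambda>n. cis (- (x \<bullet> \<xi>)) * g n x) \<longlonglongrightarrow> cis (- (x \<bullet> \<xi>)) * f x"
      unfolding g_def by (intro AE_I2 tendsto_mult tendsto_const indicator_cball_tendsto)
  qed (use f(2) in \<open>auto simp: norm_mult g_def indicator_def\<close>)
  have lim: "(\<lambda>n. FT (trunc n (cls f))) \<longlonglongrightarrow> FT (cls f)" by (intro tendsto_FT tendsto_trunc)
  have "AE \<xi> in lborel. \<forall>n. rep (FT (trunc n (cls f))) \<xi> = fourier_L1 (g n) \<xi>"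
    unfolding AE_all_countable g_def FT_trunc(1)[OF f(1)] by (intro allI rep_cls FT_trunc(2) f)
  then have ae: "AE \<xi> in lborel. (\<lambda>n. rep (FT (trunc n (cls f))) \<xi>) \<longlonglongrightarrow> fourier_L1 f \<xi>"
    by eventually_elim (simp add: pt)
  from tendsto_AE_unique[OF lim ae]
  have ae2: "AE \<xi> in lborel. rep (FT (cls f)) \<xi> = fourier_L1 f \<xi>" and L: "fourier_L1 f \<in> L2" by auto
  show "fourier_L1 f \<in> L2" by fact
  show "FT (cls f) = cls (fourier_L1 f)" using cls_eqI[OF _ L ae2] by simp
qed

text \<open>Fubini's theorem; the kernel \<open>exp (- i x \<bullet> \<xi>)\<close> is symmetric in its two arguments.\<close>

lemma fourier_multiplication:
  fixes f g :: "'a::euclidean_space \<Rightarrow> complex"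
  assumes f: "integrable lborel f" and g: "integrable lborel g"
  shows "(\<integral>\<xi>. fourier_L1 f \<xi> * g \<xi> \<partial>lborel) = (\<integral>x. f x * fourier_L1 g x \<partial>lborel)"
proof -
  have [measurable]: "f \<in> borel_measurable borel" "g \<in> borel_measurable borel" using f g by auto
  let ?c = "complex_of_real ((2 * pi) powr (- (real DIM('a) / 2)))"
  have "integrable (lborel \<Otimes>\<^sub>M lborel) (\<lambda>z. f (fst z) * g (snd z))"
  proof (rule integrableI_bounded)
    have "(\<integral>\<^sup>+ z. ennreal (norm (f (fst z) * g (snd z))) \<partial>(lborel \<Otimes>\<^sub>M lborel)) =
      (\<integral>\<^sup>+x. \<integral>\<^sup>+y. ennreal (norm (f x)) * ennreal (norm (g y)) \<partial>lborel \<partial>lborel)"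
      by (subst lborel.nn_integral_fst[symmetric]) (auto simp: norm_mult ennreal_mult)
    also have "\<dots> = (\<integral>\<^sup>+x. ennreal (norm (f x)) \<partial>lborel) * (\<integral>\<^sup>+y. ennreal (norm (g y)) \<partial>lborel)"
      by (simp add: nn_integral_cmult nn_integral_multc)
    also have "\<dots> < \<infinity>" using f g by (simp add: integrable_iff_bounded ennreal_mult_less_top)
    finally show "(\<integral>\<^sup>+ z. ennreal (norm (f (fst z) * g (snd z))) \<partial>(lborel \<Otimes>\<^sub>M lborel)) < \<infinity>" .
  qed measurable
  then have int: "integrable (lborel \<Otimes>\<^sub>M lborel) (\<lambda>(x, \<xi>). cis (- (x \<bullet> \<xi>)) * (f x * g \<xi>))"
    by (rule Bochner_Integration.integrable_bound) (auto simp: norm_mult split_beta)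
  have "(\<integral>\<xi>. fourier_L1 f \<xi> * g \<xi> \<partial>lborel) = ?c * (\<integral>\<xi>. (\<integral>x. cis (- (x \<bullet> \<xi>)) * (f x * g \<xi>) \<partial>lborel) \<partial>lborel)"
    unfolding fourier_L1_def
    by (simp del: integral_mult_left_zero integral_mult_right_zero
      add: integral_mult_right_zero[symmetric] integral_mult_left_zero[symmetric] mult_ac)
  also have "(\<integral>\<xi>. (\<integral>x. cis (- (x \<bullet> \<xi>)) * (f x * g \<xi>) \<partial>lborel) \<partial>lborel) =
     (\<integral>x. (\<integral>\<xi>. cis (- (x \<bullet> \<xi>)) * (f x * g \<xi>) \<partial>lborel) \<partial>lborel)"
    by (rule lborel_pair.Fubini_integral[OF int])
  also have "?c * \<dots> = (\<integral>x. f x * fourier_L1 g x \<partial>lborel)"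
    unfolding fourier_L1_def
    by (simp del: integral_mult_left_zero integral_mult_right_zero
      add: integral_mult_right_zero[symmetric] integral_mult_left_zero[symmetric] mult_ac inner_commute)
  finally show ?thesis .
qed

lemma trunc_integrable: "f \<in> L2 \<Longrightarrow> integrable lborel (\<lambda>t. indicator (cball 0 (real n)) t * f t)"
  by (rule bounded_support_integrable[OF trunc_L2, of _ "cball 0 (real n)"]) auto

text \<open>The identity holds for truncations by Fubini's theorem and extends by continuity.\<close>

lemma pair_FT: "pair (FT x) y = pair x (FT y)"
proof -
  define f where "f n = (\<lambda>t. indicator (cball 0 (real n)) t * rep x t)" for n
  define g where "g n = (\<lambda>t. indicator (cball 0 (real n)) t * rep y t)" for n
  have fg: "f n \<in> L2" "g n \<in> L2" "integrable lborel (f n)" "integrable lborel (g n)" for n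
    by (auto simp: f_def g_def trunc_L2 trunc_integrable)
  have e: "pair (FT (trunc n x)) (trunc n y) = pair (trunc n x) (FT (trunc n y))" for n
    unfolding trunc_def f_def[symmetric] g_def[symmetric] FT_integrable(2)[OF fg(1,3)] FT_integrable(2)[OF fg(2,4)]
    by (simp add: pair_cls FT_integrable fg fourier_multiplication)
  have "(\<lambda>n. pair (FT (trunc n x)) (trunc n y)) \<longlonglongrightarrow> pair (FT x) y"
    by (intro bounded_bilinear.tendsto[OF bounded_bilinear_pair] tendsto_FT tendsto_trunc)
  moreover have "(\<lambda>n. pair (trunc n x) (FT (trunc n y))) \<longlonglongrightarrow> pair x (FT y)"
    by (intro bounded_bilinear.tendsto[OF bounded_bilinear_pair] tendsto_FT tendsto_trunc)
  ultimately show ?thesis unfolding e by (rule LIMSEQ_unique)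
qed

lemma FT_cj: "cj (FT x) = rf (FT (cj x))"
proof -
  define f where "f n = (\<lambda>t. indicator (cball 0 (real n)) t * rep x t)" for n
  have f: "f n \<in> L2" "integrable lborel (f n)" for n
    by (auto simp: f_def trunc_L2 trunc_integrable)
  have "cj (FT (cls (f n))) = rf (FT (cj (cls (f n))))" for n
    using FT_integrable[OF f] FT_integrable[OF L2_cnj[OF f(1)] integrable_cnj[OF f(2)]]
    by (simp add: cj_cls f rf_cls cnj_fourier_L1)
  then have e: "cj (FT (trunc n x)) = rf (FT (cj (trunc n x)))" for n by (simp add: trunc_def f_def)
  have "(\<lambda>n. cj (FT (trunc n x))) \<longlonglongrightarrow> cj (FT x)"
    by (intro bounded_linear.tendsto[OF bounded_linear_cj] tendsto_FT tendsto_trunc)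
  moreover have "(\<lambda>n. rf (FT (cj (trunc n x)))) \<longlonglongrightarrow> rf (FT (cj x))"
    by (intro bounded_linear.tendsto[OF bounded_linear_cj] bounded_linear.tendsto[OF bounded_linear_rf] tendsto_FT tendsto_trunc)
  ultimately show ?thesis unfolding e by (rule LIMSEQ_unique)
qed

lemma FT_rf: "FT (rf x) = rf (FT x)"
proof -
  define f where "f n = (\<lambda>t. indicator (cball 0 (real n)) t * rep x t)" for n
  have f: "f n \<in> L2" "integrable lborel (f n)" for n
    by (auto simp: f_def trunc_L2 trunc_integrable)
  have i: "integrable lborel (\<lambda>t. f n (- t))" for n using integrable_lborel_affine[OF f(2)[of n], of "-1" 0] by simp
  have "fourier_L1 (\<lambda>t. f n (- t)) = (\<lambda>\<xi>. fourier_L1 (f n) (- \<xi>))" for n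
  proof
    fix \<xi>
    have [measurable]: "f n \<in> borel_measurable borel" using f(1) by (rule L2_measurable)
    show "fourier_L1 (\<lambda>t. f n (- t)) \<xi> = fourier_L1 (f n) (- \<xi>)" unfolding fourier_L1_def
      using integral_lborel_affine[of "\<lambda>x. cis (- (x \<bullet> - \<xi>)) * f n x" "-1" 0] by simp
  qed
  then have "FT (rf (cls (f n))) = rf (FT (cls (f n)))" for n
    using FT_integrable[OF f] FT_integrable[OF L2_reflect[OF f(1)] i]
    by (simp add: f rf_cls)
  then have e: "FT (rf (trunc n x)) = rf (FT (trunc n x))" for n by (simp add: trunc_def f_def)
  have "(\<lambda>n. FT (rf (trunc n x))) \<longlonglongrightarrow> FT (rf x)"
    by (intro bounded_linear.tendsto[OF bounded_linear_rf] tendsto_FT tendsto_trunc)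
  moreover have "(\<lambda>n. rf (FT (trunc n x))) \<longlonglongrightarrow> rf (FT x)"
    by (intro bounded_linear.tendsto[OF bounded_linear_rf] tendsto_FT tendsto_trunc)
  ultimately show ?thesis unfolding e by (rule LIMSEQ_unique)
qed

definition IFT :: "'a::euclidean_space lsq \<Rightarrow> 'a lsq" where
  "IFT x = rf (FT x)"

lemma norm_IFT [simp]: "norm (IFT x) = norm x" by (simp add: IFT_def)

lemma bounded_linear_IFT: "bounded_linear IFT"
  unfolding IFT_def using bounded_linear_compose[OF bounded_linear_rf bounded_linear_FT] .

lemma inner_FT: "inner (FT x) (FT y) = inner x y"
proof -
  have "norm (FT x + FT y) = norm (x + y)" using norm_FT[of "x + y"] by (simp add: FT_add)
  then show ?thesis using dot_norm[of "FT x" "FT y"] dot_norm[of x y] by simp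
qed

text \<open>Inversion is a formal consequence of isometry: \<open>\<langle>z, x\<rangle> = \<langle>FT z, FT x\<rangle>\<close>, and the transpose of the
  transform with respect to \<open>pair\<close> is again the transform, which conjugation turns into \<open>IFT\<close>.\<close>

lemma IFT_FT [simp]: "IFT (FT x) = x"
proof -
  have "inner z (IFT (FT x)) = inner z x" for z
  proof -
    have "inner z x = inner (FT z) (FT x)" by (simp add: inner_FT)
    also have "\<dots> = Re (pair z (FT (cj (FT x))))" by (simp add: inner_pair pair_FT)
    also have "FT (cj (FT x)) = cj (IFT (FT x))"
      using FT_cj[of "cj (FT x)"] by (simp add: IFT_def FT_cj FT_rf) (metis cj_cj FT_cj)
    finally show ?thesis by (simp add: inner_pair)
  qed
  from this[of "IFT (FT x) - x"] have "inner (IFT (FT x) - x) (IFT (FT x) - x) = 0"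
    by (simp add: inner_diff_right)
  then show ?thesis by simp
qed

lemma FT_IFT [simp]: "FT (IFT x) = x"
  using IFT_FT[of x] by (simp add: IFT_def FT_rf)

lemma pair_FT_IFT: "pair x y = pair (FT x) (IFT y)"
  by (simp add: pair_FT)

section \<open>The fractional Laplacian as a multiplication operator\<close>

definition symb :: "real \<Rightarrow> 'a::euclidean_space \<Rightarrow> complex" where
  "symb \<sigma> \<xi> = of_real (norm \<xi> powr (2 * \<sigma>))"

lemma symb_measurable [measurable]: "symb \<sigma> \<in> borel_measurable borel"
  unfolding symb_def[abs_def] by measurable

lemma symb_minus [simp]: "symb \<sigma> (- \<xi>) = symb \<sigma> \<xi>" by (simp add: symb_def)

lemma is_frac_laplacian_iff:
  "is_frac_laplacian \<sigma> u v \<longleftrightarrow> u \<in> L2 \<and> v \<in> L2 \<and> mdom (symb \<sigma>) (FT (cls u)) \<and> FT (cls v) = mul (symb \<sigma>) (FT (cls u))"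
proof (cases "u \<in> L2 \<and> v \<in> L2")
  case True
  then have u: "u \<in> L2" and v: "v \<in> L2" by auto
  note Fu = fourier_spec[OF u] and Fv = fourier_spec[OF v]
  note [measurable] = L2_measurable[OF Fu(1)]
  have "(AE \<xi> in lborel. fourier v \<xi> = of_real (norm \<xi> powr (2 * \<sigma>)) * fourier u \<xi>) \<longleftrightarrow>
    mdom (symb \<sigma>) (FT (cls u)) \<and> FT (cls v) = mul (symb \<sigma>) (FT (cls u))" (is "?L \<longleftrightarrow> ?R")
  proof
    assume ae: ?L
    have L: "(\<lambda>\<xi>. symb \<sigma> \<xi> * fourier u \<xi>) \<in> L2"
      by (rule L2_dominated[OF Fv(1), where K = 1]) (use ae in \<open>auto simp: symb_def elim: eventually_mono\<close>)
    show ?R using mdom_cls[OF Fu(1) _ L] ae unfolding Fu(2)[symmetric] Fv(2)[symmetric]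
      by (simp add: cls_eq_iff[OF Fv(1) L]) (simp add: symb_def)
  next
    assume R: ?R
    have "AE \<xi> in lborel. rep (FT (cls v)) \<xi> = fourier v \<xi>" "AE \<xi> in lborel. rep (FT (cls u)) \<xi> = fourier u \<xi>"
      unfolding Fu(2)[symmetric] Fv(2)[symmetric] by (intro rep_cls Fu Fv)+
    moreover have "AE \<xi> in lborel. rep (FT (cls v)) \<xi> = symb \<sigma> \<xi> * rep (FT (cls u)) \<xi>"
      using R rep_mul[of "symb \<sigma>" "FT (cls u)"] by auto
    ultimately show ?L by eventually_elim (simp add: symb_def)
  qed
  then show ?thesis using u v by (simp add: is_frac_laplacian_def)
qed (auto simp: is_frac_laplacian_def)

lemma frac_laplacian_spec:
  assumes "u \<in> L2" "mdom (symb \<sigma>) (FT (cls u))"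
  shows "frac_laplacian \<sigma> u \<in> L2" "cls (frac_laplacian \<sigma> u) = IFT (mul (symb \<sigma>) (FT (cls u)))"
proof -
  have "is_frac_laplacian \<sigma> u (rep (IFT (mul (symb \<sigma>) (FT (cls u)))))"
    using assms by (simp add: is_frac_laplacian_iff)
  then have "is_frac_laplacian \<sigma> u (frac_laplacian \<sigma> u)" unfolding frac_laplacian_def by (rule someI[of "is_frac_laplacian \<sigma> u"])
  then have *: "frac_laplacian \<sigma> u \<in> L2" "FT (cls (frac_laplacian \<sigma> u)) = mul (symb \<sigma>) (FT (cls u))"
    by (auto simp: is_frac_laplacian_iff)
  show "frac_laplacian \<sigma> u \<in> L2" by fact
  show "cls (frac_laplacian \<sigma> u) = IFT (mul (symb \<sigma>) (FT (cls u)))" unfolding *(2)[symmetric] by simp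
qed

lemma Hs_iff: "u \<in> Hs s \<longleftrightarrow> u \<in> L2 \<and> mdom (symb (s/2)) (FT (cls u))"
proof -
  have "\<exists>v. v \<in> L2 \<and> FT (cls v) = mul (symb (s/2)) (FT (cls u))"
    by (intro exI[of _ "rep (IFT (mul (symb (s/2)) (FT (cls u))))"]) simp
  then show ?thesis unfolding Hs_def is_frac_laplacian_iff by auto
qed

lemma Hs_norm_eq:
  assumes "u \<in> Hs s" shows "Hs_norm s u = norm (cls u) + norm (mul (symb (s/2)) (FT (cls u)))"
proof -
  have u: "u \<in> L2" "mdom (symb (s/2)) (FT (cls u))" using assms by (auto simp: Hs_iff)
  note F = frac_laplacian_spec[OF u]
  show ?thesis unfolding Hs_norm_def norm_cls[OF u(1), symmetric] norm_cls[OF F(1), symmetric] F(2) by simp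
qed

section \<open>Unitary groups with a bounded skew perturbation\<close>

lemma uniform_limit_bounded_linear_family:
  assumes u: "uniform_limit A f g F" and B: "\<And>t x y. t \<in> A \<Longrightarrow> norm (B t x - B t y) \<le> K * norm (x - y)"
  shows "uniform_limit A (\<lambda>n t. B t (f n t)) (\<lambda>t. B t (g t)) F"
proof (rule uniform_limitI)
  fix e :: real assume "e > 0"
  define K' where "K' = max K 1"
  have K': "K' > 0" "K \<le> K'" by (auto simp: K'_def)
  have "\<forall>\<^sub>F n in F. \<forall>t\<in>A. dist (f n t) (g t) < e / K'"
    using \<open>e > 0\<close> K' by (intro uniform_limitD[OF u]) auto
  then show "\<forall>\<^sub>F n in F. \<forall>t\<in>A. dist (B t (f n t)) (B t (g t)) < e"
  proof eventually_elim
    case (elim n)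
    show ?case
    proof
      fix t assume t: "t \<in> A"
      have "dist (B t (f n t)) (B t (g t)) \<le> K * norm (f n t - g t)" using B[OF t] by (simp add: dist_norm)
      also have "\<dots> \<le> K' * norm (f n t - g t)" using K' by (intro mult_right_mono) auto
      also have "\<dots> < e" using elim[rule_format, OF t] K' by (simp add: dist_norm field_simps)
      finally show "dist (B t (f n t)) (B t (g t)) < e" .
    qed
  qed
qed

lemma ftc_iff:
  fixes w :: "real \<Rightarrow> 'h::banach"
  assumes cont: "continuous_on {0..T} f" and eq: "\<And>t. t \<in> {0..T} \<Longrightarrow> w t = x + integral {0..t} f"
    and t: "t \<in> {0..T}"
  shows "(w has_vector_derivative f t) (at t within {0..T})"
proof (rule has_vector_derivative_transform[OF t])
  show "((\<lambda>t. x + integral {0..t} f) has_vector_derivative f t) (at t within {0..T})"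
    using integral_has_vector_derivative[OF cont t] by (auto intro!: derivative_eq_intros)
qed (use eq in auto)

lemma has_vector_derivative_iff_tendsto:
  fixes f :: "real \<Rightarrow> 'h::real_normed_vector"
  shows "(f has_vector_derivative D) (at x within A) \<longleftrightarrow>
    ((\<lambda>y. (1 / (y - x)) *\<^sub>R (f y - f x)) \<longlongrightarrow> D) (at x within A)"
proof -
  have "norm ((f y - f x) - (y - x) *\<^sub>R D) / norm (y - x) = norm ((1 / (y - x)) *\<^sub>R (f y - f x) - D)" if "y \<noteq> x" for y
  proof -
    have "(1 / (y - x)) *\<^sub>R (f y - f x) - D = (1 / (y - x)) *\<^sub>R ((f y - f x) - (y - x) *\<^sub>R D)"
      using that by (simp add: scaleR_diff_right)
    then show ?thesis by (simp add: divide_inverse mult.commute)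
  qed
  then have "((\<lambda>y. norm ((f y - f x) - (y - x) *\<^sub>R D) / norm (y - x)) \<longlongrightarrow> 0) (at x within A) \<longleftrightarrow>
     ((\<lambda>y. norm ((1 / (y - x)) *\<^sub>R (f y - f x) - D)) \<longlongrightarrow> 0) (at x within A)"
    by (intro filterlim_cong refl) (auto simp: eventually_at_filter)
  then show ?thesis
    unfolding has_vector_derivative_def has_derivative_iff_norm
    by (simp add: bounded_linear_scaleR_left tendsto_norm_zero_iff Lim_null[of _ D])
qed

text \<open>A unitary group \<open>S\<close>, a bounded perturbation \<open>Q\<close> of its generator, and the complex structure \<open>J\<close>.
  Orthogonality of \<open>Q x\<close> and \<open>x\<close> in the real inner product is skewness.\<close>

locale perturbed_group =
  fixes S :: "real \<Rightarrow> 'h::{real_inner,banach} \<Rightarrow> 'h" and Q J :: "'h \<Rightarrow> 'h"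
  assumes S_lin: "\<And>t. bounded_linear (S t)" and S_norm [simp]: "\<And>t x. norm (S t x) = norm x"
    and S_0 [simp]: "\<And>x. S 0 x = x" and S_add: "\<And>a b x. S (a + b) x = S a (S b x)"
    and S_cont: "\<And>x. continuous_on UNIV (\<lambda>t. S t x)"
    and Q_lin: "bounded_linear Q" and Q_skew: "\<And>x. inner (Q x) x = 0"
    and J_lin: "bounded_linear J" and J_norm [simp]: "\<And>x. norm (J x) = norm x"
    and J_S: "\<And>t x. J (S t x) = S t (J x)" and J_Q: "\<And>x. J (Q x) = Q (J x)"
begin

lemma S_inverse [simp]: "S (- t) (S t x) = x" "S t (S (- t) x) = x"
  using S_add[of "- t" t x] S_add[of t "- t" x] by simp_all

lemma S_inner: "inner (S t x) (S t y) = inner x y"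
proof -
  have "norm (S t x + S t y) = norm (x + y)"
    using S_norm[of t "x + y"] by (simp add: linear_add[OF bounded_linear.linear[OF S_lin]])
  then show ?thesis using dot_norm[of "S t x" "S t y"] dot_norm[of x y] by simp
qed

lemma S_diff: "S t (x - y) = S t x - S t y"
  by (rule linear_diff[OF bounded_linear.linear[OF S_lin]])

lemma S_tendsto:
  assumes "(f \<longlongrightarrow> x) F" "(g \<longlongrightarrow> t) F" shows "((\<lambda>a. S (g a) (f a)) \<longlongrightarrow> S t x) F"
proof -
  have "((\<lambda>a. S (g a) x) \<longlongrightarrow> S t x) F"
    using S_cont[of x] assms(2)
    by (intro isCont_tendsto_compose[of t "\<lambda>t. S t x"]) (auto simp: continuous_on_eq_continuous_at)
  then have "((\<lambda>a. S (g a) x - S t x) \<longlongrightarrow> 0) F" by (simp add: LIM_zero)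
  then have "((\<lambda>a. norm (f a - x) + norm (S (g a) x - S t x)) \<longlongrightarrow> 0 + 0) F"
    using assms(1) by (intro tendsto_add) (auto intro: tendsto_norm_zero LIM_zero)
  then have "((\<lambda>a. S (g a) (f a) - S t x) \<longlongrightarrow> 0) F"
  proof (rule Lim_null_comparison[rotated, OF tendsto_eq_rhs])
    have "norm (S (g a) (f a) - S t x) \<le> norm (f a - x) + norm (S (g a) x - S t x)" for a
    proof -
      have "norm (S (g a) (f a) - S (g a) x) = norm (f a - x)" by (simp only: S_diff[symmetric] S_norm)
      then show ?thesis using norm_triangle_ineq[of "S (g a) (f a) - S (g a) x" "S (g a) x - S t x"] by simp
    qed
    then show "\<forall>\<^sub>F a in F. norm (S (g a) (f a) - S t x) \<le> norm (f a - x) + norm (S (g a) x - S t x)" by simp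
  qed simp
  then show ?thesis by (rule LIM_zero_cancel)
qed

lemma S_continuous_on: "continuous_on A f \<Longrightarrow> continuous_on A g \<Longrightarrow> continuous_on A (\<lambda>a. S (g a) (f a))"
  unfolding continuous_on_def by (auto intro: S_tendsto)

definition "K = (SOME K. K \<ge> 0 \<and> (\<forall>x. norm (Q x) \<le> K * norm x))"

lemma K: "K \<ge> 0" "norm (Q x) \<le> K * norm x"
proof -
  obtain k where "k \<ge> 0" "\<And>x. norm (Q x) \<le> norm x * k"
    using bounded_linear.nonneg_bounded[OF Q_lin] by auto
  then have "\<exists>k. k \<ge> 0 \<and> (\<forall>x. norm (Q x) \<le> k * norm x)" by (auto simp: mult.commute)
  from someI_ex[OF this] show "K \<ge> 0" "norm (Q x) \<le> K * norm x" by (auto simp: K_def)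
qed

text \<open>The perturbation in the interaction picture.\<close>

definition B :: "real \<Rightarrow> 'h \<Rightarrow> 'h" where "B t x = S (- t) (Q (S t x))"

lemma B_lin: "bounded_linear (B t)"
  unfolding B_def by (intro bounded_linear_compose[OF S_lin] bounded_linear_compose[OF Q_lin] S_lin)

lemma B_norm: "norm (B t x) \<le> K * norm x"
  using K(2)[of "S t x"] by (simp add: B_def)

lemma B_diff: "B t (x - y) = B t x - B t y"
  by (rule linear_diff[OF bounded_linear.linear[OF B_lin]])

lemma B_skew: "inner (B t x) x = 0"
  using S_inner[of t "B t x" x] by (simp add: B_def Q_skew)

lemma B_continuous_on: "continuous_on A f \<Longrightarrow> continuous_on A (\<lambda>t. B t (f t))"
  unfolding B_def by (intro S_continuous_on bounded_linear.continuous_on[OF Q_lin] continuous_intros)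

text \<open>The skew part does not change the norm, so the norm grows at most as fast as the inhomogeneity. One
  estimate serves for uniqueness, for conservation of the norm and for the comparison of two flows.
  The norm is not differentiable at \<open>0\<close>, hence it is regularised to \<open>sqrt (|w|^2 + \<delta>^2)\<close>.\<close>

lemma skew_growth:
  assumes w: "\<And>t. t \<in> {0..T} \<Longrightarrow> (w has_vector_derivative B t (w t) + r t) (at t within {0..T})"
    and r: "\<And>t. t \<in> {0..T} \<Longrightarrow> norm (r t) \<le> R" and t: "t \<in> {0..T}"
  shows "\<bar>norm (w t) - norm (w 0)\<bar> \<le> R * t"
proof (rule field_le_epsilon)
  fix \<delta> :: real assume \<delta>: "\<delta> > 0"
  \<comment> \<open>The skew part drops out of the derivative of \<open>g\<close>.\<close>
  define g where "g t = sqrt (inner (w t) (w t) + \<delta>\<^sup>2)" for t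
  have pos: "inner (w t) (w t) + \<delta>\<^sup>2 > 0" for t using \<delta> by (intro add_nonneg_pos) auto
  have dg: "(g has_real_derivative inner (r \<tau>) (w \<tau>) / g \<tau>) (at \<tau> within {0..t})" if \<tau>: "\<tau> \<in> {0..t}" for \<tau>
  proof -
    have \<tau>T: "\<tau> \<in> {0..T}" using \<tau> t by auto
    have wd: "(w has_derivative (\<lambda>h. h *\<^sub>R (B \<tau> (w \<tau>) + r \<tau>))) (at \<tau> within {0..t})"
      using has_vector_derivative_within_subset[OF w[OF \<tau>T], of "{0..t}"] t by (auto simp: has_vector_derivative_def)
    have "((\<lambda>t. inner (w t) (w t) + \<delta>\<^sup>2) has_derivative (\<lambda>h. inner (w \<tau>) (h *\<^sub>R (B \<tau> (w \<tau>) + r \<tau>)) + inner (h *\<^sub>R (B \<tau> (w \<tau>) + r \<tau>)) (w \<tau>) + 0)) (at \<tau> within {0..t})"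
      by (intro derivative_intros wd)
    also have "(\<lambda>h. inner (w \<tau>) (h *\<^sub>R (B \<tau> (w \<tau>) + r \<tau>)) + inner (h *\<^sub>R (B \<tau> (w \<tau>) + r \<tau>)) (w \<tau>) + 0) = (\<lambda>h. 2 * inner (r \<tau>) (w \<tau>) * h)"
      by (auto simp: fun_eq_iff inner_add_left inner_add_right B_skew inner_commute[of "w \<tau>"] algebra_simps)
    finally have "((\<lambda>t. inner (w t) (w t) + \<delta>\<^sup>2) has_real_derivative 2 * inner (r \<tau>) (w \<tau>)) (at \<tau> within {0..t})"
      by (simp add: has_field_derivative_def)
    from DERIV_chain2[OF DERIV_real_sqrt[OF pos[of \<tau>]] this] show ?thesis
      unfolding g_def[abs_def] by (simp add: field_simps)
  qed
  have bound: "\<bar>inner (r \<tau>) (w \<tau>) / g \<tau>\<bar> \<le> R" if \<tau>: "\<tau> \<in> {0..t}" for \<tau>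
  proof -
    have "norm (w \<tau>) \<le> g \<tau>" unfolding g_def norm_eq_sqrt_inner by simp
    moreover have "norm (r \<tau>) \<le> R" using r \<tau> t by auto
    moreover have "g \<tau> > 0" unfolding g_def using pos by simp
    moreover have "\<bar>inner (r \<tau>) (w \<tau>)\<bar> \<le> norm (r \<tau>) * norm (w \<tau>)" by (rule Cauchy_Schwarz_ineq2)
    moreover have "norm (r \<tau>) * norm (w \<tau>) \<le> R * g \<tau>"
      using calculation by (intro mult_mono) (auto intro: order_trans[OF norm_ge_zero])
    ultimately show ?thesis by (simp add: pos_divide_le_eq abs_divide)
  qed
  have "\<exists>\<xi>\<in>{0..t}. g t - g 0 = (inner (r \<xi>) (w \<xi>) / g \<xi>) * (t - 0)"
  proof (rule mvt_very_simple)
    show "0 \<le> t" using t by auto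
    show "\<And>x. 0 \<le> x \<Longrightarrow> x \<le> t \<Longrightarrow> (g has_derivative (*) (inner (r x) (w x) / g x)) (at x within {0..t})"
      using dg unfolding has_field_derivative_def by auto
  qed
  then obtain \<xi> where \<xi>: "\<xi> \<in> {0..t}" "g t - g 0 = (inner (r \<xi>) (w \<xi>) / g \<xi>) * t" by auto
  have "R \<ge> 0" using r[OF t] norm_ge_zero order_trans by blast
  then have "\<bar>g t - g 0\<bar> \<le> R * t" unfolding \<xi>(2) abs_mult using bound[OF \<xi>(1)] t by (intro mult_mono) auto
  moreover have "norm (w s) \<le> g s" "g s \<le> norm (w s) + \<delta>" for s
  proof -
    show "norm (w s) \<le> g s" unfolding g_def norm_eq_sqrt_inner by simp
    show "g s \<le> norm (w s) + \<delta>" unfolding g_def dot_square_norm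
      using sqrt_sum_squares_le_sum[of "norm (w s)" \<delta>] \<delta> by simp
  qed
  note this[of t] this[of 0]
  ultimately show "\<bar>norm (w t) - norm (w 0)\<bar> \<le> R * t + \<delta>" by linarith
qed

primrec dyson :: "'h \<Rightarrow> nat \<Rightarrow> real \<Rightarrow> 'h" where
  "dyson x 0 = (\<lambda>t. x)"
| "dyson x (Suc n) = (\<lambda>t. integral {0..t} (\<lambda>\<tau>. B \<tau> (dyson x n \<tau>)))"

lemma dyson_continuous: "continuous_on {0..T} (dyson x n)"
proof (induct n)
  case (Suc n)
  then show ?case
    by (simp add: indefinite_integral_continuous_1 integrable_continuous_real B_continuous_on)
qed simp

lemma dyson_bound: "t \<ge> 0 \<Longrightarrow> norm (dyson x n t) \<le> (K * t) ^ n / fact n * norm x"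
proof (induct n arbitrary: t)
  case (Suc n)
  let ?G = "\<lambda>t. K ^ Suc n * norm x / fact (Suc n) * t ^ Suc n"
  have int: "((\<lambda>\<tau>. K * ((K * \<tau>) ^ n / fact n * norm x)) has_integral (?G t - ?G 0)) {0..t}"
  proof (rule fundamental_theorem_of_calculus[OF Suc(2)])
    fix \<tau> assume "\<tau> \<in> {0..t}"
    have "(?G has_real_derivative K ^ Suc n * norm x / fact (Suc n) * (real (Suc n) * \<tau> ^ n)) (at \<tau> within {0..t})"
      by (rule DERIV_cmult) (use DERIV_pow[of "Suc n" \<tau>] in simp)
    also have "K ^ Suc n * norm x / fact (Suc n) * (real (Suc n) * \<tau> ^ n) = K * ((K * \<tau>) ^ n / fact n * norm x)"
      by (simp add: power_mult_distrib fact_Suc del: of_nat_Suc)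
    finally show "(?G has_vector_derivative K * ((K * \<tau>) ^ n / fact n * norm x)) (at \<tau> within {0..t})"
      by (simp add: has_real_derivative_iff_has_vector_derivative)
  qed
  have "norm (dyson x (Suc n) t) \<le> integral {0..t} (\<lambda>\<tau>. K * ((K * \<tau>) ^ n / fact n * norm x))"
    unfolding dyson.simps
  proof (rule integral_norm_bound_integral)
    show "(\<lambda>\<tau>. B \<tau> (dyson x n \<tau>)) integrable_on {0..t}"
      by (intro integrable_continuous_real B_continuous_on dyson_continuous)
    show "(\<lambda>\<tau>. K * ((K * \<tau>) ^ n / fact n * norm x)) integrable_on {0..t}" using int by blast
    show "norm (B \<tau> (dyson x n \<tau>)) \<le> K * ((K * \<tau>) ^ n / fact n * norm x)" if "\<tau> \<in> {0..t}" for \<tau>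
      using that by (intro order_trans[OF B_norm] mult_left_mono K Suc(1)) auto
  qed
  also have "\<dots> = ?G t" by (subst integral_unique[OF int]) simp
  also have "\<dots> = (K * t) ^ Suc n / fact (Suc n) * norm x" by (simp add: power_mult_distrib)
  finally show ?case .
qed simp

definition sol :: "'h \<Rightarrow> real \<Rightarrow> 'h" where "sol x t = (\<Sum>n. dyson x n t)"

lemma dyson_uniform: "uniform_limit {0..T} (\<lambda>n t. \<Sum>i<n. dyson x i t) (sol x) sequentially"
  unfolding sol_def[abs_def]
proof (rule Weierstrass_m_test)
  show "norm (dyson x n t) \<le> (K * T) ^ n / fact n * norm x" if "t \<in> {0..T}" for n t
    using that K(1)
    by (intro order_trans[OF dyson_bound] mult_right_mono divide_right_mono power_mono mult_left_mono) auto
  show "summable (\<lambda>n. (K * T) ^ n / fact n * norm x)"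
    using summable_exp[of "K * T"] by (intro summable_mult2) (simp add: divide_inverse mult.commute)
qed

lemma sol_continuous: "continuous_on {0..T} (sol x)"
  by (rule uniform_limit_theorem[OF _ dyson_uniform])
     (auto intro!: always_eventually continuous_on_sum dyson_continuous)

lemma sol_eq:
  assumes "t \<ge> 0" shows "sol x t = x + integral {0..t} (\<lambda>\<tau>. B \<tau> (sol x \<tau>))"
proof -
  let ?P = "\<lambda>n t. \<Sum>i<n. dyson x i t"
  have u: "uniform_limit {0..t} (\<lambda>n \<tau>. B \<tau> (?P n \<tau>)) (\<lambda>\<tau>. B \<tau> (sol x \<tau>)) sequentially"
    by (rule uniform_limit_bounded_linear_family[OF dyson_uniform, where K = K]) (simp add: B_diff[symmetric] B_norm)
  have c: "continuous_on {0..t} (\<lambda>\<tau>. B \<tau> (?P n \<tau>))" for n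
    by (intro B_continuous_on continuous_on_sum dyson_continuous)
  obtain I L where I: "\<And>n. ((\<lambda>\<tau>. B \<tau> (?P n \<tau>)) has_integral I n) {0..t}"
    "((\<lambda>\<tau>. B \<tau> (sol x \<tau>)) has_integral L) {0..t}" "I \<longlonglongrightarrow> L"
    using uniform_limit_integral[OF u c] by auto
  have "?P (Suc n) t = x + I n" for n
  proof -
    have "((\<lambda>\<tau>. \<Sum>i<n. B \<tau> (dyson x i \<tau>)) has_integral (\<Sum>i<n. dyson x (Suc i) t)) {0..t}"
      unfolding dyson.simps
      by (intro has_integral_sum integrable_integral integrable_continuous_real B_continuous_on dyson_continuous) simp
    then have "((\<lambda>\<tau>. B \<tau> (?P n \<tau>)) has_integral (\<Sum>i<n. dyson x (Suc i) t)) {0..t}"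
      by (simp add: linear_sum[OF bounded_linear.linear[OF B_lin]])
    with I(1)[of n] have "I n = (\<Sum>i<n. dyson x (Suc i) t)" by (rule has_integral_unique)
    then show ?thesis by (simp add: sum.lessThan_Suc_shift del: dyson.simps(2) sum.lessThan_Suc)
  qed
  then have "(\<lambda>n. ?P (Suc n) t) \<longlonglongrightarrow> x + L" using I(3) by (simp add: tendsto_add del: sum.lessThan_Suc)
  then have "(\<lambda>n. ?P n t) \<longlonglongrightarrow> x + L" by (rule LIMSEQ_imp_Suc[of "\<lambda>n. ?P n t"])
  moreover have "(\<lambda>n. ?P n t) \<longlonglongrightarrow> sol x t"
    using tendsto_uniform_limitI[OF dyson_uniform[where T = t and x = x], where x = t] assms by simp
  ultimately have "sol x t = x + L" by (rule LIMSEQ_unique[rotated])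
  then show ?thesis using I(2) by (simp add: integral_unique)
qed

lemma sol_0 [simp]: "sol x 0 = x"
  using sol_eq[of 0 x] by simp

lemma sol_deriv: "t \<in> {0..T} \<Longrightarrow> (sol x has_vector_derivative B t (sol x t)) (at t within {0..T})"
  by (rule ftc_iff[where x = x]) (auto intro: B_continuous_on sol_continuous sol_eq)

lemma sol_unique:
  assumes w: "\<And>t. t \<in> {0..T} \<Longrightarrow> (w has_vector_derivative B t (w t)) (at t within {0..T})"
    and "w 0 = x" "t \<in> {0..T}"
  shows "w t = sol x t"
proof -
  have "\<bar>norm (w t - sol x t) - norm (w 0 - sol x 0)\<bar> \<le> 0 * t"
  proof (rule skew_growth[where r = "\<lambda>_. 0" and R = 0])
    show "((\<lambda>t. w t - sol x t) has_vector_derivative B t (w t - sol x t) + 0) (at t within {0..T})" if "t \<in> {0..T}" for t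
      using has_vector_derivative_diff[OF w[OF that] sol_deriv[OF that, of x]] by (simp add: B_diff)
  qed (use assms in auto)
  then show ?thesis using assms(2) by simp
qed

definition V :: "real \<Rightarrow> 'h \<Rightarrow> 'h" where "V t x = S t (sol x t)"

lemma V_0 [simp]: "V 0 x = x" by (simp add: V_def)

lemma V_norm [simp]: "t \<ge> 0 \<Longrightarrow> norm (V t x) = norm x"
  using skew_growth[of t "sol x" "\<lambda>_. 0" 0 t] sol_deriv[of _ t x] by (simp add: V_def)

lemma sol_linear:
  assumes T: "bounded_linear T" and TB: "\<And>t x. T (B t x) = B t (T x)" and "t \<ge> 0"
  shows "sol (T x) t = T (sol x t)"
  by (rule sol_unique[of t "\<lambda>t. T (sol x t)", symmetric])
     (use assms bounded_linear.has_vector_derivative[OF T sol_deriv] in auto)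

lemma sol_add: "t \<ge> 0 \<Longrightarrow> sol (x + y) t = sol x t + sol y t"
proof (rule sol_unique[of t "\<lambda>t. sol x t + sol y t", symmetric])
  fix s assume s: "s \<in> {0..t}"
  show "((\<lambda>t. sol x t + sol y t) has_vector_derivative B s (sol x s + sol y s)) (at s within {0..t})"
    using has_vector_derivative_add[OF sol_deriv[OF s, of x] sol_deriv[OF s, of y]]
    by (simp add: linear_add[OF bounded_linear.linear[OF B_lin]])
qed auto

lemma V_add_arg: "t \<ge> 0 \<Longrightarrow> V t (x + y) = V t x + V t y"
  by (simp add: V_def sol_add linear_add[OF bounded_linear.linear[OF S_lin]])

lemma V_minus: "t \<ge> 0 \<Longrightarrow> V t (- x) = - V t x"
  using sol_linear[OF bounded_linear_minus[OF bounded_linear_ident], of t x]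
  by (simp add: V_def linear_neg[OF bounded_linear.linear[OF B_lin]] linear_neg[OF bounded_linear.linear[OF S_lin]])

lemma V_diff_arg: "t \<ge> 0 \<Longrightarrow> V t (x - y) = V t x - V t y"
  using V_add_arg[of t x "- y"] by (simp add: V_minus)

lemma V_J: "t \<ge> 0 \<Longrightarrow> V t (J x) = J (V t x)"
  unfolding V_def by (subst sol_linear[OF J_lin]) (auto simp: B_def J_S J_Q)

lemma V_inner: "t \<ge> 0 \<Longrightarrow> inner (V t x) (V t y) = inner x y"
proof -
  assume t: "t \<ge> 0"
  then have "norm (V t x + V t y) = norm (x + y)" by (simp add: V_add_arg[symmetric])
  then show ?thesis using dot_norm[of "V t x" "V t y"] dot_norm[of x y] t by simp
qed

lemma V_continuous: "continuous_on {0..T} (\<lambda>t. V t x)"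
  unfolding V_def by (intro S_continuous_on sol_continuous continuous_intros)

text \<open>In the interaction picture, a time shift of a solution conjugates the equation by \<open>S r\<close>, so that the
  shifted solution is the one with initial value \<open>V r x\<close>. Times are nonnegative because \<open>sol\<close> is only controlled there.\<close>

lemma V_group:
  assumes "t \<ge> 0" "r \<ge> 0" shows "V (t + r) x = V t (V r x)"
proof -
  define w where "w \<tau> = S r (sol x (\<tau> + r))" for \<tau>
  have "w t = sol (V r x) t"
  proof (rule sol_unique[of t])
    fix \<tau> assume \<tau>: "\<tau> \<in> {0..t}"
    then have tr: "\<tau> + r \<in> {0..t + r}" using assms by auto
    have "((sol x \<circ> (\<lambda>\<tau>. \<tau> + r)) has_vector_derivative 1 *\<^sub>R B (\<tau> + r) (sol x (\<tau> + r))) (at \<tau> within {0..t})"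
    proof (rule vector_diff_chain_within)
      show "((\<lambda>\<tau>. \<tau> + r) has_vector_derivative 1) (at \<tau> within {0..t})"
        by (auto intro!: derivative_eq_intros)
      show "(sol x has_vector_derivative B (\<tau> + r) (sol x (\<tau> + r))) (at (\<tau> + r) within (\<lambda>\<tau>. \<tau> + r) ` {0..t})"
        by (rule has_vector_derivative_within_subset[OF sol_deriv[OF tr]]) (use assms in auto)
    qed
    then have "((\<lambda>\<tau>. sol x (\<tau> + r)) has_vector_derivative B (\<tau> + r) (sol x (\<tau> + r))) (at \<tau> within {0..t})"
      by (simp only: o_def scaleR_one)
    from bounded_linear.has_vector_derivative[OF S_lin this]
    have "(w has_vector_derivative S r (B (\<tau> + r) (sol x (\<tau> + r)))) (at \<tau> within {0..t})"
      unfolding w_def .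
    also have "S r (B (\<tau> + r) (sol x (\<tau> + r))) = B \<tau> (w \<tau>)"
    proof -
      have "S r (S (- (\<tau> + r)) y) = S (- \<tau>) y" for y
        using S_add[of r "- (\<tau> + r)" y] by simp
      then show ?thesis unfolding B_def w_def by (simp only: S_add)
    qed
    finally show "(w has_vector_derivative B \<tau> (w \<tau>)) (at \<tau> within {0..t})" .
  qed (use assms in \<open>auto simp: w_def V_def\<close>)
  then show ?thesis by (simp add: V_def w_def S_add)
qed

text \<open>The unbounded generators cancel in the difference of the two groups, so that the limit exists for every vector.\<close>

lemma V_small: "((\<lambda>\<tau>. (1 / \<tau>) *\<^sub>R (V \<tau> x - S \<tau> x)) \<longlongrightarrow> Q x) (at_right 0)"
proof -
  have "(sol x has_vector_derivative B 0 (sol x 0)) (at 0 within {0..1})" by (rule sol_deriv) simp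
  then have "((\<lambda>\<tau>. (1 / (\<tau> - 0)) *\<^sub>R (sol x \<tau> - sol x 0)) \<longlongrightarrow> B 0 x) (at 0 within {0..1})"
    unfolding has_vector_derivative_iff_tendsto by simp
  then have "((\<lambda>\<tau>. (1 / \<tau>) *\<^sub>R (sol x \<tau> - x)) \<longlongrightarrow> Q x) (at_right 0)"
    by (simp add: B_def at_within_Icc_at_right)
  then have "((\<lambda>\<tau>. S \<tau> ((1 / \<tau>) *\<^sub>R (sol x \<tau> - x))) \<longlongrightarrow> S 0 (Q x)) (at_right 0)"
    by (intro S_tendsto) auto
  then show ?thesis
    by (simp add: V_def linear_scale[OF bounded_linear.linear[OF S_lin]] S_diff)
qed

lemma V_minus_S_bound: "t \<ge> 0 \<Longrightarrow> norm (V t x - S t x) \<le> K * t * norm x"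
proof -
  assume t: "t \<ge> 0"
  have "norm (sol x t - x) = norm (integral {0..t} (\<lambda>\<tau>. B \<tau> (sol x \<tau>)))" using sol_eq[OF t] by simp
  also have "\<dots> \<le> integral {0..t} (\<lambda>\<tau>. K * norm x)"
  proof (rule integral_norm_bound_integral)
    show "(\<lambda>\<tau>. B \<tau> (sol x \<tau>)) integrable_on {0..t}"
      by (intro integrable_continuous_real B_continuous_on sol_continuous)
    show "norm (B \<tau> (sol x \<tau>)) \<le> K * norm x" if "\<tau> \<in> {0..t}" for \<tau>
      using B_norm[of \<tau> "sol x \<tau>"] V_norm[of \<tau> x] that by (simp add: V_def)
  qed auto
  finally show ?thesis using t by (simp add: V_def S_diff[symmetric] mult_ac)
qed

section \<open>The averaged generator\<close>

text \<open>If \<open>V\<close> is generated by \<open>J A\<close>, then \<open>\<langle>V \<tau> w, J w\<rangle>\<close> is \<open>\<tau> \<langle>A w, w\<rangle>\<close> to first order for \<open>w\<close> in the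
  domain of \<open>A\<close>, so \<open>E h w\<close> approximates half of the energy; it is defined for every \<open>w\<close>. Averaging over \<open>\<tau>\<close> makes the corresponding Fourier kernel
  nonnegative. \<open>ES\<close> is the analogue for the unperturbed group.\<close>

definition E :: "real \<Rightarrow> 'h \<Rightarrow> real" where
  "E h w = integral {0..h} (\<lambda>\<tau>. inner (V \<tau> w) (J w)) / h\<^sup>2"

definition ES :: "real \<Rightarrow> 'h \<Rightarrow> real" where
  "ES h w = integral {0..h} (\<lambda>\<tau>. inner (S \<tau> w) (J w)) / h\<^sup>2"

text \<open>\<open>V t\<close> is an isometry that commutes with \<open>V \<tau>\<close> and with \<open>J\<close>.\<close>

lemma E_conserved: "t \<ge> 0 \<Longrightarrow> E h (V t w) = E h w"
proof -
  assume t: "t \<ge> 0"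
  have "inner (V \<tau> (V t w)) (J (V t w)) = inner (V \<tau> w) (J w)" if "\<tau> \<in> {0..h}" for \<tau>
  proof -
    have "V \<tau> (V t w) = V t (V \<tau> w)" using that t V_group[of \<tau> t w] V_group[of t \<tau> w] by (simp add: add.commute)
    then show ?thesis using t by (simp add: V_J[symmetric] V_inner)
  qed
  then have "integral {0..h} (\<lambda>\<tau>. inner (V \<tau> (V t w)) (J (V t w))) = integral {0..h} (\<lambda>\<tau>. inner (V \<tau> w) (J w))"
    by (rule integral_cong)
  then show ?thesis by (simp add: E_def)
qed

lemma E_minus_ES:
  assumes "h > 0"
  shows "E h w - ES h w = integral {0..h} (\<lambda>\<tau>. inner (V \<tau> w - S \<tau> w) (J w)) / h\<^sup>2"
proof -
  have i: "(\<lambda>\<tau>. inner (V \<tau> w) (J w)) integrable_on {0..h}" "(\<lambda>\<tau>. inner (S \<tau> w) (J w)) integrable_on {0..h}"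
    by (intro integrable_continuous_real continuous_intros V_continuous S_continuous_on)+
  show ?thesis unfolding E_def ES_def diff_divide_distrib[symmetric]
    by (simp add: integral_diff[OF i, symmetric] inner_diff_left)
qed

lemma half_sq_integral: "h \<ge> 0 \<Longrightarrow> ((\<lambda>\<tau>. c * \<tau>) has_integral (c * h\<^sup>2 / 2)) {0..h::real}"
proof -
  assume h: "h \<ge> 0"
  have "((\<lambda>\<tau>. c * \<tau>) has_integral (c * h\<^sup>2 / 2 - c * 0\<^sup>2 / 2)) {0..h}"
    by (rule fundamental_theorem_of_calculus[OF h])
       (auto intro!: derivative_eq_intros simp: has_real_derivative_iff_has_vector_derivative[symmetric])
  then show ?thesis by simp
qed

text \<open>The flows differ by \<open>O(\<tau>)\<close>, uniformly, since the perturbation is bounded. Hence the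
  conserved quantity controls the free one even where neither limit is known to exist.\<close>

lemma E_minus_ES_bound:
  assumes "h > 0" shows "\<bar>E h w - ES h w\<bar> \<le> K * (norm w)\<^sup>2 / 2"
proof -
  have "norm (integral {0..h} (\<lambda>\<tau>. inner (V \<tau> w - S \<tau> w) (J w))) \<le> integral {0..h} (\<lambda>\<tau>. (K * (norm w)\<^sup>2) * \<tau>)"
  proof (rule integral_norm_bound_integral)
    show "(\<lambda>\<tau>. inner (V \<tau> w - S \<tau> w) (J w)) integrable_on {0..h}"
      by (intro integrable_continuous_real continuous_intros V_continuous S_continuous_on)
    show "(\<lambda>\<tau>. (K * (norm w)\<^sup>2) * \<tau>) integrable_on {0..h}"
      using half_sq_integral[of h] assms by (auto simp: integrable_on_def)
    show "norm (inner (V \<tau> w - S \<tau> w) (J w)) \<le> (K * (norm w)\<^sup>2) * \<tau>" if "\<tau> \<in> {0..h}" for \<tau>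
    proof -
      have "norm (inner (V \<tau> w - S \<tau> w) (J w)) \<le> norm (V \<tau> w - S \<tau> w) * norm (J w)"
        unfolding real_norm_def by (rule Cauchy_Schwarz_ineq2)
      also have "\<dots> \<le> (K * \<tau> * norm w) * norm (J w)"
        using that by (intro mult_right_mono V_minus_S_bound) auto
      finally show ?thesis by (simp add: power2_eq_square mult_ac)
    qed
  qed
  also have "\<dots> = K * (norm w)\<^sup>2 * h\<^sup>2 / 2" using half_sq_integral assms by (intro integral_unique) auto
  finally show ?thesis unfolding E_minus_ES[OF assms] using assms
    by (simp add: abs_divide divide_le_eq mult_ac)
qed

lemma E_minus_ES_tendsto: "((\<lambda>h. E h w - ES h w) \<longlongrightarrow> inner (Q w) (J w) / 2) (at_right 0)"
proof (rule tendstoI)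
  fix e :: real assume e: "e > 0"
  let ?L = "inner (Q w) (J w)"
  have "((\<lambda>\<tau>. inner ((1 / \<tau>) *\<^sub>R (V \<tau> w - S \<tau> w)) (J w)) \<longlongrightarrow> ?L) (at_right 0)"
    by (intro tendsto_intros V_small)
  then have "\<forall>\<^sub>F \<tau> in at_right 0. dist (inner ((1 / \<tau>) *\<^sub>R (V \<tau> w - S \<tau> w)) (J w)) ?L < e"
    using e by (rule tendstoD)
  then obtain d where d: "d > 0" "\<And>\<tau>. 0 < \<tau> \<Longrightarrow> \<tau> < d \<Longrightarrow> \<bar>inner ((1 / \<tau>) *\<^sub>R (V \<tau> w - S \<tau> w)) (J w) - ?L\<bar> < e"
    unfolding eventually_at_right_field dist_real_def by auto
  have "dist (E h w - ES h w) (?L / 2) < e" if h: "0 < h" "h < d" for h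
  proof -
    have b: "norm (inner (V \<tau> w - S \<tau> w) (J w) - ?L * \<tau>) \<le> e * \<tau>" if "\<tau> \<in> {0..h}" for \<tau>
    proof (cases "\<tau> = 0")
      case False
      then have \<tau>: "\<tau> > 0" using that by auto
      have "inner (V \<tau> w - S \<tau> w) (J w) - ?L * \<tau> = \<tau> * (inner ((1 / \<tau>) *\<^sub>R (V \<tau> w - S \<tau> w)) (J w) - ?L)"
        unfolding inner_scaleR_left using \<tau> by (simp add: field_simps)
      then have "norm (inner (V \<tau> w - S \<tau> w) (J w) - ?L * \<tau>) = \<tau> * \<bar>inner ((1 / \<tau>) *\<^sub>R (V \<tau> w - S \<tau> w)) (J w) - ?L\<bar>"
        using \<tau> by (simp add: abs_mult del: inner_scaleR_left)
      also have "\<dots> \<le> \<tau> * e" using d(2)[OF \<tau>] that h \<tau> by (intro mult_left_mono) auto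
      finally show ?thesis by (simp add: mult.commute)
    qed simp
    have i: "(\<lambda>\<tau>. inner (V \<tau> w - S \<tau> w) (J w)) integrable_on {0..h}"
      by (intro integrable_continuous_real continuous_intros V_continuous S_continuous_on)
    have L: "((\<lambda>\<tau>. ?L * \<tau>) has_integral (?L * h\<^sup>2 / 2)) {0..h}"
      and L': "((\<lambda>\<tau>. e * \<tau>) has_integral (e * h\<^sup>2 / 2)) {0..h}"
      using h by (auto intro!: half_sq_integral)
    have "norm (integral {0..h} (\<lambda>\<tau>. inner (V \<tau> w - S \<tau> w) (J w) - ?L * \<tau>)) \<le> integral {0..h} (\<lambda>\<tau>. e * \<tau>)"
      by (rule integral_norm_bound_integral[OF _ _ b]) (use i L L' in \<open>auto intro!: integrable_diff\<close>)
    also have "integral {0..h} (\<lambda>\<tau>. inner (V \<tau> w - S \<tau> w) (J w) - ?L * \<tau>) = (E h w - ES h w) * h\<^sup>2 - ?L * h\<^sup>2 / 2"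
      unfolding E_minus_ES[OF h(1)] using h(1) L
      by (simp add: integral_diff[OF i has_integral_integrable[OF L]] integral_unique)
    also have "\<dots> = (E h w - ES h w - ?L / 2) * h\<^sup>2" by (simp add: field_simps)
    finally have "norm ((E h w - ES h w - ?L / 2) * h\<^sup>2) \<le> integral {0..h} (\<lambda>\<tau>. e * \<tau>)" .
    then have "\<bar>E h w - ES h w - ?L / 2\<bar> * h\<^sup>2 \<le> (e / 2) * h\<^sup>2"
      unfolding integral_unique[OF L'] by (simp add: abs_mult)
    then have "\<bar>E h w - ES h w - ?L / 2\<bar> \<le> e / 2" using h(1) by simp
    then show ?thesis using e by (simp add: dist_real_def)
  qed
  then show "\<forall>\<^sub>F h in at_right 0. dist (E h w - ES h w) (?L / 2) < e"
    unfolding eventually_at_right_field using d(1) by auto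
qed

end

text \<open>The difference of the two interaction pictures satisfies the first equation with inhomogeneity
  \<open>(B - B') w'\<close>, and \<open>w'\<close> has constant norm.\<close>

lemma V_compare:
  assumes 1: "perturbed_group S Q J" and 2: "perturbed_group S Q' J"
    and d: "\<And>x. norm (Q x - Q' x) \<le> \<delta> * norm x" and t: "t \<ge> 0"
  shows "norm (perturbed_group.V S Q t x - perturbed_group.V S Q' t x) \<le> \<delta> * norm x * t"
proof -
  interpret A: perturbed_group S Q J by fact
  interpret A': perturbed_group S Q' J by fact
  have "\<bar>norm (A.sol x t - A'.sol x t) - norm (A.sol x 0 - A'.sol x 0)\<bar> \<le> (\<delta> * norm x) * t"
  proof (rule A.skew_growth)
    fix \<tau> assume \<tau>: "\<tau> \<in> {0..t}"
    show "((\<lambda>t. A.sol x t - A'.sol x t) has_vector_derivative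
        A.B \<tau> (A.sol x \<tau> - A'.sol x \<tau>) + (A.B \<tau> (A'.sol x \<tau>) - A'.B \<tau> (A'.sol x \<tau>))) (at \<tau> within {0..t})"
      using has_vector_derivative_diff[OF A.sol_deriv[OF \<tau>, of x] A'.sol_deriv[OF \<tau>, of x]]
      by (simp add: A.B_diff)
    have "norm (A.B \<tau> (A'.sol x \<tau>) - A'.B \<tau> (A'.sol x \<tau>)) = norm (Q (S \<tau> (A'.sol x \<tau>)) - Q' (S \<tau> (A'.sol x \<tau>)))"
      unfolding A.B_def A'.B_def A.S_diff[symmetric] by simp
    also have "\<dots> \<le> \<delta> * norm (S \<tau> (A'.sol x \<tau>))" by (rule d)
    also have "norm (S \<tau> (A'.sol x \<tau>)) = norm x" using A'.V_norm[of \<tau> x] \<tau> by (simp add: A'.V_def)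
    finally show "norm (A.B \<tau> (A'.sol x \<tau>) - A'.B \<tau> (A'.sol x \<tau>)) \<le> \<delta> * norm x" .
  qed (use t in auto)
  then show ?thesis by (simp add: A.V_def A'.V_def A.S_diff[symmetric])
qed

section \<open>The Schroedinger group and its energy\<close>

definition freeS :: "real \<Rightarrow> real \<Rightarrow> 'a::euclidean_space lsq \<Rightarrow> 'a lsq" where
  "freeS s t = mul (\<lambda>\<xi>. cis (t * norm \<xi> powr (2 * s)))"

text \<open>Multiplication by the coefficient, transported to the Fourier side.\<close>

definition pot :: "('a::euclidean_space \<Rightarrow> real) \<Rightarrow> 'a lsq \<Rightarrow> 'a lsq" where
  "pot p x = FT (mul (\<lambda>y. of_real (p y)) (IFT x))"

abbreviation imul :: "'a::euclidean_space lsq \<Rightarrow> 'a lsq" where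
  "imul \<equiv> mul (\<lambda>_. \<i>)"

lemma bmult_cis: "bmult (\<lambda>\<xi>::'a::euclidean_space. cis (t * norm \<xi> powr r))"
  by (rule bmult_unimodular) auto

lemma tendsto_mul_DCT:
  assumes h: "\<And>n. h n \<in> borel_measurable borel" "h' \<in> borel_measurable borel" and z: "z \<in> L2"
    and lim: "AE t in lborel. (\<lambda>n. h n t * rep x t) \<longlonglongrightarrow> h' t * rep x t"
    and b: "\<And>n. AE t in lborel. cmod (h n t * rep x t) \<le> cmod (z t)"
  shows "(\<lambda>n. mul (h n) x) \<longlonglongrightarrow> mul h' x" "mdom h' x" "mdom (h n) x"
  using lsq_dominated_convergence[of "\<lambda>n t. h n t * rep x t" "\<lambda>t. h' t * rep x t" z] assms
  by (auto simp: mul_def mdom_def)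

lemma freeS_tendsto:
  assumes "t \<longlonglongrightarrow> t'" shows "(\<lambda>n. freeS s (t n) x) \<longlonglongrightarrow> freeS s t' x"
  unfolding freeS_def
proof (rule tendsto_mul_DCT(1)[where z = "rep x"])
  show "AE \<xi> in lborel. (\<lambda>n. cis (t n * norm \<xi> powr (2 * s)) * rep x \<xi>) \<longlonglongrightarrow> cis (t' * norm \<xi> powr (2 * s)) * rep x \<xi>"
    using assms by (intro AE_I2 tendsto_intros)
qed (auto simp: norm_mult)

lemma IFT_mul_const: "IFT (mul (\<lambda>_. c) x) = mul (\<lambda>_. c) (IFT x)"
  unfolding IFT_def FT_mul_const by (rule mul_rf(2)[symmetric]) (auto intro: bmult_mdom)

lemma pot_mul_const:
  assumes "bmult (\<lambda>x. complex_of_real (p x))"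
  shows "pot p (mul (\<lambda>_. c) x) = mul (\<lambda>_. c) (pot p x)"
  unfolding pot_def IFT_mul_const by (simp add: mul_mul assms FT_mul_const[symmetric] mult.commute)

text \<open>Multiplication by a real function is symmetric, so after multiplication by \<open>i\<close> it is skew.\<close>

lemma perturbed_group_freeS:
  fixes p :: "'a::euclidean_space \<Rightarrow> real"
  assumes p: "bmult (\<lambda>x. complex_of_real (p x))"
  shows "perturbed_group (freeS s) (\<lambda>x. imul (pot p x)) imul"
proof (rule perturbed_group.intro)
  show "bounded_linear (freeS s t :: 'a lsq \<Rightarrow> 'a lsq)" for t :: real
    unfolding freeS_def by (rule bounded_linear_mul[OF bmult_cis])
  show "norm (freeS s t x) = norm x" for t and x :: "'a lsq"
    unfolding freeS_def by (rule norm_mul_unimodular) auto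
  show "freeS s 0 x = x" for x :: "'a lsq" by (simp add: freeS_def cis_zero)
  show "freeS s (a + b) x = freeS s a (freeS s b x)" for a b and x :: "'a lsq"
    unfolding freeS_def by (subst mul_mul[OF bmult_cis bmult_cis]) (simp add: cis_mult distrib_right)
  show "continuous_on UNIV (\<lambda>t. freeS s t x)" for x :: "'a lsq"
    unfolding continuous_on_sequentially by (auto simp: o_def intro: freeS_tendsto)
  show "bounded_linear (\<lambda>x. imul (pot p x))"
    unfolding pot_def
    by (intro bounded_linear_compose[OF bounded_linear_mul] bounded_linear_compose[OF bounded_linear_FT]
       bounded_linear_IFT p bmult_const)
  show "inner (imul (pot p x)) x = 0" for x
  proof -
    define y where "y = IFT x"
    have "inner (imul (pot p x)) x = inner (FT (imul (mul (\<lambda>y. of_real (p y)) y))) (FT y)"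
      by (simp add: pot_def y_def FT_mul_const)
    also have "\<dots> = inner (mul (\<lambda>t. \<i> * of_real (p t)) y) y"
      by (simp add: inner_FT mul_mul p)
    also have "\<dots> = (\<integral>t. 0 \<partial>(lborel :: 'a measure))"
      unfolding inner_lsq_def
    proof (rule integral_cong_AE)
      have "mdom (\<lambda>t. \<i> * of_real (p t)) y" using bmult_mdom[OF bmult_mul[OF bmult_const p]] .
      from rep_mul[OF this] show "AE t in lborel. inner (rep (mul (\<lambda>t. \<i> * of_real (p t)) y) t) (rep y t) = 0"
        by eventually_elim (simp add: inner_complex_def)
    qed measurable
    finally show ?thesis by simp
  qed
  show "bounded_linear (imul :: 'a lsq \<Rightarrow> _)" by (rule bounded_linear_mul) simp
  show "norm (imul x) = norm x" for x :: "'a lsq" by (rule norm_mul_unimodular) auto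
  show "imul (freeS s t x) = freeS s t (imul x)" for t and x :: "'a lsq"
    unfolding freeS_def by (simp add: mul_mul bmult_cis mult.commute)
  show "imul (imul (pot p x)) = imul (pot p (imul x))" for x
    by (simp only: pot_mul_const[OF p])
qed

lemma norm_pot_le:
  assumes "p \<in> borel_measurable borel" "AE x in lborel. \<bar>p x\<bar> \<le> M" shows "norm (pot p x) \<le> M * norm x"
  using norm_mul_le[of "\<lambda>x. of_real (p x)" M "IFT x"] assms unfolding pot_def by simp

text \<open>The result of averaging \<open>sin (\<tau> m)\<close> over \<open>\<tau> \<in> [0,h]\<close> and dividing by \<open>h\<close>. It lies between \<open>0\<close> and its limit
  \<open>m / 2\<close>, so both Fatou's lemma and dominated convergence apply as \<open>h\<close> tends to \<open>0\<close>.\<close>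

definition gker :: "real \<Rightarrow> real \<Rightarrow> real" where
  "gker h m = (1 - cos (h * m)) / (h\<^sup>2 * m)"

lemma gker_bounds:
  assumes "m \<ge> 0" "h > 0" shows "0 \<le> gker h m" "gker h m \<le> m / 2"
proof -
  show "0 \<le> gker h m" unfolding gker_def using assms by (intro divide_nonneg_nonneg) auto
  have "1 - cos (h * m) = 2 * (sin (h * m / 2))\<^sup>2" using cos_double_sin[of "h * m / 2"] by simp
  also have "\<dots> \<le> 2 * (h * m / 2)\<^sup>2"
    using power_mono[OF abs_sin_x_le_abs_x[of "h * m / 2"], of 2] by (simp only: power2_abs) simp
  finally have *: "1 - cos (h * m) \<le> (m / 2) * (h\<^sup>2 * m)" by (simp add: power2_eq_square field_simps)
  show "gker h m \<le> m / 2"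
  proof (cases "m = 0")
    case False then show ?thesis unfolding gker_def using * assms by (subst pos_divide_le_eq) auto
  qed (simp add: gker_def)
qed

lemma gker_tendsto: "m \<ge> 0 \<Longrightarrow> (\<lambda>n. gker (1 / real (Suc n)) m) \<longlonglongrightarrow> m / 2"
proof (cases "m = 0")
  case False
  moreover assume "m \<ge> 0"
  ultimately have "m > 0" by simp
  then show ?thesis unfolding gker_def by real_asymp
qed (simp add: gker_def)

lemma gker_measurable [measurable]: "gker h \<in> borel_measurable borel"
  unfolding gker_def[abs_def] by measurable

lemma symb_half_sq: "(cmod (symb (s / 2) \<xi>))\<^sup>2 = norm \<xi> powr (2 * s)"
  by (simp add: symb_def power2_eq_square powr_add[symmetric])

lemma norm_mul_symb_half:
  assumes "mdom (symb (s / 2)) w"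
  shows "(norm (mul (symb (s / 2)) w))\<^sup>2 = (\<integral>\<xi>. norm \<xi> powr (2 * s) * (cmod (rep w \<xi>))\<^sup>2 \<partial>lborel)"
    "integrable lborel (\<lambda>\<xi>. norm \<xi> powr (2 * s) * (cmod (rep w \<xi>))\<^sup>2)"
proof -
  have e: "(cmod (symb (s / 2) \<xi> * rep w \<xi>))\<^sup>2 = norm \<xi> powr (2 * s) * (cmod (rep w \<xi>))\<^sup>2" for \<xi>
    by (simp add: norm_mult power_mult_distrib symb_half_sq)
  have L: "(\<lambda>\<xi>. symb (s / 2) \<xi> * rep w \<xi>) \<in> L2" using assms by (simp add: mdom_def)
  show "integrable lborel (\<lambda>\<xi>. norm \<xi> powr (2 * s) * (cmod (rep w \<xi>))\<^sup>2)"
    using L2_integrable[OF L] by (simp only: e)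
  have "(norm (mul (symb (s / 2)) w))\<^sup>2 = (\<integral>\<xi>. (cmod (symb (s / 2) \<xi> * rep w \<xi>))\<^sup>2 \<partial>lborel)"
    unfolding mul_def norm_cls[OF L] L2_norm_def by (simp add: real_sqrt_pow2)
  then show "(norm (mul (symb (s / 2)) w))\<^sup>2 = (\<integral>\<xi>. norm \<xi> powr (2 * s) * (cmod (rep w \<xi>))\<^sup>2 \<partial>lborel)"
    by (simp only: e)
qed

lemma inner_freeS_imul:
  "inner (freeS s \<tau> w) (imul w) = (\<integral>\<xi>. sin (\<tau> * norm \<xi> powr (2 * s)) * (cmod (rep w \<xi>))\<^sup>2 \<partial>lborel)"
  unfolding inner_lsq_def freeS_def
proof (rule integral_cong_AE)
  show "AE \<xi> in lborel. inner (rep (mul (\<lambda>\<xi>. cis (\<tau> * norm \<xi> powr (2 * s))) w) \<xi>) (rep (imul w) \<xi>) =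
    sin (\<tau> * norm \<xi> powr (2 * s)) * (cmod (rep w \<xi>))\<^sup>2"
    using rep_mul[OF bmult_mdom[OF bmult_cis], of \<tau> "2 * s" w] rep_mul[OF bmult_mdom[OF bmult_const], of \<i> w]
  proof eventually_elim
    case (elim \<xi>)
    show ?case unfolding elim cmod_power2 by (simp add: inner_complex_def power2_eq_square algebra_simps)
  qed
qed measurable

lemma integral_sin_kernel:
  assumes "h > 0" "m \<ge> 0"
  shows "(\<integral>\<tau>. indicator {0..h} \<tau> * sin (\<tau> * m) \<partial>lborel) = h\<^sup>2 * gker h m"
proof (cases "m = 0")
  case False
  have "(\<integral>\<tau>. sin (\<tau> * m) * indicator {0..h} \<tau> \<partial>lborel) = - cos (h * m) / m - - cos (0 * m) / m"
  proof (rule integral_FTC_Icc_real)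
    show "((\<lambda>\<tau>. - cos (\<tau> * m) / m) has_real_derivative sin (\<tau> * m)) (at \<tau>)" for \<tau>
      using False by (auto intro!: derivative_eq_intros)
    show "isCont (\<lambda>\<tau>. sin (\<tau> * m)) \<tau>" for \<tau> by (intro continuous_intros)
  qed (use assms in simp)
  also have "\<dots> = (1 - cos (h * m)) / m" by (simp add: diff_divide_distrib)
  also have "\<dots> = h\<^sup>2 * gker h m" using assms by (simp add: gker_def)
  finally show ?thesis by (simp only: mult.commute)
qed (simp add: gker_def)

text \<open>Fubini's theorem; the integrand is bounded by \<open>|w(\<xi>)|^2\<close> on a time interval of finite length.\<close>

lemma ES_eq:
  assumes h: "h > 0"
  shows "integral {0..h} (\<lambda>\<tau>. inner (freeS s \<tau> w) (imul w)) / h\<^sup>2 =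
    (\<integral>\<xi>. gker h (norm \<xi> powr (2 * s)) * (cmod (rep w \<xi>))\<^sup>2 \<partial>lborel)"
proof -
  interpret perturbed_group "freeS s" "\<lambda>x. imul (pot (\<lambda>_. 0) x)" imul
    by (rule perturbed_group_freeS) simp
  let ?F = "\<lambda>\<tau>. inner (freeS s \<tau> w) (imul w)"
  have c: "continuous_on {0..h} ?F" by (intro continuous_intros S_continuous_on)
  have "integral {0..h} ?F = (LINT \<tau>:{0..h}|lborel. ?F \<tau>)"
    by (rule set_borel_integral_eq_integral(2)[symmetric]) (rule borel_integrable_atLeastAtMost'[OF c])
  also have "\<dots> = (\<integral>\<tau>. (\<integral>\<xi>. indicator {0..h} \<tau> * sin (\<tau> * norm \<xi> powr (2 * s)) * (cmod (rep w \<xi>))\<^sup>2 \<partial>lborel) \<partial>lborel)"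
    unfolding set_lebesgue_integral_def inner_freeS_imul
    by (simp add: mult.assoc)
  also have "\<dots> = (\<integral>\<xi>. (\<integral>\<tau>. indicator {0..h} \<tau> * sin (\<tau> * norm \<xi> powr (2 * s)) * (cmod (rep w \<xi>))\<^sup>2 \<partial>lborel) \<partial>lborel)"
  proof (rule lborel_pair.Fubini_integral[symmetric])
    have "integrable (lborel \<Otimes>\<^sub>M lborel) (\<lambda>z. indicator {0..h} (fst z) * (cmod (rep w (snd z)))\<^sup>2)"
    proof (rule integrableI_bounded)
      have "(\<integral>\<^sup>+ z. ennreal (norm (indicator {0..h} (fst z) * (cmod (rep w (snd z)))\<^sup>2)) \<partial>(lborel \<Otimes>\<^sub>M lborel)) =
        (\<integral>\<^sup>+x. \<integral>\<^sup>+y. ennreal (indicator {0..h} x) * ennreal ((cmod (rep w y))\<^sup>2) \<partial>lborel \<partial>lborel)"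
        by (subst lborel.nn_integral_fst[symmetric]) (auto simp: norm_mult ennreal_mult)
      also have "\<dots> = (\<integral>\<^sup>+x. ennreal (indicator {0..h} x) \<partial>lborel) * ennreal ((norm w)\<^sup>2)"
        by (simp add: nn_integral_cmult nn_integral_multc nn_integral_rep)
      also have "\<dots> < \<infinity>" using h by (simp add: ennreal_indicator ennreal_mult_less_top)
      finally show "(\<integral>\<^sup>+ z. ennreal (norm (indicator {0..h} (fst z) * (cmod (rep w (snd z)))\<^sup>2)) \<partial>(lborel \<Otimes>\<^sub>M lborel)) < \<infinity>" .
    qed measurable
    then show "integrable (lborel \<Otimes>\<^sub>M lborel) (\<lambda>(\<tau>, \<xi>). indicator {0..h} \<tau> * sin (\<tau> * norm \<xi> powr (2 * s)) * (cmod (rep w \<xi>))\<^sup>2)"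
      by (rule Bochner_Integration.integrable_bound)
         (auto simp: norm_mult split_beta abs_mult intro!: AE_I2 mult_left_le_one_le split: split_indicator)
  qed
  also have "\<dots> = (\<integral>\<xi>. h\<^sup>2 * (gker h (norm \<xi> powr (2 * s)) * (cmod (rep w \<xi>))\<^sup>2) \<partial>lborel)"
    unfolding integral_mult_left_zero integral_sin_kernel[OF h powr_ge_zero] by (simp only: mult.assoc)
  finally show ?thesis using h by simp
qed

locale schroedinger =
  fixes s :: real and p :: "'a::euclidean_space \<Rightarrow> real" and M :: real
  assumes s: "s > 0" and p_meas [measurable]: "p \<in> borel_measurable borel" and p_bound: "AE x in lborel. \<bar>p x\<bar> \<le> M"
begin

lemma p_bmult: "bmult (\<lambda>x. complex_of_real (p x))"
  unfolding bmult_def using p_bound by auto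

sublocale perturbed_group "freeS s" "\<lambda>x. imul (pot p x)" "imul :: 'a lsq \<Rightarrow> _"
  by (rule perturbed_group_freeS[OF p_bmult])

text \<open>The potential energy.\<close>

definition pe :: "'a lsq \<Rightarrow> real" where "pe w = inner (pot p w) w"

lemma imul_inner: "inner (imul x) (imul y) = inner x (y :: 'a lsq)"
proof -
  have "norm (imul x + imul y) = norm (imul (x + y))"
    by (simp only: linear_add[OF bounded_linear.linear[OF J_lin]])
  then show ?thesis using dot_norm[of "imul x" "imul y"] dot_norm[of x y] by (simp only: J_norm)
qed

lemma ES_gker: "h > 0 \<Longrightarrow> ES h w = (\<integral>\<xi>. gker h (norm \<xi> powr (2 * s)) * (cmod (rep w \<xi>))\<^sup>2 \<partial>lborel)"
  unfolding ES_def by (rule ES_eq)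

lemma gker_integrable:
  fixes w :: "'a lsq"
  assumes h: "h > 0"
  shows "integrable lborel (\<lambda>\<xi>. gker h (norm \<xi> powr (2 * s)) * (cmod (rep w \<xi>))\<^sup>2)"
proof (rule Bochner_Integration.integrable_bound)
  show "integrable lborel (\<lambda>\<xi>. (2 / h\<^sup>2 + 1 / 2) * (cmod (rep w \<xi>))\<^sup>2)"
    by (intro integrable_mult_right L2_integrable rep_L2)
  \<comment> \<open>For \<open>m \<le> 1\<close> the bound \<open>m / 2\<close> applies, for larger \<open>m\<close> the bound \<open>2 / (h^2 m)\<close>.\<close>
  have "gker h m \<le> 2 / h\<^sup>2 + 1 / 2" if "m \<ge> 0" for m
  proof (cases "m \<le> 1")
    case True
    have "gker h m \<le> 0 + 1 / 2" using gker_bounds(2)[OF that h] True by linarith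
    also have "\<dots> \<le> 2 / h\<^sup>2 + 1 / 2" by (intro add_right_mono) simp
    finally show ?thesis .
  next
    case False
    have "1 - cos (h * m) \<le> 2" using cos_ge_minus_one[of "h * m"] by linarith
    then have "gker h m \<le> 2 / (h\<^sup>2 * m)"
      unfolding gker_def using that by (intro divide_right_mono) auto
    also have "h\<^sup>2 * 1 \<le> h\<^sup>2 * m" using False by (intro mult_left_mono) auto
    then have "2 / (h\<^sup>2 * m) \<le> 2 / h\<^sup>2" using h False by (intro divide_left_mono) auto
    finally show ?thesis by linarith
  qed
  then have le: "gker h (norm \<xi> powr (2 * s)) * (cmod (rep w \<xi>))\<^sup>2 \<le> (2 / h\<^sup>2 + 1 / 2) * (cmod (rep w \<xi>))\<^sup>2" for \<xi> :: 'a
    by (rule mult_right_mono) auto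
  have nn: "0 \<le> gker h (norm \<xi> powr (2 * s)) * (cmod (rep w \<xi>))\<^sup>2" for \<xi> :: 'a
    by (intro mult_nonneg_nonneg gker_bounds(1)[OF _ h]) auto
  show "AE \<xi> in lborel. norm (gker h (norm \<xi> powr (2 * s)) * (cmod (rep w \<xi>))\<^sup>2) \<le> norm ((2 / h\<^sup>2 + 1 / 2) * (cmod (rep w \<xi>))\<^sup>2)"
    unfolding real_norm_def abs_of_nonneg[OF nn] abs_of_nonneg[OF order_trans[OF nn le]] by (intro AE_I2 le)
qed measurable

lemma ES_upper:
  assumes w: "mdom (symb (s / 2)) w" and h: "h > 0"
  shows "ES h w \<le> (norm (mul (symb (s / 2)) w))\<^sup>2 / 2"
proof -
  have "ES h w \<le> (\<integral>\<xi>. norm \<xi> powr (2 * s) * (cmod (rep w \<xi>))\<^sup>2 / 2 \<partial>lborel)"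
    unfolding ES_gker[OF h]
  proof (rule integral_mono[OF gker_integrable[OF h]])
    show "integrable lborel (\<lambda>\<xi>. norm \<xi> powr (2 * s) * (cmod (rep w \<xi>))\<^sup>2 / 2)" using norm_mul_symb_half(2)[OF w] by simp
    show "gker h (norm \<xi> powr (2 * s)) * (cmod (rep w \<xi>))\<^sup>2 \<le> norm \<xi> powr (2 * s) * (cmod (rep w \<xi>))\<^sup>2 / 2" for \<xi>
      using mult_right_mono[OF gker_bounds(2)[OF _ h, of "norm \<xi> powr (2 * s)"], of "(cmod (rep w \<xi>))\<^sup>2"] by simp
  qed
  then show ?thesis by (simp add: norm_mul_symb_half(1)[OF w])
qed

lemma ES_tendsto:
  assumes w: "mdom (symb (s / 2)) w"
  shows "(\<lambda>n. ES (1 / real (Suc n)) w) \<longlonglongrightarrow> (norm (mul (symb (s / 2)) w))\<^sup>2 / 2"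
proof -
  have "(\<lambda>n. \<integral>\<xi>. gker (1 / real (Suc n)) (norm \<xi> powr (2 * s)) * (cmod (rep w \<xi>))\<^sup>2 \<partial>lborel) \<longlonglongrightarrow>
     (\<integral>\<xi>. norm \<xi> powr (2 * s) / 2 * (cmod (rep w \<xi>))\<^sup>2 \<partial>lborel)"
  proof (rule integral_dominated_convergence[OF _ _ norm_mul_symb_half(2)[OF w]])
    show "AE \<xi> in lborel. (\<lambda>n. gker (1 / real (Suc n)) (norm \<xi> powr (2 * s)) * (cmod (rep w \<xi>))\<^sup>2) \<longlonglongrightarrow> norm \<xi> powr (2 * s) / 2 * (cmod (rep w \<xi>))\<^sup>2"
      by (intro AE_I2 tendsto_mult tendsto_const gker_tendsto) simp
    show "AE \<xi> in lborel. norm (gker (1 / real (Suc n)) (norm \<xi> powr (2 * s)) * (cmod (rep w \<xi>))\<^sup>2) \<le> norm \<xi> powr (2 * s) * (cmod (rep w \<xi>))\<^sup>2" for n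
    proof (rule AE_I2)
      fix \<xi> :: 'a
      have "0 \<le> gker (1 / real (Suc n)) (norm \<xi> powr (2 * s))" "gker (1 / real (Suc n)) (norm \<xi> powr (2 * s)) \<le> norm \<xi> powr (2 * s) / 2"
        by (rule gker_bounds; simp)+
      then show "norm (gker (1 / real (Suc n)) (norm \<xi> powr (2 * s)) * (cmod (rep w \<xi>))\<^sup>2) \<le> norm \<xi> powr (2 * s) * (cmod (rep w \<xi>))\<^sup>2"
        unfolding norm_mult by (intro mult_mono) auto
    qed
  qed measurable
  then show ?thesis by (simp add: ES_gker norm_mul_symb_half(1)[OF w])
qed

text \<open>Fatou's lemma: the kernels are nonnegative and converge to \<open>|\<xi>|^(2s) / 2\<close>.\<close>

lemma ES_bounded_imp_mdom:
  assumes C: "\<And>n. ES (1 / real (Suc n)) w \<le> C"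
  shows "mdom (symb (s / 2)) w"
proof -
  have "(\<integral>\<^sup>+\<xi>. ennreal (norm \<xi> powr (2 * s) / 2 * (cmod (rep w \<xi>))\<^sup>2) \<partial>lborel) =
    (\<integral>\<^sup>+\<xi>. liminf (\<lambda>n. ennreal (gker (1 / real (Suc n)) (norm \<xi> powr (2 * s)) * (cmod (rep w \<xi>))\<^sup>2)) \<partial>lborel)"
  proof (rule nn_integral_cong)
    fix \<xi> :: 'a
    have "(\<lambda>n. ennreal (gker (1 / real (Suc n)) (norm \<xi> powr (2 * s)) * (cmod (rep w \<xi>))\<^sup>2)) \<longlonglongrightarrow> ennreal (norm \<xi> powr (2 * s) / 2 * (cmod (rep w \<xi>))\<^sup>2)"
      by (intro tendsto_ennrealI tendsto_mult tendsto_const gker_tendsto) simp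
    from lim_imp_Liminf[OF _ this] show "ennreal (norm \<xi> powr (2 * s) / 2 * (cmod (rep w \<xi>))\<^sup>2) =
      liminf (\<lambda>n. ennreal (gker (1 / real (Suc n)) (norm \<xi> powr (2 * s)) * (cmod (rep w \<xi>))\<^sup>2))" by simp
  qed
  also have "\<dots> \<le> liminf (\<lambda>n. \<integral>\<^sup>+\<xi>. ennreal (gker (1 / real (Suc n)) (norm \<xi> powr (2 * s)) * (cmod (rep w \<xi>))\<^sup>2) \<partial>lborel)"
    by (rule nn_integral_liminf) measurable
  also have "\<dots> \<le> liminf (\<lambda>n::nat. ennreal C)"
  proof (rule Liminf_mono[OF always_eventually], rule allI)
    fix n
    have h: "1 / real (Suc n) > 0" by simp
    have "(\<integral>\<^sup>+\<xi>. ennreal (gker (1 / real (Suc n)) (norm \<xi> powr (2 * s)) * (cmod (rep w \<xi>))\<^sup>2) \<partial>lborel) = ennreal (ES (1 / real (Suc n)) w)"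
      unfolding ES_gker[OF h]
      by (rule nn_integral_eq_integral[OF gker_integrable[OF h]])
         (intro AE_I2 mult_nonneg_nonneg gker_bounds h; simp)
    then show "(\<integral>\<^sup>+\<xi>. ennreal (gker (1 / real (Suc n)) (norm \<xi> powr (2 * s)) * (cmod (rep w \<xi>))\<^sup>2) \<partial>lborel) \<le> ennreal C"
      using C[of n] by (simp add: ennreal_leI)
  qed
  also have "\<dots> = ennreal C" by (rule Liminf_const) simp
  finally have *: "(\<integral>\<^sup>+\<xi>. ennreal (norm \<xi> powr (2 * s) / 2 * (cmod (rep w \<xi>))\<^sup>2) \<partial>lborel) \<le> ennreal C" .
  have "(\<integral>\<^sup>+\<xi>. ennreal ((cmod (symb (s / 2) \<xi> * rep w \<xi>))\<^sup>2) \<partial>lborel) =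
     (\<integral>\<^sup>+\<xi>. 2 * ennreal (norm \<xi> powr (2 * s) / 2 * (cmod (rep w \<xi>))\<^sup>2) \<partial>lborel)"
  proof (rule nn_integral_cong)
    fix \<xi> :: 'a
    have "ennreal ((cmod (symb (s / 2) \<xi> * rep w \<xi>))\<^sup>2) = ennreal (2 * (norm \<xi> powr (2 * s) / 2 * (cmod (rep w \<xi>))\<^sup>2))"
      by (simp add: norm_mult power_mult_distrib symb_half_sq)
    then show "ennreal ((cmod (symb (s / 2) \<xi> * rep w \<xi>))\<^sup>2) = 2 * ennreal (norm \<xi> powr (2 * s) / 2 * (cmod (rep w \<xi>))\<^sup>2)"
      by (subst (asm) ennreal_mult) auto
  qed
  also have "\<dots> = 2 * (\<integral>\<^sup>+\<xi>. ennreal (norm \<xi> powr (2 * s) / 2 * (cmod (rep w \<xi>))\<^sup>2) \<partial>lborel)"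
    by (rule nn_integral_cmult) measurable
  also have "\<dots> \<le> 2 * ennreal C" using * by (rule mult_left_mono) simp
  also have "\<dots> \<le> ennreal ((sqrt (2 * \<bar>C\<bar>))\<^sup>2)"
    by (auto simp: ennreal_mult intro!: mult_left_mono ennreal_leI)
  finally show ?thesis unfolding mdom_def by (intro L2_of_nn_integral(1)[of _ "sqrt (2 * \<bar>C\<bar>)"]) auto
qed

lemma E_diff_tendsto: "(\<lambda>n. E (1 / real (Suc n)) w - ES (1 / real (Suc n)) w) \<longlonglongrightarrow> pe w / 2"
proof -
  have "filterlim (\<lambda>n. 1 / real (Suc n)) (at_right 0) sequentially"
    unfolding filterlim_at
    by (intro conjI always_eventually allI LIMSEQ_Suc[OF lim_1_over_n]) simp_all
  from filterlim_compose[OF E_minus_ES_tendsto this, of w] show ?thesis by (simp add: pe_def imul_inner)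
qed

text \<open>The averaged energy of \<open>V t w\<close> equals that of \<open>w\<close>; the free part of it differs by a bounded amount, and
  finiteness of the free part in the limit characterises the form domain.\<close>

lemma V_mdom:
  assumes w: "mdom (symb (s / 2)) w" and t: "t \<ge> 0"
  shows "mdom (symb (s / 2)) (V t w)"
proof (rule ES_bounded_imp_mdom)
  fix n
  let ?h = "1 / real (Suc n)"
  have h: "?h > 0" by simp
  show "ES ?h (V t w) \<le> (norm (mul (symb (s / 2)) w))\<^sup>2 / 2 + K * (norm w)\<^sup>2"
    using E_minus_ES_bound[OF h, of w] E_minus_ES_bound[OF h, of "V t w"] E_conserved[OF t, of ?h w] ES_upper[OF w h] V_norm[OF t, of w]
    unfolding abs_le_iff by simp
qed

text \<open>For vectors of the form domain the conserved \<open>E h\<close> tends to half of the energy.\<close>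

theorem energy_conservation:
  assumes w: "mdom (symb (s / 2)) w" and t: "t \<ge> 0"
  shows "(norm (mul (symb (s / 2)) (V t w)))\<^sup>2 + pe (V t w) = (norm (mul (symb (s / 2)) w))\<^sup>2 + pe w"
proof -
  have *: "(\<lambda>n. E (1 / real (Suc n)) u) \<longlonglongrightarrow> (norm (mul (symb (s / 2)) u))\<^sup>2 / 2 + pe u / 2" if "mdom (symb (s / 2)) u" for u
    using tendsto_add[OF ES_tendsto[OF that] E_diff_tendsto[of u]] by simp
  have "(\<lambda>n. E (1 / real (Suc n)) w) \<longlonglongrightarrow> (norm (mul (symb (s / 2)) (V t w)))\<^sup>2 / 2 + pe (V t w) / 2"
    using *[OF V_mdom[OF w t]] by (simp add: E_conserved[OF t])
  from LIMSEQ_unique[OF this *[OF w]] show ?thesis by (simp add: field_simps)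
qed

lemma pe_bound: "\<bar>pe w\<bar> \<le> M * (norm w)\<^sup>2"
proof -
  have "\<bar>pe w\<bar> \<le> norm (pot p w) * norm w" unfolding pe_def by (rule Cauchy_Schwarz_ineq2)
  also have "\<dots> \<le> (M * norm w) * norm w" by (intro mult_right_mono norm_pot_le p_meas p_bound) auto
  finally show ?thesis by (simp add: power2_eq_square)
qed

lemma V_symb_bound:
  assumes w: "mdom (symb (s / 2)) w" and t: "t \<ge> 0"
  shows "(norm (mul (symb (s / 2)) (V t w)))\<^sup>2 \<le> (norm (mul (symb (s / 2)) w))\<^sup>2 + 2 * M * (norm w)\<^sup>2"
  using energy_conservation[OF w t] pe_bound[of w] pe_bound[of "V t w"] V_norm[OF t, of w] by (simp add: abs_le_iff)

end

text \<open>In a Hilbert space, weak convergence and convergence of norms imply strong convergence. Weak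
  convergence of \<open>|\<xi>|^(2\<sigma>) y n\<close> holds against truncated vectors, for which the multiplier can be moved to the
  other side, and these approximate the limit vector itself.\<close>

lemma tendsto_mul_of_norm:
  fixes y :: "nat \<Rightarrow> 'a::euclidean_space lsq"
  assumes y: "y \<longlonglongrightarrow> w" and dom: "\<And>n. mdom (symb \<sigma>) (y n)" "mdom (symb \<sigma>) w" and \<sigma>: "\<sigma> \<ge> 0"
    and norms: "(\<lambda>n. norm (mul (symb \<sigma>) (y n))) \<longlonglongrightarrow> norm (mul (symb \<sigma>) w)"
  shows "(\<lambda>n. mul (symb \<sigma>) (y n)) \<longlonglongrightarrow> mul (symb \<sigma>) w"
proof -
  let ?h = "mul (symb \<sigma>)"
  have bd: "mdom (symb \<sigma>) (trunc k z)" for k z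
  proof -
    have "(\<lambda>t. (symb \<sigma> t * indicator (cball 0 (real k)) t) * rep z t) \<in> L2"
    proof (rule L2_mult_bounded[where K = "real k powr (2 * \<sigma>)"])
      show "AE t in lborel. cmod (symb \<sigma> t * indicator (cball 0 (real k)) t) \<le> real k powr (2 * \<sigma>)"
        using \<sigma> by (auto simp: symb_def norm_mult indicator_def intro!: powr_mono2)
    qed (auto intro!: borel_measurable_times borel_measurable_indicator)
    then show ?thesis unfolding trunc_def by (intro mdom_cls(1) trunc_L2) (auto simp: mult.assoc)
  qed
  have cs: "cj (mul (symb \<sigma>) x) = mul (symb \<sigma>) (cj x)" if "mdom (symb \<sigma>) x" for x :: "'a lsq"
    using mul_cj[OF symb_measurable that] by (simp add: symb_def[abs_def])
  have cd: "mdom (symb \<sigma>) (cj x)" if "mdom (symb \<sigma>) x" for x :: "'a lsq"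
  proof -
    have "(\<lambda>t. symb \<sigma> t * cnj (rep x t)) \<in> L2" using L2_cnj[OF that[unfolded mdom_def]] by (simp add: symb_def)
    then show ?thesis unfolding cj_def by (intro mdom_cls(1) L2_cnj) auto
  qed
  have sym: "inner (?h x) z = inner x (?h z)" if "mdom (symb \<sigma>) x" "mdom (symb \<sigma>) z" for x z :: "'a lsq"
    by (simp add: inner_pair pair_mul[OF that(1) cd[OF that(2)]] cs[OF that(2)])
  have weak: "(\<lambda>n. inner (?h (y n)) (?h w)) \<longlonglongrightarrow> inner (?h w) (?h w)"
  proof (rule LIMSEQ_I)
    fix e :: real assume e: "e > 0"
    obtain C where C: "C > 0" "\<And>n. norm (?h (y n)) \<le> C"
      using convergent_imp_Bseq[OF convergentI[OF norms]] by (auto elim: BseqE)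
    define e' where "e' = e / (3 * (C + norm (?h w) + 1))"
    have D: "C + norm (?h w) + 1 > 0" using C by (simp add: add_pos_nonneg)
    then have e': "e' > 0" using e by (simp add: e'_def)
    obtain k where k: "norm (trunc k (?h w) - ?h w) < e'"
      using LIMSEQ_D[OF tendsto_trunc e', of "?h w"] by auto
    let ?z = "trunc k (?h w)"
    have "(\<lambda>n. inner (y n) (?h ?z)) \<longlonglongrightarrow> inner w (?h ?z)" by (intro tendsto_intros y)
    then obtain N where N: "\<And>n. n \<ge> N \<Longrightarrow> \<bar>inner (y n) (?h ?z) - inner w (?h ?z)\<bar> < e / 3"
      using e LIMSEQ_D[of "\<lambda>n. inner (y n) (?h ?z)" "inner w (?h ?z)" "e / 3"] by auto
    have "norm (inner (?h (y n)) (?h w) - inner (?h w) (?h w)) < e" if n: "n \<ge> N" for n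
    proof -
      have 1: "inner (?h (y n)) (?h w) - inner (?h w) (?h w) =
        inner (?h (y n)) (?h w - ?z) + (inner (y n) (?h ?z) - inner w (?h ?z)) - inner (?h w) (?h w - ?z)"
        using sym[OF dom(1) bd] sym[OF dom(2) bd] by (simp add: inner_diff_right)
      have 2: "\<bar>inner (?h (y n)) (?h w - ?z)\<bar> \<le> C * e'"
        using k by (intro order_trans[OF Cauchy_Schwarz_ineq2] mult_mono C) (auto simp: norm_minus_commute C less_imp_le)
      have 3: "\<bar>inner (?h w) (?h w - ?z)\<bar> \<le> norm (?h w) * e'"
        using k by (intro order_trans[OF Cauchy_Schwarz_ineq2] mult_mono) (auto simp: norm_minus_commute less_imp_le)
      have "C * e' + norm (?h w) * e' \<le> (C + norm (?h w) + 1) * e'" using e' by (simp add: algebra_simps)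
      also have "\<dots> = e / 3" using D by (simp add: e'_def field_simps)
      finally show ?thesis unfolding 1 real_norm_def using 2 3 N[OF n] e by linarith
    qed
    then show "\<exists>no. \<forall>n\<ge>no. norm (inner (?h (y n)) (?h w) - inner (?h w) (?h w)) < e" by blast
  qed
  have "(norm (?h (y n) - ?h w))\<^sup>2 = (norm (?h (y n)))\<^sup>2 + (norm (?h w))\<^sup>2 - 2 * inner (?h (y n)) (?h w)" for n
    by (simp add: power2_norm_eq_inner inner_diff_left inner_diff_right inner_commute)
  moreover have "(\<lambda>n. (norm (?h (y n)))\<^sup>2 + (norm (?h w))\<^sup>2 - 2 * inner (?h (y n)) (?h w)) \<longlonglongrightarrow>
    (norm (?h w))\<^sup>2 + (norm (?h w))\<^sup>2 - 2 * inner (?h w) (?h w)"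
    by (intro tendsto_intros norms weak)
  ultimately have "(\<lambda>n. (norm (?h (y n) - ?h w))\<^sup>2) \<longlonglongrightarrow> 0" by (simp add: power2_norm_eq_inner)
  then have "(\<lambda>n. sqrt ((norm (?h (y n) - ?h w))\<^sup>2)) \<longlonglongrightarrow> sqrt 0" by (rule tendsto_real_sqrt)
  then show ?thesis by (simp add: tendsto_norm_zero_iff LIM_zero_iff)
qed

section \<open>Continuity in time of the Sobolev norm\<close>

context schroedinger begin

text \<open>The potential energy is continuous on \<open>L2\<close>, so energy conservation forces the norms of the
  \<open>(s/2)\<close>-derivatives to converge.\<close>

lemma V_symb_small:
  assumes w: "mdom (symb (s / 2)) w" and \<tau>: "\<And>n. \<tau> n \<ge> 0" "\<tau> \<longlonglongrightarrow> 0"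
  shows "(\<lambda>n. mul (symb (s / 2)) (V (\<tau> n) w)) \<longlonglongrightarrow> mul (symb (s / 2)) w" "(\<lambda>n. V (\<tau> n) w) \<longlonglongrightarrow> w"
proof -
  obtain B where B: "\<And>n. \<tau> n \<le> B"
  proof -
    obtain C where "\<And>n. norm (\<tau> n) \<le> C" using convergent_imp_Bseq[OF convergentI[OF \<tau>(2)]] unfolding Bseq_def by blast
    then have "\<tau> n \<le> C" for n using abs_ge_self[of "\<tau> n"] order_trans by (metis real_norm_def)
    then show ?thesis using that by blast
  qed
  have B0: "0 \<le> B" using B[of 0] \<tau>(1)[of 0] by linarith
  have "continuous (at 0 within {0..B}) (\<lambda>t. V t w)"
    using V_continuous[of B w] B0 by (auto simp: continuous_on_eq_continuous_within)
  from continuous_within_tendsto_compose'[OF this, of \<tau> sequentially]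
  show lim: "(\<lambda>n. V (\<tau> n) w) \<longlonglongrightarrow> w" using \<tau> B by simp
  have pl: "(\<lambda>n. pe (V (\<tau> n) w)) \<longlonglongrightarrow> pe w"
    unfolding pe_def
  proof (intro tendsto_inner lim)
    have "bounded_linear (pot p)"
      unfolding pot_def
      by (intro bounded_linear_compose[OF bounded_linear_FT] bounded_linear_compose[OF bounded_linear_mul]
         bounded_linear_IFT p_bmult)
    from bounded_linear.tendsto[OF this lim] show "(\<lambda>n. pot p (V (\<tau> n) w)) \<longlonglongrightarrow> pot p w" .
  qed
  have "(norm (mul (symb (s / 2)) (V (\<tau> n) w)))\<^sup>2 = (norm (mul (symb (s / 2)) w))\<^sup>2 + pe w - pe (V (\<tau> n) w)" for n
    using energy_conservation[OF w \<tau>(1)[of n]] by simp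
  then have "(\<lambda>n. (norm (mul (symb (s / 2)) (V (\<tau> n) w)))\<^sup>2) \<longlonglongrightarrow> (norm (mul (symb (s / 2)) w))\<^sup>2 + pe w - pe w"
    using pl by (simp only:) (intro tendsto_intros)
  from tendsto_real_sqrt[OF this]
  have "(\<lambda>n. norm (mul (symb (s / 2)) (V (\<tau> n) w))) \<longlonglongrightarrow> norm (mul (symb (s / 2)) w)" by simp
  then show "(\<lambda>n. mul (symb (s / 2)) (V (\<tau> n) w)) \<longlonglongrightarrow> mul (symb (s / 2)) w"
    using s by (intro tendsto_mul_of_norm[OF lim]) (auto intro: V_mdom w \<tau>)
qed

text \<open>By the group property the increment between two times is, up to sign, \<open>V\<close> at the smaller time applied to the
  increment \<open>V \<tau> w - w\<close> with \<open>\<tau>\<close> the distance of the times, and \<open>V\<close> is bounded in the energy norm. So continuity at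
  time \<open>0\<close> suffices.\<close>

lemma V_symb_continuous:
  assumes w: "mdom (symb (s / 2)) w" and t: "t \<in> {0..T}"
  shows "((\<lambda>r. norm (mul (symb (s / 2)) (V r w - V t w))) \<longlongrightarrow> 0) (at t within {0..T})"
  unfolding tendsto_at_iff_sequentially
proof (intro allI impI)
  fix X assume X: "\<forall>i. X i \<in> {0..T} - {t}" "X \<longlonglongrightarrow> t"
  let ?h = "mul (symb (s / 2)) :: 'a lsq \<Rightarrow> 'a lsq"
  define \<tau> where "\<tau> n = \<bar>X n - t\<bar>" for n
  have \<tau>: "\<tau> n \<ge> 0" for n by (simp add: \<tau>_def)
  have \<tau>0: "\<tau> \<longlonglongrightarrow> 0" unfolding \<tau>_def using X(2) by (intro tendsto_rabs_zero) (simp add: LIM_zero)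
  note sm = V_symb_small[OF w \<tau> \<tau>0]
  define y where "y n = V (\<tau> n) w - w" for n
  have yd: "mdom (symb (s / 2)) (y n)" for n unfolding y_def by (intro mdom_diff V_mdom w \<tau>) simp
  have hy: "?h (y n) = ?h (V (\<tau> n) w) - ?h w" for n unfolding y_def by (intro mdom_diff V_mdom w \<tau>) simp
  have y0: "(\<lambda>n. norm (y n)) \<longlonglongrightarrow> 0" unfolding y_def using sm(2) by (intro tendsto_norm_zero) (simp add: LIM_zero)
  have hy0: "(\<lambda>n. norm (?h (y n))) \<longlonglongrightarrow> 0" unfolding hy using sm(1) by (intro tendsto_norm_zero) (simp add: LIM_zero)
  have b: "norm (?h (V (X n) w - V t w)) \<le> sqrt ((norm (?h (y n)))\<^sup>2 + 2 * M * (norm (y n))\<^sup>2)" for n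
  proof (rule real_le_rsqrt)
    have Xn: "X n \<ge> 0" using X(1) by auto
    have "V (X n) w - V t w = V (min (X n) t) (y n) \<or> V (X n) w - V t w = - V (min (X n) t) (y n)"
    proof (cases "X n \<ge> t")
      case True
      then have "V (X n) w = V t (V (\<tau> n) w)" using V_group[of t "\<tau> n" w] t by (simp add: \<tau>_def)
      then show ?thesis using True t by (simp add: y_def V_diff_arg min_def)
    next
      case False
      then have "V t w = V (X n) (V (\<tau> n) w)" using V_group[of "X n" "\<tau> n" w] Xn by (simp add: \<tau>_def)
      then show ?thesis using False Xn by (simp add: y_def V_diff_arg min_def)
    qed
    moreover have "norm (?h (- z)) = norm (?h z)" if "mdom (symb (s / 2)) z" for z
      using mdom_scaleR(2)[OF symb_measurable that, of "-1"] by simp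
    moreover have "mdom (symb (s / 2)) (V (min (X n) t) (y n))" using Xn t by (intro V_mdom yd) auto
    ultimately have "norm (?h (V (X n) w - V t w)) = norm (?h (V (min (X n) t) (y n)))" by metis
    then show "(norm (?h (V (X n) w - V t w)))\<^sup>2 \<le> (norm (?h (y n)))\<^sup>2 + 2 * M * (norm (y n))\<^sup>2"
      using V_symb_bound[OF yd, of "min (X n) t"] Xn t by simp
  qed
  have l: "(\<lambda>n. sqrt ((norm (?h (y n)))\<^sup>2 + 2 * M * (norm (y n))\<^sup>2)) \<longlonglongrightarrow> sqrt (0\<^sup>2 + 2 * M * 0\<^sup>2)"
    by (intro tendsto_intros y0 hy0)
  then have "(\<lambda>n. sqrt ((norm (?h (y n)))\<^sup>2 + 2 * M * (norm (y n))\<^sup>2)) \<longlonglongrightarrow> 0" by simp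
  then have "(\<lambda>n. norm (?h (V (X n) w - V t w))) \<longlonglongrightarrow> 0"
    by (rule tendsto_sandwich[OF always_eventually always_eventually tendsto_const, rotated 2]) (simp_all add: b)
  then show "((\<lambda>r. norm (?h (V r w - V t w))) \<circ> X) \<longlonglongrightarrow> 0" by (simp only: o_def)
qed

end

section \<open>Smooth functions of compact support\<close>

lemma Ck_const [simp]: "Ck k (\<lambda>z. c)"
proof (induct k arbitrary: c)
  case (Suc k)
  have "frechet_derivative (\<lambda>z::'a. c) (at z) = (\<lambda>v. 0)" for z
    by (rule frechet_derivative_at[symmetric]) (rule has_derivative_const)
  then show ?case using Suc by simp
qed simp

lemma Ck_SucI:
  assumes "\<And>z. (f has_derivative f' z) (at z)" "\<And>v. Ck k (\<lambda>z. f' z v)" shows "Ck (Suc k) f"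
proof -
  have "frechet_derivative f (at z) = f' z" for z using frechet_derivative_at[OF assms(1)] by simp
  then show ?thesis using assms by (auto simp: differentiable_def)
qed

lemma Ck_SucD: "Ck (Suc k) f \<Longrightarrow> (f has_derivative frechet_derivative f (at z)) (at z)"
  by (simp add: frechet_derivative_works[symmetric])

lemma Ck_Suc_lower: "Ck (Suc k) f \<Longrightarrow> Ck k f"
proof (induct k arbitrary: f)
  case 0
  then show ?case by (auto intro!: continuous_at_imp_continuous_on differentiable_imp_continuous_within)
next
  case (Suc k)
  have "Ck k (\<lambda>z. frechet_derivative f (at z) v)" for v
    by (rule Suc(1)) (use Suc(2) in auto)
  then show ?case using Suc(2) by auto
qed

lemma Ck_add: "Ck k f \<Longrightarrow> Ck k g \<Longrightarrow> Ck k (\<lambda>z. f z + g z)"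
proof (induct k arbitrary: f g)
  case 0 then show ?case by (auto intro: continuous_on_add)
next
  case (Suc k)
  show ?case
    by (rule Ck_SucI[OF has_derivative_add[OF Ck_SucD[OF Suc(2)] Ck_SucD[OF Suc(3)]]])
       (rule Suc(1), use Suc(2,3) in auto)
qed

lemma Ck_mult: "Ck k f \<Longrightarrow> Ck k g \<Longrightarrow> Ck k (\<lambda>z. f z * g z)"
proof (induct k arbitrary: f g)
  case 0 then show ?case by (auto intro: continuous_on_mult)
next
  case (Suc k)
  note l = Ck_Suc_lower[OF Suc(2)] Ck_Suc_lower[OF Suc(3)]
  show ?case
    by (rule Ck_SucI[OF has_derivative_mult[OF Ck_SucD[OF Suc(2)] Ck_SucD[OF Suc(3)]]])
       (intro Ck_add Suc(1) l, use Suc(2,3) in auto)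
qed

lemma Ck_affine:
  assumes L: "bounded_linear L" shows "Ck k f \<Longrightarrow> Ck k (\<lambda>y. f (a + L y))"
proof (induct k arbitrary: f)
  case 0 then show ?case
    using bounded_linear.continuous_on[OF L continuous_on_id]
    by (auto intro!: continuous_on_compose2[of UNIV f] continuous_intros)
next
  case (Suc k)
  show ?case
  proof (rule Ck_SucI)
    fix z
    have "((\<lambda>y. a + L y) has_derivative (\<lambda>y. 0 + L y)) (at z)"
      by (intro derivative_intros bounded_linear.has_derivative[OF L] has_derivative_ident)
    from has_derivative_compose[OF this Ck_SucD[OF Suc(2)]]
    show "((\<lambda>y. f (a + L y)) has_derivative (\<lambda>v. frechet_derivative f (at (a + L z)) (L v))) (at z)" by simp
  next
    fix v show "Ck k (\<lambda>z. frechet_derivative f (at (a + L z)) (L v))"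
      by (rule Suc(1)[of "\<lambda>z. frechet_derivative f (at z) (L v)"]) (use Suc(2) in auto)
  qed
qed

text \<open>Smooth functions of compact support.\<close>

definition csm :: "('a::euclidean_space \<Rightarrow> complex) \<Rightarrow> bool" where
  "csm f \<longleftrightarrow> (\<forall>k. Ck k f) \<and> (\<exists>R. \<forall>x. norm x > R \<longrightarrow> f x = 0)"

text \<open>The directional derivative as a function of the point, which makes it possible to iterate it.\<close>

definition dird :: "('b::real_normed_vector \<Rightarrow> complex) \<Rightarrow> 'b \<Rightarrow> 'b \<Rightarrow> complex" where
  "dird f v = (\<lambda>z. frechet_derivative f (at z) v)"

lemma Ck_dird: "(\<And>k. Ck k f) \<Longrightarrow> Ck k (dird f v)"
proof -
  assume "\<And>k. Ck k f"
  then have "Ck (Suc k) f" .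
  then show ?thesis by (simp add: dird_def)
qed

lemma dird_line:
  assumes "\<And>k. Ck k f" shows "((\<lambda>r. f (z + r *\<^sub>R v)) has_vector_derivative dird f v (z + r *\<^sub>R v)) (at r)"
proof -
  have "((\<lambda>r. z + r *\<^sub>R v) has_derivative (\<lambda>h. 0 + h *\<^sub>R v)) (at r)"
    by (intro derivative_intros)
  from has_derivative_compose[OF this Ck_SucD[OF assms]]
  have *: "((\<lambda>r. f (z + r *\<^sub>R v)) has_derivative (\<lambda>h. frechet_derivative f (at (z + r *\<^sub>R v)) (h *\<^sub>R v))) (at r)" by simp
  have "linear (frechet_derivative f (at (z + r *\<^sub>R v)))"
    using has_derivative_linear[OF Ck_SucD[OF assms]] .
  then show ?thesis using * unfolding has_vector_derivative_def dird_def by (simp add: linear_scale)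
qed

lemma dird_zero_outside:
  assumes "\<And>k. Ck k f" "open A" "\<And>z. z \<in> A \<Longrightarrow> f z = 0" "z \<in> A" shows "dird f v z = 0"
proof -
  have "(f has_derivative (\<lambda>_. 0)) (at z)"
    by (rule has_derivative_transform_within_open[OF has_derivative_const[of 0] assms(2,4)]) (simp add: assms(3))
  then show ?thesis using frechet_derivative_at[of f "\<lambda>_. 0" z] by (simp add: dird_def) metis
qed

text \<open>Mean value estimate; it dominates difference quotients.\<close>

lemma dird_lipschitz:
  assumes "\<And>k. Ck k f" "\<And>z. cmod (dird f v z) \<le> B"
  shows "cmod (f (z + r *\<^sub>R v) - f z) \<le> B * \<bar>r\<bar>"
proof -
  have "cmod (f (z + r *\<^sub>R v) - f (z + 0 *\<^sub>R v)) \<le> B * norm (r - 0)"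
  proof (rule differentiable_bound[of UNIV "\<lambda>r. f (z + r *\<^sub>R v)" "\<lambda>r h. h *\<^sub>R dird f v (z + r *\<^sub>R v)"])
    show "((\<lambda>r. f (z + r *\<^sub>R v)) has_derivative (\<lambda>h. h *\<^sub>R dird f v (z + r *\<^sub>R v))) (at r within UNIV)" for r
      using dird_line[OF assms(1), of z v r] by (simp add: has_vector_derivative_def)
    show "onorm (\<lambda>h. h *\<^sub>R dird f v (z + r *\<^sub>R v)) \<le> B" for r
      by (rule onorm_le)
         (use assms(2)[of "z + r *\<^sub>R v"] mult_left_mono[OF assms(2)[of "z + r *\<^sub>R v"] abs_ge_zero] in \<open>simp add: mult.commute\<close>)
  qed auto
  then show ?thesis by simp
qed

lemma dird_quotient_tendsto:
  assumes "\<And>k. Ck k f" "r \<longlonglongrightarrow> 0" "\<And>n. r n \<noteq> 0"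
  shows "(\<lambda>n. (1 / r n) *\<^sub>R (f (z + r n *\<^sub>R v) - f z)) \<longlonglongrightarrow> dird f v z"
proof -
  have "((\<lambda>y. (1 / (y - 0)) *\<^sub>R (f (z + y *\<^sub>R v) - f (z + 0 *\<^sub>R v))) \<longlongrightarrow> dird f v (z + 0 *\<^sub>R v)) (at 0)"
    using dird_line[OF assms(1), of z v 0] unfolding has_vector_derivative_iff_tendsto .
  then have *: "((\<lambda>y. (1 / y) *\<^sub>R (f (z + y *\<^sub>R v) - f z)) \<longlongrightarrow> dird f v z) (at 0)" by simp
  have "filterlim r (at 0) sequentially" using assms(2,3) by (simp add: filterlim_at)
  from filterlim_compose[OF * this] show ?thesis .
qed

lemma csm_D:
  assumes "csm f" shows "Ck k f" "f \<in> borel_measurable borel"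
proof -
  show "Ck k f" using assms by (simp add: csm_def)
  have "Ck 0 f" using assms by (simp only: csm_def)
  then show "f \<in> borel_measurable borel" by (simp add: borel_measurable_continuous_onI)
qed

lemma csm_bound:
  assumes "csm f" obtains B R where "B > 0" "R > 0" "\<And>x. cmod (f x) \<le> B" "\<And>x. norm x > R \<Longrightarrow> f x = 0"
proof -
  obtain R0 where R0: "\<And>x. norm x > R0 \<Longrightarrow> f x = 0" using assms by (auto simp: csm_def)
  define R where "R = max R0 1"
  have R: "norm x > R \<Longrightarrow> f x = 0" for x using R0 by (simp add: R_def)
  have "Ck 0 f" using assms by (simp only: csm_def)
  then have "continuous_on (cball 0 R) f" by (auto intro: continuous_on_subset)
  then have "bounded (f ` cball 0 R)" by (intro compact_imp_bounded compact_continuous_image) auto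
  then obtain B where B: "B > 0" "\<And>x. x \<in> cball 0 R \<Longrightarrow> cmod (f x) \<le> B" by (auto simp: bounded_pos)
  have "cmod (f x) \<le> B" for x using B R[of x] by (cases "norm x \<le> R") auto
  then show thesis using that[of B R] B(1) R by (auto simp: R_def)
qed

lemma csm_dird: assumes "csm f" shows "csm (dird f v)"
proof -
  obtain B R where R: "\<And>x. norm x > R \<Longrightarrow> f x = 0" using csm_bound[OF assms] by metis
  have "dird f v x = 0" if "norm x > R" for x
    by (rule dird_zero_outside[of f "- cball 0 R"]) (use R csm_D[OF assms] that in auto)
  then show ?thesis using Ck_dird[of f] csm_D[OF assms] by (auto simp: csm_def)
qed

lemma csm_L2: assumes "csm f" shows "f \<in> L2" "integrable lborel f"
proof -
  obtain B R where BR: "\<And>x. cmod (f x) \<le> B" "\<And>x. norm x > R \<Longrightarrow> f x = 0" using csm_bound[OF assms] by metis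
  show L: "f \<in> L2"
  proof (rule L2_dominated[of "indicator (cball 0 R)" _ B])
    show "AE x in lborel. cmod (f x) \<le> B * cmod (indicator (cball 0 R) x)"
      using BR by (intro AE_I2) (auto simp: indicator_def)
  qed (auto intro!: L2_indicator csm_D assms)
  show "integrable lborel f" by (rule bounded_support_integrable[OF L, of "cball 0 R"]) (use BR in auto)
qed

text \<open>Difference quotients are handled by translation invariance and pass to the limit by dominated convergence;
  this avoids integration by parts in several variables.\<close>

lemma fourier_L1_dird:
  assumes f: "csm f" and b: "norm b = 1"
  shows "fourier_L1 (dird f b) \<xi> = \<i> * of_real (b \<bullet> \<xi>) * fourier_L1 f \<xi>"
proof -
  note [measurable] = csm_D(2)[OF f]
  note fi = csm_L2(2)[OF f]
  obtain B R where BR: "\<And>x. cmod (dird f b x) \<le> B" using csm_bound[OF csm_dird[OF f]] by metis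
  obtain R where R: "\<And>x. norm x > R \<Longrightarrow> f x = 0" using csm_bound[OF f] by metis
  define r where "r n = 1 / real (Suc n)" for n
  have r: "r n \<noteq> 0" "0 < r n" "r n \<le> 1" for n by (auto simp: r_def)
  have r0: "r \<longlonglongrightarrow> 0" unfolding r_def by (rule LIMSEQ_Suc[OF lim_1_over_n])
  define I where "I = (\<integral>x. cis (- (x \<bullet> \<xi>)) * f x \<partial>lborel)"
  have ci: "integrable lborel (\<lambda>x. cis (- (x \<bullet> \<xi>)) * g x)" if "integrable lborel g" for g
    by (rule integrable_cis_mult[OF that])
  have shift: "integrable lborel (\<lambda>x. f (x + c))" for c
    using integrable_lborel_affine[OF fi, of 1 c] by (simp add: add.commute)
  have eq: "(\<integral>x. cis (- (x \<bullet> \<xi>)) * ((1 / r n) *\<^sub>R (f (x + r n *\<^sub>R b) - f x)) \<partial>lborel) = ((1 / r n) *\<^sub>R (cis (r n * (b \<bullet> \<xi>)) - 1)) * I" for n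
  proof -
    have "(\<integral>x. cis (- (x \<bullet> \<xi>)) * f (x + r n *\<^sub>R b) \<partial>lborel) = (\<integral>x. cis (- ((r n *\<^sub>R b + 1 *\<^sub>R x) \<bullet> \<xi>)) * cis (r n * (b \<bullet> \<xi>)) * f (r n *\<^sub>R b + 1 *\<^sub>R x) \<partial>lborel)"
      by (intro Bochner_Integration.integral_cong refl) (simp add: cis_mult inner_add_left add.commute)
    also have "\<dots> = (\<integral>x. cis (- (x \<bullet> \<xi>)) * cis (r n * (b \<bullet> \<xi>)) * f x \<partial>lborel)"
      by (rule integral_lborel_affine[of "\<lambda>x. cis (- (x \<bullet> \<xi>)) * cis (r n * (b \<bullet> \<xi>)) * f x"]) auto
    also have "\<dots> = (\<integral>x. cis (r n * (b \<bullet> \<xi>)) * (cis (- (x \<bullet> \<xi>)) * f x) \<partial>lborel)"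
      by (simp add: mult_ac)
    also have "\<dots> = cis (r n * (b \<bullet> \<xi>)) * I"
      unfolding I_def by simp
    finally have 1: "(\<integral>x. cis (- (x \<bullet> \<xi>)) * f (x + r n *\<^sub>R b) \<partial>lborel) = cis (r n * (b \<bullet> \<xi>)) * I" .
    have "(\<integral>x. cis (- (x \<bullet> \<xi>)) * ((1 / r n) *\<^sub>R (f (x + r n *\<^sub>R b) - f x)) \<partial>lborel) =
       (\<integral>x. (1 / r n) *\<^sub>R (cis (- (x \<bullet> \<xi>)) * f (x + r n *\<^sub>R b) - cis (- (x \<bullet> \<xi>)) * f x) \<partial>lborel)"
      by (intro Bochner_Integration.integral_cong refl) (simp add: algebra_simps)
    also have "\<dots> = (1 / r n) *\<^sub>R (cis (r n * (b \<bullet> \<xi>)) * I - I)"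
      by (subst integral_scaleR_right, subst Bochner_Integration.integral_diff) (use ci[OF shift] ci[OF fi] 1 I_def in auto)
    finally show ?thesis by (simp add: algebra_simps)
  qed
  have "(\<lambda>n. \<integral>x. cis (- (x \<bullet> \<xi>)) * ((1 / r n) *\<^sub>R (f (x + r n *\<^sub>R b) - f x)) \<partial>lborel) \<longlonglongrightarrow> (\<integral>x. cis (- (x \<bullet> \<xi>)) * dird f b x \<partial>lborel)"
  proof (rule integral_dominated_convergence[where w = "\<lambda>x. B * indicator (cball 0 (R + 1)) x"])
    show "integrable lborel (\<lambda>x. B * indicator (cball 0 (R + 1)) x)"
      using emeasure_bounded_finite[of "cball 0 (R + 1)"] by (intro integrable_mult_right integrable_real_indicator) auto
    show "AE x in lborel. (\<lambda>n. cis (- (x \<bullet> \<xi>)) * ((1 / r n) *\<^sub>R (f (x + r n *\<^sub>R b) - f x))) \<longlonglongrightarrow> cis (- (x \<bullet> \<xi>)) * dird f b x"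
      by (intro AE_I2 tendsto_mult tendsto_const dird_quotient_tendsto csm_D f r0 r)
    show "AE x in lborel. norm (cis (- (x \<bullet> \<xi>)) * ((1 / r n) *\<^sub>R (f (x + r n *\<^sub>R b) - f x))) \<le> B * indicator (cball 0 (R + 1)) x" for n
    proof (rule AE_I2)
      fix x
      have "cmod (f (x + r n *\<^sub>R b) - f x) \<le> B * r n"
        using dird_lipschitz[OF csm_D(1)[OF f] BR, where z = x and r = "r n"] r(2)[of n] by simp
      then have 1: "norm (cis (- (x \<bullet> \<xi>)) * ((1 / r n) *\<^sub>R (f (x + r n *\<^sub>R b) - f x))) \<le> B"
        unfolding norm_mult norm_scaleR norm_cis using r(2)[of n] by (simp add: field_simps)
      show "norm (cis (- (x \<bullet> \<xi>)) * ((1 / r n) *\<^sub>R (f (x + r n *\<^sub>R b) - f x))) \<le> B * indicator (cball 0 (R + 1)) x"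
      proof (cases "norm x \<le> R + 1")
        case False
        have "norm (r n *\<^sub>R b) \<le> 1" using b r[of n] by simp
        then have "norm (x + r n *\<^sub>R b) > R" using False norm_diff_ineq[of x "r n *\<^sub>R b"] by linarith
        then show ?thesis using False R by simp
      qed (use 1 in simp)
    qed
  qed (use csm_D(2)[OF csm_dird[OF f]] in measurable)
  moreover have "(\<lambda>n. ((1 / r n) *\<^sub>R (cis (r n * (b \<bullet> \<xi>)) - 1)) * I) \<longlonglongrightarrow> (\<i> * of_real (b \<bullet> \<xi>)) * I"
  proof (intro tendsto_mult tendsto_const)
    have "((\<lambda>t. cis (t * (b \<bullet> \<xi>))) has_derivative (\<lambda>t. (t * (b \<bullet> \<xi>)) *\<^sub>R (\<i> * cis (0 * (b \<bullet> \<xi>))))) (at 0)"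
      by (intro derivative_intros)
    then have "((\<lambda>t. cis (t * (b \<bullet> \<xi>))) has_vector_derivative (\<i> * of_real (b \<bullet> \<xi>))) (at 0)"
      by (simp add: has_vector_derivative_def scaleR_conv_of_real mult_ac)
    then have *: "((\<lambda>y. (1 / y) *\<^sub>R (cis (y * (b \<bullet> \<xi>)) - 1)) \<longlongrightarrow> \<i> * of_real (b \<bullet> \<xi>)) (at 0)"
      unfolding has_vector_derivative_iff_tendsto by simp
    have "filterlim r (at 0) sequentially" using r0 r(1) by (simp add: filterlim_at)
    from filterlim_compose[OF * this] show "(\<lambda>n. (1 / r n) *\<^sub>R (cis (r n * (b \<bullet> \<xi>)) - 1)) \<longlonglongrightarrow> \<i> * of_real (b \<bullet> \<xi>)" .
  qed
  ultimately have "(\<integral>x. cis (- (x \<bullet> \<xi>)) * dird f b x \<partial>lborel) = (\<i> * of_real (b \<bullet> \<xi>)) * I"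
    unfolding eq by (rule LIMSEQ_unique)
  then show ?thesis unfolding fourier_L1_def I_def by simp
qed

lemma fourier_L1_dird_iter:
  assumes f: "csm f" and b: "norm b = 1"
  shows "\<exists>g. csm g \<and> (\<forall>\<xi>. fourier_L1 g \<xi> = (\<i> * of_real (b \<bullet> \<xi>)) ^ k * fourier_L1 f \<xi>)"
proof (induct k)
  case (Suc k)
  then obtain g where "csm g" "\<And>\<xi>. fourier_L1 g \<xi> = (\<i> * of_real (b \<bullet> \<xi>)) ^ k * fourier_L1 f \<xi>" by auto
  then show ?case using csm_dird[of g b] fourier_L1_dird[of g b] b
    by (intro exI[of _ "dird g b"]) (auto simp: mult_ac)
qed (use f in auto)

lemma norm_power_le_sum:
  fixes \<xi> :: "'a::euclidean_space"
  shows "norm \<xi> ^ k \<le> real (DIM('a)) ^ k * (\<Sum>b\<in>Basis. \<bar>b \<bullet> \<xi>\<bar> ^ k)"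
proof -
  have "Max ((\<lambda>b. \<bar>b \<bullet> \<xi>\<bar>) ` Basis) \<in> (\<lambda>b. \<bar>b \<bullet> \<xi>\<bar>) ` Basis"
    by (rule Max_in) auto
  then obtain b0 where b0': "Max ((\<lambda>b. \<bar>b \<bullet> \<xi>\<bar>) ` Basis) = \<bar>b0 \<bullet> \<xi>\<bar>" and b0: "b0 \<in> Basis" by (rule imageE)
  have m: "\<bar>b \<bullet> \<xi>\<bar> \<le> \<bar>b0 \<bullet> \<xi>\<bar>" if "b \<in> Basis" for b unfolding b0'[symmetric] using that by (intro Max_ge) auto
  have "norm \<xi> \<le> (\<Sum>b\<in>Basis. \<bar>\<xi> \<bullet> b\<bar>)" by (rule norm_le_l1)
  also have "\<dots> \<le> (\<Sum>b\<in>(Basis::'a set). \<bar>b0 \<bullet> \<xi>\<bar>)" by (intro sum_mono) (use m in \<open>simp add: inner_commute\<close>)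
  also have "\<dots> = real (DIM('a)) * \<bar>b0 \<bullet> \<xi>\<bar>" by simp
  finally have "norm \<xi> ^ k \<le> (real (DIM('a)) * \<bar>b0 \<bullet> \<xi>\<bar>) ^ k" by (intro power_mono) auto
  also have "\<dots> = real (DIM('a)) ^ k * \<bar>b0 \<bullet> \<xi>\<bar> ^ k" by (rule power_mult_distrib)
  also have "\<dots> \<le> real (DIM('a)) ^ k * (\<Sum>b\<in>Basis. \<bar>b \<bullet> \<xi>\<bar> ^ k)"
    using b0 by (intro mult_left_mono member_le_sum) auto
  finally show ?thesis .
qed

text \<open>For an integer \<open>k \<ge> 2\<sigma>\<close> the symbol is at most \<open>1 + |\<xi>|^k\<close>, hence at most a constant times
  \<open>1 + \<Sum>_b |\<xi>_b|^k\<close>, and multiplication of the transform by \<open>(i \<xi>_b)^k\<close>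
  corresponds to a \<open>k\<close>-fold derivative.\<close>

lemma csm_symb_bound:
  assumes f: "csm f" and \<sigma>: "\<sigma> \<ge> 0"
  shows "\<exists>G\<in>L2. \<exists>C. (\<forall>\<xi>. cmod (symb \<sigma> \<xi> * fourier_L1 f \<xi>) \<le> cmod (G \<xi>)) \<and> (\<forall>\<xi>. cmod (symb \<sigma> \<xi> * fourier_L1 f \<xi>) \<le> C)"
proof -
  obtain k :: nat where k: "2 * \<sigma> \<le> real k" using real_arch_simple by blast
  define c where "c = real (DIM('a)) ^ k"
  have "\<exists>g. csm g \<and> (\<forall>\<xi>. fourier_L1 g \<xi> = (\<i> * of_real (b \<bullet> \<xi>)) ^ k * fourier_L1 f \<xi>)" if "b \<in> Basis" for b
    using fourier_L1_dird_iter[OF f] that by simp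
  then obtain g where g: "\<And>b. b \<in> Basis \<Longrightarrow> csm (g b)"
    "\<And>b \<xi>. b \<in> Basis \<Longrightarrow> fourier_L1 (g b) \<xi> = (\<i> * of_real (b \<bullet> \<xi>)) ^ k * fourier_L1 f \<xi>" by metis
  define G where "G \<xi> = cmod (fourier_L1 f \<xi>) + c * (\<Sum>b\<in>Basis. cmod (fourier_L1 (g b) \<xi>))" for \<xi>
  have le: "cmod (symb \<sigma> \<xi> * fourier_L1 f \<xi>) \<le> G \<xi>" for \<xi>
  proof -
    have "norm \<xi> powr (2 * \<sigma>) \<le> 1 + norm \<xi> ^ k"
    proof (cases "norm \<xi> \<le> 1")
      case True
      then have "norm \<xi> powr (2 * \<sigma>) \<le> 1 powr (2 * \<sigma>)" using \<sigma> by (intro powr_mono2) auto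
      then show ?thesis by (simp add: add_increasing2)
    next
      case False
      then have "norm \<xi> powr (2 * \<sigma>) \<le> norm \<xi> powr (real k)" using k by (intro powr_mono) auto
      also have "\<dots> = norm \<xi> ^ k" using False by (intro powr_realpow) auto
      finally show ?thesis by simp
    qed
    also have "norm \<xi> ^ k \<le> c * (\<Sum>b\<in>Basis. \<bar>b \<bullet> \<xi>\<bar> ^ k)" unfolding c_def by (rule norm_power_le_sum)
    finally have "norm \<xi> powr (2 * \<sigma>) * cmod (fourier_L1 f \<xi>) \<le> (1 + c * (\<Sum>b\<in>Basis. \<bar>b \<bullet> \<xi>\<bar> ^ k)) * cmod (fourier_L1 f \<xi>)"
      by (intro mult_right_mono) auto
    also have "\<dots> = G \<xi>" unfolding G_def
      by (simp add: distrib_right mult.assoc sum_distrib_right g(2) norm_mult norm_power)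
    finally show ?thesis by (simp add: symb_def norm_mult)
  qed
  have fL: "fourier_L1 h \<in> L2" if "csm h" for h :: "'a \<Rightarrow> complex" by (rule FT_integrable(1)[OF csm_L2[OF that]])
  have absL: "(\<lambda>\<xi>. complex_of_real (cmod (h \<xi>))) \<in> L2" if "h \<in> L2" for h :: "'a \<Rightarrow> complex"
    by (rule L2_dominated[OF that, of _ 1]) (use L2_measurable[OF that] in auto)
  have sumL: "(\<lambda>\<xi>. \<Sum>b\<in>A. complex_of_real (cmod (fourier_L1 (g b) \<xi>))) \<in> L2" if "finite A" "A \<subseteq> Basis" for A
    using that by (induct A) (auto intro!: L2_add absL fL g(1))
  have "(\<lambda>\<xi>. complex_of_real (cmod (fourier_L1 f \<xi>)) + of_real c * (\<Sum>b\<in>Basis. complex_of_real (cmod (fourier_L1 (g b) \<xi>)))) \<in> L2"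
    by (intro L2_add L2_cmult sumL absL fL f) auto
  then have GL: "(\<lambda>\<xi>. complex_of_real (G \<xi>)) \<in> L2" by (simp add: G_def)
  have G0: "G \<xi> \<ge> 0" for \<xi> unfolding G_def c_def by (intro add_nonneg_nonneg mult_nonneg_nonneg sum_nonneg) auto
  have bd: "\<exists>C. \<forall>\<xi>. cmod (fourier_L1 h \<xi>) \<le> C" if "csm h" for h :: "'a \<Rightarrow> complex"
  proof (intro exI allI)
    fix \<xi>
    have "cmod (\<integral>x. cis (- (x \<bullet> \<xi>)) * h x \<partial>lborel) \<le> (\<integral>x. cmod (h x) \<partial>lborel)"
      using integral_norm_bound[of lborel "\<lambda>x. cis (- (x \<bullet> \<xi>)) * h x"] by (simp add: norm_mult)
    then show "cmod (fourier_L1 h \<xi>) \<le> (2 * pi) powr (- (real DIM('a) / 2)) * (\<integral>x. cmod (h x) \<partial>lborel)"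
      unfolding fourier_L1_def by (simp add: norm_mult mult_left_mono)
  qed
  obtain C0 where C0: "\<And>\<xi>. cmod (fourier_L1 f \<xi>) \<le> C0" using bd[OF f] by auto
  have "\<forall>b\<in>Basis. \<exists>C. \<forall>\<xi>. cmod (fourier_L1 (g b) \<xi>) \<le> C" using bd g(1) by auto
  then obtain C1 where C1: "\<And>b \<xi>. b \<in> Basis \<Longrightarrow> cmod (fourier_L1 (g b) \<xi>) \<le> C1 b" by metis
  have GC: "G \<xi> \<le> C0 + c * (\<Sum>b\<in>Basis. C1 b)" for \<xi>
    unfolding G_def c_def by (intro add_mono mult_left_mono sum_mono C0 C1) auto
  show ?thesis
  proof (intro bexI[OF _ GL] exI[of _ "C0 + c * (\<Sum>b\<in>Basis. C1 b)"] conjI allI)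
    fix \<xi>
    show "cmod (symb \<sigma> \<xi> * fourier_L1 f \<xi>) \<le> cmod (complex_of_real (G \<xi>))"
      using le[of \<xi>] G0[of \<xi>] by (simp only: norm_of_real abs_of_nonneg)
    show "cmod (symb \<sigma> \<xi> * fourier_L1 f \<xi>) \<le> C0 + c * (\<Sum>b\<in>Basis. C1 b)"
      by (rule order_trans[OF le GC])
  qed
qed

lemma csm_mdom:
  assumes f: "csm f" and \<sigma>: "\<sigma> \<ge> 0"
  shows "(\<lambda>\<xi>. symb \<sigma> \<xi> * fourier_L1 f \<xi>) \<in> L2" "mdom (symb \<sigma>) (FT (cls f))"
proof -
  note [measurable] = csm_D(2)[OF f]
  obtain G where G: "G \<in> L2" "\<And>\<xi>. cmod (symb \<sigma> \<xi> * fourier_L1 f \<xi>) \<le> cmod (G \<xi>)"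
    using csm_symb_bound[OF assms] by blast
  show L: "(\<lambda>\<xi>. symb \<sigma> \<xi> * fourier_L1 f \<xi>) \<in> L2"
  proof (rule L2_dominated[OF G(1), where K = 1])
    show "AE \<xi> in lborel. cmod (symb \<sigma> \<xi> * fourier_L1 f \<xi>) \<le> 1 * cmod (G \<xi>)"
      using G(2) by (intro AE_I2) (simp only: mult_1)
  qed measurable
  show "mdom (symb \<sigma>) (FT (cls f))" unfolding FT_integrable(2)[OF csm_L2[OF f]]
    by (rule mdom_cls(1)[OF FT_integrable(1)[OF csm_L2[OF f]] _ L]) simp
qed

section \<open>The free group along curves\<close>

lemma cis_lipschitz: "cmod (cis a - cis b) \<le> \<bar>a - b\<bar>"
proof -
  have "cmod (cis a - cis b) \<le> 1 * norm (a - b)"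
  proof (rule differentiable_bound[of UNIV cis "\<lambda>x h. h *\<^sub>R (\<i> * cis x)"])
    show "(cis has_derivative (\<lambda>h. h *\<^sub>R (\<i> * cis x))) (at x within UNIV)" for x
      using has_derivative_cis[OF has_derivative_ident] by simp
    show "onorm (\<lambda>h. h *\<^sub>R (\<i> * cis x)) \<le> 1" for x
      by (rule onorm_le) (simp add: norm_mult)
  qed auto
  then show ?thesis by simp
qed

text \<open>Product rule. The difference quotients of \<open>exp (i c t |\<xi>|^(2s))\<close> are dominated by \<open>|c| |\<xi>|^(2s)\<close>, so dominated
  convergence needs only that the value of the curve at the given time lies in the domain.
  The factor \<open>c\<close> allows the flow to run backwards.\<close>

lemma freeS_derivative:
  assumes G: "(G has_vector_derivative G') (at t within A)" and dom: "mdom (symb s) (G t)"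
  shows "((\<lambda>t. freeS s (c * t) (G t)) has_vector_derivative
     freeS s (c * t) (G' + mul (\<lambda>_. \<i> * of_real c) (mul (symb s) (G t)))) (at t within A)"
  unfolding has_vector_derivative_iff_tendsto tendsto_at_iff_sequentially
proof (intro allI impI)
  fix X assume X: "\<forall>i. X i \<in> A - {t}" "X \<longlonglongrightarrow> t"
  interpret perturbed_group "freeS s" "\<lambda>x. imul (pot (\<lambda>_. 0) x)" imul
    by (rule perturbed_group_freeS) simp
  have Xt: "X n \<noteq> t" for n using X(1) by auto
  define m where "m \<xi> = norm \<xi> powr (2 * s)" for \<xi> :: 'a
  have [measurable]: "m \<in> borel_measurable borel" unfolding m_def[abs_def] by measurable
  \<comment> \<open>The multiplier of the difference quotient.\<close>
  define k where "k n \<xi> = (1 / complex_of_real (X n - t)) * (cis (c * X n * m \<xi>) - cis (c * t * m \<xi>))" for n \<xi>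
  have Sc: "bmult (\<lambda>\<xi>. cis (r * m \<xi>))" for r unfolding m_def by (rule bmult_cis)
  have km: "mul (k n) x = (1 / (X n - t)) *\<^sub>R (freeS s (c * X n) x - freeS s (c * t) x)" for n x
  proof -
    have 1: "mul (\<lambda>\<xi>. cis (c * X n * m \<xi>) + (-1) * cis (c * t * m \<xi>)) x = mul (\<lambda>\<xi>. cis (c * X n * m \<xi>)) x - mul (\<lambda>\<xi>. cis (c * t * m \<xi>)) x"
      unfolding mul_def using bmult_mdom[OF Sc, of "c * X n" x] bmult_mdom[OF Sc, of "c * t" x]
      by (simp add: mdom_def cls_diff left_diff_distrib)
    have 2: "bmult (\<lambda>\<xi>. cis (c * X n * m \<xi>) + (-1) * cis (c * t * m \<xi>))"
      unfolding bmult_def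
      by (auto intro!: exI[of _ 2] AE_I2 order_trans[OF norm_triangle_ineq4])
    have "mul (k n) x = mul (\<lambda>_. of_real (1 / (X n - t))) (mul (\<lambda>\<xi>. cis (c * X n * m \<xi>) + (-1) * cis (c * t * m \<xi>)) x)"
      by (subst mul_mul[OF bmult_const 2]) (simp add: k_def[abs_def])
    then show ?thesis unfolding 1 mul_const_of_real by (simp add: freeS_def m_def)
  qed
  have "(\<lambda>n. mul (k n) (G t)) \<longlonglongrightarrow> mul (\<lambda>\<xi>. \<i> * of_real c * symb s \<xi> * cis (c * t * m \<xi>)) (G t)"
  proof (rule tendsto_mul_DCT(1)[where z = "\<lambda>\<xi>. of_real c * (symb s \<xi> * rep (G t) \<xi>)"])
    show "(\<lambda>\<xi>. of_real c * (symb s \<xi> * rep (G t) \<xi>)) \<in> L2" using dom by (intro L2_cmult) (simp add: mdom_def)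
    show "AE \<xi> in lborel. (\<lambda>n. k n \<xi> * rep (G t) \<xi>) \<longlonglongrightarrow> \<i> * of_real c * symb s \<xi> * cis (c * t * m \<xi>) * rep (G t) \<xi>"
    proof (intro AE_I2 tendsto_mult tendsto_const)
      fix \<xi> :: 'a
      have "((\<lambda>r. cis (c * r * m \<xi>)) has_derivative (\<lambda>h. (c * h * m \<xi>) *\<^sub>R (\<i> * cis (c * t * m \<xi>)))) (at t)"
        by (intro derivative_intros)
      then have "((\<lambda>r. cis (c * r * m \<xi>)) has_vector_derivative (\<i> * of_real c * symb s \<xi> * cis (c * t * m \<xi>))) (at t)"
        by (simp add: has_vector_derivative_def scaleR_conv_of_real mult_ac symb_def m_def)
      then have *: "((\<lambda>y. (1 / (y - t)) *\<^sub>R (cis (c * y * m \<xi>) - cis (c * t * m \<xi>))) \<longlongrightarrow> \<i> * of_real c * symb s \<xi> * cis (c * t * m \<xi>)) (at t)"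
        unfolding has_vector_derivative_iff_tendsto .
      have "filterlim X (at t) sequentially" using X(2) Xt by (simp add: filterlim_at)
      from filterlim_compose[OF * this]
      show "(\<lambda>n. k n \<xi>) \<longlonglongrightarrow> \<i> * of_real c * symb s \<xi> * cis (c * t * m \<xi>)"
        unfolding k_def by (simp add: scaleR_conv_of_real)
    qed
    show "AE \<xi> in lborel. cmod (k n \<xi> * rep (G t) \<xi>) \<le> cmod (of_real c * (symb s \<xi> * rep (G t) \<xi>))" for n
    proof (rule AE_I2)
      fix \<xi> :: 'a
      have "cmod (k n \<xi>) \<le> (1 / \<bar>X n - t\<bar>) * \<bar>c * X n * m \<xi> - c * t * m \<xi>\<bar>"
        unfolding k_def norm_mult norm_divide norm_of_real norm_one by (intro mult_left_mono cis_lipschitz) auto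
      also have "c * X n * m \<xi> - c * t * m \<xi> = c * m \<xi> * (X n - t)" by (simp add: algebra_simps)
      also have "(1 / \<bar>X n - t\<bar>) * \<bar>c * m \<xi> * (X n - t)\<bar> = \<bar>c\<bar> * m \<xi>" using Xt[of n] by (simp add: abs_mult m_def)
      finally have "cmod (k n \<xi>) * cmod (rep (G t) \<xi>) \<le> (\<bar>c\<bar> * m \<xi>) * cmod (rep (G t) \<xi>)" by (rule mult_right_mono) simp
      then show "cmod (k n \<xi> * rep (G t) \<xi>) \<le> cmod (of_real c * (symb s \<xi> * rep (G t) \<xi>))"
        by (simp add: norm_mult symb_def m_def)
    qed
    show "k n \<in> borel_measurable borel" for n unfolding k_def[abs_def] by measurable
  qed measurable
  moreover have "mul (\<lambda>\<xi>. \<i> * of_real c * symb s \<xi> * cis (c * t * m \<xi>)) (G t) = freeS s (c * t) (mul (\<lambda>_. \<i> * of_real c) (mul (symb s) (G t)))"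
  proof -
    have 1: "mdom (\<lambda>\<xi>. \<i> * of_real c * symb s \<xi>) (G t)"
      using L2_cmult[OF dom[unfolded mdom_def], of "\<i> * of_real c"] by (simp add: mdom_def mult.assoc)
    have e: "(\<lambda>\<xi>. cis (c * t * m \<xi>) * (\<i> * of_real c * symb s \<xi>)) = (\<lambda>\<xi>. \<i> * of_real c * symb s \<xi> * cis (c * t * m \<xi>))"
      by (auto simp: mult_ac)
    have 2: "mdom (\<lambda>\<xi>. cis (c * t * m \<xi>) * (\<i> * of_real c * symb s \<xi>)) (G t)"
      using L2_mult_bounded[OF 1[unfolded mdom_def], of "\<lambda>\<xi>. cis (c * t * m \<xi>)" 1] by (simp add: mdom_def mult.assoc)
    have "mul (\<lambda>_. \<i> * of_real c) (mul (symb s) (G t)) = mul (\<lambda>\<xi>. \<i> * of_real c * symb s \<xi>) (G t)"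
      by (rule mdom_mul(2)[OF _ _ dom 1]) auto
    moreover have "freeS s (c * t) (mul (\<lambda>\<xi>. \<i> * of_real c * symb s \<xi>) (G t)) = mul (\<lambda>\<xi>. cis (c * t * m \<xi>) * (\<i> * of_real c * symb s \<xi>)) (G t)"
      unfolding freeS_def m_def[symmetric] by (rule mdom_mul(2)[OF _ _ 1 2]) measurable
    ultimately show ?thesis unfolding e by simp
  qed
  ultimately have 1: "(\<lambda>n. (1 / (X n - t)) *\<^sub>R (freeS s (c * X n) (G t) - freeS s (c * t) (G t))) \<longlonglongrightarrow> freeS s (c * t) (mul (\<lambda>_. \<i> * of_real c) (mul (symb s) (G t)))"
    unfolding km by simp
  have "(\<lambda>n. (1 / (X n - t)) *\<^sub>R (G (X n) - G t)) \<longlonglongrightarrow> G'"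
    using G X unfolding has_vector_derivative_iff_tendsto tendsto_at_iff_sequentially o_def by blast
  then have 2: "(\<lambda>n. freeS s (c * X n) ((1 / (X n - t)) *\<^sub>R (G (X n) - G t))) \<longlonglongrightarrow> freeS s (c * t) G'"
    by (intro S_tendsto tendsto_mult tendsto_const X)
  have "(1 / (X n - t)) *\<^sub>R (freeS s (c * X n) (G (X n)) - freeS s (c * t) (G t)) =
      freeS s (c * X n) ((1 / (X n - t)) *\<^sub>R (G (X n) - G t)) + (1 / (X n - t)) *\<^sub>R (freeS s (c * X n) (G t) - freeS s (c * t) (G t))" for n
    by (simp add: linear_scale[OF bounded_linear.linear[OF S_lin]] S_diff scaleR_diff_right)
  then show "((\<lambda>y. (1 / (y - t)) *\<^sub>R (freeS s (c * y) (G y) - freeS s (c * t) (G t))) \<circ> X) \<longlonglongrightarrow>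
     freeS s (c * t) (G' + mul (\<lambda>_. \<i> * of_real c) (mul (symb s) (G t)))"
    using tendsto_add[OF 2 1] by (simp add: o_def linear_add[OF bounded_linear.linear[OF S_lin]])
qed

section \<open>Test functions as curves\<close>

lemma test_function_props:
  assumes "\<phi> \<in> test_functions T"
  obtains R where "\<And>k. Ck k \<phi>" "\<And>t x. norm x > R \<Longrightarrow> \<phi> (t, x) = 0" "\<And>t x. t \<notin> {0<..<T} \<Longrightarrow> \<phi> (t, x) = 0"
    "\<And>v t x. norm x > R \<Longrightarrow> dird \<phi> v (t, x) = 0" "\<And>v. \<exists>B. \<forall>z. cmod (dird \<phi> v z) \<le> B"
proof -
  from assms obtain K where K: "compact K" "K \<subseteq> {0<..<T} \<times> UNIV" "\<And>z. z \<notin> K \<Longrightarrow> \<phi> z = 0" and Ck: "\<And>k. Ck k \<phi>"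
    by (auto simp: test_functions_def)
  obtain R where R: "\<And>z. z \<in> K \<Longrightarrow> norm z \<le> R" using compact_imp_bounded[OF K(1)] by (auto simp: bounded_iff)
  have nK: "(t, x) \<notin> K" if "norm x > R" for t x
    using R[of "(t, x)"] norm_snd_le[of x t] that by auto
  have dK: "dird \<phi> v z = 0" if "z \<notin> K" for v z
    by (rule dird_zero_outside[OF Ck open_Compl[OF compact_imp_closed[OF K(1)]]]) (use K that in auto)
  have "\<exists>B. \<forall>z. cmod (dird \<phi> v z) \<le> B" for v
  proof -
    have "Ck 0 (dird \<phi> v)" by (rule Ck_dird[OF Ck])
    then have "continuous_on K (dird \<phi> v)" by (auto intro: continuous_on_subset)
    then have "bounded (dird \<phi> v ` K)" by (intro compact_imp_bounded compact_continuous_image K)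
    then obtain B where B: "B > 0" "\<And>z. z \<in> K \<Longrightarrow> cmod (dird \<phi> v z) \<le> B" by (auto simp: bounded_pos)
    then have "cmod (dird \<phi> v z) \<le> B" for z using dK[of z] by (cases "z \<in> K") auto
    then show ?thesis by blast
  qed
  moreover have "\<phi> (t, x) = 0" if "t \<notin> {0<..<T}" for t x using K(2,3) that by blast
  ultimately show thesis using that[of R] Ck K(3) nK dK by blast
qed

lemma bounded_linear_slice: "bounded_linear (\<lambda>y::'a::euclidean_space. (0::real, y))"
  by (intro bounded_linear_Pair bounded_linear_zero bounded_linear_ident)

lemma csm_slice:
  fixes \<phi> :: "real \<times> 'a::euclidean_space \<Rightarrow> complex"
  assumes "\<phi> \<in> test_functions T" shows "csm (\<lambda>y. \<phi> (t, y))" "csm (\<lambda>y. dird \<phi> v (t, y))"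
proof -
  obtain R where R: "\<And>k. Ck k \<phi>" "\<And>t x. norm x > R \<Longrightarrow> \<phi> (t, x) = 0" "\<And>v t x. norm x > R \<Longrightarrow> dird \<phi> v (t, x) = 0"
    using test_function_props[OF assms] by metis
  have "Ck k (\<lambda>y. \<phi> ((t, 0) + (0, y)))" "Ck k (\<lambda>y. dird \<phi> v ((t, 0) + (0, y)))" for k
    by (intro Ck_affine[OF bounded_linear_slice] Ck_dird R)+
  then have "Ck k (\<lambda>y. \<phi> (t, y))" "Ck k (\<lambda>y. dird \<phi> v (t, y))" for k by simp_all
  moreover have "\<forall>x. norm x > R \<longrightarrow> \<phi> (t, x) = 0" "\<forall>x. norm x > R \<longrightarrow> dird \<phi> v (t, x) = 0"
    using R(2) R(3)[where v = v] by blast+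
  ultimately show "csm (\<lambda>y. \<phi> (t, y))" "csm (\<lambda>y. dird \<phi> v (t, y))"
    unfolding csm_def by blast+
qed

lemma time_derivative_test_function:
  fixes \<phi> :: "real \<times> 'a::euclidean_space \<Rightarrow> complex"
  assumes "\<phi> \<in> test_functions T"
  shows "vector_derivative (\<lambda>\<tau>. \<phi> (\<tau>, x)) (at t) = dird \<phi> (1, 0) (t, x)"
proof -
  obtain R where R: "\<And>k. Ck k \<phi>" using test_function_props[OF assms] by metis
  have "((\<lambda>r. \<phi> ((0, x) + r *\<^sub>R (1, 0))) has_vector_derivative dird \<phi> (1, 0) ((0, x) + t *\<^sub>R (1, 0))) (at t)"
    by (rule dird_line[OF R])
  then show ?thesis by (intro vector_derivative_at) simp
qed

text \<open>The time difference quotients vanish outside a fixed ball and are bounded by the time derivative.\<close>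

lemma test_function_curve:
  fixes \<phi> :: "real \<times> 'a::euclidean_space \<Rightarrow> complex"
  assumes \<phi>: "\<phi> \<in> test_functions T"
  shows "((\<lambda>t. cls (\<lambda>y. \<phi> (t, y))) has_vector_derivative cls (\<lambda>y. dird \<phi> (1, 0) (t, y))) (at t within A)"
  unfolding has_vector_derivative_iff_tendsto tendsto_at_iff_sequentially
proof (intro allI impI)
  fix X assume X: "\<forall>i. X i \<in> A - {t}" "X \<longlonglongrightarrow> t"
  have Xt: "X n - t \<noteq> 0" for n using X(1) by auto
  obtain R where R: "\<And>k. Ck k \<phi>" "\<And>t x. norm x > R \<Longrightarrow> \<phi> (t, x) = 0" "\<And>v. \<exists>B. \<forall>z. cmod (dird \<phi> v z) \<le> B"
    using test_function_props[OF \<phi>] by metis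
  obtain B where B: "\<And>z. cmod (dird \<phi> (1, 0) z) \<le> B" using R(3) by metis
  note sl = csm_L2(1)[OF csm_slice(1)[OF \<phi>]]
  note [measurable] = csm_D(2)[OF csm_slice(1)[OF \<phi>]] csm_D(2)[OF csm_slice(2)[OF \<phi>]]
  have step: "\<phi> (X n, y) = \<phi> ((t, y) + (X n - t) *\<^sub>R (1, 0))" for n y by simp
  have "(\<lambda>n. cls (\<lambda>y. (1 / (X n - t)) *\<^sub>R (\<phi> (X n, y) - \<phi> (t, y)))) \<longlonglongrightarrow> cls (\<lambda>y. dird \<phi> (1, 0) (t, y))"
  proof (rule lsq_dominated_convergence(1)[where w = "\<lambda>y. of_real B * indicator (cball 0 R) y"])
    show "(\<lambda>y. complex_of_real B * indicator (cball 0 R) y) \<in> L2" by (intro L2_cmult L2_indicator) auto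
    have "(\<lambda>n. X n - t) \<longlonglongrightarrow> 0" using X(2) by (simp add: LIM_zero)
    then show "AE y in lborel. (\<lambda>n. (1 / (X n - t)) *\<^sub>R (\<phi> (X n, y) - \<phi> (t, y))) \<longlonglongrightarrow> dird \<phi> (1, 0) (t, y)"
      unfolding step by (intro AE_I2 dird_quotient_tendsto R Xt)
    show "AE y in lborel. cmod ((1 / (X n - t)) *\<^sub>R (\<phi> (X n, y) - \<phi> (t, y))) \<le> cmod (complex_of_real B * indicator (cball 0 R) y)" for n
    proof (rule AE_I2)
      fix y
      have "cmod (\<phi> (X n, y) - \<phi> (t, y)) \<le> B * \<bar>X n - t\<bar>"
        unfolding step by (rule dird_lipschitz[OF R(1) B])
      then have 1: "cmod ((1 / (X n - t)) *\<^sub>R (\<phi> (X n, y) - \<phi> (t, y))) \<le> B"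
        unfolding norm_scaleR using Xt[of n] by (simp add: field_simps)
      then have "B \<ge> 0" using norm_ge_zero order_trans by blast
      then show "cmod ((1 / (X n - t)) *\<^sub>R (\<phi> (X n, y) - \<phi> (t, y))) \<le> cmod (complex_of_real B * indicator (cball 0 R) y)"
        using 1 R(2)[of y] by (cases "norm y \<le> R") (auto simp: norm_mult)
    qed
  qed measurable
  moreover have "cls (\<lambda>y. (1 / (X n - t)) *\<^sub>R (\<phi> (X n, y) - \<phi> (t, y))) = (1 / (X n - t)) *\<^sub>R (cls (\<lambda>y. \<phi> (X n, y)) - cls (\<lambda>y. \<phi> (t, y)))" for n
    by (simp only: cls_scaleR[OF L2_diff[OF sl sl]] cls_diff[OF sl sl])
  ultimately show "((\<lambda>r. (1 / (r - t)) *\<^sub>R (cls (\<lambda>y. \<phi> (r, y)) - cls (\<lambda>y. \<phi> (t, y)))) \<circ> X) \<longlonglongrightarrow> cls (\<lambda>y. dird \<phi> (1, 0) (t, y))"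
    by (simp only: o_def)
qed

text \<open>If \<open>g\<close> is not Lebesgue integrable, then the left-hand side is \<open>0\<close> by the default value of the integral.\<close>

lemma LINT_eq_zero:
  fixes g :: "real \<Rightarrow> complex"
  assumes "(g has_integral 0) {0..T}" shows "(LINT t:{0..T}|lborel. g t) = 0"
proof (cases "set_integrable lborel {0..T} g")
  case True
  then show ?thesis using set_borel_integral_eq_integral(2)[OF True] assms by (simp add: integral_unique)
next
  case False
  then show ?thesis by (simp add: set_integrable_def set_lebesgue_integral_def not_integrable_integral_eq)
qed

section \<open>Existence of solutions\<close>

lemma pair_IFT: "pair (IFT x) y = pair x (IFT y)"
  by (subst pair_FT_IFT) simp

lemma IFT_IFT: "IFT (IFT x) = rf x"
  using FT_IFT[of x] by (simp add: IFT_def[of "IFT x"])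

lemma mdom_IFT_symb:
  assumes "mdom (symb s) (FT x)"
  shows "mdom (symb s) (IFT x)" "IFT (IFT (mul (symb s) (FT x))) = mul (symb s) (IFT x)"
  using mul_rf[OF symb_measurable assms] by (simp_all add: IFT_def[of x] IFT_IFT)

lemma pair_freeS: "pair (freeS s t x) y = pair x (freeS s t y)"
  unfolding freeS_def by (rule pair_mul) (rule bmult_mdom[OF bmult_cis])+

text \<open>The operator \<open>(-\<Delta>)^s + p\<close>, which is its own transpose for \<open>pair\<close>.\<close>

definition gen :: "real \<Rightarrow> ('a::euclidean_space \<Rightarrow> real) \<Rightarrow> 'a lsq \<Rightarrow> 'a lsq" where
  "gen s p x = IFT (mul (symb s) (FT x)) + mul (\<lambda>y. of_real (p y)) x"

context schroedinger begin

lemma integrand_eq: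
  assumes "u \<in> L2" "f \<in> L2" "g \<in> L2" "mdom (symb s) (FT (cls f))"
  shows "(\<integral>x. u x * (- \<i> * g x + frac_laplacian s f x + of_real (p x) * f x) \<partial>lborel) =
    pair (cls u) (mul (\<lambda>_. - \<i>) (cls g) + gen s p (cls f))"
proof -
  note F = frac_laplacian_spec[OF assms(2,4)]
  have pf: "(\<lambda>x. of_real (p x) * f x) \<in> L2" using p_bound by (intro L2_mult_bounded[OF assms(2), of _ M]) auto
  have pm: "(\<lambda>x. complex_of_real (p x)) \<in> borel_measurable borel" by measurable
  have "cls (\<lambda>x. - \<i> * g x + frac_laplacian s f x + of_real (p x) * f x) = mul (\<lambda>_. - \<i>) (cls g) + gen s p (cls f)"
    using assms(2,3) F pf
    by (simp only: cls_add L2_add L2_cmult mul_const_cls gen_def mdom_cls(2)[OF assms(2) pm pf] add.assoc)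
  moreover have "(\<lambda>x. - \<i> * g x + frac_laplacian s f x + of_real (p x) * f x) \<in> L2"
    by (intro L2_add L2_cmult assms F pf)
  ultimately show ?thesis using pair_cls[OF assms(1)] by metis
qed

text \<open>For a test function \<open>\<phi>\<close> the function \<open>Y t = pair (u t) (\<phi> t)\<close> equals, in the interaction picture,
  \<open>pair (sol t) (S t (IFT (\<phi> t)))\<close>. The first factor is differentiable by construction and the second one because \<open>\<phi> t\<close> is
  smooth, although \<open>u\<close> itself need not be differentiable. The derivative of \<open>Y\<close> is \<open>i\<close> times the integrand of the weak formulation, and \<open>Y\<close> vanishes at both ends.\<close>

theorem V_solution:
  assumes u0: "u0 \<in> Hs s"
  shows "cauchy_solution T s p u0 (\<lambda>t. rep (IFT (V t (FT (cls u0)))))"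
proof -
  define w where "w = FT (cls u0)"
  have u0L: "u0 \<in> L2" and wd: "mdom (symb (s / 2)) w" using u0 by (auto simp: Hs_iff w_def)
  have Hs: "rep (IFT (V t w)) \<in> Hs s" if "t \<ge> 0" for t
    using V_mdom[OF wd that] by (simp add: Hs_iff)
  have cH: "(\<lambda>t. rep (IFT (V t w))) \<in> C_Hs T s"
    unfolding C_Hs_def
  proof (safe)
    fix t assume t: "t \<in> {0..T}"
    then show "rep (IFT (V t w)) \<in> Hs s" by (intro Hs) auto
    have eq: "Hs_norm s (\<lambda>x. rep (IFT (V \<tau> w)) x - rep (IFT (V t w)) x) = norm (V \<tau> w - V t w) + norm (mul (symb (s / 2)) (V \<tau> w - V t w))"
      if \<tau>: "\<tau> \<in> {0..T}" for \<tau>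
    proof -
      have c: "cls (\<lambda>x. rep (IFT (V \<tau> w)) x - rep (IFT (V t w)) x) = IFT (V \<tau> w - V t w)"
        by (simp add: cls_diff linear_diff[OF bounded_linear.linear[OF bounded_linear_IFT]])
      have "mdom (symb (s / 2)) (V \<tau> w - V t w)" using t \<tau> by (intro mdom_diff V_mdom wd) auto
      then have "(\<lambda>x. rep (IFT (V \<tau> w)) x - rep (IFT (V t w)) x) \<in> Hs s" by (simp add: Hs_iff c L2_diff)
      from Hs_norm_eq[OF this] show ?thesis by (simp add: c)
    qed
    have "((\<lambda>\<tau>. V \<tau> w) \<longlongrightarrow> V t w) (at t within {0..T})"
      using V_continuous[of T w] t by (auto simp: continuous_on_def)
    then have "((\<lambda>\<tau>. norm (V \<tau> w - V t w)) \<longlongrightarrow> 0) (at t within {0..T})"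
      by (intro tendsto_norm_zero LIM_zero)
    from tendsto_add[OF this V_symb_continuous[OF wd t]]
    have "((\<lambda>\<tau>. norm (V \<tau> w - V t w) + norm (mul (symb (s / 2)) (V \<tau> w - V t w))) \<longlongrightarrow> 0) (at t within {0..T})" by simp
    then show "((\<lambda>\<tau>. Hs_norm s (\<lambda>x. rep (IFT (V \<tau> w)) x - rep (IFT (V t w)) x)) \<longlongrightarrow> 0) (at t within {0..T})"
      by (rule Lim_transform_eventually) (auto simp: eventually_at_filter eq)
  qed
  have eq: "schroedinger_eq T s p (\<lambda>t. rep (IFT (V t w)))"
    unfolding schroedinger_eq_def
  proof
    fix \<phi> :: "real \<times> 'a \<Rightarrow> complex" assume \<phi>: "\<phi> \<in> test_functions T"
    note sl = csm_L2(1)[OF csm_slice(1)[OF \<phi>]] csm_L2(1)[OF csm_slice(2)[OF \<phi>]]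
    define \<Phi> where "\<Phi> t = cls (\<lambda>y. \<phi> (t, y))" for t
    define \<Phi>' where "\<Phi>' t = cls (\<lambda>y. dird \<phi> (1, 0) (t, y))" for t
    have md: "mdom (symb s) (FT (\<Phi> t))" for t
      unfolding \<Phi>_def using s by (intro csm_mdom csm_slice[OF \<phi>]) auto
    define I where "I t = pair (IFT (V t w)) (mul (\<lambda>_. - \<i>) (\<Phi>' t) + gen s p (\<Phi> t))" for t
    have int: "(\<integral>x. rep (IFT (V t w)) x * (- \<i> * vector_derivative (\<lambda>\<tau>. \<phi> (\<tau>, x)) (at t)
         + frac_laplacian s (\<lambda>y. \<phi> (t, y)) x + of_real (p x) * \<phi> (t, x)) \<partial>lborel) = I t" for t
      unfolding time_derivative_test_function[OF \<phi>]
      by (subst integrand_eq[OF rep_L2 sl(1) sl(2) md[unfolded \<Phi>_def]]) (simp add: I_def \<Phi>_def \<Phi>'_def)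
    define Y where "Y t = pair (IFT (V t w)) (\<Phi> t)" for t
    define G where "G t = IFT (\<Phi> t)" for t
    have Yeq: "Y t = pair (sol w t) (freeS s t (G t))" for t
      unfolding Y_def pair_IFT V_def G_def by (rule pair_freeS)
    have Yd: "(Y has_vector_derivative \<i> * I t) (at t within {0..T})" if t: "t \<in> {0..T}" for t
    proof -
      have "(G has_vector_derivative IFT (\<Phi>' t)) (at t within {0..T})"
        unfolding G_def \<Phi>_def \<Phi>'_def
        by (rule bounded_linear.has_vector_derivative[OF bounded_linear_IFT test_function_curve[OF \<phi>]])
      moreover have Gd: "mdom (symb s) (G t)" unfolding G_def by (rule mdom_IFT_symb(1)[OF md])
      ultimately have "((\<lambda>t. freeS s t (G t)) has_vector_derivative freeS s t (IFT (\<Phi>' t) + imul (mul (symb s) (G t)))) (at t within {0..T})"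
        using freeS_derivative[of G "IFT (\<Phi>' t)" t "{0..T}" s 1] by simp
      from bounded_bilinear.has_vector_derivative[OF bounded_bilinear_pair sol_deriv[OF t, of w] this]
      have "(Y has_vector_derivative pair (sol w t) (freeS s t (IFT (\<Phi>' t) + imul (mul (symb s) (G t)))) + pair (B t (sol w t)) (freeS s t (G t))) (at t within {0..T})"
        unfolding Yeq[abs_def] .
      also have "pair (sol w t) (freeS s t (IFT (\<Phi>' t) + imul (mul (symb s) (G t)))) = pair (V t w) (IFT (\<Phi>' t) + imul (mul (symb s) (G t)))"
        unfolding V_def by (rule pair_freeS[symmetric])
      also have "\<dots> = pair (IFT (V t w)) (\<Phi>' t) + \<i> * pair (IFT (V t w)) (IFT (mul (symb s) (FT (\<Phi> t))))"
        unfolding pair_IFT mdom_IFT_symb(2)[OF md] G_def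
        by (simp add: pair_commute[of "V t w"] pair_add pair_cmult)
      also have "pair (B t (sol w t)) (freeS s t (G t)) = pair (imul (pot p (V t w))) (freeS s (- t) (freeS s t (G t)))"
        unfolding B_def V_def[symmetric] by (rule pair_freeS)
      also have "\<dots> = \<i> * pair (pot p (V t w)) (G t)" by (simp add: pair_cmult)
      also have "pair (pot p (V t w)) (G t) = pair (IFT (V t w)) (mul (\<lambda>y. of_real (p y)) (\<Phi> t))"
        unfolding pot_def G_def pair_FT FT_IFT by (rule pair_mul) (rule bmult_mdom[OF p_bmult])+
      also have "pair (IFT (V t w)) (\<Phi>' t) + \<i> * pair (IFT (V t w)) (IFT (mul (symb s) (FT (\<Phi> t)))) + \<i> * pair (IFT (V t w)) (mul (\<lambda>y. of_real (p y)) (\<Phi> t)) = \<i> * I t"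
        unfolding I_def gen_def
        by (simp add: pair_commute[of "IFT (V t w)"] pair_add pair_cmult ring_distribs)
      finally show ?thesis .
    qed
    show "(LINT t:{0..T}|lborel. (\<integral>x. rep (IFT (V t w)) x * (- \<i> * vector_derivative (\<lambda>\<tau>. \<phi> (\<tau>, x)) (at t)
         + frac_laplacian s (\<lambda>y. \<phi> (t, y)) x + of_real (p x) * \<phi> (t, x)) \<partial>lborel)) = 0"
      unfolding int
    proof (cases "T \<ge> 0")
      case True
      obtain R where R: "\<And>t x. t \<notin> {0<..<T} \<Longrightarrow> \<phi> (t, x) = 0" using test_function_props[OF \<phi>] by metis
      have "\<Phi> T = 0" "\<Phi> 0 = 0" by (auto simp: \<Phi>_def R zero_lsq_def)
      then have "Y T = 0" "Y 0 = 0" by (auto simp: Y_def bounded_bilinear.zero_right[OF bounded_bilinear_pair])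
      then have "((\<lambda>t. \<i> * I t) has_integral 0) {0..T}"
        using fundamental_theorem_of_calculus[OF True Yd] by simp
      from has_integral_mult_right[OF this, of "- \<i>"] have "(I has_integral 0) {0..T}" by simp
      then show "(LINT t:{0..T}|lborel. I t) = 0" by (rule LINT_eq_zero)
    qed (simp add: set_lebesgue_integral_def)
  qed
  have "IFT (V 0 w) = cls u0" by (simp add: w_def)
  then have "AE x in lborel. rep (IFT (V 0 w)) x = u0 x" using rep_cls[OF u0L] by simp
  then show ?thesis using cH eq by (simp add: cauchy_solution_def w_def)
qed

end

section \<open>Bump functions and the du Bois-Reymond lemma\<close>

text \<open>A family of flat functions, \<open>P (1/x) exp (-1/x)\<close> on the positive axis, that is closed under differentiation; this
  gives smoothness by induction.\<close>

definition flat :: "real poly \<Rightarrow> real \<Rightarrow> real" where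
  "flat P x = (if x \<le> 0 then 0 else poly P (1 / x) * exp (- (1 / x)))"

lemma poly_exp_tendsto_0: "((\<lambda>y. poly P y * exp (- y)) \<longlongrightarrow> (0::real)) at_top"
proof -
  have "((\<lambda>y. \<Sum>i\<le>degree P. coeff P i * (y ^ i / exp y)) \<longlongrightarrow> (\<Sum>i\<le>degree P. coeff P i * 0)) at_top"
    by (intro tendsto_sum tendsto_mult tendsto_const tendsto_power_div_exp_0)
  moreover have "(\<lambda>y. \<Sum>i\<le>degree P. coeff P i * (y ^ i / exp y)) = (\<lambda>y. poly P y * exp (- y))"
    by (auto simp: poly_altdef exp_minus divide_inverse sum_distrib_right mult.assoc)
  ultimately show ?thesis by simp
qed

lemma flat_tendsto_0: "(flat P \<longlongrightarrow> 0) (at 0)"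
proof -
  have "((\<lambda>x. poly P (inverse x) * exp (- (inverse x))) \<longlongrightarrow> 0) (at_right 0)"
    by (rule filterlim_compose[OF poly_exp_tendsto_0 filterlim_inverse_at_top_right])
  moreover have "\<forall>\<^sub>F x in at_right 0. poly P (inverse x) * exp (- (inverse x)) = flat P x"
    using eventually_at_right_less[of 0] by eventually_elim (simp add: flat_def inverse_eq_divide)
  ultimately have r: "(flat P \<longlongrightarrow> 0) (at_right 0)" by (rule Lim_transform_eventually)
  have "\<forall>\<^sub>F x in at_left 0. 0 = flat P x"
    by (auto simp: eventually_at_filter flat_def)
  then have l: "(flat P \<longlongrightarrow> 0) (at_left 0)" by (rule Lim_transform_eventually[OF tendsto_const])
  show ?thesis using l r filterlim_split_at by blast
qed

text \<open>With \<open>y = 1/x\<close> one has \<open>dy/dx = - y^2\<close>, so the derivative replaces \<open>P\<close> by \<open>y^2 (P - P')\<close>.\<close>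

definition flat' :: "real poly \<Rightarrow> real poly" where
  "flat' P = [:0, 0, 1:] * (P - pderiv P)"

lemma DERIV_flat: "(flat P has_real_derivative flat (flat' P) x) (at x)"
proof -
  consider "x < 0" | "x = 0" | "x > 0" by linarith
  then show ?thesis
  proof cases
    case 1
    have d: "((\<lambda>_. 0) has_real_derivative flat (flat' P) x) (at x)" using 1 by (simp add: flat_def)
    have "\<forall>\<^sub>F y in nhds x. y < 0" using eventually_nhds_in_open[of "{..<0}" x] 1 by auto
    then have "\<forall>\<^sub>F y in nhds x. 0 = flat P y"
      by eventually_elim (simp add: flat_def)
    from DERIV_cong_ev[OF refl this refl, THEN iffD1, OF d] show ?thesis .
  next
    case 2
    have "flat P y / y = flat ([:0, 1:] * P) y" for y
      by (simp add: flat_def)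
    then have "((\<lambda>y. (flat P y - flat P 0) / (y - 0)) \<longlongrightarrow> 0) (at 0)"
      using flat_tendsto_0[of "[:0, 1:] * P"] by (simp add: flat_def[of P 0])
    then show ?thesis unfolding 2 has_field_derivative_iff by (simp add: flat_def[of _ 0])
  next
    case 3
    have "((\<lambda>x. poly P (1 / x) * exp (- (1 / x))) has_real_derivative
       (poly (pderiv P) (1 / x) * (- (1 / x\<^sup>2))) * exp (- (1 / x)) + exp (- (1 / x)) * (1 / x\<^sup>2) * poly P (1 / x)) (at x)"
      using 3 by (auto intro!: derivative_eq_intros DERIV_chain2[OF poly_DERIV] simp: power2_eq_square field_simps)
    also have "(poly (pderiv P) (1 / x) * (- (1 / x\<^sup>2))) * exp (- (1 / x)) + exp (- (1 / x)) * (1 / x\<^sup>2) * poly P (1 / x) = flat (flat' P) x"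
      using 3 by (simp add: flat_def flat'_def power2_eq_square algebra_simps)
    finally have d: "((\<lambda>x. poly P (1 / x) * exp (- (1 / x))) has_real_derivative flat (flat' P) x) (at x)" .
    have "\<forall>\<^sub>F y in nhds x. y > 0" using eventually_nhds_in_open[of "{0<..}" x] 3 by auto
    then have "\<forall>\<^sub>F y in nhds x. poly P (1 / y) * exp (- (1 / y)) = flat P y"
      by eventually_elim (simp add: flat_def)
    from DERIV_cong_ev[OF refl this refl, THEN iffD1, OF d] show ?thesis .
  qed
qed

lemma Ck_flat:
  assumes g: "\<And>z. (g has_derivative g' z) (at z)" "\<And>v k. Ck k (\<lambda>z. complex_of_real (g' z v))"
  shows "Ck k (\<lambda>z. complex_of_real (flat P (g z)))"
proof -
  have d: "((\<lambda>z. complex_of_real (flat P (g z))) has_derivative (\<lambda>v. complex_of_real (flat (flat' P) (g z)) * complex_of_real (g' z v))) (at z)" for z P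
  proof -
    have "((\<lambda>z. flat P (g z)) has_derivative (\<lambda>v. flat (flat' P) (g z) * g' z v)) (at z)"
      using has_derivative_compose[OF g(1) DERIV_flat[unfolded has_field_derivative_def], of P z] .
    from has_derivative_of_real[OF this] show ?thesis by simp
  qed
  show ?thesis
  proof (induct k arbitrary: P)
    case 0
    show ?case unfolding Ck.simps
      by (intro continuous_at_imp_continuous_on ballI has_derivative_continuous[OF d])
  next
    case (Suc k)
    show ?case by (rule Ck_SucI[OF d]) (intro Ck_mult Suc g)
  qed
qed

lemma Ck_linear:
  assumes L: "bounded_linear L" shows "Ck k L"
proof (cases k)
  case 0 then show ?thesis using bounded_linear.continuous_on[OF L continuous_on_id] by simp
next
  case (Suc j)
  show ?thesis unfolding Suc
    by (rule Ck_SucI[of L "\<lambda>z. L"]) (auto intro: bounded_linear_imp_has_derivative L)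
qed

definition bump :: "'a::euclidean_space \<Rightarrow> real" where
  "bump x = flat 1 (1 - inner x x)"

lemma bump_nonneg: "bump x \<ge> 0" by (simp add: bump_def flat_def)

lemma bump_pos: "norm x < 1 \<Longrightarrow> bump x > 0"
proof -
  assume "norm x < 1"
  then have "(norm x)\<^sup>2 < 1" by (simp add: power_less_one_iff abs_square_less_1)
  then show ?thesis by (simp add: bump_def flat_def dot_square_norm)
qed

lemma bump_zero: "norm x \<ge> 1 \<Longrightarrow> bump x = 0"
proof -
  assume "norm x \<ge> 1"
  then have "(norm x)\<^sup>2 \<ge> 1" by (simp add: one_le_power)
  then show ?thesis by (simp add: bump_def flat_def dot_square_norm)
qed

lemma Ck_bump: "Ck k (\<lambda>x. complex_of_real (bump x))"
  unfolding bump_def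
proof (rule Ck_flat)
  show "((\<lambda>x. 1 - inner x x) has_derivative (\<lambda>v. - 2 * inner x v)) (at x)" for x :: 'a
  proof -
    have "((\<lambda>x. 1 - inner x x) has_derivative (\<lambda>v. 0 - (inner x v + inner v x))) (at x)"
      by (intro derivative_intros)
    then show ?thesis by (simp add: inner_commute)
  qed
  show "Ck k (\<lambda>x. complex_of_real (- 2 * inner x v))" for v :: 'a and k
  proof (rule Ck_linear)
    have "bounded_linear (\<lambda>x. complex_of_real (inner x v))"
      by (intro bounded_linear_compose[OF bounded_linear_of_real] bounded_linear_inner_left)
    from bounded_linear_const_mult[OF this, of "-2"] show "bounded_linear (\<lambda>x. complex_of_real (- 2 * inner x v))" by simp
  qed
qed

text \<open>Concentrated in the ball of radius \<open>1 / n\<close> about \<open>a\<close>.\<close>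

definition sbump :: "real \<Rightarrow> 'a::euclidean_space \<Rightarrow> 'a \<Rightarrow> complex" where
  "sbump n a x = complex_of_real (bump (n *\<^sub>R (x - a)))"

lemma Ck_sbump: "Ck k (sbump n a)"
proof -
  have "Ck k (\<lambda>x. complex_of_real (bump (- (n *\<^sub>R a) + n *\<^sub>R x)))"
    by (rule Ck_affine[OF bounded_linear_scaleR_right Ck_bump])
  then show ?thesis unfolding sbump_def[abs_def] by (simp add: scaleR_diff_right)
qed

lemma sbump_zero: "n > 0 \<Longrightarrow> norm (x - a) \<ge> 1 / n \<Longrightarrow> sbump n a x = 0"
proof -
  assume n: "n > 0" and "norm (x - a) \<ge> 1 / n"
  then have "1 \<le> n * norm (x - a)" by (simp add: field_simps)
  then have "norm (n *\<^sub>R (x - a)) \<ge> 1" using n by (simp only: norm_scaleR abs_of_pos)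
  then show ?thesis unfolding sbump_def by (simp only: bump_zero of_real_0)
qed

lemma csm_sbump:
  fixes a :: "'a::euclidean_space"
  assumes n: "n > 0" shows "csm (sbump n a)"
  unfolding csm_def
proof (intro conjI allI exI[of _ "norm a + 1 / n"] impI)
  fix x :: 'a assume "norm x > norm a + 1 / n"
  then show "sbump n a x = 0"
    using norm_triangle_ineq2[of x a] by (intro sbump_zero n) auto
qed (rule Ck_sbump)

lemma integral_pos_of_open:
  fixes f :: "'a::euclidean_space \<Rightarrow> real"
  assumes "integrable lborel f" "\<And>x. f x \<ge> 0" "open S" "S \<noteq> {}" "\<And>x. x \<in> S \<Longrightarrow> f x > 0"
  shows "(\<integral>x. f x \<partial>lborel) > 0"
proof (rule ccontr)
  assume "\<not> ?thesis"
  moreover have "(\<integral>x. f x \<partial>lborel) \<ge> 0" by (rule integral_nonneg_AE) (simp add: assms(2))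
  ultimately have "(\<integral>x. f x \<partial>lborel) = 0" by simp
  then have "AE x in lborel. f x = 0" using integral_nonneg_eq_0_iff_AE[OF assms(1)] assms(2) by simp
  then have "AE x in lborel. x \<notin> S" by eventually_elim (use assms(5) in force)
  then have "S \<in> null_sets lborel" using assms(3) by (simp add: AE_iff_null_sets)
  then have "negligible S" by (simp add: negligible_iff_null_sets null_sets_completionI)
  then show False using open_not_negligible[OF assms(3,4)] by simp
qed

text \<open>On the support \<open>|x \<bullet> \<xi>| \<le> 1 < \<pi> / 2\<close>, so the cosine is positive and the real part of the transform is a
  positive integral.\<close>

lemma fourier_sbump_nonzero:
  fixes \<xi> :: "'a::euclidean_space"
  assumes n: "n > 0" and \<xi>: "norm \<xi> \<le> n" shows "fourier_L1 (sbump n 0) \<xi> \<noteq> 0"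
proof -
  define f where "f x = cos (x \<bullet> \<xi>) * bump (n *\<^sub>R x)" for x :: 'a
  have re: "Re (cis (- (x \<bullet> \<xi>)) * sbump n 0 x) = f x" for x by (simp add: sbump_def f_def)
  have int: "integrable lborel (\<lambda>x. cis (- (x \<bullet> \<xi>)) * sbump n 0 x)"
    by (rule integrable_cis_mult[OF csm_L2(2)[OF csm_sbump[OF n]]])
  have c: "cos (x \<bullet> \<xi>) > 0" if "norm (n *\<^sub>R x) < 1" for x
  proof -
    have "\<bar>x \<bullet> \<xi>\<bar> \<le> norm x * norm \<xi>" by (rule Cauchy_Schwarz_ineq2)
    also have "\<dots> \<le> norm x * n" using \<xi> by (intro mult_left_mono) auto
    also have "\<dots> < 1" using that n by (simp add: mult.commute)
    finally have "\<bar>x \<bullet> \<xi>\<bar> < pi / 2" using pi_gt3 by linarith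
    then show ?thesis by (intro cos_gt_zero_pi) auto
  qed
  have "(\<integral>x. f x \<partial>lborel) > 0"
  proof (rule integral_pos_of_open[of _ "ball 0 (1 / n)"])
    show "integrable lborel f" using integrable_Re[OF int] by (simp only: re)
    show "f x \<ge> 0" for x
      using c[of x] bump_nonneg[of "n *\<^sub>R x"] bump_zero[of "n *\<^sub>R x"] by (cases "norm (n *\<^sub>R x) < 1") (auto simp: f_def)
    show "f x > 0" if "x \<in> ball 0 (1 / n)" for x
    proof -
      have "norm (n *\<^sub>R x) < 1" using that n by (simp add: field_simps)
      then show ?thesis using c[of x] bump_pos[of "n *\<^sub>R x"] by (simp add: f_def)
    qed
  qed (use n in auto)
  also have "(\<integral>x. f x \<partial>lborel) = Re (\<integral>x. cis (- (x \<bullet> \<xi>)) * sbump n 0 x \<partial>lborel)"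
    unfolding re[symmetric] by (rule integral_Re[OF int])
  finally show ?thesis by (auto simp: fourier_L1_def)
qed

lemma fourier_L1_translate:
  assumes "integrable lborel f"
  shows "fourier_L1 (\<lambda>x. f (x - a)) \<xi> = cis (- (a \<bullet> \<xi>)) * fourier_L1 f \<xi>"
proof -
  have [measurable]: "f \<in> borel_measurable borel" using assms by auto
  have "(\<integral>x. cis (- (x \<bullet> \<xi>)) * f (x - a) \<partial>lborel) = (\<integral>x. cis (- ((a + 1 *\<^sub>R x) \<bullet> \<xi>)) * f ((a + 1 *\<^sub>R x) - a) \<partial>lborel)"
    by (rule integral_lborel_affine[symmetric]) auto
  also have "\<dots> = (\<integral>x. cis (- (a \<bullet> \<xi>)) * (cis (- (x \<bullet> \<xi>)) * f x) \<partial>lborel)"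
    by (intro Bochner_Integration.integral_cong refl) (simp add: inner_add_left cis_mult mult.assoc[symmetric])
  finally show ?thesis unfolding fourier_L1_def by simp
qed

lemma product_test_function:
  fixes g :: "'a::euclidean_space \<Rightarrow> complex"
  assumes \<theta>: "\<And>k. Ck k \<theta>" "0 < \<alpha>" "\<beta> < T" "\<And>t. t \<notin> {\<alpha>..\<beta>} \<Longrightarrow> \<theta> t = 0" and g: "csm g"
  shows "(\<lambda>z. \<theta> (fst z) * g (snd z)) \<in> test_functions T"
proof -
  obtain R where R: "\<And>x. norm x > R \<Longrightarrow> g x = 0" using csm_bound[OF g] by metis
  have "Ck k (\<lambda>z. \<theta> (0 + fst z) * g (0 + snd z))" for k
    by (intro Ck_mult Ck_affine[OF bounded_linear_fst] Ck_affine[OF bounded_linear_snd] \<theta> csm_D g)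
  then have Ck: "Ck k (\<lambda>z. \<theta> (fst z) * g (snd z))" for k by simp
  have c: "compact ({\<alpha>..\<beta>} \<times> cball (0::'a) R)" by (intro compact_Times) auto
  have s: "{\<alpha>..\<beta>} \<times> cball (0::'a) R \<subseteq> {0<..<T} \<times> UNIV" using \<theta>(2,3) by auto
  have "\<theta> (fst z) * g (snd z) = 0" if "z \<notin> {\<alpha>..\<beta>} \<times> cball 0 R" for z
    using that \<theta>(4)[of "fst z"] R[of "snd z"] by (cases z) (auto simp: not_le)
  then show ?thesis unfolding test_functions_def using Ck c s by blast
qed

lemma integral_eq_LINT_support:
  fixes f :: "real \<Rightarrow> complex"
  assumes "continuous_on UNIV f" "\<And>t. t \<notin> {0..b} \<Longrightarrow> f t = 0"
  shows "integral {0..b} f = (\<integral>t. f t \<partial>lborel)"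
proof -
  have "continuous_on {0..b} f" using assms(1) by (rule continuous_on_subset) simp
  from set_borel_integral_eq_integral(2)[OF borel_integrable_atLeastAtMost'[OF this]]
  have "integral {0..b} f = (\<integral>t. indicator {0..b} t *\<^sub>R f t \<partial>lborel)" by (simp add: set_lebesgue_integral_def)
  also have "(\<lambda>t. indicator {0..b} t *\<^sub>R f t) = f" using assms(2) by (auto simp: indicator_def fun_eq_iff)
  finally show ?thesis by simp
qed

text \<open>Two bumps of equal mass: their difference has integral \<open>0\<close>, so its antiderivative has compact support.\<close>

lemma test_antiderivative:
  fixes n t1 t2 :: real
  assumes n: "n > 0" and \<alpha>: "0 < \<alpha>" "\<alpha> < t1 - 1 / n" "\<alpha> < t2 - 1 / n" and \<beta>: "t1 + 1 / n < \<beta>" "t2 + 1 / n < \<beta>"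
  obtains \<theta> where "\<And>k. Ck k \<theta>" "\<And>t. t \<notin> {\<alpha>..\<beta>} \<Longrightarrow> \<theta> t = 0"
    "\<And>t. (\<theta> has_vector_derivative sbump n t1 t - sbump n t2 t) (at t)"
proof -
  define r where "r t = sbump n t1 t - sbump n t2 t" for t
  have Ckr: "Ck k r" for k
  proof -
    have "Ck k (\<lambda>t. sbump n t1 t + (-1) * sbump n t2 t)" by (intro Ck_add Ck_mult Ck_sbump Ck_const)
    then show ?thesis by (simp add: r_def[abs_def])
  qed
  have cont: "continuous_on A (sbump n a)" for A and a :: real
  proof -
    have "Ck 0 (sbump n a)" by (rule Ck_sbump)
    then show ?thesis by (auto intro: continuous_on_subset)
  qed
  have contr: "continuous_on A r" for A unfolding r_def[abs_def] by (intro continuous_intros cont)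
  have z: "sbump n t1 t = 0 \<and> sbump n t2 t = 0" if "t \<le> \<alpha> \<or> t \<ge> \<beta>" for t
    using that \<alpha> \<beta> by (intro conjI sbump_zero n) (auto simp: abs_le_iff abs_if)
  have r0: "r t = 0" if "t \<le> \<alpha> \<or> t \<ge> \<beta>" for t using z[OF that] by (simp add: r_def)
  define \<theta> where "\<theta> t = integral {0..t} r" for t
  have \<theta>a: "\<theta> t = 0" if "t \<le> \<alpha>" for t
  proof -
    have "integral {0..t} r = integral {0..t} (\<lambda>_. 0)" by (intro integral_cong) (use r0 that in auto)
    then show ?thesis by (simp add: \<theta>_def)
  qed
  have \<theta>b: "\<theta> t = 0" if "t \<ge> \<beta>" for t
  proof -
    have "integral {0..t} (sbump n a) = (\<integral>x. sbump n 0 (x::real) \<partial>lborel)" if a: "a = t1 \<or> a = t2" for a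
    proof -
      have "integral {0..t} (sbump n a) = (\<integral>x. sbump n a x \<partial>lborel)"
        by (rule integral_eq_LINT_support[OF cont]) (use z \<open>t \<ge> \<beta>\<close> \<alpha> a in auto)
      also have "\<dots> = (\<integral>x. sbump n a (a + 1 *\<^sub>R x) \<partial>lborel)"
        by (rule integral_lborel_affine[symmetric]) (auto intro: borel_measurable_continuous_onI cont)
      finally show ?thesis by (simp add: sbump_def)
    qed
    then have "integral {0..t} (sbump n t1) = integral {0..t} (sbump n t2)" by simp
    then show ?thesis unfolding \<theta>_def r_def[abs_def]
      by (subst integral_diff) (auto intro!: integrable_continuous_real cont)
  qed
  have d: "(\<theta> has_vector_derivative r t) (at t)" for t
  proof (cases "t < \<alpha>")
    case True
    have "((\<lambda>_. 0) has_vector_derivative 0) (at t)" by simp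
    then have "(\<theta> has_vector_derivative 0) (at t)"
      by (rule has_vector_derivative_transform_within_open[where S = "{..<\<alpha>}"]) (use True \<theta>a in auto)
    then show ?thesis using r0[of t] True by simp
  next
    case False
    then have t: "0 < t" "t < t + 1" using \<alpha> by auto
    have "(\<theta> has_vector_derivative r t) (at t within {0..t + 1})"
      unfolding \<theta>_def[abs_def] by (rule integral_has_vector_derivative[OF contr]) (use t in auto)
    then show ?thesis using at_within_Icc_at[OF t] by simp
  qed
  have "Ck (Suc k) \<theta>" for k
  proof (rule Ck_SucI)
    show "(\<theta> has_derivative (\<lambda>h. of_real h * r t)) (at t)" for t
      using d[of t] by (simp add: has_vector_derivative_def scaleR_conv_of_real)
    show "Ck k (\<lambda>t. complex_of_real v * r t)" for v by (intro Ck_mult Ck_const Ckr)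
  qed
  then have "Ck k \<theta>" for k by (rule Ck_Suc_lower)
  moreover have "\<theta> t = 0" if "t \<notin> {\<alpha>..\<beta>}" for t using that \<theta>a[of t] \<theta>b[of t] by auto
  ultimately show thesis using that[of \<theta>] d by (auto simp: r_def)
qed

text \<open>Integration by parts shows that \<open>c t = a t - i \<integral>_0^t e\<close> has integral \<open>0\<close> against the derivative of every test
  function. If \<open>c\<close> took different values at two points, the derivative given by the difference of two
  narrow bumps around them would detect it; so \<open>c\<close> is constant.\<close>

lemma du_Bois_Reymond:
  fixes a e :: "real \<Rightarrow> complex"
  assumes T: "T > 0" and a: "continuous_on {0..T} a" and e: "continuous_on {0..T} e"
    and H: "\<And>\<theta> \<theta>' \<alpha> \<beta>. (\<And>k. Ck k \<theta>) \<Longrightarrow> 0 < \<alpha> \<Longrightarrow> \<beta> < T \<Longrightarrow> (\<And>t. t \<notin> {\<alpha>..\<beta>} \<Longrightarrow> \<theta> t = 0) \<Longrightarrow>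
      (\<And>t. (\<theta> has_vector_derivative \<theta>' t) (at t)) \<Longrightarrow> continuous_on UNIV \<theta>' \<Longrightarrow>
      integral {0..T} (\<lambda>t. - \<i> * \<theta>' t * a t + \<theta> t * e t) = 0"
    and t: "t \<in> {0..T}"
  shows "a t - a 0 = \<i> * integral {0..t} e"
proof -
  define E where "E t = integral {0..t} e" for t
  define c where "c t = a t - \<i> * E t" for t
  have Ed: "(E has_vector_derivative e t) (at t within {0..T})" if "t \<in> {0..T}" for t
    unfolding E_def[abs_def] by (rule integral_has_vector_derivative[OF e that])
  have Ec: "continuous_on {0..T} E" unfolding E_def[abs_def] by (intro indefinite_integral_continuous_1 integrable_continuous_real e)
  have cc: "continuous_on {0..T} c" unfolding c_def[abs_def] by (intro continuous_intros a Ec)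
  have const: "c t1 = c t2" if t1: "t1 \<in> {0<..<T}" and t2: "t2 \<in> {0<..<T}" for t1 t2
  proof (rule ccontr)
    assume ne: "c t1 \<noteq> c t2"
    define \<epsilon> where "\<epsilon> = cmod (c t1 - c t2) / 4"
    have \<epsilon>: "\<epsilon> > 0" using ne by (simp add: \<epsilon>_def)
    obtain d1 where d1: "d1 > 0" "\<And>t. t \<in> {0..T} \<Longrightarrow> \<bar>t - t1\<bar> < d1 \<Longrightarrow> cmod (c t - c t1) < \<epsilon>"
      using cc[unfolded continuous_on_iff, rule_format, of t1 \<epsilon>] t1 \<epsilon> by (auto simp: dist_norm)
    obtain d2 where d2: "d2 > 0" "\<And>t. t \<in> {0..T} \<Longrightarrow> \<bar>t - t2\<bar> < d2 \<Longrightarrow> cmod (c t - c t2) < \<epsilon>"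
      using cc[unfolded continuous_on_iff, rule_format, of t2 \<epsilon>] t2 \<epsilon> by (auto simp: dist_norm)
    \<comment> \<open>The radius of the bumps: \<open>c\<close> is nearly constant on their supports, which stay away from \<open>0\<close> and \<open>T\<close>.\<close>
    define \<delta> where "\<delta> = Min {d1, d2, t1 / 2, t2 / 2, (T - t1) / 2, (T - t2) / 2}"
    have \<delta>: "\<delta> > 0" "\<delta> \<le> d1" "\<delta> \<le> d2" "\<delta> \<le> t1 / 2" "\<delta> \<le> t2 / 2" "\<delta> \<le> (T - t1) / 2" "\<delta> \<le> (T - t2) / 2"
    proof -
      show "\<delta> > 0" unfolding \<delta>_def using d1(1) d2(1) t1 t2 by (subst Min_gr_iff) auto
    qed (unfold \<delta>_def, (rule Min_le; simp)+)
    define n where "n = 1 / \<delta>"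
    have n: "n > 0" "1 / n = \<delta>" using \<delta>(1) by (auto simp: n_def)
    define m1 where "m1 = min t1 t2"
    define m2 where "m2 = min (T - t1) (T - t2)"
    define \<alpha> where "\<alpha> = m1 / 4"
    define \<beta> where "\<beta> = T - m2 / 4"
    have \<alpha>: "0 < \<alpha>" "\<alpha> < t1 - 1 / n" "\<alpha> < t2 - 1 / n" and \<beta>: "t1 + 1 / n < \<beta>" "t2 + 1 / n < \<beta>" "\<beta> < T"
    proof -
      have m: "0 < m1" "m1 \<le> t1" "m1 \<le> t2" "0 < m2" "m2 \<le> T - t1" "m2 \<le> T - t2"
        unfolding m1_def m2_def using t1 t2 by simp_all
      show "0 < \<alpha>" "\<beta> < T" unfolding \<alpha>_def \<beta>_def using m(1,4) by simp_all
      show "\<alpha> < t1 - 1 / n" unfolding n(2) \<alpha>_def using m(1,2) \<delta>(4) by linarith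
      show "\<alpha> < t2 - 1 / n" unfolding n(2) \<alpha>_def using m(1,3) \<delta>(5) by linarith
      show "t1 + 1 / n < \<beta>" unfolding n(2) \<beta>_def using m(4,5) \<delta>(6) by argo
      show "t2 + 1 / n < \<beta>" unfolding n(2) \<beta>_def using m(4,6) \<delta>(7) by argo
    qed
    obtain \<theta> where \<theta>: "\<And>k. Ck k \<theta>" "\<And>t. t \<notin> {\<alpha>..\<beta>} \<Longrightarrow> \<theta> t = 0"
      "\<And>t. (\<theta> has_vector_derivative sbump n t1 t - sbump n t2 t) (at t)"
      using test_antiderivative[OF n(1) \<alpha> \<beta>(1,2)] by metis
    have sc: "continuous_on A (sbump n x)" for A and x :: real
    proof -
      have "Ck 0 (sbump n x)" by (rule Ck_sbump)
      then show ?thesis by (auto intro: continuous_on_subset)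
    qed
    define r where "r t = sbump n t1 t - sbump n t2 t" for t
    have rc: "continuous_on A r" for A unfolding r_def[abs_def] by (intro continuous_intros sc)
    have \<theta>c: "continuous_on {0..T} \<theta>" using \<theta>(1)[of 0] by (auto intro: continuous_on_subset)
    have "integral {0..T} (\<lambda>t. - \<i> * r t * a t + \<theta> t * e t) = 0"
      by (rule H[OF \<theta>(1) \<alpha>(1) \<beta>(3) \<theta>(2)]) (use \<theta>(3) rc in \<open>auto simp: r_def\<close>)
    moreover have "((\<lambda>t. r t * E t + \<theta> t * e t) has_integral (\<theta> T * E T - \<theta> 0 * E 0)) {0..T}"
    proof (rule fundamental_theorem_of_calculus)
      fix t assume t: "t \<in> {0..T}"
      have "((\<lambda>t. \<theta> t * E t) has_vector_derivative \<theta> t * e t + r t * E t) (at t within {0..T})"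
        unfolding r_def by (rule has_vector_derivative_mult[OF has_vector_derivative_at_within[OF \<theta>(3)] Ed[OF t]])
      then show "((\<lambda>t. \<theta> t * E t) has_vector_derivative r t * E t + \<theta> t * e t) (at t within {0..T})"
        by (simp add: add.commute)
    qed (use T in simp)
    moreover have "\<theta> T = 0" "\<theta> 0 = 0" using \<theta>(2) \<alpha> \<beta> by auto
    moreover have "((\<lambda>t. - \<i> * r t * a t + \<theta> t * e t) has_integral integral {0..T} (\<lambda>t. - \<i> * r t * a t + \<theta> t * e t)) {0..T}"
      by (intro integrable_integral integrable_continuous_real continuous_intros rc a e \<theta>c)
    ultimately have "((\<lambda>t. (- \<i> * r t * a t + \<theta> t * e t) - (r t * E t + \<theta> t * e t)) has_integral (0 - 0)) {0..T}"
      by (intro has_integral_diff) auto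
    moreover have "(- \<i> * r t * a t + \<theta> t * e t) - (r t * E t + \<theta> t * e t) = - \<i> * (r t * c t)" for t
      by (simp add: c_def algebra_simps)
    ultimately have "((\<lambda>t. - \<i> * (r t * c t)) has_integral 0) {0..T}" by simp
    from has_integral_mult_right[OF this, of "\<i>"] have rc0: "((\<lambda>t. r t * c t) has_integral 0) {0..T}" by simp
    \<comment> \<open>The mass of a bump. Integrals of \<open>c\<close> against the two bumps agree but are close to \<open>m t1 * c t1\<close> and \<open>m t2 * c t2\<close>, respectively.\<close>
    define m where "m x = integral {0..T} (\<lambda>t. bump (n *\<^sub>R (t - x)))" for x :: real
    have bc: "continuous_on A (\<lambda>t. bump (n *\<^sub>R (t - x)))" for A and x :: real
      using continuous_on_Re[OF sc[of A x]] by (simp add: sbump_def)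
    have mi: "((\<lambda>t. sbump n x t) has_integral of_real (m x)) {0..T}" for x
      unfolding m_def sbump_def
      by (rule has_integral_of_real[OF integrable_integral[OF integrable_continuous_real[OF bc]]])
    have meq: "m t1 = m t2"
    proof -
      have "(r has_integral (\<theta> T - \<theta> 0)) {0..T}"
        by (rule fundamental_theorem_of_calculus) (use T \<theta>(3) in \<open>auto simp: r_def intro: has_vector_derivative_at_within\<close>)
      moreover have "(r has_integral (of_real (m t1) - of_real (m t2))) {0..T}"
        unfolding r_def[abs_def] by (intro has_integral_diff mi)
      ultimately have "\<theta> T - \<theta> 0 = of_real (m t1) - of_real (m t2)" by (rule has_integral_unique)
      then have "of_real (m t1) = (of_real (m t2) :: complex)" using \<open>\<theta> T = 0\<close> \<open>\<theta> 0 = 0\<close> by simp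
      then show ?thesis by (simp only: of_real_eq_iff)
    qed
    have mpos: "m t1 > 0"
    proof -
      have "m t1 \<ge> 0" unfolding m_def by (intro integral_nonneg integrable_continuous_real bc bump_nonneg)
      moreover have "m t1 \<noteq> 0"
      proof
        assume "m t1 = 0"
        moreover have "integral {0..T} (\<lambda>t. bump (n *\<^sub>R (t - t1))) = 0 \<longleftrightarrow> (\<forall>t\<in>{0..T}. bump (n *\<^sub>R (t - t1)) = 0)"
          by (rule integral_eq_0_iff[OF bc T]) (rule bump_nonneg)
        ultimately have "\<forall>t\<in>{0..T}. bump (n *\<^sub>R (t - t1)) = 0" unfolding m_def by blast
        then have "bump (n *\<^sub>R (t1 - t1)) = 0" by (rule bspec) (use t1 in simp)
        then show False using bump_pos[of "0::real"] by simp
      qed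
      ultimately show ?thesis by simp
    qed
    have est: "cmod (integral {0..T} (\<lambda>t. sbump n x t * c t) - of_real (m x) * c x) \<le> \<epsilon> * m x"
      if x: "\<And>t. t \<in> {0..T} \<Longrightarrow> \<bar>t - x\<bar> < \<delta> \<Longrightarrow> cmod (c t - c x) < \<epsilon>" for x
    proof -
      have i1: "(\<lambda>t. sbump n x t * c t) integrable_on {0..T}" by (intro integrable_continuous_real continuous_intros sc cc)
      have "((\<lambda>t. sbump n x t * c t - sbump n x t * c x) has_integral (integral {0..T} (\<lambda>t. sbump n x t * c t) - of_real (m x) * c x)) {0..T}"
        by (intro has_integral_diff integrable_integral[OF i1] has_integral_mult_left mi)
      then have eq: "integral {0..T} (\<lambda>t. sbump n x t * c t - sbump n x t * c x) = integral {0..T} (\<lambda>t. sbump n x t * c t) - of_real (m x) * c x"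
        by (rule integral_unique)
      have "cmod (integral {0..T} (\<lambda>t. sbump n x t * c t - sbump n x t * c x)) \<le> integral {0..T} (\<lambda>t. \<epsilon> * bump (n *\<^sub>R (t - x)))"
      proof (rule integral_norm_bound_integral)
        show "(\<lambda>t. sbump n x t * c t - sbump n x t * c x) integrable_on {0..T}"
          by (intro integrable_continuous_real continuous_intros sc cc)
        show "(\<lambda>t. \<epsilon> * bump (n *\<^sub>R (t - x))) integrable_on {0..T}" by (intro integrable_continuous_real continuous_intros bc)
        show "cmod (sbump n x t * c t - sbump n x t * c x) \<le> \<epsilon> * bump (n *\<^sub>R (t - x))" if t: "t \<in> {0..T}" for t
        proof -
          have b: "cmod (sbump n x t) = bump (n *\<^sub>R (t - x))" by (simp only: sbump_def norm_of_real abs_of_nonneg[OF bump_nonneg])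
          have "cmod (sbump n x t * c t - sbump n x t * c x) = bump (n *\<^sub>R (t - x)) * cmod (c t - c x)"
            unfolding right_diff_distrib[symmetric] norm_mult b ..
          also have "\<dots> \<le> bump (n *\<^sub>R (t - x)) * \<epsilon>"
          proof (cases "\<bar>t - x\<bar> < \<delta>")
            case True
            then show ?thesis using x[OF t True] bump_nonneg by (intro mult_left_mono) auto
          next
            case False
            then have "bump (n *\<^sub>R (t - x)) = 0" using \<delta>(1) by (intro bump_zero) (auto simp: n_def abs_mult field_simps)
            then show ?thesis by simp
          qed
          finally show ?thesis by (simp add: mult.commute)
        qed
      qed
      then show ?thesis unfolding eq by (simp add: m_def)
    qed
    have "integral {0..T} (\<lambda>t. sbump n t1 t * c t) - integral {0..T} (\<lambda>t. sbump n t2 t * c t) = integral {0..T} (\<lambda>t. r t * c t)"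
      unfolding r_def left_diff_distrib
      by (rule integral_diff[symmetric]) (intro integrable_continuous_real continuous_intros sc cc)+
    then have eq: "integral {0..T} (\<lambda>t. sbump n t1 t * c t) = integral {0..T} (\<lambda>t. sbump n t2 t * c t)"
      using rc0 by (simp add: integral_unique)
    let ?I = "integral {0..T} (\<lambda>t. sbump n t2 t * c t)"
    have b: "cmod (?I - of_real (m t2) * c t1) \<le> \<epsilon> * m t2" "cmod (?I - of_real (m t2) * c t2) \<le> \<epsilon> * m t2"
      using est[of t1] est[of t2] d1(2) d2(2) \<delta>(2,3) unfolding eq meq by auto
    have "cmod ((?I - of_real (m t2) * c t2) - (?I - of_real (m t2) * c t1)) \<le> \<epsilon> * m t2 + \<epsilon> * m t2"
      by (rule order_trans[OF norm_triangle_ineq4 add_mono[OF b(2,1)]])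
    also have "(?I - of_real (m t2) * c t2) - (?I - of_real (m t2) * c t1) = of_real (m t2) * (c t1 - c t2)"
      by (simp add: algebra_simps)
    finally have "m t2 * cmod (c t1 - c t2) \<le> m t2 * (2 * \<epsilon>)" using mpos meq by (simp add: norm_mult)
    then have "cmod (c t1 - c t2) \<le> 2 * \<epsilon>" using mpos meq by simp
    then show False using \<epsilon> by (simp add: \<epsilon>_def)
  qed
  have cl: "c r = c (T / 2)" if r: "r \<in> {0..T}" for r
  proof (rule continuous_constant_on_closure[of "{0<..<T}" c "c (T / 2)" r])
    show "continuous_on (closure {0<..<T}) c" using cc T by simp
    show "c x = c (T / 2)" if "x \<in> {0<..<T}" for x by (rule const[OF that]) (use T in simp)
    show "r \<in> closure {0<..<T}" using r T by simp
  qed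
  have "c t = c 0" using cl[OF t] cl[of 0] T by (metis atLeastAtMost_iff less_imp_le order_refl)
  then show ?thesis by (simp add: c_def E_def algebra_simps)
qed

section \<open>Uniqueness of distributional solutions\<close>

lemma vector_derivative_product_test:
  fixes \<theta> :: "real \<Rightarrow> complex"
  assumes "(\<theta> has_vector_derivative d) (at t)"
  shows "vector_derivative (\<lambda>\<tau>. \<theta> \<tau> * c) (at t) = d * c"
  by (rule vector_derivative_at) (rule has_vector_derivative_mult_left[OF assms])

lemma gen_mul_const:
  assumes "mdom (symb s) (FT x)" "bmult (\<lambda>y. complex_of_real (p y))"
  shows "mdom (symb s) (FT (mul (\<lambda>_. c) x))" "gen s p (mul (\<lambda>_. c) x) = mul (\<lambda>_. c) (gen s p x)"
proof -
  have L: "(\<lambda>\<xi>. symb s \<xi> * c * rep (FT x) \<xi>) \<in> L2"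
    using L2_cmult[OF assms(1)[unfolded mdom_def], of c] by (simp add: mult_ac)
  then have m: "mdom (\<lambda>\<xi>. symb s \<xi> * c) (FT x)" by (simp add: mdom_def)
  show 1: "mdom (symb s) (FT (mul (\<lambda>_. c) x))"
    unfolding FT_mul_const by (rule mdom_mul(1)[OF _ _ bmult_mdom[OF bmult_const] m]) auto
  have 2: "mul (symb s) (FT (mul (\<lambda>_. c) x)) = mul (\<lambda>\<xi>. symb s \<xi> * c) (FT x)"
    unfolding FT_mul_const by (rule mdom_mul(2)[OF _ _ bmult_mdom[OF bmult_const] m]) auto
  have 3: "mul (\<lambda>_. c) (mul (symb s) (FT x)) = mul (\<lambda>\<xi>. c * symb s \<xi>) (FT x)"
    by (rule mdom_mul(2)[OF _ _ assms(1)]) (use m in \<open>auto simp: mult.commute\<close>)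
  have lin: "mul (\<lambda>_. c) (x + y) = mul (\<lambda>_. c) x + mul (\<lambda>_. c) y" for x y :: "'a lsq"
    by (rule linear_add[OF bounded_linear.linear[OF bounded_linear_mul[OF bmult_const]]])
  have "mul (\<lambda>_. c) (gen s p x) = IFT (mul (\<lambda>\<xi>. c * symb s \<xi>) (FT x)) + mul (\<lambda>_. c) (mul (\<lambda>y. of_real (p y)) x)"
    unfolding gen_def lin IFT_mul_const[symmetric] 3 ..
  then show "gen s p (mul (\<lambda>_. c) x) = mul (\<lambda>_. c) (gen s p x)"
    unfolding gen_def[of s p "mul (\<lambda>_. c) x"] 2 by (simp add: mul_mul assms(2) mult.commute)
qed

text \<open>The classical transform is the isometry \<open>FT\<close> on this class.\<close>

lemma fourier_injective:
  assumes "f \<in> L2" "integrable lborel f" "\<And>\<xi>. fourier_L1 f \<xi> = 0" shows "AE x in lborel. f x = 0"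
proof -
  have "fourier_L1 f = (\<lambda>_. 0)" using assms(3) by (rule ext)
  then have "FT (cls f) = 0" unfolding FT_integrable(2)[OF assms(1,2)] by (simp add: zero_lsq_def)
  then have "cls f = 0" using norm_FT[of "cls f"] by simp
  then show ?thesis using rep_cls[OF assms(1)] rep_zero[where 'a = 'a] by (auto elim: eventually_elim2)
qed

context schroedinger begin

text \<open>Testing with products \<open>\<theta>(t) g(x)\<close> yields the weak form, in \<open>t\<close>, of an ordinary differential equation for
  \<open>pair (u t) g\<close>.\<close>

lemma weak_equation:
  assumes T: "T > 0" and u: "cauchy_solution T s p u0 u" and \<chi>: "csm g" and t: "t \<in> {0..T}"
  shows "continuous_on {0..T} (\<lambda>t. cls (u t))"
    "pair (cls (u t)) (cls g) - pair (cls (u 0)) (cls g) = \<i> * pair (integral {0..t} (\<lambda>t. cls (u t))) (gen s p (cls g))"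
proof -
  have uC: "u \<in> C_Hs T s" and ueq: "schroedinger_eq T s p u" using u by (auto simp: cauchy_solution_def)
  have uHs: "u t \<in> Hs s" if "t \<in> {0..T}" for t using uC that by (auto simp: C_Hs_def)
  then have uL: "u t \<in> L2" if "t \<in> {0..T}" for t using that by (auto simp: Hs_iff)
  show cont: "continuous_on {0..T} (\<lambda>t. cls (u t))"
    unfolding continuous_on_def
  proof
    fix t assume t: "t \<in> {0..T}"
    have l: "((\<lambda>\<tau>. Hs_norm s (\<lambda>x. u \<tau> x - u t x)) \<longlongrightarrow> 0) (at t within {0..T})" using uC t by (auto simp: C_Hs_def)
    have b: "norm (cls (u \<tau>) - cls (u t)) \<le> Hs_norm s (\<lambda>x. u \<tau> x - u t x)" if \<tau>: "\<tau> \<in> {0..T}" for \<tau>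
    proof -
      have "L2_norm (\<lambda>x. u \<tau> x - u t x) = norm (cls (u \<tau>) - cls (u t))"
        unfolding norm_cls[OF L2_diff[OF uL[OF \<tau>] uL[OF t]], symmetric] cls_diff[OF uL[OF \<tau>] uL[OF t]] ..
      moreover have "L2_norm f \<ge> 0" for f :: "'a \<Rightarrow> complex" by (simp add: L2_norm_def)
      ultimately show ?thesis by (simp add: Hs_norm_def)
    qed
    have "((\<lambda>\<tau>. cls (u \<tau>) - cls (u t)) \<longlongrightarrow> 0) (at t within {0..T})"
      by (rule Lim_null_comparison[OF _ l]) (auto simp: eventually_at_filter b)
    then show "((\<lambda>t. cls (u t)) \<longlongrightarrow> cls (u t)) (at t within {0..T})" by (rule LIM_zero_cancel)
  qed
  note gL = csm_L2(1)[OF \<chi>]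
  have md: "mdom (symb s) (FT (cls g))" using s by (intro csm_mdom \<chi>) auto
  have cp: "continuous_on {0..T} (\<lambda>t. pair (cls (u t)) x)" for x
    by (intro bounded_bilinear.continuous_on[OF bounded_bilinear_pair] cont continuous_intros)
  have "pair (cls (u t)) (cls g) - pair (cls (u 0)) (cls g) = \<i> * integral {0..t} (\<lambda>t. pair (cls (u t)) (gen s p (cls g)))"
  proof (rule du_Bois_Reymond[OF T cp cp _ t])
    fix \<theta> \<theta>' :: "real \<Rightarrow> complex" and \<alpha> \<beta>
    assume \<theta>: "\<And>k. Ck k \<theta>" "0 < \<alpha>" "\<beta> < T" "\<And>t. t \<notin> {\<alpha>..\<beta>} \<Longrightarrow> \<theta> t = 0"
      and d: "\<And>t. (\<theta> has_vector_derivative \<theta>' t) (at t)" and \<theta>'c: "continuous_on UNIV \<theta>'"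
    define \<phi> where "\<phi> z = \<theta> (fst z) * g (snd z)" for z
    have \<phi>: "\<phi> \<in> test_functions T" unfolding \<phi>_def[abs_def] by (rule product_test_function[OF \<theta> \<chi>])
    have \<theta>c: "continuous_on {0..T} \<theta>" using \<theta>(1)[of 0] by (auto intro: continuous_on_subset)
    have i: "(\<integral>x. u t x * (- \<i> * vector_derivative (\<lambda>\<tau>. \<phi> (\<tau>, x)) (at t)
         + frac_laplacian s (\<lambda>y. \<phi> (t, y)) x + of_real (p x) * \<phi> (t, x)) \<partial>lborel) =
       - \<i> * \<theta>' t * pair (cls (u t)) (cls g) + \<theta> t * pair (cls (u t)) (gen s p (cls g))" if t: "t \<in> {0..T}" for t
    proof -
      have 1: "vector_derivative (\<lambda>\<tau>. \<phi> (\<tau>, x)) (at t) = \<theta>' t * g x" for x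
        unfolding \<phi>_def using vector_derivative_product_test[OF d] by simp
      have c: "cls (\<lambda>y. \<theta> t * g y) = mul (\<lambda>_. \<theta> t) (cls g)" "cls (\<lambda>y. \<theta>' t * g y) = mul (\<lambda>_. \<theta>' t) (cls g)"
        by (simp_all add: mul_const_cls gL)
      have "(\<integral>x. u t x * (- \<i> * (\<theta>' t * g x) + frac_laplacian s (\<lambda>y. \<theta> t * g y) x + of_real (p x) * (\<theta> t * g x)) \<partial>lborel) =
        pair (cls (u t)) (mul (\<lambda>_. - \<i>) (mul (\<lambda>_. \<theta>' t) (cls g)) + gen s p (mul (\<lambda>_. \<theta> t) (cls g)))"
        unfolding c[symmetric]
        by (rule integrand_eq[OF uL[OF t] L2_cmult[OF gL] L2_cmult[OF gL]])
           (simp only: c gen_mul_const(1)[OF md p_bmult])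
      also have "\<dots> = - \<i> * \<theta>' t * pair (cls (u t)) (cls g) + \<theta> t * pair (cls (u t)) (gen s p (cls g))"
        unfolding gen_mul_const(2)[OF md p_bmult] pair_commute[of "cls (u t)"] pair_add pair_cmult by simp
      finally show ?thesis unfolding 1 by (simp add: \<phi>_def)
    qed
    let ?h = "\<lambda>t. - \<i> * \<theta>' t * pair (cls (u t)) (cls g) + \<theta> t * pair (cls (u t)) (gen s p (cls g))"
    have hc: "continuous_on {0..T} ?h"
      by (intro continuous_intros cp \<theta>c continuous_on_subset[OF \<theta>'c]) auto
    have "0 = (LINT t:{0..T}|lborel. (\<integral>x. u t x * (- \<i> * vector_derivative (\<lambda>\<tau>. \<phi> (\<tau>, x)) (at t)
         + frac_laplacian s (\<lambda>y. \<phi> (t, y)) x + of_real (p x) * \<phi> (t, x)) \<partial>lborel))"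
      using ueq \<phi> unfolding schroedinger_eq_def by auto
    also have "\<dots> = (LINT t:{0..T}|lborel. ?h t)"
      by (rule set_lebesgue_integral_cong) (use i in auto)
    also have "\<dots> = integral {0..T} ?h"
      by (rule set_borel_integral_eq_integral(2)[OF borel_integrable_atLeastAtMost'[OF hc]])
    finally show "integral {0..T} ?h = 0" by simp
  qed
  also have "integral {0..t} (\<lambda>t. pair (cls (u t)) (gen s p (cls g))) = pair (integral {0..t} (\<lambda>t. cls (u t))) (gen s p (cls g))"
  proof -
    have ct: "continuous_on {0..t} (\<lambda>t. cls (u t))" using cont t by (auto intro: continuous_on_subset)
    show ?thesis
      by (rule integral_unique, rule has_integral_linear[OF integrable_integral[OF integrable_continuous_real[OF ct]]
           bounded_bilinear.bounded_linear_left[OF bounded_bilinear_pair], unfolded o_def])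
  qed
  finally show "pair (cls (u t)) (cls g) - pair (cls (u 0)) (cls g) = \<i> * pair (integral {0..t} (\<lambda>t. cls (u t))) (gen s p (cls g))" .
qed

text \<open>Pair the weak equation with the translates by \<open>- y\<close> of a fixed bump, whose transform is \<open>h\<close>. Translation becomes
  multiplication by \<open>exp (i y \<bullet> \<xi>)\<close>, so the identities for all \<open>y\<close> say that the classical transform of
  \<open>(k - i |\<xi>|^(2s) W) h(-\<xi>)\<close> is \<open>0\<close>, where \<open>k\<close> collects the other terms. This function is integrable because \<open>h\<close> decays, although
  \<open>|\<xi>|^(2s) W\<close> is not yet known to be square integrable. Injectivity gives the equation wherever \<open>h\<close> does not vanish,
  and that set contains any given ball if the bump is narrow enough.\<close>

lemma integrated_equation:
  assumes T: "T > 0" and u: "cauchy_solution T s p u0 u" and t: "t \<in> {0..T}"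
  defines "W \<equiv> integral {0..t} (\<lambda>t. FT (cls (u t)))"
  shows "mdom (symb s) W" "imul (mul (symb s) W) = FT (cls (u t)) - FT (cls (u 0)) - imul (pot p W)"
proof -
  define k where "k = FT (cls (u t)) - FT (cls (u 0)) - imul (pot p W)"
  have "continuous_on {0..T} (\<lambda>t. cls (u t))" by (rule weak_equation(1)[OF T u csm_sbump[of 1 0] t]) simp
  then have ct: "continuous_on {0..t} (\<lambda>t. cls (u t))" using t by (auto intro: continuous_on_subset)
  have W: "W = FT (integral {0..t} (\<lambda>t. cls (u t)))" unfolding W_def
    by (rule integral_unique, rule has_integral_linear[OF integrable_integral[OF integrable_continuous_real[OF ct]] bounded_linear_FT, unfolded o_def])
  then have IW: "integral {0..t} (\<lambda>t. cls (u t)) = IFT W" by simp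
  have ae: "AE \<xi> in lborel. norm \<xi> \<le> real (Suc n) \<longrightarrow> rep k \<xi> - \<i> * (symb s \<xi> * rep W \<xi>) = 0" for n
  proof -
    define h where "h = fourier_L1 (sbump (real (Suc n)) (0::'a))"
    have h0: "csm (sbump (real (Suc n)) (0::'a))" by (rule csm_sbump) simp
    have hL: "h \<in> L2" unfolding h_def by (rule FT_integrable(1)[OF csm_L2[OF h0]])
    note [measurable] = L2_measurable[OF hL]
    obtain G C where G: "G \<in> L2" "\<And>\<xi>. cmod (symb s \<xi> * h \<xi>) \<le> cmod (G \<xi>)" "\<And>\<xi>. cmod (symb s \<xi> * h \<xi>) \<le> C"
      using csm_symb_bound[OF h0, of s] s unfolding h_def by (metis less_imp_le)
    obtain G0 C0 where C0: "\<And>\<xi>. cmod (symb 0 \<xi> * h \<xi>) \<le> C0"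
      using csm_symb_bound[OF h0, of 0] unfolding h_def by (metis order_refl)
    \<comment> \<open>\<open>symb 0\<close> is \<open>1\<close> except at the origin, where \<open>0 powr 0 = 0\<close>.\<close>
    have hb: "AE \<xi> in lborel. cmod (h \<xi>) \<le> C0"
      using AE_lborel_singleton[of "0::'a"]
    proof eventually_elim
      case (elim \<xi>)
      then show ?case using C0[of \<xi>] by (simp add: symb_def norm_mult)
    qed
    have shL: "(\<lambda>\<xi>. symb s \<xi> * h \<xi>) \<in> L2" unfolding h_def using s by (intro csm_mdom h0) auto
    define f where "f \<xi> = rep k \<xi> * h (- \<xi>) - \<i> * (rep W \<xi> * (symb s (- \<xi>) * h (- \<xi>)))" for \<xi>
    have fL: "f \<in> L2" unfolding f_def
    proof (intro L2_diff L2_cmult)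
      show "(\<lambda>\<xi>. rep k \<xi> * h (- \<xi>)) \<in> L2"
        using L2_mult_bounded[OF rep_L2, of "\<lambda>\<xi>. h (- \<xi>)" C0 k] AE_reflect[OF hb] by (simp add: mult.commute)
      show "(\<lambda>\<xi>. rep W \<xi> * (symb s (- \<xi>) * h (- \<xi>))) \<in> L2"
        using L2_mult_bounded[OF rep_L2, of "\<lambda>\<xi>. symb s (- \<xi>) * h (- \<xi>)" C W] G(3)[of "- _"]
        by (simp add: mult.commute)
    qed
    have i1: "integrable lborel (\<lambda>\<xi>. rep k \<xi> * h (- \<xi>))" by (intro L2_integrable_mult rep_L2 L2_reflect hL)
    have i2: "integrable lborel (\<lambda>\<xi>. rep W \<xi> * (symb s (- \<xi>) * h (- \<xi>)))"
      by (intro L2_integrable_mult rep_L2 L2_reflect[of "\<lambda>\<xi>. symb s \<xi> * h \<xi>"] shL)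
    have fi: "integrable lborel f" unfolding f_def using i1 i2 by simp
    have "fourier_L1 f y = 0" for y
    proof -
      let ?g = "sbump (real (Suc n)) (- y)"
      have g: "csm ?g" by (rule csm_sbump) simp
      note gL = csm_L2[OF g]
      have md: "mdom (symb s) (FT (cls ?g))" using s by (intro csm_mdom g) auto
      have tr: "fourier_L1 ?g \<xi> = cis (y \<bullet> \<xi>) * h \<xi>" for \<xi>
        using fourier_L1_translate[OF csm_L2(2)[OF h0], of "- y" \<xi>] by (simp add: sbump_def[abs_def] h_def)
      have Ig: "IFT (cls ?g) = cls (\<lambda>\<xi>. cis (- (\<xi> \<bullet> y)) * h (- \<xi>))"
        unfolding IFT_def FT_integrable(2)[OF gL] rf_cls[OF FT_integrable(1)[OF gL]] tr by (simp add: inner_commute)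
      have IL: "(\<lambda>\<xi>. cis (- (\<xi> \<bullet> y)) * h (- \<xi>)) \<in> L2"
        using L2_reflect[OF hL] by (intro L2_mult_bounded[where K = 1]) auto
      have sIL: "(\<lambda>\<xi>. symb s \<xi> * (cis (- (\<xi> \<bullet> y)) * h (- \<xi>))) \<in> L2"
      proof -
        have "(\<lambda>\<xi>. cis (- (\<xi> \<bullet> y)) * (symb s (- \<xi>) * h (- \<xi>))) \<in> L2"
          by (rule L2_mult_bounded[OF L2_reflect[OF shL], where K = 1]) auto
        then show ?thesis by (simp add: mult.left_commute)
      qed
      have "pair (FT (cls (u t)) - FT (cls (u 0))) (IFT (cls ?g)) = pair (cls (u t)) (cls ?g) - pair (cls (u 0)) (cls ?g)"
        by (simp add: pair_FT_IFT[symmetric] FT_diff[symmetric] bounded_bilinear.diff_left[OF bounded_bilinear_pair])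
      also have "\<dots> = \<i> * pair (IFT W) (gen s p (cls ?g))"
        using weak_equation(2)[OF T u g t] unfolding IW .
      also have "pair (IFT W) (gen s p (cls ?g)) = pair W (mul (symb s) (IFT (cls ?g))) + pair (pot p W) (IFT (cls ?g))"
      proof -
        have "pair (IFT W) (mul (\<lambda>y. of_real (p y)) (cls ?g)) = pair (mul (\<lambda>y. of_real (p y)) (IFT W)) (cls ?g)"
          by (rule pair_mul[symmetric]) (rule bmult_mdom[OF p_bmult])+
        also have "\<dots> = pair (pot p W) (IFT (cls ?g))" unfolding pot_def by (rule pair_FT_IFT)
        finally have a: "pair (IFT W) (mul (\<lambda>y. of_real (p y)) (cls ?g)) = pair (pot p W) (IFT (cls ?g))" .
        show ?thesis
          unfolding gen_def bounded_bilinear.add_right[OF bounded_bilinear_pair] a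
            pair_IFT[of W "IFT (mul (symb s) (FT (cls ?g)))"] mdom_IFT_symb(2)[OF md] ..
      qed
      finally have "pair k (IFT (cls ?g)) = \<i> * pair W (mul (symb s) (IFT (cls ?g)))"
        unfolding k_def by (simp add: bounded_bilinear.diff_left[OF bounded_bilinear_pair] pair_cmult ring_distribs)
      then have "pair k (cls (\<lambda>\<xi>. cis (- (\<xi> \<bullet> y)) * h (- \<xi>))) = \<i> * pair W (cls (\<lambda>\<xi>. symb s \<xi> * (cis (- (\<xi> \<bullet> y)) * h (- \<xi>))))"
        unfolding Ig using mdom_cls(2)[OF IL _ sIL] by simp
      then have e: "(\<integral>\<xi>. rep k \<xi> * (cis (- (\<xi> \<bullet> y)) * h (- \<xi>)) \<partial>lborel) = \<i> * (\<integral>\<xi>. rep W \<xi> * (symb s \<xi> * (cis (- (\<xi> \<bullet> y)) * h (- \<xi>))) \<partial>lborel)"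
        using pair_cls[OF rep_L2[of k] IL] pair_cls[OF rep_L2[of W] sIL] by simp
      have "(\<integral>\<xi>. cis (- (\<xi> \<bullet> y)) * f \<xi> \<partial>lborel) =
        (\<integral>\<xi>. rep k \<xi> * (cis (- (\<xi> \<bullet> y)) * h (- \<xi>)) - \<i> * (rep W \<xi> * (symb s \<xi> * (cis (- (\<xi> \<bullet> y)) * h (- \<xi>)))) \<partial>lborel)"
        by (intro Bochner_Integration.integral_cong refl) (simp add: f_def algebra_simps)
      also have "\<dots> = 0" using e L2_integrable_mult[OF rep_L2 IL, of k] L2_integrable_mult[OF rep_L2 sIL, of W] by simp
      finally show ?thesis by (simp add: fourier_L1_def)
    qed
    then have "AE \<xi> in lborel. f \<xi> = 0" by (rule fourier_injective[OF fL fi])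
    then show ?thesis
    proof eventually_elim
      case (elim \<xi>)
      have e: "(rep k \<xi> - \<i> * (symb s \<xi> * rep W \<xi>)) * h (- \<xi>) = 0" using elim by (simp add: f_def algebra_simps)
      show ?case
      proof
        assume "norm \<xi> \<le> real (Suc n)"
        then have "h (- \<xi>) \<noteq> 0" unfolding h_def by (intro fourier_sbump_nonzero) auto
        then show "rep k \<xi> - \<i> * (symb s \<xi> * rep W \<xi>) = 0" using e by simp
      qed
    qed
  qed
  then have "AE \<xi> in lborel. \<forall>n. norm \<xi> \<le> real (Suc n) \<longrightarrow> rep k \<xi> - \<i> * (symb s \<xi> * rep W \<xi>) = 0"
    unfolding AE_all_countable by blast
  then have ae2: "AE \<xi> in lborel. symb s \<xi> * rep W \<xi> = - \<i> * rep k \<xi>"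
  proof eventually_elim
    case (elim \<xi>)
    obtain n where "norm \<xi> \<le> real n" using real_arch_simple by blast
    then have "norm \<xi> \<le> real (Suc n)" by simp
    then have "rep k \<xi> - \<i> * (symb s \<xi> * rep W \<xi>) = 0" using elim by blast
    then have "rep k \<xi> = \<i> * (symb s \<xi> * rep W \<xi>)" by simp
    then show ?case by simp
  qed
  have le: "AE \<xi> in lborel. norm (symb s \<xi> * rep W \<xi>) \<le> 1 * norm (rep k \<xi>)"
    using ae2 by eventually_elim (metis mult_1 norm_ii norm_minus_cancel norm_mult mult_minus_left order_refl)
  show md: "mdom (symb s) W" unfolding mdom_def
    by (rule L2_dominated[OF rep_L2[of k], where K = 1]) (use le in auto)
  show "imul (mul (symb s) W) = FT (cls (u t)) - FT (cls (u 0)) - imul (pot p W)"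
    unfolding k_def[symmetric]
  proof (rule lsq_eqI)
    show "AE \<xi> in lborel. rep (imul (mul (symb s) W)) \<xi> = rep k \<xi>"
      using rep_mul[OF bmult_mdom[OF bmult_const], of \<i> "mul (symb s) W"] rep_mul[OF md] ae2 by eventually_elim simp
  qed
qed

text \<open>A solution \<open>u\<close> in \<open>H^s\<close> need not be differentiable in \<open>L2\<close>, but the time integral \<open>Z\<close> of the difference between
  \<open>u\<close> and the flow is, and by the integrated equation it lies in the domain and solves \<open>Z' = i m Z + Q Z\<close> with
  \<open>Z 0 = 0\<close>, where \<open>m\<close> is the symbol. So \<open>Z = 0\<close>, and its derivative vanishes as well.\<close>

theorem solution_unique:
  assumes T: "T > 0" and u: "cauchy_solution T s p u0 u" and t: "t \<in> {0..T}"
  shows "cls (u t) = IFT (V t (FT (cls (u 0))))"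
proof -
  define u' where "u' t = rep (IFT (V t (FT (cls (u 0)))))" for t
  have uHs: "u 0 \<in> Hs s" using u T by (auto simp: cauchy_solution_def C_Hs_def)
  have u': "cauchy_solution T s p (u 0) u'" unfolding u'_def by (rule V_solution[OF uHs])
  have u'c: "cls (u' t) = IFT (V t (FT (cls (u 0))))" for t by (simp add: u'_def)
  define U where "U t = FT (cls (u t)) - FT (cls (u' t))" for t
  define Z where "Z t = integral {0..t} U" for t
  have cu: "continuous_on {0..T} (\<lambda>t. FT (cls (u t)))"
    by (intro bounded_linear.continuous_on[OF bounded_linear_FT] weak_equation(1)[OF T u csm_sbump[of 1 0] t]) simp
  have cu': "continuous_on {0..T} (\<lambda>t. FT (cls (u' t)))"
    by (intro bounded_linear.continuous_on[OF bounded_linear_FT] weak_equation(1)[OF T u' csm_sbump[of 1 0] t]) simp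
  have cU: "continuous_on {0..T} U" unfolding U_def[abs_def] by (intro continuous_intros cu cu')
  have Zd: "(Z has_vector_derivative U r) (at r within {0..T})" if "r \<in> {0..T}" for r
    unfolding Z_def[abs_def] by (rule integral_has_vector_derivative[OF cU that])
  \<comment> \<open>The flow itself is a distributional solution, so the integrated equation holds for both and the initial values cancel.\<close>
  have Zeq: "mdom (symb s) (Z r) \<and> imul (mul (symb s) (Z r)) = U r - imul (pot p (Z r))" if r: "r \<in> {0..T}" for r
  proof -
    define W where "W = integral {0..r} (\<lambda>t. FT (cls (u t)))"
    define W' where "W' = integral {0..r} (\<lambda>t. FT (cls (u' t)))"
    note w = integrated_equation[OF T u r, folded W_def] and w' = integrated_equation[OF T u' r, folded W'_def]
    have Z: "Z r = W - W'" unfolding Z_def U_def[abs_def] W_def W'_def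
      by (intro integral_diff integrable_continuous_real continuous_on_subset[OF cu] continuous_on_subset[OF cu']) (use r in auto)
    have lin: "imul (x - y) = imul x - imul y" for x y :: "'a lsq"
      by (rule linear_diff[OF bounded_linear.linear[OF J_lin]])
    have ql: "imul (pot p (x - y)) = imul (pot p x) - imul (pot p y)" for x y
      by (rule linear_diff[OF bounded_linear.linear[OF Q_lin]])
    have "cls (u' 0) = cls (u 0)" by (simp add: u'c)
    then show ?thesis unfolding Z mdom_diff(2)[OF symb_measurable w(1) w'(1)] lin w(2) w'(2) ql
      using mdom_diff(1)[OF symb_measurable w(1) w'(1)] by (simp add: U_def)
  qed
  \<comment> \<open>In the interaction picture the unbounded part of the equation for \<open>Z\<close> disappears.\<close>
  define z where "z r = freeS s (- r) (Z r)" for r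
  have zd: "(z has_vector_derivative B r (z r)) (at r within {0..T})" if r: "r \<in> {0..T}" for r
  proof -
    have "mul (\<lambda>_. - \<i>) (mul (symb s) (Z r)) = - imul (mul (symb s) (Z r))"
      unfolding mul_def[of "\<lambda>_. - \<i>"] mul_def[of "\<lambda>_. \<i>"]
      using cls_scaleR[OF L2_cmult[OF rep_L2], of "-1" \<i> "mul (symb s) (Z r)"] by simp
    then have "(z has_vector_derivative freeS s (- r) (U r - imul (mul (symb s) (Z r)))) (at r within {0..T})"
      using freeS_derivative[OF Zd[OF r], of s "-1"] Zeq[OF r] by (simp add: z_def[abs_def])
    also have "freeS s (- r) (U r - imul (mul (symb s) (Z r))) = B r (z r)"
      using Zeq[OF r] by (simp add: B_def z_def)
    finally show ?thesis .
  qed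
  have "z r = 0" if r: "r \<in> {0..T}" for r
  proof -
    have "z r = sol 0 r" by (rule sol_unique[OF zd]) (use r in \<open>auto simp: z_def Z_def linear_0[OF bounded_linear.linear[OF S_lin]]\<close>)
    moreover have "norm (sol 0 r) = 0" using V_norm[of r 0] r by (simp add: V_def)
    ultimately show ?thesis by simp
  qed
  then have Z0: "Z r = 0" if "r \<in> {0..T}" for r
    using that S_norm[of "- r" "Z r"] by (simp add: z_def)
  have d1: "((\<lambda>_. 0) has_vector_derivative U t) (at t within {0..T})"
    by (rule has_vector_derivative_transform[OF t _ Zd[OF t]]) (simp add: Z0)
  have d2: "((\<lambda>_. 0 :: 'a lsq) has_vector_derivative 0) (at t within {0..T})" by simp
  have "U t = 0"
    by (rule vector_derivative_unique_within_closed_interval[OF T, unfolded cbox_interval, OF t d1 d2])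
  then have "FT (cls (u t)) = FT (cls (u' t))" by (simp add: U_def)
  then have "IFT (FT (cls (u t))) = IFT (FT (cls (u' t)))" by simp
  then show ?thesis by (simp add: u'c)
qed

end

lemma Linf_norm_bound:
  assumes "p \<in> borel_measurable borel" "Linf_norm p \<le> ereal c" shows "AE x in lborel. \<bar>p x\<bar> \<le> c"
proof -
  have "AE x in lborel. ereal \<bar>p x\<bar> \<le> esssup lborel (\<lambda>x. ereal \<bar>p x\<bar>)"
    by (rule esssup_AE)
  then show ?thesis
    by eventually_elim (use assms(2) in \<open>auto simp: Linf_norm_def dest: order_trans\<close>)
qed

lemma schroedingerI:
  assumes "s > 0" "moderate_coefficient p" "\<epsilon> \<in> {0<..1}"
  obtains M where "schroedinger s (p \<epsilon>) M"
proof -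
  obtain N :: nat and C where NC: "\<forall>\<epsilon>\<in>{0<..1}. Linf_norm (p \<epsilon>) \<le> ereal (C * \<epsilon> powr (- real N))"
    using assms(2) unfolding moderate_coefficient_def by blast
  have b: "Linf_norm (p \<epsilon>) \<le> ereal (C * \<epsilon> powr (- real N))" using NC assms(3) by blast
  have m: "p \<epsilon> \<in> borel_measurable borel" using assms(2,3) unfolding moderate_coefficient_def by simp
  show thesis using that[of "C * \<epsilon> powr (- real N)"] assms(1) m Linf_norm_bound[OF m b] by (simp add: schroedinger_def)
qed

lemma pot_nonneg:
  assumes "schroedinger s p M" "AE x in lborel. p x \<ge> 0" shows "0 \<le> inner (pot p w) w"
proof -
  interpret schroedinger s p M by fact
  have "inner (pot p w) w = inner (FT (mul (\<lambda>y. of_real (p y)) (IFT w))) (FT (IFT w))" by (simp add: pot_def)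
  also have "\<dots> = (\<integral>x. inner (rep (mul (\<lambda>y. of_real (p y)) (IFT w)) x) (rep (IFT w) x) \<partial>lborel)"
    unfolding inner_FT by (simp add: inner_lsq_def)
  also have "\<dots> \<ge> 0"
  proof (rule integral_nonneg_AE)
    show "AE x in lborel. 0 \<le> inner (rep (mul (\<lambda>y. of_real (p y)) (IFT w)) x) (rep (IFT w) x)"
      using rep_mul[OF bmult_mdom[OF p_bmult], of "IFT w"] assms(2)
    proof eventually_elim
      case (elim x)
      have "inner (of_real (p x) * rep (IFT w) x) (rep (IFT w) x) = p x * inner (rep (IFT w) x) (rep (IFT w) x)"
        by (simp add: scaleR_conv_of_real[symmetric])
      then show ?case using elim by simp
    qed
  qed
  finally show ?thesis .
qed

section \<open>Moderate bounds and stability\<close>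

context schroedinger begin

text \<open>Since \<open>p\<close> is nonnegative, the potential energy at time \<open>t\<close> may be dropped from the conserved energy.\<close>

lemma Hs_norm_bound:
  assumes u0: "u0 \<in> Hs s" and p0: "AE x in lborel. p x \<ge> 0" and M: "M \<ge> 0" and t: "t \<ge> 0"
  shows "Hs_norm s (rep (IFT (V t (FT (cls u0))))) \<le> (2 + M) * Hs_norm s u0"
proof -
  define w where "w = FT (cls u0)"
  define H where "H = Hs_norm s u0"
  let ?h = "mul (symb (s / 2)) :: 'a lsq \<Rightarrow> 'a lsq"
  have wd: "mdom (symb (s / 2)) w" using u0 by (simp add: Hs_iff w_def)
  have H: "H = norm w + norm (?h w)" unfolding H_def Hs_norm_eq[OF u0] by (simp add: w_def)
  then have H0: "norm w \<le> H" "norm (?h w) \<le> H" "0 \<le> H" by auto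
  have "rep (IFT (V t w)) \<in> Hs s" using V_mdom[OF wd t] by (simp add: Hs_iff)
  then have e: "Hs_norm s (rep (IFT (V t w))) = norm w + norm (?h (V t w))"
    using t by (simp add: Hs_norm_eq)
  have "schroedinger s p M" by unfold_locales
  then have "0 \<le> pe (V t w)" unfolding pe_def using p0 by (rule pot_nonneg)
  then have "(norm (?h (V t w)))\<^sup>2 \<le> (norm (?h w))\<^sup>2 + pe w"
    using energy_conservation[OF wd t] by simp
  also have "\<dots> \<le> (norm (?h w))\<^sup>2 + M * (norm w)\<^sup>2"
    using pe_bound[of w] by simp
  also have "\<dots> \<le> H\<^sup>2 + M * H\<^sup>2"
    using H0 M by (intro add_mono mult_left_mono power_mono) auto
  also have "\<dots> = (1 + M) * H\<^sup>2" by (simp add: algebra_simps)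
  also have "\<dots> \<le> (1 + M)\<^sup>2 * H\<^sup>2"
    using M by (intro mult_right_mono) (auto simp: power2_eq_square algebra_simps)
  finally have "(norm (?h (V t w)))\<^sup>2 \<le> ((1 + M) * H)\<^sup>2" by (simp add: power_mult_distrib)
  then have "norm (?h (V t w)) \<le> (1 + M) * H" by (rule power2_le_imp_le) (use M H0 in simp)
  then have "norm w + norm (?h (V t w)) \<le> H + (1 + M) * H" using H0(1) by simp
  then show ?thesis using e by (simp add: w_def H_def algebra_simps)
qed

end

lemma norm_pot_diff_le:
  assumes "schroedinger s p M" "schroedinger s p' M'" "Linf_norm (\<lambda>x. p x - p' x) \<le> ereal \<delta>"
  shows "norm (imul (pot p x) - imul (pot p' x)) \<le> \<delta> * norm x"
proof -
  interpret A: schroedinger s p M by fact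
  interpret A': schroedinger s p' M' by fact
  have m: "(\<lambda>x. p x - p' x) \<in> borel_measurable borel" by measurable
  define y where "y = IFT x"
  have e: "mul (\<lambda>y. of_real (p y - p' y)) y = mul (\<lambda>y. of_real (p y)) y - mul (\<lambda>y. of_real (p' y)) y"
    unfolding mul_def using bmult_mdom[OF A.p_bmult, of y] bmult_mdom[OF A'.p_bmult, of y]
    by (simp add: mdom_def cls_diff[symmetric] left_diff_distrib)
  have "imul (pot p x) - imul (pot p' x) = imul (pot p x - pot p' x)"
    by (rule linear_diff[OF bounded_linear.linear[OF A.J_lin], symmetric])
  also have "pot p x - pot p' x = pot (\<lambda>x. p x - p' x) x"
    unfolding pot_def y_def[symmetric] e FT_diff ..
  finally have "norm (imul (pot p x) - imul (pot p' x)) = norm (pot (\<lambda>x. p x - p' x) x)"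
    by (simp only: A.J_norm)
  also have "\<dots> \<le> \<delta> * norm x" by (rule norm_pot_le[OF m Linf_norm_bound[OF m assms(3)]])
  finally show ?thesis .
qed

text \<open>The isometry of the first flow accounts for the difference of the data, and the comparison of the flows on the
  datum \<open>u0'\<close> for the difference of the coefficients.\<close>

lemma solution_stability:
  assumes S: "schroedinger s p M" "schroedinger s p' M'" and T: "T > 0"
    and u: "cauchy_solution T s p u0 u" and u': "cauchy_solution T s p' u0' u'"
    and L2: "u0 \<in> L2" "u0' \<in> L2" and \<delta>: "Linf_norm (\<lambda>x. p x - p' x) \<le> ereal \<delta>" "\<delta> \<ge> 0" and t: "t \<in> {0..T}"
  shows "L2_norm (\<lambda>x. u t x - u' t x) \<le> L2_norm (\<lambda>x. u0 x - u0' x) + \<delta> * L2_norm u0' * T"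
proof -
  interpret A: schroedinger s p M by fact
  interpret A': schroedinger s p' M' by fact
  have L: "u t \<in> L2" "u 0 \<in> L2" "u' t \<in> L2" "u' 0 \<in> L2"
    using u u' t T by (auto simp: cauchy_solution_def C_Hs_def Hs_iff)
  have "cls (u 0) = cls u0" "cls (u' 0) = cls u0'"
    using u u' by (auto simp: cauchy_solution_def cls_eq_iff L L2)
  then have e: "cls (u t) = IFT (A.V t (FT (cls u0)))" "cls (u' t) = IFT (A'.V t (FT (cls u0')))"
    using A.solution_unique[OF T u t] A'.solution_unique[OF T u' t] by simp_all
  have "L2_norm (\<lambda>x. u t x - u' t x) = norm (A.V t (FT (cls u0)) - A'.V t (FT (cls u0')))"
    unfolding norm_cls[OF L2_diff[OF L(1,3)], symmetric] cls_diff[OF L(1,3)] e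
    by (simp add: linear_diff[OF bounded_linear.linear[OF bounded_linear_IFT], symmetric])
  also have "\<dots> = norm (A.V t (FT (cls u0) - FT (cls u0')) + (A.V t (FT (cls u0')) - A'.V t (FT (cls u0'))))"
    using t by (simp add: A.V_diff_arg)
  also have "\<dots> \<le> norm (A.V t (FT (cls u0) - FT (cls u0'))) + norm (A.V t (FT (cls u0')) - A'.V t (FT (cls u0')))"
    by (rule norm_triangle_ineq)
  also have "norm (A.V t (FT (cls u0) - FT (cls u0'))) = L2_norm (\<lambda>x. u0 x - u0' x)"
    using t by (simp add: FT_diff[symmetric] cls_diff[symmetric] L2 norm_cls L2_diff)
  also have "norm (A.V t (FT (cls u0')) - A'.V t (FT (cls u0'))) \<le> \<delta> * norm (FT (cls u0')) * t"
    by (rule V_compare[OF A.perturbed_group_axioms A'.perturbed_group_axioms])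
       (use t norm_pot_diff_le[OF S \<delta>(1)] in auto)
  also have "\<dots> \<le> \<delta> * L2_norm u0' * T"
    using t \<delta>(2) by (simp add: norm_cls L2) (intro mult_left_mono mult_nonneg_nonneg, auto simp: L2_norm_def)
  finally show ?thesis by simp
qed

text \<open>The factor \<open>2 + C \<epsilon>^(-N)\<close> of the Sobolev bound is at most \<open>(2 + C) \<epsilon>^(-N)\<close>, so moderateness of the data is
  preserved.\<close>

lemma very_weak_solution_exists:
  fixes p :: "real \<Rightarrow> 'a::euclidean_space \<Rightarrow> real"
  assumes s: "s > 0" and p: "moderate_coefficient p" and u0: "moderate_data s u0"
  shows "\<exists>u. very_weak_solution T s p u0 u"
proof -
  obtain N C where C: "C > 0" and NC: "\<forall>\<epsilon>\<in>{0<..1}. Linf_norm (p \<epsilon>) \<le> ereal (C * \<epsilon> powr (- real N))"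
    using p unfolding moderate_coefficient_def by blast
  obtain N0 C0 where C0: "C0 > 0" and NC0: "\<forall>\<epsilon>\<in>{0<..1}. Hs_norm s (u0 \<epsilon>) \<le> C0 * \<epsilon> powr (- real N0)"
    using u0 unfolding moderate_data_def by blast
  define M where "M \<epsilon> = C * \<epsilon> powr (- real N)" for \<epsilon>
  define u where "u \<epsilon> t = rep (IFT (perturbed_group.V (freeS s) (\<lambda>x. imul (pot (p \<epsilon>) x)) t (FT (cls (u0 \<epsilon>)))))" for \<epsilon> t
  have S: "schroedinger s (p \<epsilon>) (M \<epsilon>)" and p0: "AE x in lborel. p \<epsilon> x \<ge> 0" and uH: "u0 \<epsilon> \<in> Hs s" if \<epsilon>: "\<epsilon> \<in> {0<..1}" for \<epsilon>
  proof -
    have m: "p \<epsilon> \<in> borel_measurable borel" using p \<epsilon> unfolding moderate_coefficient_def by simp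
    have b: "Linf_norm (p \<epsilon>) \<le> ereal (M \<epsilon>)" using NC \<epsilon> unfolding M_def by blast
    show "schroedinger s (p \<epsilon>) (M \<epsilon>)" using s m Linf_norm_bound[OF m b] by (simp add: schroedinger_def)
    show "AE x in lborel. p \<epsilon> x \<ge> 0" using p \<epsilon> unfolding moderate_coefficient_def by simp
    show "u0 \<epsilon> \<in> Hs s" using u0 \<epsilon> unfolding moderate_data_def by simp
  qed
  have sol: "cauchy_solution T s (p \<epsilon>) (u0 \<epsilon>) (u \<epsilon>)" if \<epsilon>: "\<epsilon> \<in> {0<..1}" for \<epsilon>
    unfolding u_def by (rule schroedinger.V_solution[OF S[OF \<epsilon>] uH[OF \<epsilon>]])
  have bound: "Hs_norm s (u \<epsilon> t) \<le> ((2 + C) * C0) * \<epsilon> powr (- real (N + N0))" if \<epsilon>: "\<epsilon> \<in> {0<..1}" and t: "t \<in> {0..T}" for \<epsilon> t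
  proof -
    have \<epsilon>1: "0 < \<epsilon>" "\<epsilon> \<le> 1" using \<epsilon> by auto
    have one: "1 \<le> \<epsilon> powr (- real N)" using powr_mono'[of "- real N" 0 \<epsilon>] \<epsilon>1 by simp
    have M0: "M \<epsilon> \<ge> 0" unfolding M_def using C by simp
    have "Hs_norm s (u \<epsilon> t) \<le> (2 + M \<epsilon>) * Hs_norm s (u0 \<epsilon>)"
      unfolding u_def by (rule schroedinger.Hs_norm_bound[OF S[OF \<epsilon>] uH[OF \<epsilon>] p0[OF \<epsilon>] M0]) (use t in simp)
    also have "\<dots> \<le> ((2 + C) * \<epsilon> powr (- real N)) * (C0 * \<epsilon> powr (- real N0))"
    proof (rule mult_mono)
      show "2 + M \<epsilon> \<le> (2 + C) * \<epsilon> powr (- real N)" unfolding M_def using one by (simp add: algebra_simps)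
      show "Hs_norm s (u0 \<epsilon>) \<le> C0 * \<epsilon> powr (- real N0)" using NC0 \<epsilon> by blast
      show "0 \<le> Hs_norm s (u0 \<epsilon>)" by (simp add: Hs_norm_def L2_norm_def)
    qed (use C in simp)
    also have "\<dots> = ((2 + C) * C0) * (\<epsilon> powr (- real N) * \<epsilon> powr (- real N0))" by (simp add: mult_ac)
    also have "\<epsilon> powr (- real N) * \<epsilon> powr (- real N0) = \<epsilon> powr (- real (N + N0))" by (simp add: powr_add[symmetric])
    finally show ?thesis .
  qed
  have c: "(2 + C) * C0 > 0" using C C0 by simp
  show ?thesis
    unfolding very_weak_solution_def
    by (rule exI[of _ u], intro conjI ballI exI[of _ "N + N0"] exI[of _ "(2 + C) * C0"] c sol bound)
qed

theorem theorem2p4: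
  fixes T s :: real
    and p :: "real \<Rightarrow> real ^ 'd \<Rightarrow> real"
    and u0 :: "real \<Rightarrow> real ^ 'd \<Rightarrow> complex"
  assumes "T > 0" and "s > 0"
    and "moderate_coefficient p" and "moderate_data s u0"
  shows "(\<exists>u. very_weak_solution T s p u0 u) \<and>
    (\<forall>p' u0' u u'.
       moderate_coefficient p' \<longrightarrow> moderate_data s u0' \<longrightarrow>
       (\<forall>k>0. \<exists>C>0. \<forall>\<epsilon>\<in>{0<..1}. Linf_norm (\<lambda>x. p \<epsilon> x - p' \<epsilon> x) \<le> ereal (C * \<epsilon> powr k)) \<longrightarrow>
       (\<forall>l>0. \<exists>C>0. \<forall>\<epsilon>\<in>{0<..1}. L2_norm (\<lambda>x. u0 \<epsilon> x - u0' \<epsilon> x) \<le> C * \<epsilon> powr l) \<longrightarrow>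
       (\<forall>\<epsilon>\<in>{0<..1}. cauchy_solution T s (p \<epsilon>) (u0 \<epsilon>) (u \<epsilon>)) \<longrightarrow>
       (\<forall>\<epsilon>\<in>{0<..1}. cauchy_solution T s (p' \<epsilon>) (u0' \<epsilon>) (u' \<epsilon>)) \<longrightarrow>
       (\<forall>N>0. \<exists>C>0. \<forall>t\<in>{0..T}. \<forall>\<epsilon>\<in>{0<..1}.
          L2_norm (\<lambda>x. u \<epsilon> t x - u' \<epsilon> t x) \<le> C * \<epsilon> powr N))"
proof (intro conjI allI impI)
  show "\<exists>u. very_weak_solution T s p u0 u"
    by (rule very_weak_solution_exists[OF assms(2-4)])
next
  fix p' :: "real \<Rightarrow> real ^ 'd \<Rightarrow> real" and u0' :: "real \<Rightarrow> real ^ 'd \<Rightarrow> complex" and u u' and N :: real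
  assume p': "moderate_coefficient p'" and u0': "moderate_data s u0'"
    and dp: "\<forall>k>0. \<exists>C>0. \<forall>\<epsilon>\<in>{0<..1}. Linf_norm (\<lambda>x. p \<epsilon> x - p' \<epsilon> x) \<le> ereal (C * \<epsilon> powr k)"
    and du: "\<forall>l>0. \<exists>C>0. \<forall>\<epsilon>\<in>{0<..1}. L2_norm (\<lambda>x. u0 \<epsilon> x - u0' \<epsilon> x) \<le> C * \<epsilon> powr l"
    and u: "\<forall>\<epsilon>\<in>{0<..1}. cauchy_solution T s (p \<epsilon>) (u0 \<epsilon>) (u \<epsilon>)"
    and u': "\<forall>\<epsilon>\<in>{0<..1}. cauchy_solution T s (p' \<epsilon>) (u0' \<epsilon>) (u' \<epsilon>)" and N: "N > 0"
  obtain N0 C0 where C0: "C0 > 0" and NC0: "\<forall>\<epsilon>\<in>{0<..1}. Hs_norm s (u0' \<epsilon>) \<le> C0 * \<epsilon> powr (- real N0)"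
    using u0' unfolding moderate_data_def by blast
  \<comment> \<open>The extra order \<open>N0\<close> compensates the growth of the data \<open>u0'\<close>.\<close>
  have "N + real N0 > 0" using N by simp
  then obtain Ck where Ck: "Ck > 0" "\<forall>\<epsilon>\<in>{0<..1}. Linf_norm (\<lambda>x. p \<epsilon> x - p' \<epsilon> x) \<le> ereal (Ck * \<epsilon> powr (N + real N0))"
    using dp by blast
  obtain Cl where Cl: "Cl > 0" "\<forall>\<epsilon>\<in>{0<..1}. L2_norm (\<lambda>x. u0 \<epsilon> x - u0' \<epsilon> x) \<le> Cl * \<epsilon> powr N"
    using du N by blast
  have "L2_norm (\<lambda>x. u \<epsilon> t x - u' \<epsilon> t x) \<le> (Cl + Ck * C0 * T) * \<epsilon> powr N" if t: "t \<in> {0..T}" and \<epsilon>: "\<epsilon> \<in> {0<..1}" for t \<epsilon>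
  proof -
    obtain M where S: "schroedinger s (p \<epsilon>) M" by (rule schroedingerI[OF assms(2,3) \<epsilon>])
    obtain M' where S': "schroedinger s (p' \<epsilon>) M'" by (rule schroedingerI[OF assms(2) p' \<epsilon>])
    have L2: "u0 \<epsilon> \<in> L2" "u0' \<epsilon> \<in> L2"
      using assms(4) u0' \<epsilon> unfolding moderate_data_def by (auto simp: Hs_iff)
    have \<epsilon>0: "\<epsilon> > 0" using \<epsilon> by simp
    have nn: "0 \<le> L2_norm f" for f :: "real ^ 'd \<Rightarrow> complex" by (simp add: L2_norm_def)
    have "L2_norm (\<lambda>x. u \<epsilon> t x - u' \<epsilon> t x) \<le> L2_norm (\<lambda>x. u0 \<epsilon> x - u0' \<epsilon> x) + (Ck * \<epsilon> powr (N + real N0)) * L2_norm (u0' \<epsilon>) * T"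
      by (rule solution_stability[OF S S' assms(1) _ _ L2 _ _ t]) (use u u' Ck \<epsilon> in auto)
    also have "\<dots> \<le> Cl * \<epsilon> powr N + (Ck * \<epsilon> powr (N + real N0)) * (C0 * \<epsilon> powr (- real N0)) * T"
    proof (intro add_mono mult_right_mono mult_left_mono)
      show "L2_norm (\<lambda>x. u0 \<epsilon> x - u0' \<epsilon> x) \<le> Cl * \<epsilon> powr N" using Cl \<epsilon> by blast
      have "L2_norm (u0' \<epsilon>) \<le> Hs_norm s (u0' \<epsilon>)" unfolding Hs_norm_def using nn by simp
      also have "\<dots> \<le> C0 * \<epsilon> powr (- real N0)" using NC0 \<epsilon> by blast
      finally show "L2_norm (u0' \<epsilon>) \<le> C0 * \<epsilon> powr (- real N0)" .
    qed (use Ck assms(1) in auto)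
    also have "\<dots> = Cl * \<epsilon> powr N + Ck * C0 * T * (\<epsilon> powr (N + real N0) * \<epsilon> powr (- real N0))" by (simp add: mult_ac)
    also have "\<epsilon> powr (N + real N0) * \<epsilon> powr (- real N0) = \<epsilon> powr N" by (simp add: powr_add[symmetric])
    finally show ?thesis by (simp add: algebra_simps)
  qed
  moreover have "Cl + Ck * C0 * T > 0" using Cl Ck C0 assms(1) by (simp add: add_pos_pos)
  ultimately show "\<exists>C>0. \<forall>t\<in>{0..T}. \<forall>\<epsilon>\<in>{0<..1}. L2_norm (\<lambda>x. u \<epsilon> t x - u' \<epsilon> t x) \<le> C * \<epsilon> powr N" by blast
qed

end
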